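(* For all integers $s,n,t\geq 0$ there is an isomorphism of $\mathbb{F}_2$-vector spaces $$\mathrm{Ext}_{\mathcal{U}}^{s}\bigl(\Sigma^{n}\mathbb{F}_2,\Sigma^{t}\tilde{\mathrm{H}}^{*}(\mathbb{C}P^{\infty};\mathbb{F}_2)\bigr)\cong\bigoplus_{m=1}^{s}\mathrm{Ext}_{\mathcal{U}}^{s-m}\bigl(\Sigma^{n}\mathbb{F}_2,\Sigma^{t+m}\mathbb{F}_2\bigr).$$
   Context: Let $\mathcal{U}$ be the category of unstable modules over the mod $2$ Steenrod algebra $\mathcal{A}_2$, i.e. $\mathbb{N}$-graded $\mathcal{A}_2$-modules $M$ with $Sq^{k}x=0$ for all $x\in M^{n}$ and $k>n$. $\Sigma^{t}$ is the $t$-fold suspension: $(\Sigma^{t}M)^{n}=M^{n-t}$ with $Sq^{k}\Sigma^{t}x=\Sigma^{t}Sq^{k}x$. $\Sigma^{n}\mathbb{F}_2$ is $\mathbb{F}_2$ concentrated in degree $n$. $\tilde{\mathrm{H}}^{*}(\mathbb{C}P^{\infty};\mathbb{F}_2)$ is the reduced mod $2$ singular cohomology of the infinite complex projective space, i.e. the augmentation ideal of the polynomial algebra $\mathbb{F}_2[x]$, $|x|=2$, with its usual Steenrod action. *)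

theory Defs
  imports
    "HOL-Library.FuncSet"
    "HOL-Library.Z2"
    "HOL-Computational_Algebra.Polynomial"
    "HOL-Algebra.AbelCoset"
    "HOL-Algebra.Module"
begin

section \<open>Vector spaces over the field with two elements\<close>

definition F2 :: "bit ring" where
  "F2 = \<lparr>carrier = UNIV, monoid.mult = (*), one = 1, zero = 0, add = (+)\<rparr>"

text \<open>
  An \<open>\<bbbF>\<^sub>2\<close>-vector space is a record \<open>V\<close> with \<^prop>\<open>module F2 V\<close>. The record type of modules extends
  that of rings; its fields for multiplication and one are not used, so they are left unspecified.
\<close>

type_synonym 'a vs = "(bit, 'a) module"

definition mk_vs :: "'a set \<Rightarrow> 'a \<Rightarrow> ('a \<Rightarrow> 'a \<Rightarrow> 'a) \<Rightarrow> (bit \<Rightarrow> 'a \<Rightarrow> 'a) \<Rightarrow> 'a vs" where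
  "mk_vs C z p m = \<lparr>carrier = C, monoid.mult = undefined, one = undefined,
                    zero = z, add = p, module.smult = m\<rparr>"

definition vs_linear :: "'a vs \<Rightarrow> 'b vs \<Rightarrow> ('a \<Rightarrow> 'b) \<Rightarrow> bool" where
  "vs_linear V W f \<longleftrightarrow>
     f \<in> hom (add_monoid V) (add_monoid W) \<and>
     (\<forall>c. \<forall>x\<in>carrier V. f (c \<odot>\<^bsub>V\<^esub> x) = c \<odot>\<^bsub>W\<^esub> f x)"

definition vs_isomorphic :: "'a vs \<Rightarrow> 'b vs \<Rightarrow> bool" where
  "vs_isomorphic V W \<longleftrightarrow> module F2 V \<and> module F2 W \<and>
     (\<exists>f. vs_linear V W f \<and> bij_betw f (carrier V) (carrier W))"

definition vs_zero :: "'a vs \<Rightarrow> 'a vs" where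
  "vs_zero V = V\<lparr>carrier := {\<zero>\<^bsub>V\<^esub>}\<rparr>"

definition vs_quotient :: "'a vs \<Rightarrow> 'a set \<Rightarrow> 'a set vs" where
  "vs_quotient V W = mk_vs (a_rcosets\<^bsub>V\<^esub> W) W (\<lambda>X Y. X <+>\<^bsub>V\<^esub> Y)
     (\<lambda>c X. \<Union>x\<in>X. W +>\<^bsub>V\<^esub> (c \<odot>\<^bsub>V\<^esub> x))"

definition vs_direct_sum :: "'i set \<Rightarrow> ('i \<Rightarrow> 'a vs) \<Rightarrow> ('i \<Rightarrow> 'a) vs" where
  "vs_direct_sum I V = mk_vs
     {x \<in> (\<Pi>\<^sub>E i\<in>I. carrier (V i)). finite {i\<in>I. x i \<noteq> \<zero>\<^bsub>V i\<^esub>}}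
     (\<lambda>i\<in>I. \<zero>\<^bsub>V i\<^esub>)
     (\<lambda>x y. \<lambda>i\<in>I. x i \<oplus>\<^bsub>V i\<^esub> y i)
     (\<lambda>c x. \<lambda>i\<in>I. c \<odot>\<^bsub>V i\<^esub> x i)"


section \<open>Unstable modules over the Steenrod algebra\<close>

text \<open>
  The mod 2 Steenrod algebra is the associative unital \<open>\<bbbF>\<^sub>2\<close>-algebra generated by symbols \<open>Sq\<^sup>i\<close> of
  degree \<open>i\<close>, subject to \<open>Sq\<^sup>0 = 1\<close> and the Adem relations. A graded module over it is therefore a
  family of vector spaces \<open>M\<^sup>n\<close> with linear operations \<open>Sq\<^sup>i : M\<^sup>n \<rightarrow> M\<^sup>n\<^sup>+\<^sup>i\<close> satisfying these relations.
  Below, \<open>piece M n\<close> is \<open>M\<^sup>n\<close>, and \<open>Sq M i n\<close> is \<open>Sq\<^sup>i\<close> on \<open>M\<^sup>n\<close>. The carriers of distinct pieces may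
  overlap: elements of different degrees are never compared.
\<close>

record 'a sq_module =
  piece :: "nat \<Rightarrow> 'a vs"
  Sq :: "nat \<Rightarrow> nat \<Rightarrow> 'a \<Rightarrow> 'a"

text \<open>
  In the Adem relation \<open>k \<le> i div 2 < j\<close>, so none of the subtractions on \<^typ>\<open>nat\<close> truncates.
\<close>

definition steenrod_module :: "'a sq_module \<Rightarrow> bool" where
  "steenrod_module M \<longleftrightarrow>
     (\<forall>n. module F2 (piece M n)) \<and>
     (\<forall>i n. vs_linear (piece M n) (piece M (n + i)) (Sq M i n)) \<and>
     (\<forall>n. \<forall>x\<in>carrier (piece M n). Sq M 0 n x = x) \<and>
     (\<forall>i j n. 0 < i \<longrightarrow> i < 2 * j \<longrightarrow> (\<forall>x\<in>carrier (piece M n).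
        Sq M i (n + j) (Sq M j n x) =
        (\<Oplus>\<^bsub>piece M (n + i + j)\<^esub> k\<in>{0..i div 2}.
           of_nat ((j - k - 1) choose (i - 2 * k)) \<odot>\<^bsub>piece M (n + i + j)\<^esub>
             Sq M (i + j - k) (n + k) (Sq M k n x))))"

definition unstable_module :: "'a sq_module \<Rightarrow> bool" where
  "unstable_module M \<longleftrightarrow> steenrod_module M \<and>
     (\<forall>k n. n < k \<longrightarrow> (\<forall>x\<in>carrier (piece M n). Sq M k n x = \<zero>\<^bsub>piece M (n + k)\<^esub>))"

text \<open>
  Morphisms are extensional, that is, equal to \<^const>\<open>undefined\<close> off the carriers, so that equality of
  morphisms is equality of functions.
\<close>

definition sq_hom :: "'a sq_module \<Rightarrow> 'b sq_module \<Rightarrow> (nat \<Rightarrow> 'a \<Rightarrow> 'b) set" where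
  "sq_hom M N = {f. \<forall>n.
     f n \<in> extensional (carrier (piece M n)) \<and>
     vs_linear (piece M n) (piece N n) (f n) \<and>
     (\<forall>i. \<forall>x\<in>carrier (piece M n). f (n + i) (Sq M i n x) = Sq N i n (f n x))}"

definition sq_zero :: "'a sq_module \<Rightarrow> 'b sq_module \<Rightarrow> nat \<Rightarrow> 'a \<Rightarrow> 'b" where
  "sq_zero M N = (\<lambda>n. \<lambda>x\<in>carrier (piece M n). \<zero>\<^bsub>piece N n\<^esub>)"

definition sq_comp ::
  "'a sq_module \<Rightarrow> (nat \<Rightarrow> 'b \<Rightarrow> 'c) \<Rightarrow> (nat \<Rightarrow> 'a \<Rightarrow> 'b) \<Rightarrow> nat \<Rightarrow> 'a \<Rightarrow> 'c" where
  "sq_comp M g f = (\<lambda>n. compose (carrier (piece M n)) (g n) (f n))"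

definition sq_hom_space :: "'a sq_module \<Rightarrow> 'b sq_module \<Rightarrow> (nat \<Rightarrow> 'a \<Rightarrow> 'b) vs" where
  "sq_hom_space M N = mk_vs (sq_hom M N) (sq_zero M N)
     (\<lambda>f g n. \<lambda>x\<in>carrier (piece M n). f n x \<oplus>\<^bsub>piece N n\<^esub> g n x)
     (\<lambda>c f n. \<lambda>x\<in>carrier (piece M n). c \<odot>\<^bsub>piece N n\<^esub> f n x)"

definition sq_surj :: "'a sq_module \<Rightarrow> 'b sq_module \<Rightarrow> (nat \<Rightarrow> 'a \<Rightarrow> 'b) \<Rightarrow> bool" where
  "sq_surj M N f \<longleftrightarrow> f \<in> sq_hom M N \<and> (\<forall>n. f n ` carrier (piece M n) = carrier (piece N n))"


section \<open>Suspensions and examples\<close>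

definition suspension :: "nat \<Rightarrow> 'a sq_module \<Rightarrow> 'a sq_module" where
  "suspension t M = \<lparr>
     piece = (\<lambda>n. if n < t then vs_zero (piece M 0) else piece M (n - t)),
     Sq = (\<lambda>k n x. if n < t
             then (if n + k < t then \<zero>\<^bsub>piece M 0\<^esub> else \<zero>\<^bsub>piece M (n + k - t)\<^esub>)
             else Sq M k (n - t) x)\<rparr>"

text \<open>\<open>\<bbbF>\<^sub>2\<close> concentrated in degree 0; there \<open>Sq\<^sup>0\<close> is the identity.\<close>

definition F2_module :: "bit sq_module" where
  "F2_module = \<lparr>
     piece = (\<lambda>n. mk_vs (if n = 0 then UNIV else {0}) 0 (+) (*)),
     Sq = (\<lambda>k n x. if k = 0 then x else 0)\<rparr>"

text \<open>
  The augmentation ideal of \<open>\<bbbF>\<^sub>2[x]\<close> with \<open>x\<close> in degree 2, so \<open>x\<^sup>k\<close> has degree \<open>2k\<close>. The action is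
  the one forced by the Cartan formula from \<open>Sq(x) = x + x\<^sup>2\<close>: the total square of \<open>x\<^sup>k\<close> is
  \<open>(x + x\<^sup>2)\<^sup>k\<close>, hence \<open>Sq\<^sup>2\<^sup>i x\<^sup>k = (k choose i) x\<^sup>k\<^sup>+\<^sup>i\<close> and the odd squares vanish.
\<close>

definition CP_infinity_module :: "bit poly sq_module" where
  "CP_infinity_module = \<lparr>
     piece = (\<lambda>n. mk_vs {p. \<forall>k. coeff p k \<noteq> 0 \<longrightarrow> 0 < k \<and> n = 2 * k} 0 (+) Polynomial.smult),
     Sq = (\<lambda>i n p. if even i \<and> even n
             then monom (of_nat ((n div 2) choose (i div 2)) * coeff p (n div 2)) ((n + i) div 2)
             else 0)\<rparr>"


section \<open>Ext groups in the category of unstable modules\<close>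

text \<open>
  Epimorphisms of unstable modules are the degreewise surjections. The lifting property below
  quantifies over modules with carriers in the same type as \<open>P\<close>. If that type is infinite, this is no
  restriction: the free unstable module on the elements of \<open>P\<close> has no more elements than the type, so
  it has an isomorphic copy in it; the property then makes \<open>P\<close> a direct summand of a free unstable
  module, hence projective against all unstable modules.
\<close>

definition projective :: "'p sq_module \<Rightarrow> bool" where
  "projective P \<longleftrightarrow> unstable_module P \<and>
     (\<forall>(E :: 'p sq_module) (B :: 'p sq_module) q f.
        unstable_module E \<longrightarrow> unstable_module B \<longrightarrow> sq_surj E B q \<longrightarrow> f \<in> sq_hom P B \<longrightarrow>
        (\<exists>g\<in>sq_hom P E. sq_comp P q g = f))"

text \<open>Exactness of \<open>\<dots> \<rightarrow> P\<^sub>2 \<rightarrow> P\<^sub>1 \<rightarrow> P\<^sub>0 \<rightarrow> M \<rightarrow> 0\<close>, where \<open>d s : P\<^sub>s\<^sub>+\<^sub>1 \<rightarrow> P\<^sub>s\<close> and \<open>e : P\<^sub>0 \<rightarrow> M\<close>.\<close>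

definition projective_resolution ::
  "(nat \<Rightarrow> 'p sq_module) \<Rightarrow> (nat \<Rightarrow> nat \<Rightarrow> 'p \<Rightarrow> 'p) \<Rightarrow> (nat \<Rightarrow> 'p \<Rightarrow> 'a) \<Rightarrow> 'a sq_module \<Rightarrow> bool"
where
  "projective_resolution P d e M \<longleftrightarrow>
     (\<forall>s. projective (P s)) \<and>
     (\<forall>s. d s \<in> sq_hom (P (Suc s)) (P s)) \<and>
     sq_surj (P 0) M e \<and>
     (\<forall>n. d 0 n ` carrier (piece (P 1) n) =
            {x \<in> carrier (piece (P 0) n). e n x = \<zero>\<^bsub>piece M n\<^esub>}) \<and>
     (\<forall>s n. d (Suc s) n ` carrier (piece (P (Suc (Suc s))) n) =
            {x \<in> carrier (piece (P (Suc s)) n). d s n x = \<zero>\<^bsub>piece (P s) n\<^esub>})"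

text \<open>Cohomology in degree \<open>s\<close> of the cochain complex \<open>Hom(P\<^sub>0, N) \<rightarrow> Hom(P\<^sub>1, N) \<rightarrow> \<dots>\<close>\<close>

definition hom_cocycles ::
  "(nat \<Rightarrow> 'p sq_module) \<Rightarrow> (nat \<Rightarrow> nat \<Rightarrow> 'p \<Rightarrow> 'p) \<Rightarrow> nat \<Rightarrow> 'b sq_module \<Rightarrow> (nat \<Rightarrow> 'p \<Rightarrow> 'b) set"
where
  "hom_cocycles P d s N =
     {f \<in> sq_hom (P s) N. sq_comp (P (Suc s)) f (d s) = sq_zero (P (Suc s)) N}"

fun hom_coboundaries ::
  "(nat \<Rightarrow> 'p sq_module) \<Rightarrow> (nat \<Rightarrow> nat \<Rightarrow> 'p \<Rightarrow> 'p) \<Rightarrow> nat \<Rightarrow> 'b sq_module \<Rightarrow> (nat \<Rightarrow> 'p \<Rightarrow> 'b) set"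
where
  "hom_coboundaries P d 0 N = {sq_zero (P 0) N}"
| "hom_coboundaries P d (Suc s) N = (\<lambda>f. sq_comp (P (Suc s)) f (d s)) ` sq_hom (P s) N"

definition hom_cohomology ::
  "(nat \<Rightarrow> 'p sq_module) \<Rightarrow> (nat \<Rightarrow> nat \<Rightarrow> 'p \<Rightarrow> 'p) \<Rightarrow> nat \<Rightarrow> 'b sq_module \<Rightarrow> (nat \<Rightarrow> 'p \<Rightarrow> 'b) set vs"
where
  "hom_cohomology P d s N =
     vs_quotient ((sq_hom_space (P s) N)\<lparr>carrier := hom_cocycles P d s N\<rparr>) (hom_coboundaries P d s N)"

text \<open>
  \<open>Ext\<close> is computed from a chosen projective resolution. The type \<^typ>\<open>nat \<times> 'a\<close> is infinite and at
  least as large as \<^typ>\<open>'a\<close>, so every unstable module over \<^typ>\<open>'a\<close> has a (free) resolution by modules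
  with carriers in it. As usual, different choices give isomorphic \<open>Ext\<close> spaces.
\<close>

definition chosen_resolution ::
  "'a sq_module \<Rightarrow> (nat \<Rightarrow> (nat \<times> 'a) sq_module) \<times> (nat \<Rightarrow> nat \<Rightarrow> nat \<times> 'a \<Rightarrow> nat \<times> 'a)" where
  "chosen_resolution M = (SOME (P, d). \<exists>e. projective_resolution P d e M)"

definition Ext_U ::
  "nat \<Rightarrow> 'a sq_module \<Rightarrow> 'b sq_module \<Rightarrow> (nat \<Rightarrow> nat \<times> 'a \<Rightarrow> 'b) set vs" where
  "Ext_U s M N = (case chosen_resolution M of (P, d) \<Rightarrow> hom_cohomology P d s N)"

end

theory Submission
  imports Defs
    "HOL-Library.Countable_Set"
    "HOL-Computational_Algebra.Formal_Power_Series"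
begin

text \<open>
  Write \<open>R\<close> for the reduced cohomology of \<open>\<real>P\<^sup>\<infinity>\<close>, with generator \<open>u\<close>, and \<open>C\<close> for that of \<open>\<complex>P\<^sup>\<infinity>\<close>. The even powers of
  \<open>u\<close> span a copy of \<open>C\<close> in \<open>R\<close>, and the quotient is \<open>\<Sigma>\<bbbF>\<^sub>2 \<oplus> \<Sigma>C\<close>, since \<open>Sq\<^sup>2\<^sup>i u\<^sup>2\<^sup>k\<^sup>+\<^sup>1 = (k choose i) u\<^sup>2\<^sup>k\<^sup>+\<^sup>2\<^sup>i\<^sup>+\<^sup>1\<close>
  while the odd squares of \<open>u\<^sup>2\<^sup>k\<^sup>+\<^sup>1\<close> are even powers. If \<open>Hom(P, \<Sigma>\<^sup>tR)\<close> is acyclic for a projective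
  resolution \<open>P\<close> of \<open>\<Sigma>\<^sup>n\<bbbF>\<^sub>2\<close>, the long exact sequence turns \<open>Ext\<^sup>s\<^sup>+\<^sup>1\<close> into \<open>\<Sigma>\<^sup>tC\<close> into the sum of the \<open>Ext\<^sup>s\<close> into
  \<open>\<Sigma>\<^sup>t\<^sup>+\<^sup>1\<bbbF>\<^sub>2\<close> and into \<open>\<Sigma>\<^sup>t\<^sup>+\<^sup>1C\<close>, and induction on \<open>s\<close> gives the result.

  For the acyclicity, \<open>Hom(P, \<Sigma>\<^sup>tR) = Hom(\<Omega>\<^sup>tP, R)\<close>. Projective unstable modules are reduced, because free ones
  embed into products of polynomial rings, so that the homology of \<open>\<Omega>\<^sup>tP\<close> stays bounded above in
  each homological degree; and \<open>R\<close> behaves like an injective module modulo nilpotent ones. The latter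
  is shown without the general theory: \<open>c(Sq\<^sup>q)u\<^sup>m = u\<^sup>2\<^sup>^\<^sup>j\<close> for the conjugate squares \<open>c(Sq\<^sup>q)\<close> with
  \<open>q = 2\<^sup>j - m\<close> and large \<open>j\<close>, hence a map into \<open>R\<close> is determined by a functional on large degrees \<open>2\<^sup>j\<close>,
  and such functionals extend.
\<close>

text \<open>The Steenrod algebra enters only through its operations and the Adem relations. An
  identity between composites of squares on a class of degree \<open>m\<close> is therefore checked
  on the product of \<open>m\<close> variables of degree one, where squares are explicit; it
  transfers because the free module on such a class embeds into the tensor power. The decisive
  identity is c(Sq^q) Sq^i = (m choose i) c(Sq^(q+i)) on degree \<open>m\<close> with values in
  degree 2^j, where m <= j. Since Sq^i u^m = (m choose i) u^(m+i), it makes p -> Psi(c(Sq^q) p) u^m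
  compatible with the squares. Omega destroys exactness, and a bound on the homology replaces it.
  The bound suffices because Sq^n u^n = u^(2n): if a map to R kills boundaries but not some cycle,
  it is nonzero on the iterated top squares of that cycle, which are cycles of unbounded degree,
  hence finally boundaries. The bound survives Omega because a cycle of Omega P has boundary Sq^h z,
  and reducedness forces z to be a cycle. As \<open>projective\<close> tests modules over a single
  type, countable modules are copied between types.\<close>

declare add_bit_eq_xor [simp del] mult_bit_eq_and [simp del]

section \<open>Vector spaces over the field with two elements\<close>

lemma bit_add_self [simp]: "a + a = (0::bit)"
  by (cases a) auto

lemma F2_cring: "cring F2"
proof (rule cringI)
  show "abelian_group F2"
    by (rule abelian_groupI) (auto simp: F2_def algebra_simps intro!: exI[of _ "_ :: bit"] bit_add_self)
  show "comm_monoid F2"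
    by (rule comm_monoidI) (auto simp: F2_def algebra_simps)
qed (auto simp: F2_def algebra_simps)

lemma F2_simps [simp]:
  "carrier F2 = UNIV" "x \<otimes>\<^bsub>F2\<^esub> y = x * y" "x \<oplus>\<^bsub>F2\<^esub> y = x + y" "\<one>\<^bsub>F2\<^esub> = 1" "\<zero>\<^bsub>F2\<^esub> = 0"
  by (simp_all add: F2_def)

text \<open>Over F_2 every element is its own negative and a scalar is 0 or 1, so \<open>xx\<close>
  takes the place of the axiom on inverses and \<open>sm\<close> that of all axioms on
  scalars.\<close>

lemma module_F2I:
  assumes z: "\<zero>\<^bsub>V\<^esub> \<in> carrier V"
    and c: "\<And>x y. x \<in> carrier V \<Longrightarrow> y \<in> carrier V \<Longrightarrow> x \<oplus>\<^bsub>V\<^esub> y \<in> carrier V"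
    and a: "\<And>x y w. x \<in> carrier V \<Longrightarrow> y \<in> carrier V \<Longrightarrow> w \<in> carrier V \<Longrightarrow>
              (x \<oplus>\<^bsub>V\<^esub> y) \<oplus>\<^bsub>V\<^esub> w = x \<oplus>\<^bsub>V\<^esub> (y \<oplus>\<^bsub>V\<^esub> w)"
    and co: "\<And>x y. x \<in> carrier V \<Longrightarrow> y \<in> carrier V \<Longrightarrow> x \<oplus>\<^bsub>V\<^esub> y = y \<oplus>\<^bsub>V\<^esub> x"
    and l0: "\<And>x. x \<in> carrier V \<Longrightarrow> \<zero>\<^bsub>V\<^esub> \<oplus>\<^bsub>V\<^esub> x = x"
    and xx: "\<And>x. x \<in> carrier V \<Longrightarrow> x \<oplus>\<^bsub>V\<^esub> x = \<zero>\<^bsub>V\<^esub>"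
    and sm: "\<And>x b. x \<in> carrier V \<Longrightarrow> b \<odot>\<^bsub>V\<^esub> x = (if b = 0 then \<zero>\<^bsub>V\<^esub> else x)"
  shows "module F2 V"
proof (rule moduleI)
  show "cring F2" by (rule F2_cring)
  show "abelian_group V"
  proof (rule abelian_groupI)
    show "\<exists>y\<in>carrier V. y \<oplus>\<^bsub>V\<^esub> x = \<zero>\<^bsub>V\<^esub>" if "x \<in> carrier V" for x
      using xx that by blast
  qed (use assms in auto)
qed (use assms in \<open>auto simp: bit_add_self\<close>)

lemma F2_smult:
  assumes "module F2 V" "x \<in> carrier V"
  shows "b \<odot>\<^bsub>V\<^esub> x = (if b = 0 then \<zero>\<^bsub>V\<^esub> else x)"
proof -
  interpret module F2 V by fact
  show ?thesis
    using smult_one[of x] smult_l_null[of x] assms by (cases b) auto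
qed

lemma
  assumes "module F2 V"
  shows F2_zero [simp]: "\<zero>\<^bsub>V\<^esub> \<in> carrier V"
    and F2_add [simp]: "x \<in> carrier V \<Longrightarrow> y \<in> carrier V \<Longrightarrow> x \<oplus>\<^bsub>V\<^esub> y \<in> carrier V"
    and F2_assoc: "x \<in> carrier V \<Longrightarrow> y \<in> carrier V \<Longrightarrow> z \<in> carrier V \<Longrightarrow>
          (x \<oplus>\<^bsub>V\<^esub> y) \<oplus>\<^bsub>V\<^esub> z = x \<oplus>\<^bsub>V\<^esub> (y \<oplus>\<^bsub>V\<^esub> z)"
    and F2_comm: "x \<in> carrier V \<Longrightarrow> y \<in> carrier V \<Longrightarrow> x \<oplus>\<^bsub>V\<^esub> y = y \<oplus>\<^bsub>V\<^esub> x"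
    and F2_lcomm: "x \<in> carrier V \<Longrightarrow> y \<in> carrier V \<Longrightarrow> z \<in> carrier V \<Longrightarrow>
          x \<oplus>\<^bsub>V\<^esub> (y \<oplus>\<^bsub>V\<^esub> z) = y \<oplus>\<^bsub>V\<^esub> (x \<oplus>\<^bsub>V\<^esub> z)"
    and F2_l0 [simp]: "x \<in> carrier V \<Longrightarrow> \<zero>\<^bsub>V\<^esub> \<oplus>\<^bsub>V\<^esub> x = x"
    and F2_r0 [simp]: "x \<in> carrier V \<Longrightarrow> x \<oplus>\<^bsub>V\<^esub> \<zero>\<^bsub>V\<^esub> = x"
    and F2_self [simp]: "x \<in> carrier V \<Longrightarrow> x \<oplus>\<^bsub>V\<^esub> x = \<zero>\<^bsub>V\<^esub>"
    and F2_self2 [simp]: "x \<in> carrier V \<Longrightarrow> y \<in> carrier V \<Longrightarrow> x \<oplus>\<^bsub>V\<^esub> (x \<oplus>\<^bsub>V\<^esub> y) = y"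
    and F2_abelian: "abelian_group V"
    and F2_smult_closed [simp]: "x \<in> carrier V \<Longrightarrow> b \<odot>\<^bsub>V\<^esub> x \<in> carrier V"
proof -
  interpret module F2 V by fact
  show "\<zero>\<^bsub>V\<^esub> \<in> carrier V" by simp
  show *: "x \<oplus>\<^bsub>V\<^esub> x = \<zero>\<^bsub>V\<^esub>" if "x \<in> carrier V" for x
    using smult_l_distr[of 1 1 x] smult_one[of x] smult_l_null[of x] that by (simp add: bit_add_self)
  show "x \<oplus>\<^bsub>V\<^esub> (x \<oplus>\<^bsub>V\<^esub> y) = y" if "x \<in> carrier V" "y \<in> carrier V"
    using that M.a_assoc[of x x y] * by simp
  show "abelian_group V" by unfold_locales
  show "b \<odot>\<^bsub>V\<^esub> x \<in> carrier V" if "x \<in> carrier V"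
    using that smult_closed by simp
  show "(x \<oplus>\<^bsub>V\<^esub> y) \<oplus>\<^bsub>V\<^esub> z = x \<oplus>\<^bsub>V\<^esub> (y \<oplus>\<^bsub>V\<^esub> z)" "x \<oplus>\<^bsub>V\<^esub> (y \<oplus>\<^bsub>V\<^esub> z) = y \<oplus>\<^bsub>V\<^esub> (x \<oplus>\<^bsub>V\<^esub> z)"
    if "x \<in> carrier V" "y \<in> carrier V" "z \<in> carrier V"
    using that by (auto simp: M.a_ac)
  show "x \<oplus>\<^bsub>V\<^esub> y \<in> carrier V" "x \<oplus>\<^bsub>V\<^esub> y = y \<oplus>\<^bsub>V\<^esub> x" if "x \<in> carrier V" "y \<in> carrier V"
    using that by (auto simp: M.a_comm)
  show "\<zero>\<^bsub>V\<^esub> \<oplus>\<^bsub>V\<^esub> x = x" "x \<oplus>\<^bsub>V\<^esub> \<zero>\<^bsub>V\<^esub> = x" if "x \<in> carrier V"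
    using that by auto
qed

lemma F2_add_eq_zero:
  assumes "module F2 V" "x \<in> carrier V" "y \<in> carrier V"
  shows "x \<oplus>\<^bsub>V\<^esub> y = \<zero>\<^bsub>V\<^esub> \<longleftrightarrow> x = y"
  by (metis F2_self F2_self2 F2_r0 assms)

text \<open>Additivity suffices: a scalar is 0 or 1, and zero is preserved because f 0 = f (0 + 0) =
  f 0 + f 0 = 0 in characteristic two.\<close>

lemma vs_linear_iff:
  assumes V: "module F2 V" and W: "module F2 W"
  shows "vs_linear V W f \<longleftrightarrow> (\<forall>x\<in>carrier V. f x \<in> carrier W) \<and>
     (\<forall>x\<in>carrier V. \<forall>y\<in>carrier V. f (x \<oplus>\<^bsub>V\<^esub> y) = f x \<oplus>\<^bsub>W\<^esub> f y)"
proof -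
  have "f \<zero>\<^bsub>V\<^esub> = \<zero>\<^bsub>W\<^esub>"
    if "\<forall>x\<in>carrier V. f x \<in> carrier W" "\<forall>x\<in>carrier V. \<forall>y\<in>carrier V. f (x \<oplus>\<^bsub>V\<^esub> y) = f x \<oplus>\<^bsub>W\<^esub> f y"
    using that F2_self[OF V F2_zero[OF V]] F2_self[OF W, of "f \<zero>\<^bsub>V\<^esub>"] F2_zero[OF V] by metis
  then show ?thesis
    unfolding vs_linear_def hom_def by (auto simp: F2_smult[OF V] F2_smult[OF W])
qed

lemma vs_linearD:
  assumes "vs_linear V W f"
  shows vs_linear_closed: "x \<in> carrier V \<Longrightarrow> f x \<in> carrier W"
    and vs_linear_add: "x \<in> carrier V \<Longrightarrow> y \<in> carrier V \<Longrightarrow> f (x \<oplus>\<^bsub>V\<^esub> y) = f x \<oplus>\<^bsub>W\<^esub> f y"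
    and vs_linear_smult: "x \<in> carrier V \<Longrightarrow> f (b \<odot>\<^bsub>V\<^esub> x) = b \<odot>\<^bsub>W\<^esub> f x"
  using assms by (auto simp: vs_linear_def hom_def)

lemma vs_linear_zero:
  assumes "vs_linear V W f" "module F2 V" "module F2 W"
  shows "f \<zero>\<^bsub>V\<^esub> = \<zero>\<^bsub>W\<^esub>"
  using vs_linear_smult[OF assms(1), of "\<zero>\<^bsub>V\<^esub>" 0] assms
  by (simp add: F2_smult vs_linear_closed[OF assms(1)])

lemma finsum_atMost_linear:
  assumes V: "module F2 V" and W: "module F2 W" and h: "vs_linear V W h"
    and f: "\<And>k. k \<le> n \<Longrightarrow> f k \<in> carrier V"
  shows "finsum V f {..n} \<in> carrier V \<and> h (finsum V f {..n}) = finsum W (\<lambda>k. h (f k)) {..n::nat}"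
proof -
  interpret v: abelian_group V by (rule F2_abelian[OF V])
  interpret w: abelian_group W by (rule F2_abelian[OF W])
  show ?thesis using f
  proof (induction n)
    case 0
    then show ?case using vs_linear_closed[OF h] by (simp add: Pi_def)
  next
    case (Suc n)
    then have "finsum V f {..n} \<in> carrier V" "h (finsum V f {..n}) = finsum W (\<lambda>k. h (f k)) {..n}"
      by auto
    with Suc.prems show ?case
      using vs_linear_closed[OF h] vs_linear_add[OF h] by (simp add: Pi_def)
  qed
qed

lemma mk_vs_simps [simp]:
  "carrier (mk_vs C z p m) = C" "\<zero>\<^bsub>mk_vs C z p m\<^esub> = z" "x \<oplus>\<^bsub>mk_vs C z p m\<^esub> y = p x y"
  "b \<odot>\<^bsub>mk_vs C z p m\<^esub> x = m b x"
  by (simp_all add: mk_vs_def)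

subsection \<open>Unstable modules\<close>

lemma
  assumes "steenrod_module M"
  shows steenrod_vs [simp]: "module F2 (piece M n)"
    and steenrod_linear: "vs_linear (piece M n) (piece M (n + i)) (Sq M i n)"
    and steenrod_Sq0: "x \<in> carrier (piece M n) \<Longrightarrow> Sq M 0 n x = x"
  using assms by (auto simp: steenrod_module_def)

lemma
  assumes "unstable_module M"
  shows unstable_steenrod [simp]: "steenrod_module M"
    and unstable_vs [simp]: "module F2 (piece M n)"
    and unstable_Sq_closed: "x \<in> carrier (piece M n) \<Longrightarrow> d = n + i \<Longrightarrow> Sq M i n x \<in> carrier (piece M d)"
    and unstable_Sq_add: "x \<in> carrier (piece M n) \<Longrightarrow> y \<in> carrier (piece M n) \<Longrightarrow>
       Sq M i n (x \<oplus>\<^bsub>piece M n\<^esub> y) = Sq M i n x \<oplus>\<^bsub>piece M (n + i)\<^esub> Sq M i n y"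
    and unstable_Sq_zero: "d = n \<Longrightarrow> Sq M i n \<zero>\<^bsub>piece M d\<^esub> = \<zero>\<^bsub>piece M (n + i)\<^esub>"
    and unstable_Sq0: "x \<in> carrier (piece M n) \<Longrightarrow> Sq M 0 n x = x"
    and unstable_Sq_big: "x \<in> carrier (piece M n) \<Longrightarrow> n < k \<Longrightarrow> Sq M k n x = \<zero>\<^bsub>piece M (n + k)\<^esub>"
proof -
  have M: "steenrod_module M" using assms by (simp add: unstable_module_def)
  note l = steenrod_linear[OF M, of n i]
  show "steenrod_module M" "module F2 (piece M n)" using M by auto
  show "x \<in> carrier (piece M n) \<Longrightarrow> d = n + i \<Longrightarrow> Sq M i n x \<in> carrier (piece M d)"
    using vs_linear_closed[OF l] by blast
  show "d = n \<Longrightarrow> Sq M i n \<zero>\<^bsub>piece M d\<^esub> = \<zero>\<^bsub>piece M (n + i)\<^esub>"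
    using vs_linear_zero[OF l] M by simp
  show "x \<in> carrier (piece M n) \<Longrightarrow> Sq M 0 n x = x" using steenrod_Sq0[OF M] .
qed (use vs_linear_add[OF steenrod_linear] assms in \<open>auto simp: unstable_module_def\<close>)

definition adem_rhs :: "'a sq_module \<Rightarrow> nat \<Rightarrow> nat \<Rightarrow> nat \<Rightarrow> 'a \<Rightarrow> 'a" where
  "adem_rhs M i j n x = (\<Oplus>\<^bsub>piece M (n + i + j)\<^esub> k\<in>{..i div 2}.
           of_nat ((j - k - 1) choose (i - 2 * k)) \<odot>\<^bsub>piece M (n + i + j)\<^esub>
             Sq M (i + j - k) (n + k) (Sq M k n x))"

lemma steenrod_adem:
  assumes "steenrod_module M" "0 < i" "i < 2 * j" "x \<in> carrier (piece M n)"
  shows "Sq M i (n + j) (Sq M j n x) = adem_rhs M i j n x"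
  using assms unfolding steenrod_module_def adem_rhs_def by (auto simp: atMost_atLeast0)

text \<open>Neither \<open>M\<close> nor \<open>N\<close> is assumed to satisfy the Adem relations,
  since the lemma serves to prove them: on \<open>M\<close> by mapping to modules where they hold,
  on \<open>N\<close> as the image of such a module.\<close>

lemma adem_rhs_map:
  assumes M: "\<And>n. module F2 (piece M n)" and N: "\<And>n. module F2 (piece N n)"
    and c: "\<And>i n x. x \<in> carrier (piece M n) \<Longrightarrow> Sq M i n x \<in> carrier (piece M (n + i))"
    and h: "\<And>n. vs_linear (piece M n) (piece N n) (h n)"
    and hs: "\<And>i n x. x \<in> carrier (piece M n) \<Longrightarrow> h (n + i) (Sq M i n x) = Sq N i n (h n x)"
    and x: "x \<in> carrier (piece M n)" and ij: "i < 2 * j"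
  shows "adem_rhs M i j n x \<in> carrier (piece M (n + i + j)) \<and>
         h (n + i + j) (adem_rhs M i j n x) = adem_rhs N i j n (h n x)"
proof -
  have *: "Sq M (i + j - k) (n + k) (Sq M k n x) \<in> carrier (piece M (n + i + j))"
    if "k \<le> i div 2" for k
  proof -
    have "n + k + (i + j - k) = n + i + j" using that ij by simp
    with c[OF c[OF x, of k], of "i + j - k"] show ?thesis by metis
  qed
  have **: "h (n + i + j) (Sq M (i + j - k) (n + k) (Sq M k n x)) =
      Sq N (i + j - k) (n + k) (Sq N k n (h n x))" if "k \<le> i div 2" for k
  proof -
    have "n + k + (i + j - k) = n + i + j" using that ij by simp
    with hs[OF c[OF x, of k], of "i + j - k"] hs[OF x, of k] show ?thesis by metis
  qed
  interpret w: abelian_group "piece N (n + i + j)" by (rule F2_abelian[OF N])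
  have "finsum (piece N (n + i + j)) (\<lambda>k. h (n + i + j) (of_nat ((j - k - 1) choose (i - 2 * k)) \<odot>\<^bsub>piece M (n + i + j)\<^esub>
             Sq M (i + j - k) (n + k) (Sq M k n x))) {..i div 2} = adem_rhs N i j n (h n x)"
    unfolding adem_rhs_def
  proof (rule w.finsum_cong')
    fix k assume k: "k \<in> {..i div 2}"
    then show "h (n + i + j) (of_nat ((j - k - 1) choose (i - 2 * k)) \<odot>\<^bsub>piece M (n + i + j)\<^esub>
             Sq M (i + j - k) (n + k) (Sq M k n x)) = of_nat ((j - k - 1) choose (i - 2 * k)) \<odot>\<^bsub>piece N (n + i + j)\<^esub>
             Sq N (i + j - k) (n + k) (Sq N k n (h n x))"
      using * ** vs_linear_smult[OF h] by simp
  next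
    show "(\<lambda>k. of_nat ((j - k - 1) choose (i - 2 * k)) \<odot>\<^bsub>piece N (n + i + j)\<^esub>
             Sq N (i + j - k) (n + k) (Sq N k n (h n x))) \<in> {..i div 2} \<rightarrow> carrier (piece N (n + i + j))"
      using * vs_linear_closed[OF h] F2_smult_closed[OF N] by (auto simp: **[symmetric])
  qed simp
  with finsum_atMost_linear[OF M N h, of "i div 2" "\<lambda>k. of_nat ((j - k - 1) choose (i - 2 * k)) \<odot>\<^bsub>piece M (n + i + j)\<^esub>
             Sq M (i + j - k) (n + k) (Sq M k n x)" "n + i + j"] *
  show ?thesis
    unfolding adem_rhs_def using F2_smult_closed[OF M] by simp
qed

text \<open>Each axiom is an equation, so it can be tested after maps that respect the structure and
  jointly separate points. Copies in another type, free modules, kernels and the suspended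
  cohomology of CP^inf are recognised as unstable modules in this way.\<close>

lemma unstable_jointly:
  fixes F :: "'a sq_module" and \<H> :: "('b sq_module \<times> (nat \<Rightarrow> 'a \<Rightarrow> 'b)) set"
  assumes z: "\<And>n. \<zero>\<^bsub>piece F n\<^esub> \<in> carrier (piece F n)"
    and a: "\<And>n x y. x \<in> carrier (piece F n) \<Longrightarrow> y \<in> carrier (piece F n) \<Longrightarrow> x \<oplus>\<^bsub>piece F n\<^esub> y \<in> carrier (piece F n)"
    and sm: "\<And>n x b. x \<in> carrier (piece F n) \<Longrightarrow> b \<odot>\<^bsub>piece F n\<^esub> x = (if b = 0 then \<zero>\<^bsub>piece F n\<^esub> else x)"
    and s: "\<And>i n x. x \<in> carrier (piece F n) \<Longrightarrow> Sq F i n x \<in> carrier (piece F (n + i))"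
    and E: "\<And>E h. (E, h) \<in> \<H> \<Longrightarrow> unstable_module E"
    and hc: "\<And>E h n x. (E, h) \<in> \<H> \<Longrightarrow> x \<in> carrier (piece F n) \<Longrightarrow> h n x \<in> carrier (piece E n)"
    and hz: "\<And>E h n. (E, h) \<in> \<H> \<Longrightarrow> h n \<zero>\<^bsub>piece F n\<^esub> = \<zero>\<^bsub>piece E n\<^esub>"
    and ha: "\<And>E h n x y. (E, h) \<in> \<H> \<Longrightarrow> x \<in> carrier (piece F n) \<Longrightarrow> y \<in> carrier (piece F n) \<Longrightarrow>
       h n (x \<oplus>\<^bsub>piece F n\<^esub> y) = h n x \<oplus>\<^bsub>piece E n\<^esub> h n y"
    and hs: "\<And>E h n i x. (E, h) \<in> \<H> \<Longrightarrow> x \<in> carrier (piece F n) \<Longrightarrow> h (n + i) (Sq F i n x) = Sq E i n (h n x)"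
    and sep: "\<And>n x y. x \<in> carrier (piece F n) \<Longrightarrow> y \<in> carrier (piece F n) \<Longrightarrow>
       (\<And>E h. (E, h) \<in> \<H> \<Longrightarrow> h n x = h n y) \<Longrightarrow> x = y"
  shows "unstable_module F"
proof -
  have F: "module F2 (piece F n)" for n
  proof (rule module_F2I)
    fix x assume x: "x \<in> carrier (piece F n)"
    show "\<zero>\<^bsub>piece F n\<^esub> \<oplus>\<^bsub>piece F n\<^esub> x = x"
    proof (rule sep[of _ n])
      fix E h assume Eh: "(E, h) \<in> \<H>"
      show "h n (\<zero>\<^bsub>piece F n\<^esub> \<oplus>\<^bsub>piece F n\<^esub> x) = h n x"
        using x by (simp add: ha[OF Eh] hz[OF Eh] hc[OF Eh] z E[OF Eh])
    qed (use x a z in auto)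
    show "x \<oplus>\<^bsub>piece F n\<^esub> x = \<zero>\<^bsub>piece F n\<^esub>"
    proof (rule sep[of _ n])
      fix E h assume Eh: "(E, h) \<in> \<H>"
      show "h n (x \<oplus>\<^bsub>piece F n\<^esub> x) = h n \<zero>\<^bsub>piece F n\<^esub>"
        using x by (simp add: ha[OF Eh] hz[OF Eh] hc[OF Eh] E[OF Eh])
    qed (use x a z in auto)
    fix y assume y: "y \<in> carrier (piece F n)"
    show "x \<oplus>\<^bsub>piece F n\<^esub> y = y \<oplus>\<^bsub>piece F n\<^esub> x"
    proof (rule sep[of _ n])
      fix E h assume Eh: "(E, h) \<in> \<H>"
      show "h n (x \<oplus>\<^bsub>piece F n\<^esub> y) = h n (y \<oplus>\<^bsub>piece F n\<^esub> x)"
        using x y F2_comm[OF unstable_vs[OF E[OF Eh]] hc[OF Eh x] hc[OF Eh y]] by (simp add: ha[OF Eh])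
    qed (use x y a in auto)
    fix w assume w: "w \<in> carrier (piece F n)"
    show "x \<oplus>\<^bsub>piece F n\<^esub> y \<oplus>\<^bsub>piece F n\<^esub> w = x \<oplus>\<^bsub>piece F n\<^esub> (y \<oplus>\<^bsub>piece F n\<^esub> w)"
    proof (rule sep[of _ n])
      fix E h assume Eh: "(E, h) \<in> \<H>"
      show "h n (x \<oplus>\<^bsub>piece F n\<^esub> y \<oplus>\<^bsub>piece F n\<^esub> w) = h n (x \<oplus>\<^bsub>piece F n\<^esub> (y \<oplus>\<^bsub>piece F n\<^esub> w))"
        using x y w F2_assoc[OF unstable_vs[OF E[OF Eh]] hc[OF Eh x] hc[OF Eh y] hc[OF Eh w]]
        by (simp add: ha[OF Eh] a)
    qed (use x y w a in auto)
  qed (use z a sm in auto)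
  have hl: "vs_linear (piece F n) (piece E n) (h n)" if "(E, h) \<in> \<H>" for E h n
    using that by (simp add: vs_linear_iff F E hc ha)
  have "vs_linear (piece F n) (piece F (n + i)) (Sq F i n)" for n i
  proof -
    have "Sq F i n (x \<oplus>\<^bsub>piece F n\<^esub> y) = Sq F i n x \<oplus>\<^bsub>piece F (n + i)\<^esub> Sq F i n y"
      if "x \<in> carrier (piece F n)" "y \<in> carrier (piece F n)" for x y
    proof (rule sep[of _ "n + i"])
      show "Sq F i n (x \<oplus>\<^bsub>piece F n\<^esub> y) \<in> carrier (piece F (n + i))"
        "Sq F i n x \<oplus>\<^bsub>piece F (n + i)\<^esub> Sq F i n y \<in> carrier (piece F (n + i))"
        using that by (blast intro: s a)+
      fix E h assume Eh: "(E, h) \<in> \<H>"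
      show "h (n + i) (Sq F i n (x \<oplus>\<^bsub>piece F n\<^esub> y)) =
          h (n + i) (Sq F i n x \<oplus>\<^bsub>piece F (n + i)\<^esub> Sq F i n y)"
        using that hs[OF Eh] ha[OF Eh] unstable_Sq_add[OF E[OF Eh] hc[OF Eh] hc[OF Eh]] by (simp add: s a)
    qed
    then show ?thesis by (simp add: vs_linear_iff[OF F F] s)
  qed
  moreover have "Sq F 0 n x = x" if "x \<in> carrier (piece F n)" for n x
    using that s[of x n 0] 
  proof (intro sep[of _ n])
    fix E h assume Eh: "(E, h) \<in> \<H>"
    show "h n (Sq F 0 n x) = h n x"
      using hs[OF Eh that, of 0] unstable_Sq0[OF E[OF Eh] hc[OF Eh that]] by simp
  qed auto
  moreover have "Sq F i (n + j) (Sq F j n x) = adem_rhs F i j n x"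
    if ij: "0 < i" "i < 2 * j" and x: "x \<in> carrier (piece F n)" for i j n x
  proof (rule sep)
    show "Sq F i (n + j) (Sq F j n x) \<in> carrier (piece F (n + i + j))"
      using s[OF s[OF x]] by (metis add.commute add.left_commute)
    have ar: "adem_rhs F i j n x \<in> carrier (piece F (n + i + j)) \<and>
         h (n + i + j) (adem_rhs F i j n x) = adem_rhs E i j n (h n x)" if "(E, h) \<in> \<H>" for E h
      by (rule adem_rhs_map) (use F E hl hs s x ij that in auto)
    show "adem_rhs F i j n x \<in> carrier (piece F (n + i + j))"
    proof -
      \<comment> \<open>The family may be empty, so closure of the right-hand side is taken from the
        identity of \<open>F\<close> and not from a member of the family.\<close>
      have *: "adem_rhs F i j n x \<in> carrier (piece F (n + i + j)) \<and>
         id (adem_rhs F i j n x) = adem_rhs F i j n (id x)"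
        by (rule adem_rhs_map[where h = "\<lambda>_. id"]) (use F s x ij in \<open>auto simp: vs_linear_iff\<close>)
      then show ?thesis by simp
    qed
    fix E h assume Eh: "(E, h) \<in> \<H>"
    have "h (n + i + j) (Sq F i (n + j) (Sq F j n x)) = Sq E i (n + j) (Sq E j n (h n x))"
      using hs[OF Eh s[OF x], of j i] hs[OF Eh x, of j] by (metis add.commute add.left_commute)
    also have "\<dots> = adem_rhs E i j n (h n x)"
      using ij hc[OF Eh x] E[OF Eh] by (intro steenrod_adem) auto
    finally show "h (n + i + j) (Sq F i (n + j) (Sq F j n x)) = h (n + i + j) (adem_rhs F i j n x)"
      using ar[OF Eh] by simp
  qed
  moreover have "Sq F k n x = \<zero>\<^bsub>piece F (n + k)\<^esub>" if "n < k" "x \<in> carrier (piece F n)" for k n x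
  proof (rule sep[of _ "n + k"])
    fix E h assume Eh: "(E, h) \<in> \<H>"
    show "h (n + k) (Sq F k n x) = h (n + k) \<zero>\<^bsub>piece F (n + k)\<^esub>"
      using that hs[OF Eh] hz[OF Eh] unstable_Sq_big[OF E[OF Eh] hc[OF Eh]] by simp
  qed (use that s z in auto)
  ultimately show ?thesis
    unfolding unstable_module_def steenrod_module_def adem_rhs_def atMost_atLeast0
    using F by blast
qed

text \<open>The counterpart for surjections: equations pass to images. The source is only a Steenrod
  module because for \<open>omega\<close> it is the desuspension of \<open>M\<close>, which need not
  be unstable.\<close>

lemma steenrod_image:
  assumes M: "steenrod_module M"
    and sm: "\<And>n x b. x \<in> carrier (piece N n) \<Longrightarrow> b \<odot>\<^bsub>piece N n\<^esub> x = (if b = 0 then \<zero>\<^bsub>piece N n\<^esub> else x)"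
    and q: "\<And>n. q n ` carrier (piece M n) = carrier (piece N n)"
    and qz: "\<And>n. q n \<zero>\<^bsub>piece M n\<^esub> = \<zero>\<^bsub>piece N n\<^esub>"
    and qa: "\<And>n x y. x \<in> carrier (piece M n) \<Longrightarrow> y \<in> carrier (piece M n) \<Longrightarrow>
       q n (x \<oplus>\<^bsub>piece M n\<^esub> y) = q n x \<oplus>\<^bsub>piece N n\<^esub> q n y"
    and qs: "\<And>n i x. x \<in> carrier (piece M n) \<Longrightarrow> q (n + i) (Sq M i n x) = Sq N i n (q n x)"
  shows "steenrod_module N"
proof -
  have MV: "module F2 (piece M n)" for n using M by simp
  have qc: "x \<in> carrier (piece M n) \<Longrightarrow> q n x \<in> carrier (piece N n)" for n x using q by blast
  have Mc: "x \<in> carrier (piece M n) \<Longrightarrow> Sq M i n x \<in> carrier (piece M (n + i))" for i n x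
    using vs_linear_closed[OF steenrod_linear[OF M]] .
  have pre: "\<exists>y. y \<in> carrier (piece M n) \<and> x = q n y" if "x \<in> carrier (piece N n)" for n x
    using that q by blast
  have N: "module F2 (piece N n)" for n
  proof (rule module_F2I)
    show "\<zero>\<^bsub>piece N n\<^esub> \<in> carrier (piece N n)" using qc[OF F2_zero[OF MV]] qz by metis
    fix x assume "x \<in> carrier (piece N n)"
    then obtain x' where x: "x' \<in> carrier (piece M n)" "x = q n x'" using pre by blast
    show "\<zero>\<^bsub>piece N n\<^esub> \<oplus>\<^bsub>piece N n\<^esub> x = x" "x \<oplus>\<^bsub>piece N n\<^esub> x = \<zero>\<^bsub>piece N n\<^esub>"
      using x qa[OF F2_zero[OF MV] x(1)] qa[OF x(1) x(1)] by (simp_all add: MV qz)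
    fix y assume "y \<in> carrier (piece N n)"
    then obtain y' where y: "y' \<in> carrier (piece M n)" "y = q n y'" using pre by blast
    show "x \<oplus>\<^bsub>piece N n\<^esub> y \<in> carrier (piece N n)"
      unfolding x(2) y(2) qa[OF x(1) y(1), symmetric] using x(1) y(1) by (intro qc) (simp add: MV)
    show "x \<oplus>\<^bsub>piece N n\<^esub> y = y \<oplus>\<^bsub>piece N n\<^esub> x"
      using x y qa F2_comm[OF MV x(1) y(1)] by metis
    fix z assume "z \<in> carrier (piece N n)"
    then obtain z' where z: "z' \<in> carrier (piece M n)" "z = q n z'" using pre by blast
    show "x \<oplus>\<^bsub>piece N n\<^esub> y \<oplus>\<^bsub>piece N n\<^esub> z = x \<oplus>\<^bsub>piece N n\<^esub> (y \<oplus>\<^bsub>piece N n\<^esub> z)"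
      using x y z qa F2_assoc[OF MV x(1) y(1) z(1)] F2_add[OF MV] by metis
  qed (use sm in auto)
  have ql: "vs_linear (piece M n) (piece N n) (q n)" for n
    by (simp add: vs_linear_iff MV N qc qa)
  have "vs_linear (piece N n) (piece N (n + i)) (Sq N i n)" for n i
    unfolding vs_linear_iff[OF N N]
  proof (intro conjI ballI)
    fix x assume "x \<in> carrier (piece N n)"
    then obtain x' where x: "x' \<in> carrier (piece M n)" "x = q n x'" using pre by blast
    show "Sq N i n x \<in> carrier (piece N (n + i))"
      using qc[OF Mc[OF x(1)]] qs[OF x(1)] x(2) by metis
    fix y assume "y \<in> carrier (piece N n)"
    then obtain y' where y: "y' \<in> carrier (piece M n)" "y = q n y'" using pre by blast
    show "Sq N i n (x \<oplus>\<^bsub>piece N n\<^esub> y) = Sq N i n x \<oplus>\<^bsub>piece N (n + i)\<^esub> Sq N i n y"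
      using vs_linear_add[OF steenrod_linear[OF M] x(1) y(1), of i] qa[OF x(1) y(1)] qa[OF Mc[OF x(1)] Mc[OF y(1)], of i]
        qs[OF x(1), of i] qs[OF y(1), of i] qs[OF F2_add[OF MV x(1) y(1)], of i] x(2) y(2)
      by metis
  qed
  moreover have "Sq N 0 n x = x" if "x \<in> carrier (piece N n)" for n x
    using pre[OF that] by (metis add_0_right qs steenrod_Sq0[OF M])
  moreover have "Sq N i (n + j) (Sq N j n x) = adem_rhs N i j n x"
    if ij: "0 < i" "i < 2 * j" and x: "x \<in> carrier (piece N n)" for i j n x
  proof -
    obtain y where y: "y \<in> carrier (piece M n)" "x = q n y" using pre[OF x] by blast
    have "Sq N i (n + j) (Sq N j n x) = q (n + i + j) (Sq M i (n + j) (Sq M j n y))"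
      using qs[OF Mc[OF y(1)], of j i] qs[OF y(1), of j] y(2) by (metis add.commute add.left_commute)
    also have "\<dots> = q (n + i + j) (adem_rhs M i j n y)"
      using steenrod_adem[OF M ij y(1)] by simp
    also have "\<dots> = adem_rhs N i j n x"
      using adem_rhs_map[of M N q y n i j] MV N Mc ql qs y ij by simp
    finally show ?thesis .
  qed
  ultimately show ?thesis
    using N by (auto simp: steenrod_module_def adem_rhs_def atMost_atLeast0)
qed

subsection \<open>Morphisms\<close>

lemma
  assumes "f \<in> sq_hom M N"
  shows sq_hom_linear: "vs_linear (piece M n) (piece N n) (f n)"
    and sq_hom_closed: "x \<in> carrier (piece M n) \<Longrightarrow> f n x \<in> carrier (piece N n)"
    and sq_hom_add: "x \<in> carrier (piece M n) \<Longrightarrow> y \<in> carrier (piece M n) \<Longrightarrow>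
       f n (x \<oplus>\<^bsub>piece M n\<^esub> y) = f n x \<oplus>\<^bsub>piece N n\<^esub> f n y"
    and sq_hom_Sq: "x \<in> carrier (piece M n) \<Longrightarrow> d = n + i \<Longrightarrow> f d (Sq M i n x) = Sq N i n (f n x)"
    and sq_hom_ext: "f n \<in> extensional (carrier (piece M n))"
  using assms vs_linear_closed[of "piece M n" "piece N n" "f n"] vs_linear_add[of "piece M n" "piece N n" "f n"]
  by (auto simp: sq_hom_def)

lemma sq_hom_zero:
  assumes "f \<in> sq_hom M N" "\<And>n. module F2 (piece M n)" "\<And>n. module F2 (piece N n)"
  shows "f n \<zero>\<^bsub>piece M n\<^esub> = \<zero>\<^bsub>piece N n\<^esub>"
  using vs_linear_zero[OF sq_hom_linear] assms by blast

lemma ext_eqI: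
  assumes "\<And>n. f n \<in> extensional (A n)" "\<And>n. g n \<in> extensional (A n)"
    and "\<And>n x. x \<in> A n \<Longrightarrow> f n x = g n x"
  shows "f = g"
proof
  fix n show "f n = g n"
    by (rule extensionalityI[of _ "A n"]) (use assms in auto)
qed

lemma sq_hom_eqI:
  assumes "f \<in> sq_hom M N" "g \<in> sq_hom M N'" "\<And>n x. x \<in> carrier (piece M n) \<Longrightarrow> f n x = g n x"
  shows "f = g"
  using assms by (intro ext_eqI[of f "\<lambda>n. carrier (piece M n)"]) (auto simp: sq_hom_ext)

lemma sq_hom_restrictI:
  assumes "\<And>n. module F2 (piece M n)" "\<And>n. module F2 (piece N n)"
    and "\<And>n x. x \<in> carrier (piece M n) \<Longrightarrow> f n x \<in> carrier (piece N n)"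
    and "\<And>n x y. x \<in> carrier (piece M n) \<Longrightarrow> y \<in> carrier (piece M n) \<Longrightarrow>
       f n (x \<oplus>\<^bsub>piece M n\<^esub> y) = f n x \<oplus>\<^bsub>piece N n\<^esub> f n y"
    and "\<And>n i x. x \<in> carrier (piece M n) \<Longrightarrow> Sq M i n x \<in> carrier (piece M (n + i))"
    and "\<And>n i x. x \<in> carrier (piece M n) \<Longrightarrow> f (n + i) (Sq M i n x) = Sq N i n (f n x)"
  shows "(\<lambda>n. restrict (f n) (carrier (piece M n))) \<in> sq_hom M N"
  using assms by (auto simp: sq_hom_def vs_linear_iff)

lemma sq_comp_apply [simp]: "x \<in> carrier (piece M n) \<Longrightarrow> sq_comp M g f n x = g n (f n x)"
  by (simp add: sq_comp_def compose_eq)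

lemma sq_comp_ext: "sq_comp M g f n \<in> extensional (carrier (piece M n))"
  by (simp add: sq_comp_def compose_def)

lemma sq_comp_eq_iff:
  assumes "h \<in> sq_hom M L"
  shows "sq_comp M g f = h \<longleftrightarrow> (\<forall>n. \<forall>x\<in>carrier (piece M n). g n (f n x) = h n x)"
proof
  show "sq_comp M g f = h" if "\<forall>n. \<forall>x\<in>carrier (piece M n). g n (f n x) = h n x"
    using that by (intro ext_eqI[of _ "\<lambda>n. carrier (piece M n)"]) (auto simp: sq_hom_ext[OF assms] sq_comp_ext)
qed (metis sq_comp_apply)

lemma sq_comp_hom:
  assumes f: "f \<in> sq_hom M N" and g: "g \<in> sq_hom N L"
    and V: "\<And>n. module F2 (piece M n)" "\<And>n. module F2 (piece L n)"
    and S: "\<And>n i x. x \<in> carrier (piece M n) \<Longrightarrow> Sq M i n x \<in> carrier (piece M (n + i))"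
  shows "sq_comp M g f \<in> sq_hom M L"
proof -
  have "(\<lambda>n. restrict (\<lambda>x. g n (f n x)) (carrier (piece M n))) \<in> sq_hom M L"
    by (rule sq_hom_restrictI) (use assms in \<open>auto simp: sq_hom_closed[OF f] sq_hom_closed[OF g] sq_hom_add[OF f] sq_hom_add[OF g] sq_hom_Sq[OF f] sq_hom_Sq[OF g]\<close>)
  then show ?thesis by (simp add: sq_comp_def compose_def)
qed

lemma sq_zero_hom:
  assumes "unstable_module M" "\<And>n. module F2 (piece N n)"
    "\<And>n i. Sq N i n \<zero>\<^bsub>piece N n\<^esub> = \<zero>\<^bsub>piece N (n + i)\<^esub>"
  shows "sq_zero M N \<in> sq_hom M N"
  unfolding sq_zero_def using assms by (intro sq_hom_restrictI) (auto simp: unstable_Sq_closed)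

text \<open>The type \<open>nat \<times> 'b\<close> is infinite whatever \<open>'b\<close> is, so
  every countable carrier can be enumerated into it and the structure transported. This is how
  modules in different types meet the definition of \<open>projective\<close>, which speaks about
  one type.\<close>

lemma unstable_transport:
  fixes M :: "'a sq_module"
  assumes M: "unstable_module M" and cnt: "\<And>n. countable (carrier (piece M n))"
  obtains N :: "(nat \<times> 'b) sq_module" and a b where
    "unstable_module N" "a \<in> sq_hom M N" "b \<in> sq_hom N M"
    "\<And>n x. x \<in> carrier (piece M n) \<Longrightarrow> b n (a n x) = x"
    "\<And>n x. x \<in> carrier (piece N n) \<Longrightarrow> a n (b n x) = x"
proof -
  define c :: "nat \<Rightarrow> 'a \<Rightarrow> nat \<times> 'b" where "c n x = (to_nat_on (carrier (piece M n)) x, undefined)" for n x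
  define d where "d n = inv_into (carrier (piece M n)) (c n)" for n
  have inj: "inj_on (c n) (carrier (piece M n))" for n
    using inj_on_to_nat_on[OF cnt[of n]] by (auto simp: inj_on_def c_def)
  have dc: "d n (c n x) = x" if "x \<in> carrier (piece M n)" for n x
    using that inj by (simp add: d_def)
  define N where "N = \<lparr>piece = (\<lambda>n. mk_vs (c n ` carrier (piece M n)) (c n \<zero>\<^bsub>piece M n\<^esub>)
      (\<lambda>x y. c n (d n x \<oplus>\<^bsub>piece M n\<^esub> d n y)) (\<lambda>b x. c n (b \<odot>\<^bsub>piece M n\<^esub> d n x))),
    Sq = (\<lambda>i n x. c (n + i) (Sq M i n (d n x)))\<rparr>"
  note MV = unstable_vs[OF M] and MS = unstable_Sq_closed[OF M]
  have N: "unstable_module N"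
  proof (rule unstable_jointly[where \<H> = "{(M, d)}"])
    fix n x y assume "x \<in> carrier (piece N n)" "y \<in> carrier (piece N n)"
      "\<And>E h. (E, h) \<in> {(M, d)} \<Longrightarrow> h n x = h n y"
    then have "c n (d n x) = x" "c n (d n y) = y" "d n x = d n y"
      by (simp_all add: N_def) (use dc in fastforce)+
    then show "x = y" by metis
  qed (simp_all add: N_def, (use dc MV M MS F2_smult[OF MV] in \<open>fastforce simp: dc\<close>)+)
  show ?thesis
  proof (rule that[OF N])
    show "(\<lambda>n. restrict (c n) (carrier (piece M n))) \<in> sq_hom M N"
      by (rule sq_hom_restrictI) (auto simp: MV N unstable_vs MS, auto simp: N_def dc)
    show "(\<lambda>n. restrict (d n) (carrier (piece N n))) \<in> sq_hom N M"
      by (rule sq_hom_restrictI) (auto simp: MV N unstable_vs MS unstable_Sq_closed[OF N], auto simp: N_def dc MV MS)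
  qed (auto simp: N_def dc)
qed

lemma projective_unstable: "projective P \<Longrightarrow> unstable_module P"
  by (simp add: projective_def)

text \<open>\<open>E\<close> is copied into the type of \<open>P\<close>, and so is
  \<open>B\<close>, which is countable as an image of \<open>E\<close>; the lifting property then
  applies to the copies.\<close>

lemma projective_lift:
  fixes P :: "(nat \<times> 'p) sq_module" and E :: "'e sq_module" and B :: "'f sq_module"
  assumes P: "projective P" and E: "unstable_module E" and B: "unstable_module B"
    and cE: "\<And>n. countable (carrier (piece E n))" and q: "sq_surj E B q" and f: "f \<in> sq_hom P B"
  obtains g where "g \<in> sq_hom P E" "\<And>n x. x \<in> carrier (piece P n) \<Longrightarrow> q n (g n x) = f n x"
proof -
  have qh: "q \<in> sq_hom E B" and qs: "\<And>n. q n ` carrier (piece E n) = carrier (piece B n)"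
    using q by (auto simp: sq_surj_def)
  have cB: "countable (carrier (piece B n))" for n
    unfolding qs[symmetric] using cE by simp
  have PU: "unstable_module P" using P by (rule projective_unstable)
  obtain E' :: "(nat \<times> 'p) sq_module" and a b where E': "unstable_module E'" "a \<in> sq_hom E E'" "b \<in> sq_hom E' E"
    "\<And>n x. x \<in> carrier (piece E n) \<Longrightarrow> b n (a n x) = x"
    "\<And>n x. x \<in> carrier (piece E' n) \<Longrightarrow> a n (b n x) = x"
    using unstable_transport[OF E cE, where ?'b = 'p] by metis
  obtain B' :: "(nat \<times> 'p) sq_module" and a' b' where B': "unstable_module B'" "a' \<in> sq_hom B B'" "b' \<in> sq_hom B' B"
    "\<And>n x. x \<in> carrier (piece B n) \<Longrightarrow> b' n (a' n x) = x"
    "\<And>n x. x \<in> carrier (piece B' n) \<Longrightarrow> a' n (b' n x) = x"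
    using unstable_transport[OF B cB, where ?'b = 'p] by metis
  note h = sq_comp_hom[OF _ _ unstable_vs unstable_vs unstable_Sq_closed]
  have q': "sq_comp E' a' (sq_comp E' q b) \<in> sq_hom E' B'" (is "?q \<in> _")
    using E' B' qh B by (auto intro!: h)
  have "sq_surj E' B' ?q"
    unfolding sq_surj_def
  proof (intro conjI allI equalityI subsetI q')
    fix n y assume y: "y \<in> carrier (piece B' n)"
    then obtain x where x: "x \<in> carrier (piece E n)" "q n x = b' n y"
      using qs sq_hom_closed[OF B'(3) y] by (metis imageE)
    with y show "y \<in> ?q n ` carrier (piece E' n)"
      using E' B' sq_hom_closed[OF E'(2)] by (intro image_eqI[of _ _ "a n x"]) auto
  qed (use sq_hom_closed[OF q'] in auto)
  moreover have "sq_comp P a' f \<in> sq_hom P B'"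
    using f B' PU by (auto intro!: h)
  ultimately obtain g where g: "g \<in> sq_hom P E'" "sq_comp P ?q g = sq_comp P a' f"
    using P E'(1) B'(1) unfolding projective_def by blast
  show ?thesis
  proof (rule that)
    show "sq_comp P b g \<in> sq_hom P E" using g E' PU E by (auto intro!: h)
    fix n x assume x: "x \<in> carrier (piece P n)"
    then have "a' n (q n (b n (g n x))) = a' n (f n x)"
      using fun_cong[OF fun_cong[OF g(2), of n], of x] sq_hom_closed[OF g(1) x] by simp
    then have "q n (b n (g n x)) = f n x"
      using B'(4) sq_hom_closed[OF f x] sq_hom_closed[OF qh sq_hom_closed[OF E'(3) sq_hom_closed[OF g(1) x]]] by metis
    then show "q n (sq_comp P b g n x) = f n x" using x by simp
  qed
qed

unbundle fps_syntax

subsection \<open>The Adem relations on polynomials\<close>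

lemma fps_X_plus1_power_nth: "((1 + fps_X :: bit fps) ^ n) $ k = of_nat (n choose k)"
proof (induction n arbitrary: k)
  case (Suc n)
  then show ?case by (cases k) (auto simp: algebra_simps)
qed (auto simp: binomial_eq_0)

text \<open>Multiplying by 1 + X lowers the exponent by one, which gives Pascal's recursion; the
  signs of the negative binomial series disappear in characteristic two.\<close>

lemma fps_inverse_power_nth: "((inverse (1 + fps_X :: bit fps)) ^ Suc m) $ r = of_nat ((m + r) choose r)"
proof (induction m arbitrary: r)
  let ?a = "1 + fps_X :: bit fps" and ?b = "inverse (1 + fps_X :: bit fps)"
  have ab: "?b * ?a = 1" by (rule inverse_mult_eq_1) simp
  have step: "(?b ^ Suc m) $ Suc r = (?b ^ m) $ Suc r + (?b ^ Suc m) $ r" for m r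
  proof -
    have "?b ^ Suc m * ?a = ?b ^ m * (?b * ?a)" by (simp only: power_Suc mult_ac)
    then have "?b ^ Suc m * ?a = ?b ^ m" by (simp only: ab mult_1_right)
    then have "(?b ^ m) $ Suc r = (?b ^ Suc m + ?b ^ Suc m * fps_X) $ Suc r"
      by (simp only: distrib_left mult_1_right)
    also have "\<dots> = (?b ^ Suc m) $ Suc r + (?b ^ Suc m) $ r" by simp
    finally show ?thesis by (simp add: add.assoc)
  qed
  have start: "(?b ^ Suc m) $ 0 = 1" for m by (simp add: fps_nth_power_0)
  {
    case 0
    show ?case
    proof (induction r)
      case (Suc r)
      then show ?case using step[of 0 r] by simp
    qed (use start[of 0] in simp)
  next
    case (Suc m)
    show ?case
    proof (induction r)
      case (Suc r)
      then show ?case using step[of "Suc m" r] Suc.IH \<open>\<And>r. (?b ^ Suc m) $ r = of_nat ((m + r) choose r)\<close>[of "Suc r"]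
        by (simp del: power_Suc add: add.commute)
    qed (use start[of "Suc m"] in simp)
  }
qed

lemma of_nat_bit_even: "even n \<Longrightarrow> (of_nat n :: bit) = 0"
  by (auto elim!: evenE)

text \<open>The numerical core of the Adem relations. With a = 1 + X and b = 1/a, both sides are the
  coefficient of X^i in one power series, expanded once in powers of X a and once in powers of X^2
  b.\<close>

lemma binomial_adem:
  assumes "i < 2 * j"
  shows "(of_nat ((i + j) choose i) :: bit) =
    (\<Sum>k\<le>i div 2. of_nat ((j - k - 1) choose (i - 2 * k)) * of_nat ((i + j) choose k))"
proof -
  define a where "a = (1 + fps_X :: bit fps)"
  define b where "b = inverse a"
  define n where "n = i + j"
  define N where "N = j - 1"
  have ab: "a * b = 1" "b * a = 1" unfolding b_def a_def by (simp_all add: inverse_mult_eq_1 inverse_mult_eq_1')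
  have cancel: "a ^ (p + q) * b ^ p = a ^ q" "b ^ (p + q) * a ^ p = b ^ q" for p q
    using power_mult_distrib[of a b p] ab
    by (simp_all add: power_add algebra_simps)
  have N: "n = N + Suc i" using assms by (simp add: n_def N_def)
  \<comment> \<open>Here n = N + i + 1, and 1 + X^2 b = b (1 + X a) because a + X^2 = 1 + X + X^2 =
    1 + X a.\<close>
  have "a ^ N * (1 + fps_X ^ 2 * b) ^ n = b ^ Suc i * (1 + fps_X * a) ^ n"
  proof -
    have "1 + fps_X ^ 2 * b = b * (a + fps_X ^ 2)" using ab by (simp add: algebra_simps)
    also have "a + fps_X ^ 2 = 1 + fps_X * a" by (simp add: a_def algebra_simps power2_eq_square)
    finally have "a ^ N * (1 + fps_X ^ 2 * b) ^ n = (a ^ N * b ^ n) * (1 + fps_X * a) ^ n"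
      by (simp add: power_mult_distrib mult.assoc)
    also have "a ^ N * b ^ n = b ^ Suc i"
      using cancel(2)[of N "Suc i"] N by (simp add: mult.commute)
    finally show ?thesis .
  qed
  then have eq: "(a ^ N * (1 + fps_X ^ 2 * b) ^ n) $ i = (b ^ Suc i * (1 + fps_X * a) ^ n) $ i" by simp
  have "(a ^ N * (1 + fps_X ^ 2 * b) ^ n) $ i =
      (\<Sum>k\<le>n. (fps_X ^ (2 * k) * (of_nat (n choose k) * (a ^ N * b ^ k))) $ i)"
  proof -
    have "(1 + fps_X ^ 2 * b) ^ n = (\<Sum>k\<le>n. of_nat (n choose k) * (fps_X ^ 2 * b) ^ k)"
      using binomial_ring[of "fps_X ^ 2 * b" 1 n] by (simp add: add.commute)
    then show ?thesis
      by (simp add: sum_distrib_left power_mult_distrib fps_sum_nth mult_ac flip: power_mult)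
  qed
  also have "\<dots> = (\<Sum>k\<le>i div 2. of_nat ((j - k - 1) choose (i - 2 * k)) * of_nat ((i + j) choose k))"
  proof (rule sum.mono_neutral_cong_right)
    fix k assume "k \<in> {..i div 2}"
    then have k: "2 * k \<le> i" "k \<le> N" using assms by (auto simp: N_def)
    have "a ^ N * b ^ k = a ^ (N - k)" using cancel(1)[of k "N - k"] k by simp
    then show "(fps_X ^ (2 * k) * (of_nat (n choose k) * (a ^ N * b ^ k))) $ i =
        of_nat ((j - k - 1) choose (i - 2 * k)) * of_nat ((i + j) choose k)"
      using k by (simp add: fps_X_power_mult_nth a_def fps_X_plus1_power_nth N_def n_def fps_mult_of_nat_nth mult.commute)
  qed (auto simp: fps_X_power_mult_nth n_def)
  finally have 1: "(a ^ N * (1 + fps_X ^ 2 * b) ^ n) $ i =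
     (\<Sum>k\<le>i div 2. of_nat ((j - k - 1) choose (i - 2 * k)) * of_nat ((i + j) choose k))" .
  have "(b ^ Suc i * (1 + fps_X * a) ^ n) $ i =
      (\<Sum>k\<le>n. (fps_X ^ k * (of_nat (n choose k) * (b ^ Suc i * a ^ k))) $ i)"
  proof -
    have "(1 + fps_X * a) ^ n = (\<Sum>k\<le>n. of_nat (n choose k) * (fps_X * a) ^ k)"
      using binomial_ring[of "fps_X * a" 1 n] by (simp add: add.commute)
    then show ?thesis
      by (simp add: sum_distrib_left power_mult_distrib fps_sum_nth algebra_simps)
  qed
  \<comment> \<open>For k > i there is no X^i in the term. For k <= i it carries the central
    binomial coefficient 2(i - k) choose i - k, which is even unless k = i.\<close>
  also have "\<dots> = (\<Sum>k\<in>{i}. of_nat (n choose k))"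
  proof (rule sum.mono_neutral_cong_right)
    have *: "(fps_X ^ k * (of_nat (n choose k) * (b ^ Suc i * a ^ k))) $ i =
        of_nat (n choose k) * of_nat ((2 * (i - k)) choose (i - k))" if "k \<le> i" for k
    proof -
      have "b ^ Suc i * a ^ k = b ^ Suc (i - k)" using cancel(2)[of k "Suc (i - k)"] that by simp
      then show ?thesis
        using that fps_inverse_power_nth[of "i - k" "i - k"]
        by (simp add: fps_X_power_mult_nth b_def a_def fps_mult_of_nat_nth mult_2 del: power_Suc)
    qed
    show "(fps_X ^ k * (of_nat (n choose k) * (b ^ Suc i * a ^ k))) $ i = of_nat (n choose k)"
      if "k \<in> {i}" for k using *[of k] that by simp
    show "\<forall>k\<in>{..n} - {i}. (fps_X ^ k * (of_nat (n choose k) * (b ^ Suc i * a ^ k))) $ i = 0"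
    proof
      fix k assume k: "k \<in> {..n} - {i}"
      show "(fps_X ^ k * (of_nat (n choose k) * (b ^ Suc i * a ^ k))) $ i = 0"
      proof (cases "k < i")
        case True
        then obtain r where r: "i - k = Suc r" by (metis Suc_diff_Suc)
        have "(2 * Suc r) choose Suc r = 2 * (Suc (2 * r) choose r)"
          using binomial_symmetric[of r "Suc (2 * r)"] by simp
        then have "even ((2 * Suc r) choose Suc r)" by (simp only: dvd_triv_left)
        then have "(of_nat ((2 * Suc r) choose Suc r) :: bit) = 0" by (rule of_nat_bit_even)
        then show ?thesis using *[of k] True by (simp only: r mult_zero_right less_imp_le)
      next
        case False
        then show ?thesis using k by (simp add: fps_X_power_mult_nth del: power_Suc)
      qed
    qed
  qed (auto simp: n_def)
  finally show ?thesis using 1 eq by (simp add: n_def)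
qed

text \<open>A homogeneous polynomial in two variables is given by its array of coefficients. The
  composites \<open>Sq\<^sup>i Sq\<^sup>j\<close> on products of one-dimensional classes have generating functions that are
  polynomials in \<open>x + y\<close> and \<open>x\<^sup>2 y\<close>; the Adem relations say that an array is of this kind.\<close>

definition dickson_monomial :: "nat \<Rightarrow> nat \<Rightarrow> nat \<Rightarrow> nat \<Rightarrow> bit" where
  "dickson_monomial a b i j = (if i + j = a + 3 * b \<and> 2 * b \<le> i then of_nat (a choose (i - 2 * b)) else 0)"

inductive_set dickson :: "(nat \<Rightarrow> nat \<Rightarrow> bit) set" where
  zero: "(\<lambda>i j. 0) \<in> dickson"
| monomial_add: "c \<in> dickson \<Longrightarrow> (\<lambda>i j. dickson_monomial a b i j + c i j) \<in> dickson"

text \<open>Multiplication by x^q + y^q, which is (x + y)^q when q is a power of two; likewise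
  \<open>mult_xxy q\<close> multiplies by (x^2 y)^q.\<close>

definition mult_x_plus_y :: "nat \<Rightarrow> (nat \<Rightarrow> nat \<Rightarrow> bit) \<Rightarrow> nat \<Rightarrow> nat \<Rightarrow> bit" where
  "mult_x_plus_y q c i j = (if q \<le> i then c (i - q) j else 0) + (if q \<le> j then c i (j - q) else 0)"

definition mult_xxy :: "nat \<Rightarrow> (nat \<Rightarrow> nat \<Rightarrow> bit) \<Rightarrow> nat \<Rightarrow> nat \<Rightarrow> bit" where
  "mult_xxy q c i j = (if 2 * q \<le> i \<and> q \<le> j then c (i - 2 * q) (j - q) else 0)"

lemma dickson_add: "c \<in> dickson \<Longrightarrow> d \<in> dickson \<Longrightarrow> (\<lambda>i j. c i j + d i j) \<in> dickson"
  by (induction rule: dickson.induct) (auto simp: add.assoc intro: dickson.intros)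

lemma mult_x_plus_y_monomial: "mult_x_plus_y 1 (dickson_monomial a b) = dickson_monomial (Suc a) b"
proof (intro ext)
  fix i j
  show "mult_x_plus_y 1 (dickson_monomial a b) i j = dickson_monomial (Suc a) b i j"
  proof (cases "i + j = Suc a + 3 * b \<and> 2 * b \<le> i")
    case True
    show ?thesis
    proof (cases "i = 2 * b")
      case True
      then show ?thesis using \<open>i + j = _ \<and> _\<close>
        by (auto simp: mult_x_plus_y_def dickson_monomial_def)
    next
      case False
      then obtain r where r: "i = Suc (2 * b + r)" using True
        by (metis less_imp_Suc_add le_neq_implies_less)
      show ?thesis using True r
        by (cases j) (auto simp: mult_x_plus_y_def dickson_monomial_def binomial_eq_0)
    qed
  next
    case False
    then show ?thesis by (auto simp: mult_x_plus_y_def dickson_monomial_def)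
  qed
qed

lemma mult_xxy_monomial: "mult_xxy 1 (dickson_monomial a b) = dickson_monomial a (Suc b)"
  by (intro ext) (auto simp: mult_xxy_def dickson_monomial_def binomial_eq_0 intro!: arg_cong[of _ _ "\<lambda>k. of_nat (a choose k)"])

lemma dickson_mult:
  assumes "c \<in> dickson"
  shows dickson_mult_x_plus_y: "mult_x_plus_y (2 ^ k) c \<in> dickson"
    and dickson_mult_xxy: "mult_xxy (2 ^ k) c \<in> dickson"
proof -
  have X1: "mult_x_plus_y 1 c \<in> dickson" if "c \<in> dickson" for c
    using that
  proof (induction rule: dickson.induct)
    case (monomial_add c a b)
    have "mult_x_plus_y 1 (\<lambda>i j. dickson_monomial a b i j + c i j) =
        (\<lambda>i j. dickson_monomial (Suc a) b i j + mult_x_plus_y 1 c i j)"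
      unfolding mult_x_plus_y_monomial[symmetric] by (auto simp: mult_x_plus_y_def fun_eq_iff)
    with monomial_add show ?case by (auto intro: dickson.intros)
  qed (auto simp: mult_x_plus_y_def intro: dickson.zero)
  have Y1: "mult_xxy 1 c \<in> dickson" if "c \<in> dickson" for c
    using that
  proof (induction rule: dickson.induct)
    case (monomial_add c a b)
    have "mult_xxy 1 (\<lambda>i j. dickson_monomial a b i j + c i j) =
        (\<lambda>i j. dickson_monomial a (Suc b) i j + mult_xxy 1 c i j)"
      unfolding mult_xxy_monomial[symmetric] by (auto simp: mult_xxy_def fun_eq_iff)
    with monomial_add show ?case by (auto intro: dickson.intros)
  qed (auto simp: mult_xxy_def intro: dickson.zero)
  \<comment> \<open>In characteristic two the cross terms of (x^q + y^q)^2 cancel, so every power of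
    two reduces to q = 1, where the effect on monomials is known.\<close>
  have X2: "mult_x_plus_y (2 * q) c = mult_x_plus_y q (mult_x_plus_y q c)" for q c
    by (intro ext) (auto simp: mult_x_plus_y_def mult_2 mult_2_right ac_simps)
  have Y2: "mult_xxy (2 * q) c = mult_xxy q (mult_xxy q c)" for q c
    by (intro ext) (auto simp: mult_xxy_def mult_2 mult_2_right ac_simps)
  show "mult_x_plus_y (2 ^ k) c \<in> dickson" using assms
    by (induction k arbitrary: c) (use X1 in \<open>auto simp: X2\<close>)
  show "mult_xxy (2 ^ k) c \<in> dickson" using assms
    by (induction k arbitrary: c) (use Y1 in \<open>auto simp: Y2\<close>)
qed

text \<open>By linearity it is enough to treat (x + y)^a (x^2 y)^b. The factor (x^2 y)^b shifts
  \<open>i\<close> by 2b, and \<open>j\<close> and \<open>k\<close> by b, which leaves the Adem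
  coefficients unchanged; what remains is \<open>binomial_adem\<close>. For 2b > i both sides
  vanish.\<close>

lemma dickson_adem:
  assumes "c \<in> dickson" "i < 2 * j"
  shows "c i j = (\<Sum>k\<le>i div 2. of_nat ((j - k - 1) choose (i - 2 * k)) * c (i + j - k) k)"
  using assms(1)
proof (induction rule: dickson.induct)
  case (monomial_add c a b)
  have "dickson_monomial a b i j = (\<Sum>k\<le>i div 2. of_nat ((j - k - 1) choose (i - 2 * k)) * dickson_monomial a b (i + j - k) k)"
  proof (cases "i + j = a + 3 * b")
    case ij: True
    have mon: "dickson_monomial a b (i + j - k) k = (if b \<le> k then of_nat (a choose (k - b)) else 0)"
      if "k \<le> i div 2" for k
    proof (cases "b \<le> k")
      case True
      then obtain r where r: "k = b + r" using le_Suc_ex by blast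
      have "a = (a - r) + r" using that ij r assms by simp
      then have "a choose (a - r) = a choose r" using binomial_symmetric[of r a] by simp
      moreover have "i + j - k - 2 * b = a - r" using that ij r assms by simp
      moreover have "i + j - k + k = a + 3 * b" "2 * b \<le> i + j - k" using that ij r assms by auto
      ultimately show ?thesis using True r by (simp add: dickson_monomial_def)
    next
      case False
      then show ?thesis using that ij by (auto simp: dickson_monomial_def binomial_eq_0)
    qed
    show ?thesis
    proof (cases "2 * b \<le> i")
      case True
      define i' j' where "i' = i - 2 * b" and "j' = j - b"
      have ij': "i = i' + 2 * b" "j = j' + b" "i' < 2 * j'" "a = i' + j'"
        using True assms ij by (auto simp: i'_def j'_def)
      have "(\<Sum>k\<le>i div 2. of_nat ((j - k - 1) choose (i - 2 * k)) * dickson_monomial a b (i + j - k) k) =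
          (\<Sum>k\<in>{b..i div 2}. of_nat ((j - k - 1) choose (i - 2 * k)) * (of_nat (a choose (k - b)) :: bit))"
        by (rule sum.mono_neutral_cong_right) (auto simp: mon)
      also have "\<dots> = (\<Sum>k\<le>i' div 2. of_nat ((j' - k - 1) choose (i' - 2 * k)) * of_nat (a choose k))"
        by (rule sum.reindex_bij_witness[of _ "\<lambda>k. k + b" "\<lambda>k. k - b"]) (auto simp: ij' diff_mult_distrib2)
      also have "\<dots> = of_nat (a choose i')"
        using binomial_adem[OF ij'(3)] by (simp add: ij'(4))
      finally show ?thesis using ij True by (simp add: dickson_monomial_def i'_def)
    next
      case False
      have "(\<Sum>k\<le>i div 2. of_nat ((j - k - 1) choose (i - 2 * k)) * dickson_monomial a b (i + j - k) k) = 0"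
        using False by (intro sum.neutral) (auto simp: mon)
      then show ?thesis using False by (simp add: dickson_monomial_def)
    qed
  next
    case False
    then show ?thesis using assms by (auto simp: dickson_monomial_def intro!: sum.neutral[symmetric])
  qed
  with monomial_add show ?case by (simp add: algebra_simps sum.distrib)
qed simp

lemma unstable_moduleI:
  assumes "\<And>n. module F2 (piece M n)"
    and "\<And>n i. vs_linear (piece M n) (piece M (n + i)) (Sq M i n)"
    and "\<And>n x. x \<in> carrier (piece M n) \<Longrightarrow> Sq M 0 n x = x"
    and "\<And>i j n x. 0 < i \<Longrightarrow> i < 2 * j \<Longrightarrow> x \<in> carrier (piece M n) \<Longrightarrow>
      Sq M i (n + j) (Sq M j n x) = adem_rhs M i j n x"
    and "\<And>n k x. n < k \<Longrightarrow> x \<in> carrier (piece M n) \<Longrightarrow> Sq M k n x = \<zero>\<^bsub>piece M (n + k)\<^esub>"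
  shows "unstable_module M"
  using assms unfolding unstable_module_def steenrod_module_def adem_rhs_def atMost_atLeast0 by blast

lemma adem_rhs_zero:
  assumes V: "module F2 (piece M (n + i + j))"
    and z: "\<And>k. k \<le> i div 2 \<Longrightarrow> Sq M (i + j - k) (n + k) (Sq M k n x) = \<zero>\<^bsub>piece M (n + i + j)\<^esub>"
  shows "adem_rhs M i j n x = \<zero>\<^bsub>piece M (n + i + j)\<^esub>"
proof -
  interpret abelian_group "piece M (n + i + j)" by (rule F2_abelian[OF V])
  have "adem_rhs M i j n x = finsum (piece M (n + i + j)) (\<lambda>k. \<zero>\<^bsub>piece M (n + i + j)\<^esub>) {..i div 2}"
    unfolding adem_rhs_def by (rule finsum_cong') (auto simp: z F2_smult[OF V])
  also have "\<dots> = \<zero>\<^bsub>piece M (n + i + j)\<^esub>" by (rule finsum_zero)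
  finally show ?thesis .
qed

lemma dickson_monomial: "dickson_monomial a b \<in> dickson"
  using dickson.monomial_add[OF dickson.zero] by simp

lemma even_binomial: "even m \<Longrightarrow> odd i \<Longrightarrow> even (m choose i)"
  using times_binomial_minus1_eq[of i m] by (metis even_mult_iff odd_pos)

section \<open>The suspensions of the cohomology of RP^inf, of its odd part and of F_2\<close>

abbreviation bit_vs :: "bit set \<Rightarrow> bit vs" where
  "bit_vs A \<equiv> mk_vs A 0 (+) (*)"

lemma module_bit_vs: "A = {0} \<or> A = UNIV \<Longrightarrow> module F2 (bit_vs A)"
  by (rule module_F2I) auto

lemma finsum_bit_vs:
  assumes "module F2 (bit_vs A)" "\<And>k. k \<le> n \<Longrightarrow> f k \<in> A"
  shows "finsum (bit_vs A) f {..n::nat} = sum f {..n}"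
proof -
  interpret abelian_group "bit_vs A" by (rule F2_abelian[OF assms(1)])
  show ?thesis using assms(2)
    by (induction n) (auto simp: Pi_def add.commute)
qed

text \<open>The suspension \<open>\<Sigma>\<^sup>t\<close> of the reduced cohomology of real projective space; the coefficient of
  \<open>\<Sigma>\<^sup>t u\<^sup>k\<close> sits in degree \<open>t + k\<close>.\<close>

definition RP :: "nat \<Rightarrow> bit sq_module" where
  "RP t = \<lparr>piece = (\<lambda>d. bit_vs (if t < d then UNIV else {0})),
     Sq = (\<lambda>i d x. if t < d then of_nat ((d - t) choose i) * x else 0)\<rparr>"

text \<open>The quotient of \<open>RP t\<close> by the even powers of u. It is the direct sum of the
  (t+1)-fold suspensions of F_2 and of the cohomology of CP^inf, written as one module so that a
  single use of projectivity lifts both components.\<close>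

definition RP_odd :: "nat \<Rightarrow> bit sq_module" where
  "RP_odd t = \<lparr>piece = (\<lambda>d. bit_vs (if t < d \<and> odd (d - t) then UNIV else {0})),
     Sq = (\<lambda>i d x. if t < d \<and> odd (d - t) \<and> even i then of_nat ((d - t) choose i) * x else 0)\<rparr>"

lemma
  shows RP_simps [simp]: "piece (RP t) d = bit_vs (if t < d then UNIV else {0})"
    "Sq (RP t) i d x = (if t < d then of_nat ((d - t) choose i) * x else 0)"
  and RP_odd_simps [simp]: "piece (RP_odd t) d = bit_vs (if t < d \<and> odd (d - t) then UNIV else {0})"
    "Sq (RP_odd t) i d x = (if t < d \<and> odd (d - t) \<and> even i then of_nat ((d - t) choose i) * x else 0)"
  by (simp_all add: RP_def RP_odd_def)

text \<open>The generating function of Sq^i Sq^j u^m is (1 + x + y + x^2 y)^m: each further factor u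
  multiplies it by 1 + (x + y) + x^2 y, as the Cartan formula predicts.\<close>

lemma dickson_RP: "(\<lambda>i j. of_nat ((m choose j) * ((m + j) choose i))) \<in> dickson"
proof (induction m)
  case 0
  have "(\<lambda>i j. of_nat ((0 choose j) * ((0 + j) choose i))) = (\<lambda>i j. dickson_monomial 0 0 i j + 0)"
  proof (intro ext)
    fix i j
    show "of_nat ((0 choose j) * ((0 + j) choose i)) = dickson_monomial 0 0 i j + 0"
      by (cases "i = 0"; cases "j = 0") (auto simp: dickson_monomial_def binomial_eq_0)
  qed
  then show ?case by (simp add: dickson_monomial)
next
  case (Suc m)
  let ?R = "\<lambda>m i j. of_nat ((m choose j) * ((m + j) choose i)) :: bit"
  have "?R (Suc m) = (\<lambda>i j. (?R m i j + mult_x_plus_y (2^0) (?R m) i j) + mult_xxy (2^0) (?R m) i j)"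
  proof (intro ext)
    fix i j
    show "?R (Suc m) i j = (?R m i j + mult_x_plus_y (2^0) (?R m) i j) + mult_xxy (2^0) (?R m) i j"
    proof (cases j)
      case 0
      then show ?thesis by (cases i) (auto simp: mult_x_plus_y_def mult_xxy_def)
    next
      case j: (Suc j')
      show ?thesis
      proof (cases i)
        case 0
        then show ?thesis using j by (auto simp: mult_x_plus_y_def mult_xxy_def)
      next
        case i: (Suc i')
        show ?thesis
        proof (cases i')
          case 0
          then show ?thesis using i j
            by (simp add: mult_x_plus_y_def mult_xxy_def algebra_simps)
        next
          case (Suc i'')
          then show ?thesis using i j
            by (simp add: mult_x_plus_y_def mult_xxy_def algebra_simps)
        qed
      qed
    qed
  qed
  then show ?case
    using Suc dickson_mult_x_plus_y[OF Suc, of 0] dickson_mult_xxy[OF Suc, of 0] by (auto intro!: dickson_add)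
qed

lemma RP_unstable: "unstable_module (RP t)"
proof -
  have vs: "module F2 (piece (RP t) n)" for n by (simp add: module_bit_vs)
  have "Sq (RP t) i (n + j) (Sq (RP t) j n x) = adem_rhs (RP t) i j n x"
    if ij: "0 < i" "i < 2 * j" and x: "x \<in> carrier (piece (RP t) n)" for i j n x
  proof (cases "t < n")
    case True
    have "adem_rhs (RP t) i j n x = (\<Sum>k\<le>i div 2. of_nat ((j - k - 1) choose (i - 2 * k)) *
        (of_nat (((n - t) choose k) * ((n - t + k) choose (i + j - k))) * x))"
    proof -
      have p: "piece (RP t) (n + i + j) = bit_vs UNIV" using True by simp
      have "n + k - t = n - t + k" for k using True by simp
      then show ?thesis
        unfolding adem_rhs_def p using True
        by (subst finsum_bit_vs) (auto simp: module_bit_vs mult_ac intro!: sum.cong)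
    qed
    also have "\<dots> = of_nat (((n - t) choose j) * ((n - t + j) choose i)) * x"
    proof -
      have e: "of_nat (((n - t) choose j) * ((n - t + j) choose i)) = (\<Sum>k\<le>i div 2. of_nat ((j - k - 1) choose (i - 2 * k)) *
        (of_nat (((n - t) choose k) * ((n - t + k) choose (i + j - k))) :: bit))"
        by (rule dickson_adem[OF dickson_RP ij(2)])
      show ?thesis by (subst e, subst sum_distrib_right, subst mult.assoc, rule refl)
    qed
    finally have *: "adem_rhs (RP t) i j n x = of_nat (((n - t) choose j) * ((n - t + j) choose i)) * x" .
    have "n + j - t = n - t + j" "t < n + j" using True by auto
    then have "Sq (RP t) i (n + j) (Sq (RP t) j n x) = of_nat ((n - t + j) choose i) * (of_nat ((n - t) choose j) * x)"
      using True by (simp only: RP_simps if_True)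
    also have "\<dots> = of_nat (((n - t) choose j) * ((n - t + j) choose i)) * x"
      by (simp only: of_nat_mult mult_ac)
    finally show ?thesis unfolding * .
  next
    case False
    then have "adem_rhs (RP t) i j n x = \<zero>\<^bsub>piece (RP t) (n + i + j)\<^esub>"
      using x by (intro adem_rhs_zero) (auto simp: module_bit_vs)
    then show ?thesis using False x by auto
  qed
  moreover have "vs_linear (piece (RP t) n) (piece (RP t) (n + i)) (Sq (RP t) i n)" for n i
    unfolding vs_linear_iff[OF vs vs] by (auto simp: algebra_simps)
  ultimately show ?thesis
    using vs by (intro unstable_moduleI) (auto simp: binomial_eq_0 simp del: RP_simps(1), auto split: if_splits)
qed

text \<open>Odd squares vanish on even powers of u, because an even number choose an odd one is
  even. So the even powers span a submodule and the projection to the odd powers respects the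
  squares.\<close>

lemma RP_odd_quotient: "sq_surj (RP t) (RP_odd t)
    (\<lambda>d. restrict (\<lambda>x. if t < d \<and> odd (d - t) then x else 0) (carrier (piece (RP t) d)))"
  and RP_odd_unstable: "unstable_module (RP_odd t)"
proof -
  have b: "t < d \<Longrightarrow> \<not> odd (d - t) \<Longrightarrow> odd i \<Longrightarrow> of_nat (d - t choose i) = (0::bit)" for d i
    by (rule of_nat_bit_even) (auto intro: even_binomial)
  let ?q = "\<lambda>d x. if t < d \<and> odd (d - t) then x else (0::bit)"
  have qs: "?q (n + i) (Sq (RP t) i n x) = Sq (RP_odd t) i n (?q n x)" if "x \<in> carrier (piece (RP t) n)" for n i x
    using that b[of n i] by (auto simp: Nat.diff_add_assoc2)
  have "steenrod_module (RP_odd t)"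
    by (rule steenrod_image[of "RP t" _ ?q]) (use RP_unstable qs in \<open>auto simp: image_iff split: if_splits\<close>)
  then show u: "unstable_module (RP_odd t)"
    unfolding unstable_module_def by (auto simp: binomial_eq_0)
  show "sq_surj (RP t) (RP_odd t) (\<lambda>d. restrict (\<lambda>x. if t < d \<and> odd (d - t) then x else 0) (carrier (piece (RP t) d)))"
    unfolding sq_surj_def
    by (rule conjI, rule sq_hom_restrictI)
      (use qs unstable_Sq_closed[OF RP_unstable[of t]] in \<open>auto simp: module_bit_vs image_iff split: if_splits\<close>)
qed

lemma suspension_F2_simps:
  "carrier (piece (suspension t F2_module) d) = (if d = t then UNIV else {0})"
  "\<zero>\<^bsub>piece (suspension t F2_module) d\<^esub> = 0"
  "x \<oplus>\<^bsub>piece (suspension t F2_module) d\<^esub> y = x + y"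
  "b \<odot>\<^bsub>piece (suspension t F2_module) d\<^esub> x = b * x"
  "Sq (suspension t F2_module) i d x = (if i = 0 \<and> t \<le> d then x else 0)"
  by (auto simp: suspension_def F2_module_def vs_zero_def mk_vs_def)

lemma suspension_F2_vs: "module F2 (piece (suspension t F2_module) d)"
  by (rule module_F2I) (auto simp: suspension_F2_simps)

lemma suspension_F2_unstable: "unstable_module (suspension t F2_module)"
proof -
  have "adem_rhs (suspension t F2_module) i j n x = \<zero>\<^bsub>piece (suspension t F2_module) (n + i + j)\<^esub>"
    if ij: "0 < i" "i < 2 * j" for i j n x
    by (rule adem_rhs_zero) (use ij in \<open>auto simp: suspension_F2_vs suspension_F2_simps\<close>)
  moreover have "vs_linear (piece (suspension t F2_module) n) (piece (suspension t F2_module) (n + i)) (Sq (suspension t F2_module) i n)" for n i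
    unfolding vs_linear_iff[OF suspension_F2_vs suspension_F2_vs] by (auto simp: suspension_F2_simps)
  ultimately show ?thesis
    using suspension_F2_vs by (intro unstable_moduleI) (auto simp: suspension_F2_simps split: if_splits)
qed

subsection \<open>Tensor powers of the free module on a class of degree one\<close>

text \<open>A list \<open>b\<close> of length \<open>m\<close> stands for the monomial \<open>\<Prod>\<^sub>k u\<^sub>k^(2 ^ b\<^sub>k)\<close> in \<open>m\<close> variables of degree one, and
  an element of the module is given by its coefficients. On such a monomial the total square
  is the product of the \<open>u\<^sub>k^(2 ^ b\<^sub>k) + u\<^sub>k^(2 ^ (b\<^sub>k + 1))\<close>.\<close>

definition mdeg :: "nat list \<Rightarrow> nat" where
  "mdeg b = (\<Sum>k\<leftarrow>b. 2 ^ k)"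

lemma mdeg_simps [simp]: "mdeg [] = 0" "mdeg (k # b) = 2 ^ k + mdeg b"
  by (simp_all add: mdeg_def)

text \<open>The Cartan formula in transposed form: the value is the coefficient of the monomial
  \<open>b\<close> in Sq^i f. An entry \<open>b\<close> comes either from itself or from
  \<open>b - 1\<close>, and in the second case the squaring uses up 2^(b-1) of
  \<open>i\<close>.\<close>

fun Sq_coeff :: "nat list \<Rightarrow> nat \<Rightarrow> (nat list \<Rightarrow> bit) \<Rightarrow> bit" where
  "Sq_coeff [] i f = (if i = 0 then f [] else 0)"
| "Sq_coeff (b # bs) i f = Sq_coeff bs i (\<lambda>as. f (b # as)) +
     (if 0 < b \<and> 2 ^ (b - 1) \<le> i then Sq_coeff bs (i - 2 ^ (b - 1)) (\<lambda>as. f ((b - 1) # as)) else 0)"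

definition tensor_module :: "nat \<Rightarrow> (nat list \<Rightarrow> bit) sq_module" where
  "tensor_module m = \<lparr>piece = (\<lambda>d. mk_vs {f. \<forall>b. f b \<noteq> 0 \<longrightarrow> length b = m \<and> mdeg b = d} (\<lambda>_. 0)
       (\<lambda>f g b. f b + g b) (\<lambda>c f b. c * f b)),
     Sq = (\<lambda>i d f b. Sq_coeff b i f)\<rparr>"

lemma Sq_coeff_add: "Sq_coeff b i (\<lambda>a. f a + g a) = Sq_coeff b i f + Sq_coeff b i g"
proof (induction b arbitrary: i f g)
  case (Cons b bs)
  show ?case by (simp only: Sq_coeff.simps Cons.IH) (simp add: ac_simps)
qed simp

lemma Sq_coeff_zero [simp]: "Sq_coeff b i (\<lambda>a. 0) = 0"
  using Sq_coeff_add[of b i "\<lambda>_. 0" "\<lambda>_. 0"] by simp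

lemma Sq_coeff_0 [simp]: "Sq_coeff b 0 f = f b"
  by (induction b arbitrary: f) auto

text \<open>A raised entry takes exactly its own degree from \<open>i\<close>. Hence the degree
  count, and with it the bound \<open>i \<le> mdeg a\<close>, which is instability.\<close>

lemma Sq_coeff_support:
  "Sq_coeff b i f \<noteq> 0 \<Longrightarrow> \<exists>a. f a \<noteq> 0 \<and> length a = length b \<and> mdeg b = mdeg a + i \<and> i \<le> mdeg a"
proof (induction b i f rule: Sq_coeff.induct)
  case (2 b bs i f)
  then consider "Sq_coeff bs i (\<lambda>as. f (b # as)) \<noteq> 0" |
    "0 < b" "2 ^ (b - 1) \<le> i" "Sq_coeff bs (i - 2 ^ (b - 1)) (\<lambda>as. f ((b - 1) # as)) \<noteq> 0"
    by (cases "Sq_coeff bs i (\<lambda>as. f (b # as)) = 0")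
      (auto simp del: bit_not_zero_iff split: if_splits)
  then show ?case
  proof cases
    case 1
    then obtain a where "f (b # a) \<noteq> 0" "length a = length bs" "mdeg bs = mdeg a + i" "i \<le> mdeg a"
      using 2(1) by auto
    then show ?thesis by (intro exI[of _ "b # a"]) auto
  next
    case c: 2
    then obtain a where "f ((b - 1) # a) \<noteq> 0" "length a = length bs" "mdeg bs = mdeg a + (i - 2 ^ (b - 1))"
       "i - 2 ^ (b - 1) \<le> mdeg a"
      using 2(2) by auto
    moreover have "2 ^ b = 2 ^ (b - 1) + (2 ^ (b - 1) :: nat)"
      using c(1) by (cases b) auto
    ultimately show ?thesis using c by (intro exI[of _ "(b - 1) # a"]) auto
  qed
qed (auto split: if_splits)

text \<open>In one variable an entry \<open>b\<close> is reached by raising never, once or twice.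
  Raising once, by either of the two squares, contributes x^q + y^q with q = 2^(b-1); raising by
  both contributes (x^2 y)^(q/2). The induction multiplies these factors over the variables.\<close>

lemma dickson_Sq_coeff: "(\<lambda>i j. Sq_coeff b i (\<lambda>a. Sq_coeff a j f)) \<in> dickson"
proof (induction b arbitrary: f)
  case Nil
  have "(\<lambda>i j. Sq_coeff [] i (\<lambda>a. Sq_coeff a j f)) = (if f [] = 0 then (\<lambda>i j. 0) else dickson_monomial 0 0)"
    by (auto simp: fun_eq_iff dickson_monomial_def)
  then show ?case using dickson_monomial dickson.zero by metis
next
  case (Cons b bs)
  define D where "D k i j = Sq_coeff bs i (\<lambda>a. Sq_coeff a j (\<lambda>as. f (k # as)))" for k i j
  have D: "D k \<in> dickson" for k
    using Cons[of "\<lambda>as. f (k # as)"] unfolding D_def .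
  consider "b = 0" | "b = 1" | c where "b = Suc (Suc c)" by (metis One_nat_def not0_implies_Suc)
  then show ?case
  proof cases
    case 1
    then show ?thesis using D[of 0] by (simp add: D_def[abs_def] if_distrib cong: if_cong)
  next
    case 2
    then have "(\<lambda>i j. Sq_coeff (b # bs) i (\<lambda>a. Sq_coeff a j f)) = (\<lambda>i j. D 1 i j + mult_x_plus_y (2 ^ 0) (D 0) i j)"
      by (auto simp: fun_eq_iff D_def mult_x_plus_y_def Sq_coeff_add)
    then show ?thesis using dickson_add[OF D dickson_mult_x_plus_y[OF D]] by metis
  next
    case 3
    have e: "(\<lambda>i j. Sq_coeff (b # bs) i (\<lambda>a. Sq_coeff a j f)) =
      (\<lambda>i j. (D b i j + mult_x_plus_y (2 ^ Suc c) (D (Suc c)) i j) + mult_xxy (2 ^ c) (D c) i j)"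
    proof (intro ext)
      fix i j
      show "Sq_coeff (b # bs) i (\<lambda>a. Sq_coeff a j f) =
        (D b i j + mult_x_plus_y (2 ^ Suc c) (D (Suc c)) i j) + mult_xxy (2 ^ c) (D c) i j"
        unfolding D_def mult_x_plus_y_def mult_xxy_def 3
        by (cases "2 ^ Suc c \<le> i"; cases "2 ^ Suc c \<le> j"; cases "2 ^ c \<le> j")
          (simp_all add: Sq_coeff_add add.assoc)
    qed
    show ?thesis unfolding e
      by (rule dickson_add[OF dickson_add[OF D dickson_mult_x_plus_y[OF D]] dickson_mult_xxy[OF D]])
  qed
qed

lemma tensor_simps [simp]:
  "f \<in> carrier (piece (tensor_module m) d) \<longleftrightarrow> (\<forall>b. f b \<noteq> 0 \<longrightarrow> length b = m \<and> mdeg b = d)"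
  "\<zero>\<^bsub>piece (tensor_module m) d\<^esub> = (\<lambda>_. 0)"
  "f \<oplus>\<^bsub>piece (tensor_module m) d\<^esub> g = (\<lambda>b. f b + g b)"
  "c \<odot>\<^bsub>piece (tensor_module m) d\<^esub> f = (\<lambda>b. c * f b)"
  "Sq (tensor_module m) i d f = (\<lambda>b. Sq_coeff b i f)"
  by (simp_all add: tensor_module_def)

lemma tensor_vs: "module F2 (piece (tensor_module m) d)"
proof (rule module_F2I)
  fix f g assume "f \<in> carrier (piece (tensor_module m) d)" "g \<in> carrier (piece (tensor_module m) d)"
  moreover have "f b \<noteq> 0 \<or> g b \<noteq> 0" if "f b + g b \<noteq> 0" for b using that by auto
  ultimately show "f \<oplus>\<^bsub>piece (tensor_module m) d\<^esub> g \<in> carrier (piece (tensor_module m) d)"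
    unfolding tensor_simps by blast
qed (auto simp: fun_eq_iff ac_simps)

lemma tensor_Sq_closed:
  assumes "f \<in> carrier (piece (tensor_module m) d)"
  shows "Sq (tensor_module m) i d f \<in> carrier (piece (tensor_module m) (d + i))"
  using assms Sq_coeff_support[of _ i f] by (simp del: bit_not_zero_iff) metis

lemma tensor_unstable: "unstable_module (tensor_module m)"
proof -
  have lin: "vs_linear (piece (tensor_module m) n) (piece (tensor_module m) (n + i)) (Sq (tensor_module m) i n)" for n i
    unfolding vs_linear_iff[OF tensor_vs tensor_vs] 
  proof (intro conjI ballI)
    show "Sq (tensor_module m) i n f \<in> carrier (piece (tensor_module m) (n + i))"
      if "f \<in> carrier (piece (tensor_module m) n)" for f
      using that by (rule tensor_Sq_closed)
  qed (simp add: Sq_coeff_add)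
  have "Sq (tensor_module m) i (n + j) (Sq (tensor_module m) j n f) = adem_rhs (tensor_module m) i j n f"
    if ij: "0 < i" "i < 2 * j" and f: "f \<in> carrier (piece (tensor_module m) n)" for i j n f
  proof
    fix b
    let ?V = "piece (tensor_module m) (n + i + j)"
    have c: "Sq (tensor_module m) (i + j - k) (n + k) (Sq (tensor_module m) k n f) \<in> carrier ?V" if "k \<le> i div 2" for k
    proof -
      have "n + k + (i + j - k) = n + i + j" using that ij by simp
      with tensor_Sq_closed[OF tensor_Sq_closed[OF f, of k], of "i + j - k"] show ?thesis by metis
    qed
    let ?t = "\<lambda>k. of_nat ((j - k - 1) choose (i - 2 * k)) \<odot>\<^bsub>?V\<^esub>
             Sq (tensor_module m) (i + j - k) (n + k) (Sq (tensor_module m) k n f)"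
    \<comment> \<open>Taking one coefficient is linear, so the sum in the module becomes a sum of
      bits, to which \<open>dickson_adem\<close> applies.\<close>
    have l: "vs_linear ?V (bit_vs UNIV) (\<lambda>f. f b)"
      by (simp add: vs_linear_iff tensor_vs module_bit_vs)
    have tc: "?t k \<in> carrier ?V" if "k \<le> i div 2" for k
      using c[OF that] by (rule F2_smult_closed[OF tensor_vs])
    have "adem_rhs (tensor_module m) i j n f b = finsum (bit_vs UNIV) (\<lambda>k. ?t k b) {..i div 2}"
      unfolding adem_rhs_def
      by (rule conjunct2[OF finsum_atMost_linear[where f = ?t, OF tensor_vs module_bit_vs l tc]]) auto
    also have "\<dots> = (\<Sum>k\<le>i div 2. ?t k b)"
      by (rule finsum_bit_vs) (auto simp: module_bit_vs)
    also have "\<dots> = Sq_coeff b i (\<lambda>a. Sq_coeff a j f)"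
      by (simp add: dickson_adem[OF dickson_Sq_coeff ij(2)])
    finally show "Sq (tensor_module m) i (n + j) (Sq (tensor_module m) j n f) b = adem_rhs (tensor_module m) i j n f b"
      by simp
  qed
  moreover have "Sq (tensor_module m) k n f = (\<lambda>_. 0)" if "n < k" "f \<in> carrier (piece (tensor_module m) n)" for k n f
  proof
    fix b
    show "Sq (tensor_module m) k n f b = 0"
      using Sq_coeff_support[of b k f] that by (cases "Sq_coeff b k f = 0") (simp_all del: bit_not_zero_iff, metis not_less)
  qed
  ultimately show ?thesis
    using tensor_vs lin by (intro unstable_moduleI) (simp_all only: tensor_simps Sq_coeff_0)
qed

text \<open>Every entry is at most the degree, so a given length and degree admit only finitely many
  monomials. Countability makes the tensor powers available for transport to another type.\<close>

lemma tensor_countable: "countable (carrier (piece (tensor_module m) d))"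
proof -
  have "finite {b. length b = m \<and> mdeg b = d}"
  proof (rule finite_subset)
    have "k \<le> mdeg b" if "k \<in> set b" for k b
      using that by (induction b) (auto intro: trans_le_add1 trans_le_add2 less_imp_le[OF less_exp])
    then show "{b. length b = m \<and> mdeg b = d} \<subseteq> {b. set b \<subseteq> {..d} \<and> length b = m}" by auto
  qed (rule finite_lists_length_eq, simp)
  moreover have "carrier (piece (tensor_module m) d) \<subseteq> (\<lambda>A b. if b \<in> A then 1 else 0) ` Pow {b. length b = m \<and> mdeg b = d}"
  proof
    fix f assume "f \<in> carrier (piece (tensor_module m) d)"
    then show "f \<in> (\<lambda>A b. if b \<in> A then 1 else 0) ` Pow {b. length b = m \<and> mdeg b = d}"
      by (intro image_eqI[of _ _ "{b. f b = 1}"]) (auto simp: fun_eq_iff)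
  qed
  ultimately show ?thesis by (meson countable_finite countable_subset finite_Pow_iff finite_imageI)
qed

text \<open>On a homogeneous element of degree \<open>d\<close>, \<open>Sq\<^sup>d\<close> is the Frobenius.\<close>

lemma Sq_coeff_top:
  assumes "\<forall>a. f a \<noteq> 0 \<longrightarrow> mdeg a = d"
  shows "Sq_coeff b d f = (if 0 \<in> set b then 0 else f (map (\<lambda>k. k - 1) b))"
  using assms
proof (induction b arbitrary: d f)
  case (Cons b bs)
  have 1: "Sq_coeff bs d (\<lambda>as. f (b # as)) = 0"
  proof (rule ccontr)
    assume "Sq_coeff bs d (\<lambda>as. f (b # as)) \<noteq> 0"
    then obtain a where "f (b # a) \<noteq> 0" "d \<le> mdeg a" using Sq_coeff_support by meson
    with Cons.prems have "2 ^ b + mdeg a = d" by fastforce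
    moreover have "0 < (2::nat) ^ b" by simp
    ultimately show False using \<open>d \<le> mdeg a\<close> by linarith
  qed
  have 2: "Sq_coeff bs (d - 2 ^ (b - 1)) (\<lambda>as. f ((b - 1) # as)) =
      (if 0 \<in> set bs then 0 else f ((b - 1) # map (\<lambda>k. k - 1) bs))" if "0 < b"
    using Cons.prems by (intro Cons.IH) fastforce
  have 3: "f ((b - 1) # map (\<lambda>k. k - 1) bs) = 0" if "\<not> 2 ^ (b - 1) \<le> d"
  proof (rule ccontr)
    assume "f ((b - 1) # map (\<lambda>k. k - 1) bs) \<noteq> 0"
    with Cons.prems have "mdeg ((b - 1) # map (\<lambda>k. k - 1) bs) = d" by blast
    then show False using that by auto
  qed
  show ?case using 1 2 3 by auto
qed auto

text \<open>By \<open>Sq_coeff_top\<close> the coefficient of \<open>map Suc b\<close> in the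
  Frobenius of \<open>f\<close> is \<open>f b\<close>.\<close>

lemma tensor_reduced:
  assumes f: "f \<in> carrier (piece (tensor_module m) d)" and 0: "Sq (tensor_module m) d d f = (\<lambda>_. 0)"
  shows "f = (\<lambda>_. 0)"
proof
  fix b
  have "Sq_coeff (map Suc b) d f = 0" using fun_cong[OF 0] by simp
  moreover have "Sq_coeff (map Suc b) d f = f b"
    using f by (subst Sq_coeff_top) (auto simp: comp_def)
  ultimately show "f b = 0" by simp
qed

subsection \<open>Free unstable modules and projective resolutions\<close>

instance bit :: countable
  by (rule countable_classI[of "\<lambda>b. if b = 0 then 0 else 1"]) (auto split: if_splits)

lemma sq_comp_unstable:
  assumes "f \<in> sq_hom M N" "g \<in> sq_hom N L" "unstable_module M" "unstable_module L"
  shows "sq_comp M g f \<in> sq_hom M L"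
  by (rule sq_comp_hom[OF assms(1,2) unstable_vs[OF assms(3)] unstable_vs[OF assms(4)]
        unstable_Sq_closed[OF assms(3) _ refl]])

definition vsum :: "'a vs \<Rightarrow> 'a list \<Rightarrow> 'a" where
  "vsum V xs = foldr (\<lambda>x y. x \<oplus>\<^bsub>V\<^esub> y) xs \<zero>\<^bsub>V\<^esub>"

lemma vsum_simps [simp]: "vsum V [] = \<zero>\<^bsub>V\<^esub>" "vsum V (x # xs) = x \<oplus>\<^bsub>V\<^esub> vsum V xs"
  by (simp_all add: vsum_def)

lemma vsum_closed: "module F2 V \<Longrightarrow> set xs \<subseteq> carrier V \<Longrightarrow> vsum V xs \<in> carrier V"
  by (induction xs) auto

lemma vsum_append:
  "module F2 V \<Longrightarrow> set xs \<subseteq> carrier V \<Longrightarrow> set ys \<subseteq> carrier V \<Longrightarrow> vsum V (xs @ ys) = vsum V xs \<oplus>\<^bsub>V\<^esub> vsum V ys"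
  by (induction xs) (auto simp: vsum_closed F2_assoc)

lemma vsum_linear:
  assumes "module F2 V" "h \<zero>\<^bsub>V\<^esub> = \<zero>\<^bsub>W\<^esub>"
    "\<And>x y. x \<in> carrier V \<Longrightarrow> y \<in> carrier V \<Longrightarrow> h (x \<oplus>\<^bsub>V\<^esub> y) = h x \<oplus>\<^bsub>W\<^esub> h y" "set xs \<subseteq> carrier V"
  shows "h (vsum V xs) = vsum W (map h xs)"
  using assms(4) by (induction xs) (auto simp: assms(1-3) vsum_closed)

fun act :: "'a sq_module \<Rightarrow> nat \<Rightarrow> nat list \<Rightarrow> 'a \<Rightarrow> 'a" where
  "act M m [] x = x"
| "act M m (i # w) x = Sq M i (m + sum_list w) (act M m w x)"

lemma act_closed:
  assumes "unstable_module M" "x \<in> carrier (piece M m)"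
  shows "d = m + sum_list w \<Longrightarrow> act M m w x \<in> carrier (piece M d)"
  using assms by (induction w arbitrary: d) (auto intro!: unstable_Sq_closed)

lemma act_hom:
  assumes "f \<in> sq_hom M N" "unstable_module M" "x \<in> carrier (piece M m)"
  shows "d = m + sum_list w \<Longrightarrow> f d (act M m w x) = act N m w (f m x)"
proof (induction w arbitrary: d)
  case (Cons i w)
  have "act M m w x \<in> carrier (piece M (m + sum_list w))"
    by (rule act_closed[OF assms(2,3) refl])
  moreover have "d = m + sum_list w + i" using Cons.prems by simp
  ultimately have "f d (Sq M i (m + sum_list w) (act M m w x)) = Sq N i (m + sum_list w) (f (m + sum_list w) (act M m w x))"
    by (rule sq_hom_Sq[OF assms(1)])
  then show ?case by (simp only: act.simps Cons.IH[OF refl])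
qed simp

text \<open>Formal sums of words in the squares applied to generators \<open>g\<close> of degree \<open>\<gamma> g\<close>.\<close>

definition terms :: "('g \<Rightarrow> nat) \<Rightarrow> nat \<Rightarrow> (nat list \<times> 'g) list set" where
  "terms \<gamma> d = {L. \<forall>(w, g)\<in>set L. \<gamma> g + sum_list w = d}"

definition evaluate :: "'a sq_module \<Rightarrow> ('g \<Rightarrow> nat) \<Rightarrow> ('g \<Rightarrow> 'a) \<Rightarrow> nat \<Rightarrow> (nat list \<times> 'g) list \<Rightarrow> 'a" where
  "evaluate M \<gamma> \<phi> d L = vsum (piece M d) (map (\<lambda>(w, g). act M (\<gamma> g) w (\<phi> g)) L)"

definition Sq_terms :: "nat \<Rightarrow> (nat list \<times> 'g) list \<Rightarrow> (nat list \<times> 'g) list" where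
  "Sq_terms i = map (\<lambda>(w, g). (i # w, g))"

lemma terms_append [simp]: "L @ L' \<in> terms \<gamma> d \<longleftrightarrow> L \<in> terms \<gamma> d \<and> L' \<in> terms \<gamma> d"
  by (auto simp: terms_def)

lemma terms_Nil [simp]: "[] \<in> terms \<gamma> d"
  by (simp add: terms_def)

lemma Sq_terms_in: "L \<in> terms \<gamma> d \<Longrightarrow> Sq_terms i L \<in> terms \<gamma> (d + i)"
  by (auto simp: terms_def Sq_terms_def)

lemma evaluate_set:
  assumes "unstable_module M" "\<And>g. \<phi> g \<in> carrier (piece M (\<gamma> g))" "L \<in> terms \<gamma> d"
  shows "set (map (\<lambda>(w, g). act M (\<gamma> g) w (\<phi> g)) L) \<subseteq> carrier (piece M d)"
  using assms(3) act_closed[OF assms(1) assms(2)] by (force simp: terms_def)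

lemma evaluate_Nil [simp]: "evaluate M \<gamma> \<phi> d [] = \<zero>\<^bsub>piece M d\<^esub>"
  by (simp add: evaluate_def)

lemma
  assumes M: "unstable_module M" and \<phi>: "\<And>g. \<phi> g \<in> carrier (piece M (\<gamma> g))" and L: "L \<in> terms \<gamma> d"
  shows evaluate_closed: "evaluate M \<gamma> \<phi> d L \<in> carrier (piece M d)"
    and evaluate_append: "L' \<in> terms \<gamma> d \<Longrightarrow>
       evaluate M \<gamma> \<phi> d (L @ L') = evaluate M \<gamma> \<phi> d L \<oplus>\<^bsub>piece M d\<^esub> evaluate M \<gamma> \<phi> d L'"
    and evaluate_Sq: "evaluate M \<gamma> \<phi> (d + i) (Sq_terms i L) = Sq M i d (evaluate M \<gamma> \<phi> d L)"
    and evaluate_hom: "f \<in> sq_hom M N \<Longrightarrow> (\<And>n. module F2 (piece N n)) \<Longrightarrow>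
       f d (evaluate M \<gamma> \<phi> d L) = evaluate N \<gamma> (\<lambda>g. f (\<gamma> g) (\<phi> g)) d L"
proof -
  note MV = unstable_vs[OF M] and s = evaluate_set[OF M \<phi> L]
  show "evaluate M \<gamma> \<phi> d L \<in> carrier (piece M d)"
    unfolding evaluate_def by (rule vsum_closed[OF MV s])
  show "evaluate M \<gamma> \<phi> d (L @ L') = evaluate M \<gamma> \<phi> d L \<oplus>\<^bsub>piece M d\<^esub> evaluate M \<gamma> \<phi> d L'" if "L' \<in> terms \<gamma> d"
    unfolding evaluate_def map_append by (rule vsum_append[OF MV s evaluate_set[OF M \<phi> that]])
  have "Sq M i d (evaluate M \<gamma> \<phi> d L) = vsum (piece M (d + i)) (map (Sq M i d) (map (\<lambda>(w, g). act M (\<gamma> g) w (\<phi> g)) L))"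
    unfolding evaluate_def
    by (rule vsum_linear[OF MV _ _ s]) (auto simp: unstable_Sq_zero[OF M] unstable_Sq_add[OF M])
  also have "map (Sq M i d) (map (\<lambda>(w, g). act M (\<gamma> g) w (\<phi> g)) L) = map (\<lambda>(w, g). act M (\<gamma> g) w (\<phi> g)) (Sq_terms i L)"
    using L by (auto simp: Sq_terms_def terms_def)
  finally show "evaluate M \<gamma> \<phi> (d + i) (Sq_terms i L) = Sq M i d (evaluate M \<gamma> \<phi> d L)"
    by (simp add: evaluate_def)
  assume f: "f \<in> sq_hom M N" and N: "\<And>n. module F2 (piece N n)"
  have "f d (evaluate M \<gamma> \<phi> d L) = vsum (piece N d) (map (f d) (map (\<lambda>(w, g). act M (\<gamma> g) w (\<phi> g)) L))"
    unfolding evaluate_def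
    by (rule vsum_linear[OF MV _ _ s]) (auto simp: sq_hom_add[OF f] sq_hom_zero[OF f MV N])
  also have "map (f d) (map (\<lambda>(w, g). act M (\<gamma> g) w (\<phi> g)) L) = map (\<lambda>(w, g). act N (\<gamma> g) w (f (\<gamma> g) (\<phi> g))) L"
    using L act_hom[OF f M \<phi>] by (auto simp: terms_def)
  finally show "f d (evaluate M \<gamma> \<phi> d L) = evaluate N \<gamma> (\<lambda>g. f (\<gamma> g) (\<phi> g)) d L"
    by (simp add: evaluate_def)
qed

text \<open>Two formal sums are identified if they agree in all unstable modules over the type that is
  used for the resolutions; this makes the relations and the universal property immediate.\<close>

definition free_eq :: "('g \<Rightarrow> nat) \<Rightarrow> nat \<Rightarrow> (nat list \<times> 'g) list \<Rightarrow> (nat list \<times> 'g) list \<Rightarrow> bool" where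
  "free_eq \<gamma> d L L' \<longleftrightarrow> (\<forall>(E :: (nat \<times> bit) sq_module) \<phi>. unstable_module E \<longrightarrow>
     (\<forall>g. \<phi> g \<in> carrier (piece E (\<gamma> g))) \<longrightarrow> evaluate E \<gamma> \<phi> d L = evaluate E \<gamma> \<phi> d L')"

text \<open>A class is stored as the number of a chosen representative, so that free modules live in
  \<open>nat \<times> bit\<close>, the type in which \<open>Ext_U\<close> takes its resolutions of
  modules over \<open>bit\<close>.\<close>

definition free_class :: "('g::countable \<Rightarrow> nat) \<Rightarrow> nat \<Rightarrow> (nat list \<times> 'g) list \<Rightarrow> nat \<times> bit" where
  "free_class \<gamma> d L = (to_nat (SOME L'. L' \<in> terms \<gamma> d \<and> free_eq \<gamma> d L L'), 0)"

definition free_rep :: "nat \<times> bit \<Rightarrow> (nat list \<times> 'g::countable) list" where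
  "free_rep X = from_nat (fst X)"

definition free_module :: "('g::countable \<Rightarrow> nat) \<Rightarrow> (nat \<times> bit) sq_module" where
  "free_module \<gamma> = \<lparr>
     piece = (\<lambda>d. mk_vs (free_class \<gamma> d ` terms \<gamma> d) (free_class \<gamma> d [])
       (\<lambda>X Y. free_class \<gamma> d (free_rep X @ free_rep Y)) (\<lambda>b X. if b = 0 then free_class \<gamma> d [] else X)),
     Sq = (\<lambda>i d X. free_class \<gamma> (d + i) (Sq_terms i (free_rep X)))\<rparr>"

definition free_gen :: "('g::countable \<Rightarrow> nat) \<Rightarrow> 'g \<Rightarrow> nat \<times> bit" where
  "free_gen \<gamma> g = free_class \<gamma> (\<gamma> g) [([], g)]"

lemma free_rep_class:
  fixes \<gamma> :: "'g::countable \<Rightarrow> nat"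
  assumes "L \<in> terms \<gamma> d"
  shows "free_rep (free_class \<gamma> d L) \<in> terms \<gamma> d \<and> free_eq \<gamma> d L (free_rep (free_class \<gamma> d L))"
proof -
  have "\<exists>L'. L' \<in> terms \<gamma> d \<and> free_eq \<gamma> d L L'"
    using assms by (auto simp: free_eq_def)
  from someI_ex[OF this] show ?thesis by (simp add: free_rep_def free_class_def)
qed

lemma free_class_cong: "free_eq \<gamma> d L L' \<Longrightarrow> free_class \<gamma> d L = free_class \<gamma> d L'"
  unfolding free_class_def by (simp add: free_eq_def)

lemma
  shows free_zero: "\<zero>\<^bsub>piece (free_module \<gamma>) d\<^esub> = free_class \<gamma> d []"
    and free_add: "X \<oplus>\<^bsub>piece (free_module \<gamma>) d\<^esub> Y = free_class \<gamma> d (free_rep X @ free_rep Y)"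
    and free_smult: "b \<odot>\<^bsub>piece (free_module \<gamma>) d\<^esub> X = (if b = 0 then free_class \<gamma> d [] else X)"
    and free_Sq: "Sq (free_module \<gamma>) i d X = free_class \<gamma> (d + i) (Sq_terms i (free_rep X))"
    and free_carrier: "carrier (piece (free_module \<gamma>) d) = free_class \<gamma> d ` terms \<gamma> d"
  by (simp_all add: free_module_def)

lemma free_rep_in: "X \<in> carrier (piece (free_module \<gamma>) d) \<Longrightarrow> free_rep X \<in> terms \<gamma> d"
  using free_rep_class by (auto simp: free_carrier)

lemma evaluate_free_class:
  fixes \<gamma> :: "'g::countable \<Rightarrow> nat" and E :: "(nat \<times> bit) sq_module"
  assumes "L \<in> terms \<gamma> d" "unstable_module E" "\<And>g. \<phi> g \<in> carrier (piece E (\<gamma> g))"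
  shows "evaluate E \<gamma> \<phi> d (free_rep (free_class \<gamma> d L)) = evaluate E \<gamma> \<phi> d L"
  using free_rep_class[OF assms(1)] assms(2,3) unfolding free_eq_def by metis

lemma free_separate:
  assumes X: "X \<in> carrier (piece (free_module \<gamma>) d)" and Y: "Y \<in> carrier (piece (free_module \<gamma>) d)"
    and eq: "\<And>(E :: (nat \<times> bit) sq_module) \<phi>. unstable_module E \<Longrightarrow> (\<And>g. \<phi> g \<in> carrier (piece E (\<gamma> g))) \<Longrightarrow>
      evaluate E \<gamma> \<phi> d (free_rep X) = evaluate E \<gamma> \<phi> d (free_rep Y)"
  shows "X = Y"
proof -
  obtain L L' where L: "L \<in> terms \<gamma> d" "X = free_class \<gamma> d L" "L' \<in> terms \<gamma> d" "Y = free_class \<gamma> d L'"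
    using X Y by (auto simp: free_carrier)
  have "free_eq \<gamma> d L L'"
    unfolding free_eq_def using eq evaluate_free_class L by metis
  then show ?thesis using L free_class_cong by metis
qed

text \<open>Evaluations in the modules of the type separate classes by the very definition of
  \<open>free_eq\<close>, and each of them respects the operations.\<close>

lemma free_unstable: "unstable_module (free_module \<gamma>)"
proof (rule unstable_jointly[where \<H> = "{(E :: (nat \<times> bit) sq_module, h). unstable_module E \<and>
    (\<exists>\<phi>. (\<forall>g. \<phi> g \<in> carrier (piece E (\<gamma> g))) \<and> h = (\<lambda>d X. evaluate E \<gamma> \<phi> d (free_rep X)))}"])
  fix n X Y assume XY: "X \<in> carrier (piece (free_module \<gamma>) n)" "Y \<in> carrier (piece (free_module \<gamma>) n)"
  show "X \<oplus>\<^bsub>piece (free_module \<gamma>) n\<^esub> Y \<in> carrier (piece (free_module \<gamma>) n)"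
    using free_rep_in[OF XY(1)] free_rep_in[OF XY(2)] by (simp add: free_add free_carrier)
next
  fix i n X assume "X \<in> carrier (piece (free_module \<gamma>) n)"
  then show "Sq (free_module \<gamma>) i n X \<in> carrier (piece (free_module \<gamma>) (n + i))"
    unfolding free_Sq using Sq_terms_in[OF free_rep_in, of X \<gamma> n i] by (simp add: free_carrier[of \<gamma> "n + i"])
next
  fix n X b assume "X \<in> carrier (piece (free_module \<gamma>) n)"
  show "b \<odot>\<^bsub>piece (free_module \<gamma>) n\<^esub> X = (if b = 0 then \<zero>\<^bsub>piece (free_module \<gamma>) n\<^esub> else X)"
    by (simp add: free_smult free_zero)
next
  fix n X Y assume XY: "X \<in> carrier (piece (free_module \<gamma>) n)" "Y \<in> carrier (piece (free_module \<gamma>) n)"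
    and eq: "\<And>E h. (E, h) \<in> {(E :: (nat \<times> bit) sq_module, h). unstable_module E \<and>
    (\<exists>\<phi>. (\<forall>g. \<phi> g \<in> carrier (piece E (\<gamma> g))) \<and> h = (\<lambda>d X. evaluate E \<gamma> \<phi> d (free_rep X)))} \<Longrightarrow> h n X = h n Y"
  show "X = Y"
  proof (rule free_separate[OF XY])
    fix E :: "(nat \<times> bit) sq_module" and \<phi>
    assume "unstable_module E" "\<And>g. \<phi> g \<in> carrier (piece E (\<gamma> g))"
    then show "evaluate E \<gamma> \<phi> n (free_rep X) = evaluate E \<gamma> \<phi> n (free_rep Y)"
      using eq[of E "\<lambda>d X. evaluate E \<gamma> \<phi> d (free_rep X)"] by auto
  qed
next
  fix E :: "(nat \<times> bit) sq_module" and h n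
  assume "(E, h) \<in> {(E :: (nat \<times> bit) sq_module, h). unstable_module E \<and>
    (\<exists>\<phi>. (\<forall>g. \<phi> g \<in> carrier (piece E (\<gamma> g))) \<and> h = (\<lambda>d X. evaluate E \<gamma> \<phi> d (free_rep X)))}"
  then obtain \<phi> where E: "unstable_module E" and \<phi>: "\<And>g. \<phi> g \<in> carrier (piece E (\<gamma> g))"
    and h: "h = (\<lambda>d X. evaluate E \<gamma> \<phi> d (free_rep X))" by auto
  show "unstable_module E" by (rule E)
  show "h n \<zero>\<^bsub>piece (free_module \<gamma>) n\<^esub> = \<zero>\<^bsub>piece E n\<^esub>"
    unfolding h free_zero by (simp add: evaluate_free_class[OF _ E \<phi>])
  fix X assume X: "X \<in> carrier (piece (free_module \<gamma>) n)"
  show "h n X \<in> carrier (piece E n)"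
    unfolding h by (rule evaluate_closed[OF E \<phi> free_rep_in[OF X]])
  show "h (n + i) (Sq (free_module \<gamma>) i n X) = Sq E i n (h n X)" for i
    unfolding h free_Sq evaluate_free_class[OF Sq_terms_in[OF free_rep_in[OF X]] E \<phi>]
    by (rule evaluate_Sq[OF E \<phi> free_rep_in[OF X]])
  fix Y assume Y: "Y \<in> carrier (piece (free_module \<gamma>) n)"
  show "h n (X \<oplus>\<^bsub>piece (free_module \<gamma>) n\<^esub> Y) = h n X \<oplus>\<^bsub>piece E n\<^esub> h n Y"
    unfolding h free_add
    using free_rep_in[OF X] free_rep_in[OF Y]
    by (simp add: evaluate_free_class[OF _ E \<phi>] evaluate_append[OF E \<phi>])
qed (auto simp: free_zero free_carrier)

lemma free_gen_in: "free_gen \<gamma> g \<in> carrier (piece (free_module \<gamma>) (\<gamma> g))"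
  by (auto simp: free_gen_def free_carrier terms_def)

lemma free_hom:
  fixes E :: "(nat \<times> bit) sq_module"
  assumes E: "unstable_module E" and \<phi>: "\<And>g. \<phi> g \<in> carrier (piece E (\<gamma> g))"
  obtains h where "h \<in> sq_hom (free_module \<gamma>) E" "\<And>g. h (\<gamma> g) (free_gen \<gamma> g) = \<phi> g"
    "\<And>d X. X \<in> carrier (piece (free_module \<gamma>) d) \<Longrightarrow> h d X = evaluate E \<gamma> \<phi> d (free_rep X)"
proof (rule that)
  let ?h = "\<lambda>d. restrict (\<lambda>X. evaluate E \<gamma> \<phi> d (free_rep X)) (carrier (piece (free_module \<gamma>) d))"
  show "?h \<in> sq_hom (free_module \<gamma>) E"
  proof (rule sq_hom_restrictI)
    fix n X assume X: "X \<in> carrier (piece (free_module \<gamma>) n)"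
    show "evaluate E \<gamma> \<phi> n (free_rep X) \<in> carrier (piece E n)"
      by (rule evaluate_closed[OF E \<phi> free_rep_in[OF X]])
    show "evaluate E \<gamma> \<phi> (n + i) (free_rep (Sq (free_module \<gamma>) i n X)) = Sq E i n (evaluate E \<gamma> \<phi> n (free_rep X))" for i
      unfolding free_Sq evaluate_free_class[OF Sq_terms_in[OF free_rep_in[OF X]] E \<phi>]
      by (rule evaluate_Sq[OF E \<phi> free_rep_in[OF X]])
    fix Y assume Y: "Y \<in> carrier (piece (free_module \<gamma>) n)"
    show "evaluate E \<gamma> \<phi> n (free_rep (X \<oplus>\<^bsub>piece (free_module \<gamma>) n\<^esub> Y)) =
        evaluate E \<gamma> \<phi> n (free_rep X) \<oplus>\<^bsub>piece E n\<^esub> evaluate E \<gamma> \<phi> n (free_rep Y)"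
      unfolding free_add
      using free_rep_in[OF X] free_rep_in[OF Y]
      by (simp add: evaluate_free_class[OF _ E \<phi>] evaluate_append[OF E \<phi>])
  qed (auto simp: free_unstable E unstable_Sq_closed)
  fix g
  have "[([], g)] \<in> terms \<gamma> (\<gamma> g)" by (simp add: terms_def)
  then have "evaluate E \<gamma> \<phi> (\<gamma> g) (free_rep (free_gen \<gamma> g)) = evaluate E \<gamma> \<phi> (\<gamma> g) [([], g)]"
    unfolding free_gen_def by (rule evaluate_free_class[OF _ E \<phi>])
  also have "\<dots> = \<phi> g" using E \<phi> by (simp add: evaluate_def)
  finally show "?h (\<gamma> g) (free_gen \<gamma> g) = \<phi> g" by (simp add: free_gen_in)
qed simp

lemma
  assumes L: "L \<in> terms \<gamma> d"
  shows free_evaluate_closed: "evaluate (free_module \<gamma>) \<gamma> (free_gen \<gamma>) d L \<in> carrier (piece (free_module \<gamma>) d)"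
    and free_evaluate_hom: "f \<in> sq_hom (free_module \<gamma>) N \<Longrightarrow> (\<And>n. module F2 (piece N n)) \<Longrightarrow>
      f d (evaluate (free_module \<gamma>) \<gamma> (free_gen \<gamma>) d L) = evaluate N \<gamma> (\<lambda>g. f (\<gamma> g) (free_gen \<gamma> g)) d L"
  by (rule evaluate_closed evaluate_hom; use L free_unstable free_gen_in in blast)+

text \<open>An evaluation is induced by a morphism that sends each generator to its prescribed
  value, so it takes both sides to the same element; and evaluations separate classes.\<close>

lemma free_element:
  assumes X: "X \<in> carrier (piece (free_module \<gamma>) d)"
  shows "evaluate (free_module \<gamma>) \<gamma> (free_gen \<gamma>) d (free_rep X) = X"
proof (rule free_separate[of _ \<gamma> d])
  show "evaluate (free_module \<gamma>) \<gamma> (free_gen \<gamma>) d (free_rep X) \<in> carrier (piece (free_module \<gamma>) d)"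
    by (rule free_evaluate_closed[OF free_rep_in[OF X]])
  fix E :: "(nat \<times> bit) sq_module" and \<phi>
  assume E: "unstable_module E" and \<phi>: "\<And>g. \<phi> g \<in> carrier (piece E (\<gamma> g))"
  obtain h where h: "h \<in> sq_hom (free_module \<gamma>) E" "\<And>g. h (\<gamma> g) (free_gen \<gamma> g) = \<phi> g"
    "\<And>d X. X \<in> carrier (piece (free_module \<gamma>) d) \<Longrightarrow> h d X = evaluate E \<gamma> \<phi> d (free_rep X)"
    by (rule free_hom[where \<gamma> = \<gamma> and \<phi> = \<phi>, OF E \<phi>]) metis
  have "h d (evaluate (free_module \<gamma>) \<gamma> (free_gen \<gamma>) d (free_rep X)) = evaluate E \<gamma> \<phi> d (free_rep X)"
    using free_evaluate_hom[OF free_rep_in[OF X] h(1) unstable_vs[OF E]] by (simp add: h(2))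
  then show "evaluate E \<gamma> \<phi> d (free_rep (evaluate (free_module \<gamma>) \<gamma> (free_gen \<gamma>) d (free_rep X))) = evaluate E \<gamma> \<phi> d (free_rep X)"
    using h(3)[OF free_evaluate_closed[OF free_rep_in[OF X]]] by simp
qed (rule X)

lemma free_hom_eq:
  assumes f: "f \<in> sq_hom (free_module \<gamma>) N" and N: "\<And>n. module F2 (piece N n)"
    and X: "X \<in> carrier (piece (free_module \<gamma>) d)"
  shows "f d X = evaluate N \<gamma> (\<lambda>g. f (\<gamma> g) (free_gen \<gamma> g)) d (free_rep X)"
  using free_evaluate_hom[OF free_rep_in[OF X] f N] free_element[OF X] by simp

lemma free_projective: "projective (free_module \<gamma>)"
  unfolding projective_def
proof (intro conjI free_unstable allI impI)
  fix E B :: "(nat \<times> bit) sq_module" and q f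
  assume E: "unstable_module E" and B: "unstable_module B" and q: "sq_surj E B q" and f: "f \<in> sq_hom (free_module \<gamma>) B"
  have qh: "q \<in> sq_hom E B" and qs: "\<And>n. q n ` carrier (piece E n) = carrier (piece B n)"
    using q by (auto simp: sq_surj_def)
  have "\<forall>g. \<exists>x. x \<in> carrier (piece E (\<gamma> g)) \<and> q (\<gamma> g) x = f (\<gamma> g) (free_gen \<gamma> g)"
    using sq_hom_closed[OF f free_gen_in] qs by (metis imageE)
  then obtain \<phi> where \<phi>: "\<And>g. \<phi> g \<in> carrier (piece E (\<gamma> g))" "\<And>g. q (\<gamma> g) (\<phi> g) = f (\<gamma> g) (free_gen \<gamma> g)"
    by metis
  obtain h where h: "h \<in> sq_hom (free_module \<gamma>) E" "\<And>g. h (\<gamma> g) (free_gen \<gamma> g) = \<phi> g"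
    by (rule free_hom[where \<gamma> = \<gamma> and \<phi> = \<phi>, OF E \<phi>(1)]) metis
  have qhh: "sq_comp (free_module \<gamma>) q h \<in> sq_hom (free_module \<gamma>) B"
    by (rule sq_comp_unstable[OF h(1) qh free_unstable B])
  have "sq_comp (free_module \<gamma>) q h = f"
  proof (rule sq_hom_eqI[OF qhh f])
    fix n x assume x: "x \<in> carrier (piece (free_module \<gamma>) n)"
    have "sq_comp (free_module \<gamma>) q h n x = evaluate B \<gamma> (\<lambda>g. sq_comp (free_module \<gamma>) q h (\<gamma> g) (free_gen \<gamma> g)) n (free_rep x)"
      by (rule free_hom_eq[OF qhh unstable_vs[OF B] x])
    also have "(\<lambda>g. sq_comp (free_module \<gamma>) q h (\<gamma> g) (free_gen \<gamma> g)) = (\<lambda>g. f (\<gamma> g) (free_gen \<gamma> g))"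
      by (simp add: h(2) \<phi>(2) free_gen_in)
    also have "evaluate B \<gamma> \<dots> n (free_rep x) = f n x"
      by (rule free_hom_eq[OF f unstable_vs[OF B] x, symmetric])
    finally show "sq_comp (free_module \<gamma>) q h n x = f n x" .
  qed
  then show "\<exists>g\<in>sq_hom (free_module \<gamma>) E. sq_comp (free_module \<gamma>) q g = f" using h(1) by blast
qed

lemma free_cover:
  fixes M :: "(nat \<times> bit) sq_module"
  assumes M: "unstable_module M"
  obtains \<gamma> :: "nat \<times> nat \<times> bit \<Rightarrow> nat" and e where "sq_surj (free_module \<gamma>) M e"
proof -
  define \<gamma> :: "nat \<times> nat \<times> bit \<Rightarrow> nat" where "\<gamma> = fst"
  \<comment> \<open>There is one generator for every pair of a degree and an element of the type,
    which keeps the index set a fixed countable type. A pair whose element lies outside the carrier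
    is sent to zero.\<close>
  define \<phi> where "\<phi> g = (if snd g \<in> carrier (piece M (\<gamma> g)) then snd g else \<zero>\<^bsub>piece M (\<gamma> g)\<^esub>)" for g
  have \<phi>: "\<phi> g \<in> carrier (piece M (\<gamma> g))" for g using M by (simp add: \<phi>_def)
  obtain h where h: "h \<in> sq_hom (free_module \<gamma>) M" "\<And>g. h (\<gamma> g) (free_gen \<gamma> g) = \<phi> g"
    by (rule free_hom[where \<gamma> = \<gamma> and \<phi> = \<phi>, OF M \<phi>]) metis
  have "sq_surj (free_module \<gamma>) M h"
    unfolding sq_surj_def
  proof (intro conjI h(1) allI equalityI subsetI)
    fix n x assume "x \<in> carrier (piece M n)"
    then have "h n (free_gen \<gamma> (n, x)) = x" using h(2)[of "(n, x)"] by (simp add: \<phi>_def \<gamma>_def)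
    then show "x \<in> h n ` carrier (piece (free_module \<gamma>) n)"
      using free_gen_in[of \<gamma> "(n, x)"] by (metis \<gamma>_def fst_conv imageI)
  qed (use sq_hom_closed[OF h(1)] in auto)
  then show ?thesis using that by blast
qed

lemma projective_cover:
  fixes M :: "'a sq_module"
  assumes M: "unstable_module M" and cnt: "\<And>n. countable (carrier (piece M n))"
  obtains P :: "(nat \<times> bit) sq_module" and e where "projective P" "sq_surj P M e"
proof -
  obtain N :: "(nat \<times> bit) sq_module" and a b where N: "unstable_module N" "a \<in> sq_hom M N" "b \<in> sq_hom N M"
    "\<And>n x. x \<in> carrier (piece M n) \<Longrightarrow> b n (a n x) = x"
    using unstable_transport[OF M cnt, where ?'b = bit] by metis
  obtain \<gamma> :: "nat \<times> nat \<times> bit \<Rightarrow> nat" and e where e: "sq_surj (free_module \<gamma>) N e"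
    using free_cover[OF N(1)] by metis
  have eh: "e \<in> sq_hom (free_module \<gamma>) N" and es: "\<And>n. e n ` carrier (piece (free_module \<gamma>) n) = carrier (piece N n)"
    using e by (auto simp: sq_surj_def)
  have be: "sq_comp (free_module \<gamma>) b e \<in> sq_hom (free_module \<gamma>) M"
    by (rule sq_comp_unstable[OF eh N(3) free_unstable M])
  have "sq_surj (free_module \<gamma>) M (sq_comp (free_module \<gamma>) b e)"
    unfolding sq_surj_def
  proof (intro conjI be allI equalityI subsetI)
    fix n x assume x: "x \<in> carrier (piece M n)"
    then obtain y where "y \<in> carrier (piece (free_module \<gamma>) n)" "e n y = a n x"
      using es sq_hom_closed[OF N(2) x] by (metis imageE)
    then show "x \<in> sq_comp (free_module \<gamma>) b e n ` carrier (piece (free_module \<gamma>) n)"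
      using N(4)[OF x] by (intro image_eqI[of _ _ y]) auto
  qed (use sq_hom_closed[OF be] in auto)
  then show ?thesis using that free_projective by blast
qed

section \<open>Kernels and the existence of resolutions\<close>

definition sq_kernel :: "'a sq_module \<Rightarrow> (nat \<Rightarrow> 'a \<Rightarrow> 'b) \<Rightarrow> 'b sq_module \<Rightarrow> 'a sq_module" where
  "sq_kernel P f M = P\<lparr>piece := \<lambda>n. piece P n\<lparr>carrier := {x \<in> carrier (piece P n). f n x = \<zero>\<^bsub>piece M n\<^esub>}\<rparr>\<rparr>"

lemma sq_kernel_unstable:
  assumes P: "unstable_module P" and M: "unstable_module M" and f: "f \<in> sq_hom P M"
  shows "unstable_module (sq_kernel P f M)"
proof -
  note PV = unstable_vs[OF P] and MV = unstable_vs[OF M]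
  show ?thesis
    by (rule unstable_jointly[where \<H> = "{(P, \<lambda>n x. x)}"])
      (auto simp: sq_kernel_def P PV MV sq_hom_zero[OF f PV MV] sq_hom_add[OF f] F2_smult[OF PV]
        unstable_Sq_closed[OF P] sq_hom_Sq[OF f] unstable_Sq_zero[OF M])
qed

text \<open>Covers of successive kernels by free modules. This is what guarantees that the choice
  made in \<open>chosen_resolution\<close> denotes a resolution.\<close>

lemma resolution_exists:
  fixes M :: "'a sq_module"
  assumes M: "unstable_module M" and cnt: "\<And>n. countable (carrier (piece M n))"
  obtains P :: "nat \<Rightarrow> (nat \<times> bit) sq_module" and d e where "projective_resolution P d e M"
proof -
  obtain P0 :: "(nat \<times> bit) sq_module" and e where P0: "projective P0" "sq_surj P0 M e"
    using projective_cover[OF M cnt] by metis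
  have "\<forall>K :: (nat \<times> bit) sq_module. \<exists>C :: (nat \<times> bit) sq_module \<times> (nat \<Rightarrow> nat \<times> bit \<Rightarrow> nat \<times> bit). unstable_module K \<longrightarrow> projective (fst C) \<and> sq_surj (fst C) K (snd C)"
  proof
    fix K :: "(nat \<times> bit) sq_module"
    show "\<exists>C :: (nat \<times> bit) sq_module \<times> (nat \<Rightarrow> nat \<times> bit \<Rightarrow> nat \<times> bit). unstable_module K \<longrightarrow> projective (fst C) \<and> sq_surj (fst C) K (snd C)"
    proof (cases "unstable_module K")
      case True
      obtain P :: "(nat \<times> bit) sq_module" and e where "projective P" "sq_surj P K e"
        using projective_cover[OF True countableI_type] by metis
      then show ?thesis by (intro exI[of _ "(P, e)"]) simp
    qed simp
  qed
  then obtain C :: "(nat \<times> bit) sq_module \<Rightarrow> (nat \<times> bit) sq_module \<times> (nat \<Rightarrow> nat \<times> bit \<Rightarrow> nat \<times> bit)"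
    where C: "\<And>K. unstable_module K \<Longrightarrow> projective (fst (C K)) \<and> sq_surj (fst (C K)) K (snd (C K))"
    by metis
  \<comment> \<open>The recursion carries the module in degree \<open>s\<close> together with the
    kernel inside it that the next cover has to hit.\<close>
  define S where "S = rec_nat (P0, sq_kernel P0 e M)
    (\<lambda>_ S. (fst (C (snd S)), sq_kernel (fst (C (snd S))) (snd (C (snd S))) (snd S)))"
  define P where "P s = fst (S s)" for s
  define K where "K s = snd (S s)" for s
  define d where "d s = snd (C (K s))" for s
  have P_0: "P 0 = P0" "K 0 = sq_kernel P0 e M" by (simp_all add: P_def K_def S_def)
  have P_Suc: "P (Suc s) = fst (C (K s))" "K (Suc s) = sq_kernel (P (Suc s)) (d s) (K s)" for s
    by (simp_all add: P_def K_def S_def d_def)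
  have PK: "projective (P s) \<and> unstable_module (K s)" for s
  proof (induction s)
    case 0
    then show ?case
      using P0 M by (simp add: P_0 sq_surj_def sq_kernel_unstable projective_unstable)
  next
    case (Suc s)
    then show ?case
      using C[of "K s"] by (simp add: P_Suc d_def sq_surj_def sq_kernel_unstable projective_unstable)
  qed
  have ds: "sq_surj (P (Suc s)) (K s) (d s)" for s
    using C[of "K s"] PK[of s] by (simp add: P_Suc d_def)
  have Kp: "carrier (piece (K s) n) \<subseteq> carrier (piece (P s) n)" "\<zero>\<^bsub>piece (K s) n\<^esub> = \<zero>\<^bsub>piece (P s) n\<^esub>"
    "x \<oplus>\<^bsub>piece (K s) n\<^esub> y = x \<oplus>\<^bsub>piece (P s) n\<^esub> y" "b \<odot>\<^bsub>piece (K s) n\<^esub> x = b \<odot>\<^bsub>piece (P s) n\<^esub> x"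
    "Sq (K s) = Sq (P s)" for s n x y b
    by (cases s; auto simp: P_0 P_Suc sq_kernel_def)+
  have dh: "d s \<in> sq_hom (P (Suc s)) (P s)" for s
    using ds[of s] Kp(2-)[of s] subsetD[OF Kp(1)[of s]]
    unfolding sq_surj_def sq_hom_def vs_linear_def hom_def by (auto simp: Pi_def)
  have di: "d s n ` carrier (piece (P (Suc s)) n) = carrier (piece (K s) n)" for s n
    using ds[of s] by (simp add: sq_surj_def)
  have "projective_resolution P d e M"
    unfolding projective_resolution_def
  proof (intro conjI allI)
    show "d 0 n ` carrier (piece (P 1) n) = {x \<in> carrier (piece (P 0) n). e n x = \<zero>\<^bsub>piece M n\<^esub>}" for n
      using di[of 0 n] by (simp add: P_0 sq_kernel_def)
    show "d (Suc s) n ` carrier (piece (P (Suc (Suc s))) n) =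
            {x \<in> carrier (piece (P (Suc s)) n). d s n x = \<zero>\<^bsub>piece (P s) n\<^esub>}" for s n
      using di[of "Suc s" n] by (simp add: P_Suc(2) sq_kernel_def Kp(2))
  qed (use PK dh P0 in \<open>auto simp: P_0\<close>)
  then show ?thesis using that by blast
qed

subsection \<open>The functor \<open>\<Omega>\<close>\<close>

text \<open>In the Adem relation for Sq^i Sq^h on degree \<open>h\<close>, the term Sq^(i+h-k) Sq^k
  acts on degree h + k after the first square and vanishes by instability when 2k < i. Only k = i/2
  can remain, with coefficient 1. Outside the range of the relation, instability or a trivial
  identity gives the claim.\<close>

lemma Sq_frobenius:
  assumes M: "unstable_module M" and z: "z \<in> carrier (piece M h)"
  shows "Sq M i (h + h) (Sq M h h z) =
    (if even i then Sq M (h + i div 2) (h + i div 2) (Sq M (i div 2) h z) else \<zero>\<^bsub>piece M (h + h + i)\<^esub>)"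
proof -
  note MV = unstable_vs[OF M] and cl = unstable_Sq_closed[OF M]
  have c: "Sq M k h z \<in> carrier (piece M (h + k))" for k by (rule cl[OF z refl])
  consider "i = 0" | "2 * h < i" | "i = 2 * h" | "0 < i" "i < 2 * h" by linarith
  then show ?thesis
  proof cases
    case 1
    then show ?thesis using unstable_Sq0[OF M z] unstable_Sq0[OF M c[of h]] by simp
  next
    case 2
    have "Sq M i (h + h) (Sq M h h z) = \<zero>\<^bsub>piece M (h + h + i)\<^esub>"
      using 2 by (intro unstable_Sq_big[OF M c]) simp
    moreover have "Sq M (h + i div 2) (h + i div 2) (Sq M (i div 2) h z) = \<zero>\<^bsub>piece M (h + h + i)\<^esub>" if "even i"
    proof -
      have e: "h + i div 2 + (h + i div 2) = h + h + i" using that by presburger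
      have "Sq M (i div 2) h z = \<zero>\<^bsub>piece M (h + i div 2)\<^esub>"
        using 2 that by (intro unstable_Sq_big[OF M z]) auto
      then show ?thesis
        using unstable_Sq_zero[OF M refl, of "h + i div 2" "h + i div 2"] by (simp only: e)
    qed
    ultimately show ?thesis by simp
  next
    case 3
    then show ?thesis by (simp add: mult_2)
  next
    case 4
    have "Sq M i (h + h) (Sq M h h z) = adem_rhs M i h h z"
      by (rule steenrod_adem[OF unstable_steenrod[OF M] 4 z])
    moreover have small: "Sq M (i + h - k) (h + k) (Sq M k h z) = \<zero>\<^bsub>piece M (h + i + h)\<^esub>" if "2 * k < i" for k
    proof -
      have "Sq M (i + h - k) (h + k) (Sq M k h z) = \<zero>\<^bsub>piece M (h + k + (i + h - k))\<^esub>"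
        using that by (intro unstable_Sq_big[OF M c]) simp
      also have "h + k + (i + h - k) = h + i + h" using that by simp
      finally show ?thesis .
    qed
    ultimately show ?thesis
    proof (cases "even i")
      case False
      have "adem_rhs M i h h z = \<zero>\<^bsub>piece M (h + i + h)\<^esub>"
        by (rule adem_rhs_zero[OF MV small]) (use False in presburger)
      moreover have "h + i + h = h + h + i" by simp
      ultimately show ?thesis using False \<open>Sq M i (h + h) (Sq M h h z) = _\<close> by simp
    next
      case True
      then obtain r where r: "i = 2 * r" by blast
      let ?V = "piece M (h + i + h)"
      let ?t = "Sq M (h + r) (h + r) (Sq M r h z)"
      interpret abelian_group ?V by (rule F2_abelian[OF MV])
      have "h + r + (h + r) = h + i + h" using r by simp
      with cl[OF c refl, of "h + r" r] have t: "?t \<in> carrier ?V" by metis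
      have "adem_rhs M i h h z = finsum ?V (\<lambda>k. if r = k then ?t else \<zero>\<^bsub>?V\<^esub>) {..i div 2}"
        unfolding adem_rhs_def
      proof (rule finsum_cong')
        fix k assume "k \<in> {..i div 2}"
        then have "k \<le> r" using r by simp
        then show "of_nat (h - k - 1 choose (i - 2 * k)) \<odot>\<^bsub>?V\<^esub> Sq M (i + h - k) (h + k) (Sq M k h z) =
            (if r = k then ?t else \<zero>\<^bsub>?V\<^esub>)"
        proof (cases "k = r")
          case True
          then have "i + h - k = h + r" "i - 2 * k = 0" using r by auto
          then show ?thesis using True t by (simp add: F2_smult[OF MV])
        next
          case False
          then have "Sq M (i + h - k) (h + k) (Sq M k h z) = \<zero>\<^bsub>?V\<^esub>"
            using \<open>k \<le> r\<close> r by (intro small) simp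
          then show ?thesis using False by (simp add: F2_smult[OF MV])
        qed
      qed (use t in auto)
      also have "\<dots> = ?t"
        by (rule add.finprod_singleton) (use r t in auto)
      finally show ?thesis using True r \<open>Sq M i (h + h) (Sq M h h z) = _\<close> by simp
    qed
  qed
qed

text \<open>Zero is listed separately so that the image is the zero space in odd degrees, which are
  not of the form h + h.\<close>

definition frobenius_image :: "'a sq_module \<Rightarrow> nat \<Rightarrow> 'a set" where
  "frobenius_image M n = {y \<in> carrier (piece M n). y = \<zero>\<^bsub>piece M n\<^esub> \<or>
     (\<exists>h. \<exists>z\<in>carrier (piece M h). n = h + h \<and> y = Sq M h h z)}"

definition omega_rep :: "'a sq_module \<Rightarrow> nat \<Rightarrow> 'a \<Rightarrow> 'a" where
  "omega_rep M n x = (SOME y. y \<in> carrier (piece M n) \<and> x \<oplus>\<^bsub>piece M n\<^esub> y \<in> frobenius_image M n)"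

text \<open>\<open>\<Sigma>\<Omega>M\<close> is the cokernel of the Frobenius; its elements are taken to be chosen representatives
  of the cosets, so that the carrier type does not change.\<close>

definition omega :: "'a sq_module \<Rightarrow> 'a sq_module" where
  "omega M = \<lparr>
     piece = (\<lambda>n. mk_vs (omega_rep M (Suc n) ` carrier (piece M (Suc n))) (omega_rep M (Suc n) \<zero>\<^bsub>piece M (Suc n)\<^esub>)
       (\<lambda>x y. omega_rep M (Suc n) (x \<oplus>\<^bsub>piece M (Suc n)\<^esub> y))
       (\<lambda>b x. if b = 0 then omega_rep M (Suc n) \<zero>\<^bsub>piece M (Suc n)\<^esub> else x)),
     Sq = (\<lambda>i n x. omega_rep M (Suc (n + i)) (Sq M i (Suc n) x))\<rparr>"

context
  fixes M :: "'a sq_module"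
  assumes M: "unstable_module M"
begin

lemma frobenius_image_zero: "\<zero>\<^bsub>piece M n\<^esub> \<in> frobenius_image M n"
  using unstable_vs[OF M] by (simp add: frobenius_image_def)

lemma frobenius_image_Sq_top:
  assumes "z \<in> carrier (piece M h)" shows "Sq M h h z \<in> frobenius_image M (h + h)"
  unfolding frobenius_image_def using assms unstable_Sq_closed[OF M assms refl] by blast

lemma frobenius_image_carrier: "y \<in> frobenius_image M n \<Longrightarrow> y \<in> carrier (piece M n)"
  by (simp add: frobenius_image_def)

lemma frobenius_image_add:
  assumes x: "x \<in> frobenius_image M n" and y: "y \<in> frobenius_image M n"
  shows "x \<oplus>\<^bsub>piece M n\<^esub> y \<in> frobenius_image M n"
proof (cases "x = \<zero>\<^bsub>piece M n\<^esub> \<or> y = \<zero>\<^bsub>piece M n\<^esub>")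
  case True
  then show ?thesis
    using x y unstable_vs[OF M, of n] frobenius_image_carrier[of _ n] by (elim disjE) simp_all
next
  case False
  then obtain h z h' z' where z: "z \<in> carrier (piece M h)" "n = h + h" "x = Sq M h h z"
    "z' \<in> carrier (piece M h')" "n = h' + h'" "y = Sq M h' h' z'"
    using x y unfolding frobenius_image_def by blast
  then have "h' = h" by simp
  with z have "x \<oplus>\<^bsub>piece M n\<^esub> y = Sq M h h (z \<oplus>\<^bsub>piece M h\<^esub> z')"
    using unstable_Sq_add[OF M z(1)] by simp
  then show ?thesis
    using frobenius_image_Sq_top[of "z \<oplus>\<^bsub>piece M h\<^esub> z'" h] z \<open>h' = h\<close> unstable_vs[OF M] by simp
qed

lemma frobenius_image_Sq:
  assumes y: "y \<in> frobenius_image M n"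
  shows "Sq M i n y \<in> frobenius_image M (n + i)"
proof (cases "y = \<zero>\<^bsub>piece M n\<^esub>")
  case True
  then show ?thesis using unstable_Sq_zero[OF M refl] frobenius_image_zero by simp
next
  case False
  then obtain h z where z: "z \<in> carrier (piece M h)" "n = h + h" "y = Sq M h h z"
    using y unfolding frobenius_image_def by blast
  show ?thesis
  proof (cases "even i")
    case True
    then have e: "h + i div 2 + (h + i div 2) = n + i" using z(2) by presburger
    show ?thesis
      using frobenius_image_Sq_top[OF unstable_Sq_closed[OF M z(1) refl], of "i div 2"] Sq_frobenius[OF M z(1), of i] True z(2,3)
      unfolding e by simp
  next
    case False
    then show ?thesis using Sq_frobenius[OF M z(1), of i] z(2,3) frobenius_image_zero by simp
  qed
qed

lemma omega_rep:
  assumes x: "x \<in> carrier (piece M n)"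
  shows "omega_rep M n x \<in> carrier (piece M n) \<and> x \<oplus>\<^bsub>piece M n\<^esub> omega_rep M n x \<in> frobenius_image M n"
proof -
  have "x \<in> carrier (piece M n) \<and> x \<oplus>\<^bsub>piece M n\<^esub> x \<in> frobenius_image M n"
    using x frobenius_image_zero unstable_vs[OF M] by simp
  then show ?thesis unfolding omega_rep_def by (rule someI)
qed

lemma omega_rep_eq_iff:
  assumes x: "x \<in> carrier (piece M n)" and y: "y \<in> carrier (piece M n)"
  shows "omega_rep M n x = omega_rep M n y \<longleftrightarrow> x \<oplus>\<^bsub>piece M n\<^esub> y \<in> frobenius_image M n"
proof
  note V = unstable_vs[OF M, of n]
  have key: "x \<oplus>\<^bsub>piece M n\<^esub> z \<in> frobenius_image M n" if "x \<oplus>\<^bsub>piece M n\<^esub> y \<in> frobenius_image M n"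
    "y \<oplus>\<^bsub>piece M n\<^esub> z \<in> frobenius_image M n" "x \<in> carrier (piece M n)" "y \<in> carrier (piece M n)" "z \<in> carrier (piece M n)" for x y z
  proof -
    have "(x \<oplus>\<^bsub>piece M n\<^esub> y) \<oplus>\<^bsub>piece M n\<^esub> (y \<oplus>\<^bsub>piece M n\<^esub> z) = x \<oplus>\<^bsub>piece M n\<^esub> z"
      using that(3-) V by (simp add: F2_assoc)
    then show ?thesis using frobenius_image_add[OF that(1,2)] by simp
  qed
  have sym: "y \<oplus>\<^bsub>piece M n\<^esub> x \<in> frobenius_image M n" if "x \<oplus>\<^bsub>piece M n\<^esub> y \<in> frobenius_image M n" "x \<in> carrier (piece M n)" "y \<in> carrier (piece M n)" for x y
    using that F2_comm[OF V that(2,3)] by simp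
  { assume "omega_rep M n x = omega_rep M n y"
    then show "x \<oplus>\<^bsub>piece M n\<^esub> y \<in> frobenius_image M n"
      using key[of x "omega_rep M n x" y] sym[of y "omega_rep M n y"] omega_rep[OF x] omega_rep[OF y] x y by simp }
  assume xy: "x \<oplus>\<^bsub>piece M n\<^esub> y \<in> frobenius_image M n"
  have "z \<in> carrier (piece M n) \<and> x \<oplus>\<^bsub>piece M n\<^esub> z \<in> frobenius_image M n \<longleftrightarrow>
      z \<in> carrier (piece M n) \<and> y \<oplus>\<^bsub>piece M n\<^esub> z \<in> frobenius_image M n" for z
    using key[of x y z] key[of y x z] xy sym[OF xy x y] x y by blast
  then show "omega_rep M n x = omega_rep M n y" unfolding omega_rep_def by simp
qed

lemma
  shows omega_zero: "\<zero>\<^bsub>piece (omega M) n\<^esub> = omega_rep M (Suc n) \<zero>\<^bsub>piece M (Suc n)\<^esub>"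
    and omega_add: "x \<oplus>\<^bsub>piece (omega M) n\<^esub> y = omega_rep M (Suc n) (x \<oplus>\<^bsub>piece M (Suc n)\<^esub> y)"
    and omega_Sq: "Sq (omega M) i n x = omega_rep M (Suc (n + i)) (Sq M i (Suc n) x)"
    and omega_carrier: "carrier (piece (omega M) n) = omega_rep M (Suc n) ` carrier (piece M (Suc n))"
  by (simp_all add: omega_def)

lemma omega_rep_in: "x \<in> carrier (piece M (Suc n)) \<Longrightarrow> omega_rep M (Suc n) x \<in> carrier (piece (omega M) n)"
  by (simp add: omega_carrier)

lemma omega_sub: "x \<in> carrier (piece (omega M) n) \<Longrightarrow> x \<in> carrier (piece M (Suc n)) \<and> omega_rep M (Suc n) x = x"
proof -
  assume "x \<in> carrier (piece (omega M) n)"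
  then obtain y where y: "y \<in> carrier (piece M (Suc n))" "x = omega_rep M (Suc n) y" by (auto simp: omega_carrier)
  then show ?thesis using omega_rep[OF y(1)] omega_rep_eq_iff[OF y(1), of x] by simp
qed

lemma omega_rep_add:
  assumes x: "x \<in> carrier (piece M (Suc n))" and y: "y \<in> carrier (piece M (Suc n))"
  shows "omega_rep M (Suc n) (x \<oplus>\<^bsub>piece M (Suc n)\<^esub> y) = omega_rep M (Suc n) x \<oplus>\<^bsub>piece (omega M) n\<^esub> omega_rep M (Suc n) y"
proof -
  note V = unstable_vs[OF M, of "Suc n"]
  let ?V = "piece M (Suc n)" and ?r = "omega_rep M (Suc n)"
  have c: "?r x \<in> carrier ?V" "?r y \<in> carrier ?V" using omega_rep x y by auto
  have "(x \<oplus>\<^bsub>?V\<^esub> y) \<oplus>\<^bsub>?V\<^esub> (?r x \<oplus>\<^bsub>?V\<^esub> ?r y) = (x \<oplus>\<^bsub>?V\<^esub> ?r x) \<oplus>\<^bsub>?V\<^esub> (y \<oplus>\<^bsub>?V\<^esub> ?r y)"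
    using x y c V by (simp add: F2_assoc F2_lcomm)
  also have "\<dots> \<in> frobenius_image M (Suc n)"
    by (rule frobenius_image_add[OF conjunct2[OF omega_rep[OF x]] conjunct2[OF omega_rep[OF y]]])
  finally show ?thesis
    unfolding omega_add using omega_rep_eq_iff[of "x \<oplus>\<^bsub>?V\<^esub> y" "Suc n" "?r x \<oplus>\<^bsub>?V\<^esub> ?r y"] x y c V by simp
qed

lemma omega_rep_Sq:
  assumes x: "x \<in> carrier (piece M (Suc n))"
  shows "omega_rep M (Suc (n + i)) (Sq M i (Suc n) x) = Sq (omega M) i n (omega_rep M (Suc n) x)"
proof -
  let ?r = "omega_rep M (Suc n)"
  have c: "?r x \<in> carrier (piece M (Suc n))" using omega_rep x by auto
  have "Sq M i (Suc n) x \<oplus>\<^bsub>piece M (Suc n + i)\<^esub> Sq M i (Suc n) (?r x) \<in> frobenius_image M (Suc n + i)"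
    using frobenius_image_Sq[OF conjunct2[OF omega_rep[OF x]]] unstable_Sq_add[OF M x c] by simp
  then show ?thesis
    unfolding omega_Sq
    using omega_rep_eq_iff[OF unstable_Sq_closed[OF M x refl] unstable_Sq_closed[OF M c refl]] by simp
qed

text \<open>\<open>S\<close> is the desuspension of \<open>M\<close>: it satisfies the Adem
  relations but may have a nonzero Sq^(n+1) on degree \<open>n\<close>. That square is the Frobenius
  of \<open>M\<close>, which is what \<open>omega\<close> divides out.\<close>

lemma omega_unstable: "unstable_module (omega M)"
proof -
  define S where "S = \<lparr>piece = (\<lambda>n. piece M (Suc n)), Sq = (\<lambda>i n. Sq M i (Suc n))\<rparr>"
  have "steenrod_module S"
    using unstable_steenrod[OF M] unfolding steenrod_module_def S_def
    by (simp only: sq_module.simps add_Suc[symmetric]) blast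
  then have st: "steenrod_module (omega M)"
  proof (rule steenrod_image[where q = "\<lambda>n. omega_rep M (Suc n)"])
  qed (simp_all add: S_def omega_carrier omega_zero omega_rep_add omega_rep_Sq, simp add: omega_def)
  show ?thesis
    unfolding unstable_module_def
  proof (intro conjI st allI impI ballI)
    fix k n x assume k: "n < k" and x: "x \<in> carrier (piece (omega M) n)"
    then have x': "x \<in> carrier (piece M (Suc n))" using omega_sub by blast
    have "Sq M k (Suc n) x \<in> frobenius_image M (Suc n + k)"
    proof (cases "k = Suc n")
      case True
      then show ?thesis using frobenius_image_Sq_top[OF x'] by simp
    next
      case False
      then show ?thesis using k unstable_Sq_big[OF M x', of k] frobenius_image_zero[of "Suc n + k"] by simp
    qed
    then show "Sq (omega M) k n x = \<zero>\<^bsub>piece (omega M) (n + k)\<^esub>"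
      unfolding omega_Sq omega_zero
      using omega_rep_eq_iff[OF unstable_Sq_closed[OF M x' refl], of "\<zero>\<^bsub>piece M (Suc n + k)\<^esub>" k]
        unstable_vs[OF M] unstable_Sq_closed[OF M x' refl, of k] by simp
  qed
qed

lemma omega_rep_zero_iff:
  assumes x: "x \<in> carrier (piece M (Suc n))"
  shows "omega_rep M (Suc n) x = \<zero>\<^bsub>piece (omega M) n\<^esub> \<longleftrightarrow> x \<in> frobenius_image M (Suc n)"
  unfolding omega_zero using omega_rep_eq_iff[OF x F2_zero[OF unstable_vs[OF M]]] x unstable_vs[OF M] by simp

text \<open>The adjunction between Omega and suspension: a map from \<open>M\<close> to the
  suspension of \<open>N\<close> is given by its components \<open>u n\<close> on degree
  \<open>Suc n\<close>. It kills Sq^h z for z of degree h, because the image of z has degree h - 1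
  in \<open>N\<close>, where Sq^h vanishes.\<close>

lemma omega_factor:
  assumes N: "unstable_module N"
    and uc: "\<And>n x. x \<in> carrier (piece M (Suc n)) \<Longrightarrow> u n x \<in> carrier (piece N n)"
    and ua: "\<And>n x y. x \<in> carrier (piece M (Suc n)) \<Longrightarrow> y \<in> carrier (piece M (Suc n)) \<Longrightarrow>
      u n (x \<oplus>\<^bsub>piece M (Suc n)\<^esub> y) = u n x \<oplus>\<^bsub>piece N n\<^esub> u n y"
    and us: "\<And>n i x. x \<in> carrier (piece M (Suc n)) \<Longrightarrow> u (n + i) (Sq M i (Suc n) x) = Sq N i n (u n x)"
  obtains v where "v \<in> sq_hom (omega M) N" "\<And>n x. x \<in> carrier (piece M (Suc n)) \<Longrightarrow> v n (omega_rep M (Suc n) x) = u n x"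
proof -
  have kill: "u n y = \<zero>\<^bsub>piece N n\<^esub>" if y: "y \<in> frobenius_image M (Suc n)" for n y
  proof (cases "y = \<zero>\<^bsub>piece M (Suc n)\<^esub>")
    case True
    have z: "\<zero>\<^bsub>piece M (Suc n)\<^esub> \<in> carrier (piece M (Suc n))" using unstable_vs[OF M] by simp
    have "u n (\<zero>\<^bsub>piece M (Suc n)\<^esub> \<oplus>\<^bsub>piece M (Suc n)\<^esub> \<zero>\<^bsub>piece M (Suc n)\<^esub>) = \<zero>\<^bsub>piece N n\<^esub>"
      unfolding ua[OF z z] using uc[OF z] unstable_vs[OF N] by simp
    then show ?thesis using True z unstable_vs[OF M] by simp
  next
    case False
    then obtain h z where z: "z \<in> carrier (piece M h)" "Suc n = h + h" "y = Sq M h h z"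
      using y unfolding frobenius_image_def by blast
    then obtain h' where h: "h = Suc h'" by (cases h) auto
    with z have n: "n = h' + h" by simp
    have zz: "z \<in> carrier (piece M (Suc h'))" using z h by simp
    have "u n y = Sq N h h' (u h' z)" using us[OF zz, of h] z n h by simp
    also have "\<dots> = \<zero>\<^bsub>piece N n\<^esub>" unfolding n using unstable_Sq_big[OF N uc[OF zz], of h] h by simp
    finally show ?thesis .
  qed
  have ur: "u n (omega_rep M (Suc n) x) = u n x" if x: "x \<in> carrier (piece M (Suc n))" for n x
  proof -
    have "u n x \<oplus>\<^bsub>piece N n\<^esub> u n (omega_rep M (Suc n) x) = \<zero>\<^bsub>piece N n\<^esub>"
      using kill[OF conjunct2[OF omega_rep[OF x]]] ua[OF x conjunct1[OF omega_rep[OF x]]] by simp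
    then show ?thesis
      using F2_add_eq_zero[OF unstable_vs[OF N] uc[OF x] uc[OF conjunct1[OF omega_rep[OF x]]]] by simp
  qed
  show ?thesis
  proof (rule that)
    show "(\<lambda>n. restrict (u n) (carrier (piece (omega M) n))) \<in> sq_hom (omega M) N"
    proof (rule sq_hom_restrictI)
      fix n x assume x: "x \<in> carrier (piece (omega M) n)"
      then have x': "x \<in> carrier (piece M (Suc n))" using omega_sub by blast
      show "u n x \<in> carrier (piece N n)" by (rule uc[OF x'])
      show "Sq (omega M) i n x \<in> carrier (piece (omega M) (n + i))" for i
        by (rule unstable_Sq_closed[OF omega_unstable x refl])
      have s: "Sq M i (Suc n) x \<in> carrier (piece M (Suc (n + i)))" for i
        using unstable_Sq_closed[OF M x' refl] by simp
      show "u (n + i) (Sq (omega M) i n x) = Sq N i n (u n x)" for i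
        unfolding omega_Sq ur[OF s] by (rule us[OF x'])
      fix y assume y: "y \<in> carrier (piece (omega M) n)"
      then have y': "y \<in> carrier (piece M (Suc n))" using omega_sub by blast
      show "u n (x \<oplus>\<^bsub>piece (omega M) n\<^esub> y) = u n x \<oplus>\<^bsub>piece N n\<^esub> u n y"
        unfolding omega_add ur[OF F2_add[OF unstable_vs[OF M] x' y']] by (rule ua[OF x' y'])
    qed (simp_all add: omega_unstable N)
    fix n x assume "x \<in> carrier (piece M (Suc n))"
    then show "restrict (u n) (carrier (piece (omega M) n)) (omega_rep M (Suc n) x) = u n x"
      by (simp add: omega_rep_in ur)
  qed
qed

end

definition omega_map :: "'a sq_module \<Rightarrow> 'b sq_module \<Rightarrow> (nat \<Rightarrow> 'a \<Rightarrow> 'b) \<Rightarrow> nat \<Rightarrow> 'a \<Rightarrow> 'b" where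
  "omega_map M N f = (SOME v. v \<in> sq_hom (omega M) (omega N) \<and>
     (\<forall>n. \<forall>x\<in>carrier (piece M (Suc n)). v n (omega_rep M (Suc n) x) = omega_rep N (Suc n) (f (Suc n) x)))"

lemma
  assumes M: "unstable_module M" and N: "unstable_module N" and f: "f \<in> sq_hom M N"
  shows omega_map_hom: "omega_map M N f \<in> sq_hom (omega M) (omega N)"
    and omega_map_rep: "x \<in> carrier (piece M (Suc n)) \<Longrightarrow>
      omega_map M N f n (omega_rep M (Suc n) x) = omega_rep N (Suc n) (f (Suc n) x)"
proof -
  have "\<exists>v. v \<in> sq_hom (omega M) (omega N) \<and>
     (\<forall>n. \<forall>x\<in>carrier (piece M (Suc n)). v n (omega_rep M (Suc n) x) = omega_rep N (Suc n) (f (Suc n) x))"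
  proof (rule omega_factor[OF M omega_unstable[OF N], of "\<lambda>n x. omega_rep N (Suc n) (f (Suc n) x)"])
    fix n x assume x: "x \<in> carrier (piece M (Suc n))"
    note fx = sq_hom_closed[OF f x]
    show "omega_rep N (Suc n) (f (Suc n) x) \<in> carrier (piece (omega N) n)" by (rule omega_rep_in[OF N fx])
    show "omega_rep N (Suc (n + i)) (f (Suc (n + i)) (Sq M i (Suc n) x)) = Sq (omega N) i n (omega_rep N (Suc n) (f (Suc n) x))" for i
      using omega_rep_Sq[OF N fx, of i] sq_hom_Sq[OF f x, of "Suc (n + i)" i] by simp
    fix y assume y: "y \<in> carrier (piece M (Suc n))"
    show "omega_rep N (Suc n) (f (Suc n) (x \<oplus>\<^bsub>piece M (Suc n)\<^esub> y)) =
        omega_rep N (Suc n) (f (Suc n) x) \<oplus>\<^bsub>piece (omega N) n\<^esub> omega_rep N (Suc n) (f (Suc n) y)"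
      using omega_rep_add[OF N fx sq_hom_closed[OF f y]] sq_hom_add[OF f x y] by simp
  qed blast
  from someI_ex[OF this] show "omega_map M N f \<in> sq_hom (omega M) (omega N)" "x \<in> carrier (piece M (Suc n)) \<Longrightarrow>
      omega_map M N f n (omega_rep M (Suc n) x) = omega_rep N (Suc n) (f (Suc n) x)"
    unfolding omega_map_def by blast+
qed

lemma
  shows suspension_1_0: "piece (suspension (Suc 0) E) 0 = vs_zero (piece E 0)"
    and suspension_1_Suc: "piece (suspension (Suc 0) E) (Suc n) = piece E n"
    and suspension_1_Sq: "Sq (suspension (Suc 0) E) k (Suc n) x = Sq E k n x"
    and suspension_1_Sq_0: "Sq (suspension (Suc 0) E) k 0 x = \<zero>\<^bsub>piece (suspension (Suc 0) E) k\<^esub>"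
  by (auto simp: suspension_def vs_zero_def)

lemma vs_zero_simps [simp]:
  "carrier (vs_zero V) = {\<zero>\<^bsub>V\<^esub>}" "\<zero>\<^bsub>vs_zero V\<^esub> = \<zero>\<^bsub>V\<^esub>" "x \<oplus>\<^bsub>vs_zero V\<^esub> y = x \<oplus>\<^bsub>V\<^esub> y" "b \<odot>\<^bsub>vs_zero V\<^esub> x = b \<odot>\<^bsub>V\<^esub> x"
  by (simp_all add: vs_zero_def)

lemma suspension_1_unstable:
  assumes E: "unstable_module E"
  shows "unstable_module (suspension (Suc 0) E)"
proof -
  note EV = unstable_vs[OF E]
  have V: "module F2 (piece (suspension (Suc 0) E) n)" for n
  proof (cases n)
    case 0
    show ?thesis unfolding 0 suspension_1_0
      by (rule module_F2I) (auto simp: EV F2_smult[OF EV])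
  qed (simp only: suspension_1_Suc EV)
  have z0: "x = \<zero>\<^bsub>piece (suspension (Suc 0) E) 0\<^esub>" if "x \<in> carrier (piece (suspension (Suc 0) E) 0)" for x
    using that by (simp add: suspension_1_0)
  have Sq_zero: "Sq (suspension (Suc 0) E) k n \<zero>\<^bsub>piece (suspension (Suc 0) E) n\<^esub> = \<zero>\<^bsub>piece (suspension (Suc 0) E) (n + k)\<^esub>" for k n
  proof (cases n)
    case (Suc n')
    then show ?thesis using unstable_Sq_zero[OF E refl, of k n']
      by (simp only: suspension_1_Sq suspension_1_Suc add_Suc)
  qed (simp add: suspension_1_Sq_0)
  show ?thesis
  proof (rule unstable_moduleI)
    fix n k :: nat
    show "module F2 (piece (suspension (Suc 0) E) n)" by (rule V)
    show "vs_linear (piece (suspension (Suc 0) E) n) (piece (suspension (Suc 0) E) (n + k)) (Sq (suspension (Suc 0) E) k n)"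
    proof (cases n)
      case 0
      show ?thesis unfolding vs_linear_iff[OF V V] 0 suspension_1_Sq_0 using V[of k] by simp
    next
      case (Suc n')
      then show ?thesis using steenrod_linear[OF unstable_steenrod[OF E], of n' k]
        by (simp add: suspension_1_Suc suspension_1_Sq[abs_def])
    qed
    fix x assume x: "x \<in> carrier (piece (suspension (Suc 0) E) n)"
    show "Sq (suspension (Suc 0) E) 0 n x = x"
    proof (cases n)
      case 0
      then show ?thesis using x z0 by (simp add: suspension_1_Sq_0)
    next
      case (Suc n')
      then show ?thesis using x unstable_Sq0[OF E] by (simp add: suspension_1_Suc suspension_1_Sq)
    qed
    show "Sq (suspension (Suc 0) E) k n x = \<zero>\<^bsub>piece (suspension (Suc 0) E) (n + k)\<^esub>" if "n < k"
    proof (cases n)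
      case 0
      then show ?thesis by (simp add: suspension_1_Sq_0)
    next
      case (Suc n')
      then show ?thesis using x that unstable_Sq_big[OF E, of x n' k] by (simp add: suspension_1_Suc suspension_1_Sq)
    qed
    fix i j :: nat assume ij: "0 < i" "i < 2 * j"
    show "Sq (suspension (Suc 0) E) i (n + j) (Sq (suspension (Suc 0) E) j n x) = adem_rhs (suspension (Suc 0) E) i j n x"
    proof (cases n)
      case 0
      have "adem_rhs (suspension (Suc 0) E) i j n x = \<zero>\<^bsub>piece (suspension (Suc 0) E) (n + i + j)\<^esub>"
      proof (rule adem_rhs_zero[OF V])
        fix k assume "k \<le> i div 2"
        then have "n + k + (i + j - k) = n + i + j" using ij by simp
        then show "Sq (suspension (Suc 0) E) (i + j - k) (n + k) (Sq (suspension (Suc 0) E) k n x) = \<zero>\<^bsub>piece (suspension (Suc 0) E) (n + i + j)\<^esub>"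
          using Sq_zero[of "i + j - k" "n + k"] 0 by (simp add: suspension_1_Sq_0)
      qed
      then show ?thesis using Sq_zero[of i j] 0 by (simp add: suspension_1_Sq_0 add.commute)
    next
      case (Suc n')
      have "adem_rhs (suspension (Suc 0) E) i j n x = adem_rhs E i j n' x"
        unfolding adem_rhs_def Suc by (simp only: add_Suc suspension_1_Suc suspension_1_Sq)
      then show ?thesis using steenrod_adem[OF unstable_steenrod[OF E] ij, of x n'] x
        by (simp only: Suc add_Suc suspension_1_Suc suspension_1_Sq)
    qed
  qed
qed

text \<open>Omega is left adjoint to the suspension, and the suspension preserves
  surjections.\<close>

lemma omega_projective:
  fixes P :: "(nat \<times> bit) sq_module"
  assumes P: "projective P"
  shows "projective (omega P)"
  unfolding projective_def
proof (intro conjI allI impI)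
  have PU: "unstable_module P" using P by (rule projective_unstable)
  show "unstable_module (omega P)" by (rule omega_unstable[OF PU])
  fix E B :: "(nat \<times> bit) sq_module" and q f
  assume E: "unstable_module E" and B: "unstable_module B" and q: "sq_surj E B q" and f: "f \<in> sq_hom (omega P) B"
  have qh: "q \<in> sq_hom E B" and qs: "\<And>n. q n ` carrier (piece E n) = carrier (piece B n)"
    using q by (auto simp: sq_surj_def)
  note SE = suspension_1_unstable[OF E] and SB = suspension_1_unstable[OF B]
  \<comment> \<open>In degree 0 a suspension is the zero space, so \<open>q'\<close> and
    \<open>f'\<close> take the value zero there.\<close>
  define q' where "q' n = restrict (case n of 0 \<Rightarrow> (\<lambda>_. \<zero>\<^bsub>piece B 0\<^esub>) | Suc n \<Rightarrow> q n) (carrier (piece (suspension (Suc 0) E) n))" for n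
  define f' where "f' n = restrict (case n of 0 \<Rightarrow> (\<lambda>_. \<zero>\<^bsub>piece B 0\<^esub>) | Suc n \<Rightarrow> (\<lambda>x. f n (omega_rep P (Suc n) x))) (carrier (piece P n))" for n
  have q'h: "q' \<in> sq_hom (suspension (Suc 0) E) (suspension (Suc 0) B)"
    unfolding q'_def[abs_def]
  proof (rule sq_hom_restrictI)
    fix n i x assume x: "x \<in> carrier (piece (suspension (Suc 0) E) n)"
    show "Sq (suspension (Suc 0) E) i n x \<in> carrier (piece (suspension (Suc 0) E) (n + i))"
      by (rule unstable_Sq_closed[OF SE x refl])
    show "(case n of 0 \<Rightarrow> (\<lambda>_. \<zero>\<^bsub>piece B 0\<^esub>) | Suc n \<Rightarrow> q n) x \<in> carrier (piece (suspension (Suc 0) B) n)"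
      using x by (cases n) (simp_all add: suspension_1_0 suspension_1_Suc sq_hom_closed[OF qh])
    show "(case n + i of 0 \<Rightarrow> (\<lambda>_. \<zero>\<^bsub>piece B 0\<^esub>) | Suc n \<Rightarrow> q n) (Sq (suspension (Suc 0) E) i n x) =
        Sq (suspension (Suc 0) B) i n ((case n of 0 \<Rightarrow> (\<lambda>_. \<zero>\<^bsub>piece B 0\<^esub>) | Suc n \<Rightarrow> q n) x)"
      using x by (cases n; cases i)
        (simp_all add: suspension_1_0 suspension_1_Suc suspension_1_Sq suspension_1_Sq_0 sq_hom_Sq[OF qh]
          sq_hom_zero[OF qh unstable_vs[OF E] unstable_vs[OF B]])
    fix y assume y: "y \<in> carrier (piece (suspension (Suc 0) E) n)"
    show "(case n of 0 \<Rightarrow> (\<lambda>_. \<zero>\<^bsub>piece B 0\<^esub>) | Suc n \<Rightarrow> q n) (x \<oplus>\<^bsub>piece (suspension (Suc 0) E) n\<^esub> y) =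
        (case n of 0 \<Rightarrow> (\<lambda>_. \<zero>\<^bsub>piece B 0\<^esub>) | Suc n \<Rightarrow> q n) x \<oplus>\<^bsub>piece (suspension (Suc 0) B) n\<^esub>
        (case n of 0 \<Rightarrow> (\<lambda>_. \<zero>\<^bsub>piece B 0\<^esub>) | Suc n \<Rightarrow> q n) y"
      using x y unstable_vs[OF B] by (cases n) (simp_all add: suspension_1_0 suspension_1_Suc sq_hom_add[OF qh])
  qed (simp_all add: SE SB)
  have f'h: "f' \<in> sq_hom P (suspension (Suc 0) B)"
    unfolding f'_def[abs_def]
  proof (rule sq_hom_restrictI)
    let ?f = "\<lambda>n. case n of 0 \<Rightarrow> (\<lambda>_. \<zero>\<^bsub>piece B 0\<^esub>) | Suc n \<Rightarrow> (\<lambda>x. f n (omega_rep P (Suc n) x))"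
    fix n i x assume x: "x \<in> carrier (piece P n)"
    show "Sq P i n x \<in> carrier (piece P (n + i))"
      by (rule unstable_Sq_closed[OF PU x refl])
    show "?f n x \<in> carrier (piece (suspension (Suc 0) B) n)"
      using x by (cases n) (simp_all add: suspension_1_0 suspension_1_Suc sq_hom_closed[OF f] omega_rep_in[OF PU])
    show "?f (n + i) (Sq P i n x) = Sq (suspension (Suc 0) B) i n (?f n x)"
    proof (cases n)
      case 0
      show ?thesis
      proof (cases i)
        case (Suc i')
        then have "Sq P i n x = \<zero>\<^bsub>piece P (Suc i')\<^esub>" using unstable_Sq_big[OF PU x, of i] 0 by simp
        then show ?thesis using 0 Suc sq_hom_zero[OF f unstable_vs[OF omega_unstable[OF PU]] unstable_vs[OF B]]
          by (simp add: suspension_1_Sq_0 suspension_1_Suc omega_zero[OF PU, symmetric])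
      qed (use 0 in \<open>simp add: suspension_1_Sq_0 suspension_1_0\<close>)
    next
      case (Suc n')
      then show ?thesis
        using x omega_rep_Sq[OF PU, of x n' i] sq_hom_Sq[OF f omega_rep_in[OF PU], of x n' "n' + i" i]
        by (simp add: suspension_1_Sq)
    qed
    fix y assume y: "y \<in> carrier (piece P n)"
    show "?f n (x \<oplus>\<^bsub>piece P n\<^esub> y) = ?f n x \<oplus>\<^bsub>piece (suspension (Suc 0) B) n\<^esub> ?f n y"
      using x y unstable_vs[OF B]
      by (cases n) (simp_all add: suspension_1_0 suspension_1_Suc omega_rep_add[OF PU] sq_hom_add[OF f] omega_rep_in[OF PU])
  qed (simp_all add: PU SB)
  have "sq_surj (suspension (Suc 0) E) (suspension (Suc 0) B) q'"
    unfolding sq_surj_def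
  proof (intro conjI allI q'h)
    fix n
    show "q' n ` carrier (piece (suspension (Suc 0) E) n) = carrier (piece (suspension (Suc 0) B) n)"
      using qs by (cases n) (simp_all add: q'_def suspension_1_0 suspension_1_Suc)
  qed
  then obtain g where g: "g \<in> sq_hom P (suspension (Suc 0) E)" "\<And>n x. x \<in> carrier (piece P n) \<Longrightarrow> q' n (g n x) = f' n x"
    using projective_lift[OF P SE SB countableI_type _ f'h] by metis
  obtain v where v: "v \<in> sq_hom (omega P) E"
    "\<And>n x. x \<in> carrier (piece P (Suc n)) \<Longrightarrow> v n (omega_rep P (Suc n) x) = g (Suc n) x"
  proof (rule omega_factor[OF PU E, of "\<lambda>n. g (Suc n)"])
    fix n i x assume x: "x \<in> carrier (piece P (Suc n))"
    show "g (Suc n) x \<in> carrier (piece E n)"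
      using sq_hom_closed[OF g(1) x] by (simp only: suspension_1_Suc)
    show "g (Suc (n + i)) (Sq P i (Suc n) x) = Sq E i n (g (Suc n) x)"
      using sq_hom_Sq[OF g(1) x, of "Suc (n + i)" i] by (simp add: suspension_1_Sq)
    fix y assume y: "y \<in> carrier (piece P (Suc n))"
    show "g (Suc n) (x \<oplus>\<^bsub>piece P (Suc n)\<^esub> y) = g (Suc n) x \<oplus>\<^bsub>piece E n\<^esub> g (Suc n) y"
      using sq_hom_add[OF g(1) x y] by (simp only: suspension_1_Suc)
  qed blast
  have "sq_comp (omega P) q v = f"
    unfolding sq_comp_eq_iff[OF f]
  proof (intro allI ballI)
    fix n x assume x: "x \<in> carrier (piece (omega P) n)"
    then have x': "x \<in> carrier (piece P (Suc n))" "omega_rep P (Suc n) x = x" using omega_sub[OF PU] by auto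
    have "g (Suc n) x \<in> carrier (piece (suspension (Suc 0) E) (Suc n))" by (rule sq_hom_closed[OF g(1) x'(1)])
    then have "q' (Suc n) (g (Suc n) x) = q n (g (Suc n) x)" by (simp add: q'_def)
    moreover have "f' (Suc n) x = f n x" using x' by (simp add: f'_def)
    ultimately show "q n (v n x) = f n x" using g(2)[OF x'(1)] v(2)[OF x'(1)] x'(2) by simp
  qed
  then show "\<exists>g\<in>sq_hom (omega P) E. sq_comp (omega P) q g = f" using v(1) by blast
qed

subsection \<open>Detection of relations in polynomial rings\<close>

text \<open>The product of \<open>m\<close> distinct variables: the exponent of each is 2^0.\<close>

definition fundamental :: "nat \<Rightarrow> nat list \<Rightarrow> bit" where
  "fundamental m b = (if b = replicate m 0 then 1 else 0)"

lemma mdeg_replicate_0 [simp]: "mdeg (replicate m 0) = m"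
  by (induction m) auto

lemma fundamental_in: "fundamental m \<in> carrier (piece (tensor_module m) m)"
  by (simp add: fundamental_def)

lemma fundamental_Cons: "fundamental (Suc m) (k # b) = (if k = 0 then fundamental m b else 0)"
  by (simp add: fundamental_def)

lemma free_hom_countable:
  fixes E :: "'e sq_module"
  assumes E: "unstable_module E" and cnt: "\<And>n. countable (carrier (piece E n))"
    and \<phi>: "\<And>g. \<phi> g \<in> carrier (piece E (\<gamma> g))"
  shows "\<exists>h\<in>sq_hom (free_module \<gamma>) E. \<forall>g. h (\<gamma> g) (free_gen \<gamma> g) = \<phi> g"
proof -
  obtain N :: "(nat \<times> bit) sq_module" and a b where N: "unstable_module N" "a \<in> sq_hom E N" "b \<in> sq_hom N E"
    "\<And>n x. x \<in> carrier (piece E n) \<Longrightarrow> b n (a n x) = x"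
    using unstable_transport[OF E cnt, where ?'b = bit] by metis
  have a\<phi>: "a (\<gamma> g) (\<phi> g) \<in> carrier (piece N (\<gamma> g))" for g by (rule sq_hom_closed[OF N(2) \<phi>])
  obtain h where h: "h \<in> sq_hom (free_module \<gamma>) N" "\<And>g. h (\<gamma> g) (free_gen \<gamma> g) = a (\<gamma> g) (\<phi> g)"
    by (rule free_hom[where \<gamma> = \<gamma> and \<phi> = "\<lambda>g. a (\<gamma> g) (\<phi> g)", OF N(1) a\<phi>]) metis
  show ?thesis
  proof (intro bexI allI)
    show "sq_comp (free_module \<gamma>) b h \<in> sq_hom (free_module \<gamma>) E"
      by (rule sq_comp_unstable[OF h(1) N(3) free_unstable E])
    show "sq_comp (free_module \<gamma>) b h (\<gamma> g) (free_gen \<gamma> g) = \<phi> g" for g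
      by (simp add: free_gen_in h(2) N(4)[OF \<phi>])
  qed
qed

lemma act_degree_0:
  assumes M: "unstable_module M" and x: "x \<in> carrier (piece M 0)"
  shows "act M 0 w x = (if sum_list w = 0 then x else \<zero>\<^bsub>piece M (sum_list w)\<^esub>)"
proof (induction w)
  case (Cons i w)
  show ?case
  proof (cases "sum_list w = 0")
    case True
    then show ?thesis using Cons unstable_Sq0[OF M x] unstable_Sq_big[OF M x, of i]
      by (cases "i = 0") (simp_all add: True del: sum_list_eq_0_iff)
  next
    case False
    then show ?thesis using Cons unstable_Sq_zero[OF M refl, of i "sum_list w"]
      by (simp add: add.commute del: sum_list_eq_0_iff)
  qed
qed simp

lemma evaluate_degree_0:
  fixes L :: "(nat list \<times> unit) list"
  assumes M: "unstable_module M" and x: "x \<in> carrier (piece M 0)" and L: "L \<in> terms (\<lambda>_. 0) d"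
  shows "evaluate M (\<lambda>_. 0) (\<lambda>_. x) d L = (if d = 0 \<and> odd (length L) then x else \<zero>\<^bsub>piece M d\<^esub>)"
  using L
proof (induction L)
  case (Cons wg L)
  obtain w g where wg: "wg = (w, g)" by (cases wg)
  with Cons.prems have w: "sum_list w = d" and L: "L \<in> terms (\<lambda>_. 0) d" by (auto simp: terms_def)
  have "evaluate M (\<lambda>_. 0) (\<lambda>_. x) d (wg # L) = act M 0 w x \<oplus>\<^bsub>piece M d\<^esub> evaluate M (\<lambda>_. 0) (\<lambda>_. x) d L"
    by (simp add: evaluate_def wg)
  then show ?case using Cons.IH[OF L] act_degree_0[OF M x, of w] w x unstable_vs[OF M] by simp
qed simp

lemma vsum_tensor: "vsum (piece (tensor_module m) d) fs b = (\<Sum>f\<leftarrow>fs. f b)"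
  by (induction fs) auto

text \<open>An entry 0 never results from raising another one, so on the part where the first
  variable has exponent one the squares act as on the remaining variables. On the tensor side this
  is the passage from \<open>Suc m\<close> to \<open>m\<close>.\<close>

lemma act_tensor_Cons:
  "act (tensor_module (Suc m)) (Suc m) w (fundamental (Suc m)) (0 # b) = act (tensor_module m) m w (fundamental m) b"
  by (induction w arbitrary: b) (simp_all add: fundamental_Cons)

text \<open>The degrees \<open>d\<close> and \<open>d'\<close> may be unrelated because zero, sums
  and squares of \<open>tensor_module\<close> do not depend on their degree argument.\<close>

lemma evaluate_tensor_Cons:
  fixes L :: "(nat list \<times> unit) list"
  shows "evaluate (tensor_module (Suc m)) (\<lambda>_. Suc m) (\<lambda>_. fundamental (Suc m)) d' L (0 # b) =
    evaluate (tensor_module m) (\<lambda>_. m) (\<lambda>_. fundamental m) d L b"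
  by (simp add: evaluate_def vsum_tensor comp_def case_prod_beta act_tensor_Cons)

lemma evaluate_omega:
  fixes L :: "(nat list \<times> unit) list"
  assumes M: "unstable_module M" and x: "x \<in> carrier (piece M (Suc m))" and L: "L \<in> terms (\<lambda>_. Suc m) (Suc d)"
  shows "evaluate (omega M) (\<lambda>_. m) (\<lambda>_. omega_rep M (Suc m) x) d L =
    omega_rep M (Suc d) (evaluate M (\<lambda>_. Suc m) (\<lambda>_. x) (Suc d) L)"
proof -
  have act: "act (omega M) m w (omega_rep M (Suc m) x) = omega_rep M (Suc (m + sum_list w)) (act M (Suc m) w x)" for w
  proof (induction w)
    case (Cons i w)
    have "act M (Suc m) w x \<in> carrier (piece M (Suc (m + sum_list w)))"
      using act_closed[OF M x refl, of w] by simp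
    from omega_rep_Sq[OF M this, of i] Cons show ?case by (simp add: ac_simps)
  qed simp
  have "omega_rep M (Suc d) (evaluate M (\<lambda>_. Suc m) (\<lambda>_. x) (Suc d) L) =
      vsum (piece (omega M) d) (map (omega_rep M (Suc d)) (map (\<lambda>(w, g). act M (Suc m) w x) L))"
    unfolding evaluate_def
  proof (rule vsum_linear[OF unstable_vs[OF M]])
    show "set (map (\<lambda>(w, g). act M (Suc m) w x) L) \<subseteq> carrier (piece M (Suc d))"
      by (rule evaluate_set[OF M x L])
  qed (simp_all add: omega_zero[OF M] omega_rep_add[OF M])
  also have "map (omega_rep M (Suc d)) (map (\<lambda>(w, g). act M (Suc m) w x) L) =
      map (\<lambda>(w, g). act (omega M) m w (omega_rep M (Suc m) x)) L"
    using L by (auto simp: act terms_def)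
  finally show ?thesis by (simp add: evaluate_def)
qed

text \<open>The free module on a class of degree \<open>m\<close> embeds into the tensor power: modulo the Frobenius this
  is the statement for \<open>m - 1\<close>, and the Frobenius is injective on the tensor power.\<close>

lemma free_tensor_faithful:
  fixes L :: "(nat list \<times> unit) list"
  assumes "L \<in> terms (\<lambda>_. m) d"
    and "evaluate (tensor_module m) (\<lambda>_. m) (\<lambda>_. fundamental m) d L = (\<lambda>_. 0)"
  shows "evaluate (free_module (\<lambda>_::unit. m)) (\<lambda>_. m) (free_gen (\<lambda>_::unit. m)) d L =
    \<zero>\<^bsub>piece (free_module (\<lambda>_::unit. m)) d\<^esub>"
  using assms
proof (induction m arbitrary: d L)
  case 0
  let ?F = "free_module (\<lambda>_::unit. 0)"
  have g: "free_gen (\<lambda>_::unit. 0) () \<in> carrier (piece ?F 0)" by (rule free_gen_in)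
  have e: "evaluate ?F (\<lambda>_. 0) (free_gen (\<lambda>_::unit. 0)) d L = evaluate ?F (\<lambda>_. 0) (\<lambda>_. free_gen (\<lambda>_::unit. 0) ()) d L"
    by (rule arg_cong[of _ _ "\<lambda>f. evaluate ?F (\<lambda>_. 0) f d L"]) auto
  have "fundamental 0 [] \<noteq> 0" by (simp add: fundamental_def)
  moreover have "fundamental 0 = (\<lambda>_. 0)" if "d = 0 \<and> odd (length L)"
    using evaluate_degree_0[OF tensor_unstable fundamental_in 0(1)] 0(2) that by simp
  ultimately have "\<not> (d = 0 \<and> odd (length L))" by metis
  then show ?case
    unfolding e by (subst evaluate_degree_0[OF free_unstable g 0(1)]) auto
next
  case (Suc m)
  \<comment> \<open>Two nested inductions: on \<open>m\<close>, to pass to \<open>omega\<close>, and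
    on the degree \<open>d\<close>, to descend along the Frobenius.\<close>
  note IHm = Suc.IH
  show ?case using Suc.prems
  proof (induction d arbitrary: L rule: less_induct)
    case (less d)
    let ?\<gamma> = "\<lambda>_::unit. Suc m"
    let ?F = "free_module ?\<gamma>"
    let ?x = "free_gen ?\<gamma> ()"
    have gx: "free_gen ?\<gamma> = (\<lambda>_. ?x)" by (rule ext) simp
    note F = free_unstable[of ?\<gamma>] and xF = free_gen_in[of ?\<gamma> "()"]
    show ?case
    proof (cases "L = []")
      case False
      then obtain d' where d: "d = Suc d'" and L': "L \<in> terms (\<lambda>_. m) d'"
        using less.prems(1) by (cases d) (auto simp: terms_def neq_Nil_conv)
      let ?y = "evaluate ?F ?\<gamma> (free_gen ?\<gamma>) d L"
      have yF: "?y \<in> carrier (piece ?F d)" by (rule free_evaluate_closed[OF less.prems(1)])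
      \<comment> \<open>The coefficients at the monomials \<open>0 # b\<close> give the same
        vanishing with one variable less.\<close>
      have "evaluate (tensor_module m) (\<lambda>_. m) (\<lambda>_. fundamental m) d' L = (\<lambda>_. 0)"
      proof
        fix b
        show "evaluate (tensor_module m) (\<lambda>_. m) (\<lambda>_. fundamental m) d' L b = 0"
          using evaluate_tensor_Cons[of m d L b d'] less.prems(2) by simp
      qed
      from IHm[OF L' this]
      have z: "evaluate (free_module (\<lambda>_::unit. m)) (\<lambda>_. m) (free_gen (\<lambda>_::unit. m)) d' L =
         \<zero>\<^bsub>piece (free_module (\<lambda>_::unit. m)) d'\<^esub>" .
      \<comment> \<open>\<open>v\<close> carries the relation, valid on the free generator of degree
        \<open>m\<close>, to the class of \<open>?x\<close> in \<open>omega ?F\<close>. Hence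
        \<open>?y\<close> lies in the image of the Frobenius.\<close>
      obtain v where v: "v \<in> sq_hom (free_module (\<lambda>_::unit. m)) (omega ?F)"
        "v m (free_gen (\<lambda>_::unit. m) ()) = omega_rep ?F (Suc m) ?x"
        using free_hom_countable[OF omega_unstable[OF F] countableI_type, of "\<lambda>_. omega_rep ?F (Suc m) ?x" "\<lambda>_::unit. m"]
          omega_rep_in[OF F xF] by auto
      have "(\<lambda>_. omega_rep ?F (Suc m) ?x) = (\<lambda>g. v m (free_gen (\<lambda>_::unit. m) g))"
        using v(2) by auto
      then have "evaluate (omega ?F) (\<lambda>_. m) (\<lambda>_. omega_rep ?F (Suc m) ?x) d' L =
          evaluate (omega ?F) (\<lambda>_. m) (\<lambda>g. v m (free_gen (\<lambda>_::unit. m) g)) d' L" by (rule arg_cong)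
      also have "\<dots> = v d' (evaluate (free_module (\<lambda>_::unit. m)) (\<lambda>_. m) (free_gen (\<lambda>_::unit. m)) d' L)"
        by (rule free_evaluate_hom[OF L' v(1) unstable_vs[OF omega_unstable[OF F]], symmetric])
      also have "\<dots> = \<zero>\<^bsub>piece (omega ?F) d'\<^esub>"
        unfolding z by (rule sq_hom_zero[OF v(1) unstable_vs[OF free_unstable] unstable_vs[OF omega_unstable[OF F]]])
      finally have oz: "evaluate (omega ?F) (\<lambda>_. m) (\<lambda>_. omega_rep ?F (Suc m) ?x) d' L = \<zero>\<^bsub>piece (omega ?F) d'\<^esub>" .
      have Ls: "L \<in> terms (\<lambda>_. Suc m) (Suc d')" using less.prems(1) unfolding d .
      have "omega_rep ?F (Suc d') ?y = \<zero>\<^bsub>piece (omega ?F) d'\<^esub>"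
      proof -
        have "?y = evaluate ?F ?\<gamma> (\<lambda>_. ?x) (Suc d') L"
          unfolding d by (rule arg_cong[OF gx, of "\<lambda>f. evaluate ?F ?\<gamma> f (Suc d') L"])
        then show ?thesis using evaluate_omega[OF F xF Ls] oz by simp
      qed
      then have "?y \<in> frobenius_image ?F d"
        using omega_rep_zero_iff[OF F, of ?y d'] yF unfolding d by blast
      then consider "?y = \<zero>\<^bsub>piece ?F d\<^esub>" | h z where "z \<in> carrier (piece ?F h)" "d = h + h" "?y = Sq ?F h h z"
        unfolding frobenius_image_def by blast
      then show ?thesis
      proof cases
        case (2 h z)
        let ?T = "tensor_module (Suc m)"
        obtain f where f: "f \<in> sq_hom ?F ?T" "f (Suc m) ?x = fundamental (Suc m)"
          using free_hom_countable[OF tensor_unstable tensor_countable, where \<phi> = "\<lambda>_. fundamental (Suc m)" and \<gamma> = ?\<gamma>, OF fundamental_in] by auto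
        have fe: "f e (evaluate ?F ?\<gamma> (free_gen ?\<gamma>) e K) = evaluate ?T ?\<gamma> (\<lambda>_. fundamental (Suc m)) e K"
          if "K \<in> terms ?\<gamma> e" for K e
          using free_evaluate_hom[OF that f(1) unstable_vs[OF tensor_unstable]] f(2) by simp
        \<comment> \<open>The image of \<open>z\<close> in the tensor power has zero Frobenius, so
          it is zero. As \<open>z\<close> has degree h < d, the inner induction gives z = 0 and with
          it the claim.\<close>
        have "Sq ?T h h (f h z) = f d ?y"
          using sq_hom_Sq[OF f(1) 2(1) refl, of h] 2(2,3) by simp
        also have "\<dots> = (\<lambda>_. 0)" using fe[OF less.prems(1)] less.prems(2) by simp
        finally have "f h z = (\<lambda>_. 0)" by (rule tensor_reduced[OF sq_hom_closed[OF f(1) 2(1)]])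
        moreover have "f h z = evaluate ?T ?\<gamma> (\<lambda>_. fundamental (Suc m)) h (free_rep z)"
          using fe[OF free_rep_in[OF 2(1)]] free_element[OF 2(1)] by simp
        moreover have "h < d" using d 2(2) by simp
        ultimately have "z = \<zero>\<^bsub>piece ?F h\<^esub>"
          using less.IH[OF _ free_rep_in[OF 2(1)]] free_element[OF 2(1)] by simp
        then show ?thesis using 2(2,3) unstable_Sq_zero[OF F refl, of h h] by simp
      qed
    qed simp
  qed
qed

text \<open>\<open>x\<close> is the image of the generator of a free module, and there the relation
  already holds.\<close>

lemma tensor_detects:
  fixes L :: "(nat list \<times> unit) list" and E :: "'e sq_module"
  assumes L: "L \<in> terms (\<lambda>_. m) d"
    and z: "evaluate (tensor_module m) (\<lambda>_. m) (\<lambda>_. fundamental m) d L = (\<lambda>_. 0)"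
    and E: "unstable_module E" and cnt: "\<And>n. countable (carrier (piece E n))" and x: "x \<in> carrier (piece E m)"
  shows "evaluate E (\<lambda>_. m) (\<lambda>_. x) d L = \<zero>\<^bsub>piece E d\<^esub>"
proof -
  obtain f where f: "f \<in> sq_hom (free_module (\<lambda>_::unit. m)) E" "f m (free_gen (\<lambda>_::unit. m) ()) = x"
    using free_hom_countable[OF E cnt, of "\<lambda>_. x" "\<lambda>_::unit. m"] x by auto
  show ?thesis
    using free_evaluate_hom[OF L f(1) unstable_vs[OF E]] f(2) free_tensor_faithful[OF L z]
      sq_hom_zero[OF f(1) unstable_vs[OF free_unstable] unstable_vs[OF E]] by simp
qed

subsection \<open>Projective modules are reduced\<close>

lemma act_zero: "unstable_module M \<Longrightarrow> act M m w \<zero>\<^bsub>piece M m\<^esub> = \<zero>\<^bsub>piece M (m + sum_list w)\<^esub>"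
proof (induction w)
  case (Cons i w)
  then show ?case using unstable_Sq_zero[OF Cons.prems refl, of i "m + sum_list w"] by (simp add: ac_simps)
qed simp

lemma evaluate_Cons: "evaluate M \<gamma> \<phi> d ((w, g) # L) = act M (\<gamma> g) w (\<phi> g) \<oplus>\<^bsub>piece M d\<^esub> evaluate M \<gamma> \<phi> d L"
  by (simp add: evaluate_def)

lemma terms_Cons: "(w, g) # L \<in> terms \<gamma> d \<longleftrightarrow> \<gamma> g + sum_list w = d \<and> L \<in> terms \<gamma> d"
  by (simp add: terms_def)

lemma terms_filter: "L \<in> terms \<gamma> d \<Longrightarrow> filter P L \<in> terms \<gamma> d"
  by (auto simp: terms_def)

text \<open>Sending the generators outside \<open>Q\<close> to zero is again an admissible choice of
  values; this is how the terms of one generator are isolated below.\<close>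

lemma evaluate_filter:
  assumes M: "unstable_module M" and \<phi>: "\<And>g. \<phi> g \<in> carrier (piece M (\<gamma> g))" and L: "L \<in> terms \<gamma> d"
  shows "evaluate M \<gamma> \<phi> d L = evaluate M \<gamma> \<phi> d (filter (\<lambda>p. Q (snd p)) L) \<oplus>\<^bsub>piece M d\<^esub>
      evaluate M \<gamma> \<phi> d (filter (\<lambda>p. \<not> Q (snd p)) L)"
    and "evaluate M \<gamma> (\<lambda>g. if Q g then \<phi> g else \<zero>\<^bsub>piece M (\<gamma> g)\<^esub>) d L =
      evaluate M \<gamma> \<phi> d (filter (\<lambda>p. Q (snd p)) L)"
proof -
  note V = unstable_vs[OF M, of d]
  have "evaluate M \<gamma> \<phi> d L = evaluate M \<gamma> \<phi> d (filter (\<lambda>p. Q (snd p)) L) \<oplus>\<^bsub>piece M d\<^esub>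
      evaluate M \<gamma> \<phi> d (filter (\<lambda>p. \<not> Q (snd p)) L) \<and>
      evaluate M \<gamma> (\<lambda>g. if Q g then \<phi> g else \<zero>\<^bsub>piece M (\<gamma> g)\<^esub>) d L =
      evaluate M \<gamma> \<phi> d (filter (\<lambda>p. Q (snd p)) L)"
    using L
  proof (induction L)
    case (Cons wg L)
    obtain w g where wg: "wg = (w, g)" by (cases wg)
    with Cons.prems have w: "d = \<gamma> g + sum_list w" and L: "L \<in> terms \<gamma> d" by (auto simp: terms_Cons)
    have a: "act M (\<gamma> g) w (\<phi> g) \<in> carrier (piece M d)" by (rule act_closed[OF M \<phi> w])
    have z: "act M (\<gamma> g) w \<zero>\<^bsub>piece M (\<gamma> g)\<^esub> = \<zero>\<^bsub>piece M d\<^esub>" unfolding w by (rule act_zero[OF M])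
    have c: "evaluate M \<gamma> \<phi> d (filter P L) \<in> carrier (piece M d)" for P
      by (rule evaluate_closed[OF M \<phi> terms_filter[OF L]])
    show ?case
      using Cons.IH[OF L] a c V F2_lcomm[OF V a c c] by (cases "Q g") (simp_all add: wg evaluate_Cons z F2_assoc)
  qed (use V in simp)
  then show "evaluate M \<gamma> \<phi> d L = evaluate M \<gamma> \<phi> d (filter (\<lambda>p. Q (snd p)) L) \<oplus>\<^bsub>piece M d\<^esub>
      evaluate M \<gamma> \<phi> d (filter (\<lambda>p. \<not> Q (snd p)) L)"
    "evaluate M \<gamma> (\<lambda>g. if Q g then \<phi> g else \<zero>\<^bsub>piece M (\<gamma> g)\<^esub>) d L =
      evaluate M \<gamma> \<phi> d (filter (\<lambda>p. Q (snd p)) L)" by auto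
qed

lemma evaluate_single:
  assumes "\<forall>p\<in>set L. snd p = g0"
  shows "evaluate M \<gamma> \<phi> d L = evaluate M (\<lambda>_::unit. \<gamma> g0) (\<lambda>_. \<phi> g0) d (map (\<lambda>p. (fst p, ())) L)"
proof -
  have "map (\<lambda>(w, g). act M (\<gamma> g) w (\<phi> g)) L = map (\<lambda>(w, g). act M (\<gamma> g0) w (\<phi> g0)) (map (\<lambda>p. (fst p, ())) L)"
    using assms by (auto simp: case_prod_beta)
  then show ?thesis by (simp only: evaluate_def)
qed

text \<open>Induction on the length of \<open>L\<close>, removing all terms of one generator at a
  time. The hypothesis is about all modules and values, so it may be used with the fundamental
  class, in a copy of the tensor power, at that generator and zero at the others. There the
  Frobenius is injective, and \<open>tensor_detects\<close> brings the conclusion back to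
  \<open>E\<close>.\<close>

lemma free_reduced_terms:
  fixes L :: "(nat list \<times> 'g) list"
  assumes "L \<in> terms \<gamma> h"
    and "\<And>(E :: (nat \<times> bit) sq_module) \<phi>. unstable_module E \<Longrightarrow> (\<And>g. \<phi> g \<in> carrier (piece E (\<gamma> g))) \<Longrightarrow>
      Sq E h h (evaluate E \<gamma> \<phi> h L) = \<zero>\<^bsub>piece E (h + h)\<^esub>"
    and "unstable_module (E :: (nat \<times> bit) sq_module)" "\<And>g. \<phi> g \<in> carrier (piece E (\<gamma> g))"
  shows "evaluate E \<gamma> \<phi> h L = \<zero>\<^bsub>piece E h\<^esub>"
  using assms
proof (induction "length L" arbitrary: L E \<phi> rule: less_induct)
  case less
  note E = less.prems(3) and \<phi> = less.prems(4) and L = less.prems(1)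
  have part: "Sq N h h (evaluate N \<gamma> \<psi> h (filter (\<lambda>p. Q (snd p)) L)) = \<zero>\<^bsub>piece N (h + h)\<^esub>"
    if N: "unstable_module N" and \<psi>: "\<And>g. \<psi> g \<in> carrier (piece N (\<gamma> g))" for N :: "(nat \<times> bit) sq_module" and \<psi> Q
    unfolding evaluate_filter(2)[where Q = Q and \<gamma> = \<gamma> and \<phi> = \<psi>, OF N \<psi> L, symmetric]
    by (rule less.prems(2)[OF N]) (use \<psi> unstable_vs[OF N] in simp)
  show ?case
  proof (cases L)
    case (Cons wg L0)
    define g0 where "g0 = snd wg"
    define L1 where "L1 = filter (\<lambda>p. snd p = g0) L"
    define L2 where "L2 = filter (\<lambda>p. \<not> snd p = g0) L"
    define K where "K = map (\<lambda>p. (fst p, ())) L1"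
    have "length L2 < length L" unfolding L2_def Cons g0_def by (simp add: less_Suc_eq_le)
    moreover have "L2 \<in> terms \<gamma> h" unfolding L2_def by (rule terms_filter[OF L])
    ultimately have 2: "evaluate E \<gamma> \<phi> h L2 = \<zero>\<^bsub>piece E h\<^esub>"
      using part[where Q = "\<lambda>g. \<not> g = g0"] E \<phi> unfolding L2_def by (intro less.hyps) blast+
    have single: "evaluate N \<gamma> \<psi> h L1 = evaluate N (\<lambda>_. \<gamma> g0) (\<lambda>_. \<psi> g0) h K" for N :: "'x sq_module" and \<psi>
      unfolding K_def by (rule evaluate_single) (simp add: L1_def)
    have K: "K \<in> terms (\<lambda>_. \<gamma> g0) h"
      using L by (auto simp: K_def L1_def terms_def)
    let ?T = "tensor_module (\<gamma> g0)"
    obtain N :: "(nat \<times> bit) sq_module" and a b where N: "unstable_module N" "a \<in> sq_hom ?T N" "b \<in> sq_hom N ?T"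
      "\<And>n x. x \<in> carrier (piece ?T n) \<Longrightarrow> b n (a n x) = x"
      using unstable_transport[OF tensor_unstable tensor_countable, where ?'b = bit] by metis
    define \<psi> where "\<psi> g = (if g = g0 then a (\<gamma> g0) (fundamental (\<gamma> g0)) else \<zero>\<^bsub>piece N (\<gamma> g)\<^esub>)" for g
    have \<psi>: "\<psi> g \<in> carrier (piece N (\<gamma> g))" for g
      using sq_hom_closed[OF N(2) fundamental_in] unstable_vs[OF N(1)] by (simp add: \<psi>_def)
    have L1: "L1 \<in> terms \<gamma> h" unfolding L1_def by (rule terms_filter[OF L])
    let ?e = "evaluate N \<gamma> \<psi> h L1"
    have be: "b h ?e = evaluate ?T (\<lambda>_. \<gamma> g0) (\<lambda>_. fundamental (\<gamma> g0)) h K"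
    proof -
      have "b h ?e = evaluate ?T \<gamma> (\<lambda>g. b (\<gamma> g) (\<psi> g)) h L1"
        by (rule evaluate_hom[OF N(1) \<psi> L1 N(3) tensor_vs])
      also have "\<dots> = evaluate ?T (\<lambda>_. \<gamma> g0) (\<lambda>_. b (\<gamma> g0) (\<psi> g0)) h K"
        unfolding K_def by (rule evaluate_single) (simp add: L1_def)
      finally show ?thesis by (simp add: \<psi>_def N(4)[OF fundamental_in])
    qed
    have "Sq ?T h h (b h ?e) = b (h + h) (Sq N h h ?e)"
      by (rule sq_hom_Sq[OF N(3) evaluate_closed[OF N(1) \<psi> L1] refl, symmetric])
    also have "\<dots> = (\<lambda>_. 0)"
      using part[OF N(1) \<psi>, of "\<lambda>g. g = g0"] sq_hom_zero[OF N(3) unstable_vs[OF N(1)] tensor_vs]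
      unfolding L1_def by simp
    finally have "b h ?e = (\<lambda>_. 0)"
      by (rule tensor_reduced[OF sq_hom_closed[OF N(3) evaluate_closed[OF N(1) \<psi> L1]]])
    then have "evaluate E (\<lambda>_. \<gamma> g0) (\<lambda>_. \<phi> g0) h K = \<zero>\<^bsub>piece E h\<^esub>"
      using tensor_detects[OF K _ E countableI_type \<phi>] be by simp
    then have 1: "evaluate E \<gamma> \<phi> h L1 = \<zero>\<^bsub>piece E h\<^esub>"
      using evaluate_single[of L1 g0 E \<gamma> \<phi> h] by (simp add: L1_def K_def)
    show ?thesis
      using evaluate_filter(1)[where Q = "\<lambda>g. g = g0" and \<gamma> = \<gamma> and \<phi> = \<phi>, OF E \<phi> L] 1 2 unstable_vs[OF E]
      unfolding L1_def L2_def by simp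
  qed simp
qed

lemma free_reduced:
  assumes X: "X \<in> carrier (piece (free_module \<gamma>) h)" and 0: "Sq (free_module \<gamma>) h h X = \<zero>\<^bsub>piece (free_module \<gamma>) (h + h)\<^esub>"
  shows "X = \<zero>\<^bsub>piece (free_module \<gamma>) h\<^esub>"
proof (rule free_separate[OF X])
  show "\<zero>\<^bsub>piece (free_module \<gamma>) h\<^esub> \<in> carrier (piece (free_module \<gamma>) h)"
    by (rule F2_zero[OF unstable_vs[OF free_unstable]])
  fix E :: "(nat \<times> bit) sq_module" and \<phi>
  assume E: "unstable_module E" and \<phi>: "\<And>g. \<phi> g \<in> carrier (piece E (\<gamma> g))"
  have "evaluate E \<gamma> \<phi> h (free_rep X) = \<zero>\<^bsub>piece E h\<^esub>"
  proof (rule free_reduced_terms[OF free_rep_in[OF X] _ E \<phi>])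
    fix N :: "(nat \<times> bit) sq_module" and \<psi>
    assume N: "unstable_module N" and \<psi>: "\<And>g. \<psi> g \<in> carrier (piece N (\<gamma> g))"
    obtain f where f: "f \<in> sq_hom (free_module \<gamma>) N"
      "\<And>d X. X \<in> carrier (piece (free_module \<gamma>) d) \<Longrightarrow> f d X = evaluate N \<gamma> \<psi> d (free_rep X)"
      by (rule free_hom[where \<gamma> = \<gamma> and \<phi> = \<psi>, OF N \<psi>]) metis
    have "Sq N h h (f h X) = f (h + h) (Sq (free_module \<gamma>) h h X)"
      by (rule sq_hom_Sq[OF f(1) X refl, symmetric])
    also have "\<dots> = \<zero>\<^bsub>piece N (h + h)\<^esub>"
      unfolding 0 by (rule sq_hom_zero[OF f(1) unstable_vs[OF free_unstable] unstable_vs[OF N]])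
    finally show "Sq N h h (evaluate N \<gamma> \<psi> h (free_rep X)) = \<zero>\<^bsub>piece N (h + h)\<^esub>"
      using f(2)[OF X] by simp
  qed
  moreover have "evaluate E \<gamma> \<phi> h (free_rep \<zero>\<^bsub>piece (free_module \<gamma>) h\<^esub>) = \<zero>\<^bsub>piece E h\<^esub>"
    unfolding free_zero using evaluate_free_class[where \<gamma> = \<gamma> and \<phi> = \<phi>, OF terms_Nil E \<phi>] by simp
  ultimately show "evaluate E \<gamma> \<phi> h (free_rep X) = evaluate E \<gamma> \<phi> h (free_rep \<zero>\<^bsub>piece (free_module \<gamma>) h\<^esub>)" by simp
qed

text \<open>A projective module is a retract of a free module that covers it, and injectivity of the
  Frobenius passes to submodules.\<close>

lemma projective_reduced:
  fixes P :: "(nat \<times> bit) sq_module"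
  assumes P: "projective P" and x: "x \<in> carrier (piece P h)" and 0: "Sq P h h x = \<zero>\<^bsub>piece P (h + h)\<^esub>"
  shows "x = \<zero>\<^bsub>piece P h\<^esub>"
proof -
  have PU: "unstable_module P" using P by (rule projective_unstable)
  obtain \<gamma> :: "nat \<times> nat \<times> bit \<Rightarrow> nat" and e where e: "sq_surj (free_module \<gamma>) P e"
    using free_cover[OF PU] by metis
  have eh: "e \<in> sq_hom (free_module \<gamma>) P" using e by (simp add: sq_surj_def)
  have id: "(\<lambda>n. restrict (\<lambda>x. x) (carrier (piece P n))) \<in> sq_hom P P"
    by (rule sq_hom_restrictI) (simp_all add: PU unstable_Sq_closed[OF PU _ refl])
  obtain s where s: "s \<in> sq_hom P (free_module \<gamma>)" "\<And>n x. x \<in> carrier (piece P n) \<Longrightarrow> e n (s n x) = x"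
    using projective_lift[OF P free_unstable PU countableI_type e id] by (metis restrict_apply')
  have "Sq (free_module \<gamma>) h h (s h x) = s (h + h) (Sq P h h x)"
    by (rule sq_hom_Sq[OF s(1) x refl, symmetric])
  also have "\<dots> = \<zero>\<^bsub>piece (free_module \<gamma>) (h + h)\<^esub>"
    unfolding 0 by (rule sq_hom_zero[OF s(1) unstable_vs[OF PU] unstable_vs[OF free_unstable]])
  finally have "s h x = \<zero>\<^bsub>piece (free_module \<gamma>) h\<^esub>"
    by (rule free_reduced[OF sq_hom_closed[OF s(1) x]])
  then show ?thesis
    using s(2)[OF x] sq_hom_zero[OF eh unstable_vs[OF free_unstable] unstable_vs[OF PU]] by simp
qed

subsection \<open>The conjugate squares\<close>

text \<open>The terms \<open>\<chi>(Sq\<^sup>n)\<close>, by the recursion \<open>\<Sum>\<^sub>i Sq\<^sup>i \<chi>(Sq\<^sup>n\<^sup>-\<^sup>i) = 0\<close>.\<close>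

fun conj_terms :: "nat \<Rightarrow> (nat list \<times> unit) list" where
  "conj_terms n = (if n = 0 then [([], ())] else concat (map (\<lambda>i. Sq_terms i (conj_terms (n - i))) [1..<Suc n]))"

declare conj_terms.simps [simp del]

definition conj_Sq :: "'a sq_module \<Rightarrow> nat \<Rightarrow> nat \<Rightarrow> 'a \<Rightarrow> 'a" where
  "conj_Sq M n d x = evaluate M (\<lambda>_. d) (\<lambda>_. x) (d + n) (conj_terms n)"

lemma terms_concat: "(\<And>i. i \<in> set is \<Longrightarrow> L i \<in> terms \<gamma> d) \<Longrightarrow> concat (map L is) \<in> terms \<gamma> d"
  by (induction "is") auto

lemma conj_terms_Suc:
  "0 < n \<Longrightarrow> conj_terms n = concat (map (\<lambda>i. Sq_terms i (conj_terms (n - i))) [1..<Suc n])"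
  by (subst conj_terms.simps) (simp del: upt_Suc)

lemma conj_terms_in: "conj_terms n \<in> terms (\<lambda>_. d) (d + n)"
proof (induction n rule: less_induct)
  case (less n)
  show ?case
  proof (cases "n = 0")
    case False
    have "Sq_terms i (conj_terms (n - i)) \<in> terms (\<lambda>_. d) (d + n)" if "i \<in> set [1..<Suc n]" for i
    proof -
      have "n - i < n" "d + (n - i) + i = d + n" using that by auto
      with Sq_terms_in[OF less[of "n - i"], of i] show ?thesis by simp
    qed
    then show ?thesis using False by (simp only: conj_terms_Suc terms_concat neq0_conv)
  qed (simp add: conj_terms.simps terms_def)
qed

lemma evaluate_concat:
  assumes M: "unstable_module M" and \<phi>: "\<And>g. \<phi> g \<in> carrier (piece M (\<gamma> g))" and L: "\<And>i. i \<in> set is \<Longrightarrow> L i \<in> terms \<gamma> d"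
  shows "evaluate M \<gamma> \<phi> d (concat (map L is)) = vsum (piece M d) (map (\<lambda>i. evaluate M \<gamma> \<phi> d (L i)) is)"
  using L
proof (induction "is")
  case (Cons i "is")
  have "concat (map L is) \<in> terms \<gamma> d" using Cons.prems by (intro terms_concat) simp
  then show ?case
    using Cons evaluate_append[where \<phi> = \<phi> and \<gamma> = \<gamma> and d = d and L = "L i" and L' = "concat (map L is)", OF M \<phi>] by simp
qed simp

lemma
  assumes M: "unstable_module M" and x: "x \<in> carrier (piece M d)"
  shows conj_Sq_0: "conj_Sq M 0 d x = x"
    and conj_Sq_closed: "e = d + n \<Longrightarrow> conj_Sq M n d x \<in> carrier (piece M e)"
    and conj_Sq_rec: "0 < n \<Longrightarrow> conj_Sq M n d x = vsum (piece M (d + n))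
        (map (\<lambda>i. Sq M i (d + (n - i)) (conj_Sq M (n - i) d x)) [1..<Suc n])"
    and conj_Sq_hom: "f \<in> sq_hom M N \<Longrightarrow> (\<And>n. module F2 (piece N n)) \<Longrightarrow> e = d + n \<Longrightarrow> f e (conj_Sq M n d x) = conj_Sq N n d (f d x)"
proof -
  show "conj_Sq M 0 d x = x" using x unstable_vs[OF M] by (simp add: conj_Sq_def conj_terms.simps evaluate_def)
  show "e = d + n \<Longrightarrow> conj_Sq M n d x \<in> carrier (piece M e)"
    unfolding conj_Sq_def using evaluate_closed[OF M x conj_terms_in] by blast
  show "e = d + n \<Longrightarrow> f e (conj_Sq M n d x) = conj_Sq N n d (f d x)"
    if "f \<in> sq_hom M N" "\<And>n. module F2 (piece N n)"
    unfolding conj_Sq_def using evaluate_hom[OF M x conj_terms_in that] by blast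
  assume n: "0 < n"
  have t: "Sq_terms i (conj_terms (n - i)) \<in> terms (\<lambda>_. d) (d + n)" if "i \<in> set [1..<Suc n]" for i
  proof -
    have "d + (n - i) + i = d + n" using that by auto
    with Sq_terms_in[OF conj_terms_in[of "n - i" d], of i] show ?thesis by simp
  qed
  have "conj_Sq M n d x = vsum (piece M (d + n)) (map (\<lambda>i. evaluate M (\<lambda>_. d) (\<lambda>_. x) (d + n) (Sq_terms i (conj_terms (n - i)))) [1..<Suc n])"
    unfolding conj_Sq_def conj_terms_Suc[OF n] by (rule evaluate_concat[OF M x t])
  also have "map (\<lambda>i. evaluate M (\<lambda>_. d) (\<lambda>_. x) (d + n) (Sq_terms i (conj_terms (n - i)))) [1..<Suc n] =
      map (\<lambda>i. Sq M i (d + (n - i)) (conj_Sq M (n - i) d x)) [1..<Suc n]"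
  proof (rule map_cong[OF refl])
    fix i assume "i \<in> set [1..<Suc n]"
    then have "d + (n - i) + i = d + n" by auto
    with evaluate_Sq[OF M x conj_terms_in, of "n - i" i]
    show "evaluate M (\<lambda>_. d) (\<lambda>_. x) (d + n) (Sq_terms i (conj_terms (n - i))) = Sq M i (d + (n - i)) (conj_Sq M (n - i) d x)"
      by (simp add: conj_Sq_def)
  qed
  finally show "conj_Sq M n d x = vsum (piece M (d + n))
        (map (\<lambda>i. Sq M i (d + (n - i)) (conj_Sq M (n - i) d x)) [1..<Suc n])" .
qed

lemma act_add:
  assumes M: "unstable_module M" and x: "x \<in> carrier (piece M m)" and y: "y \<in> carrier (piece M m)"
  shows "act M m w (x \<oplus>\<^bsub>piece M m\<^esub> y) = act M m w x \<oplus>\<^bsub>piece M (m + sum_list w)\<^esub> act M m w y"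
proof (induction w)
  case (Cons i w)
  have e: "m + sum_list w + i = m + sum_list (i # w)" by simp
  show ?case
    using Cons unstable_Sq_add[OF M act_closed[OF M x refl, of w] act_closed[OF M y refl, of w], of i]
    unfolding e by simp
qed simp

lemma conj_Sq_add:
  assumes M: "unstable_module M" and x: "x \<in> carrier (piece M d)" and y: "y \<in> carrier (piece M d)"
  shows "conj_Sq M n d (x \<oplus>\<^bsub>piece M d\<^esub> y) = conj_Sq M n d x \<oplus>\<^bsub>piece M (d + n)\<^esub> conj_Sq M n d y"
proof -
  have "evaluate M (\<lambda>_. d) (\<lambda>_. x \<oplus>\<^bsub>piece M d\<^esub> y) e L =
      evaluate M (\<lambda>_. d) (\<lambda>_. x) e L \<oplus>\<^bsub>piece M e\<^esub> evaluate M (\<lambda>_. d) (\<lambda>_. y) e L"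
    if "L \<in> terms (\<lambda>_::unit. d) e" for e L
    using that
  proof (induction L)
    case (Cons wg L)
    obtain w where wg: "wg = (w, ())" by (cases wg) auto
    with Cons.prems have e: "e = d + sum_list w" and L: "L \<in> terms (\<lambda>_. d) e" by (auto simp: terms_Cons)
    note V = unstable_vs[OF M, of e]
    have c: "act M d w x \<in> carrier (piece M e)" "act M d w y \<in> carrier (piece M e)"
      "evaluate M (\<lambda>_. d) (\<lambda>_. x) e L \<in> carrier (piece M e)" "evaluate M (\<lambda>_. d) (\<lambda>_. y) e L \<in> carrier (piece M e)"
      using act_closed[OF M x e] act_closed[OF M y e] evaluate_closed[OF M x L] evaluate_closed[OF M y L] by auto
    have "act M d w (x \<oplus>\<^bsub>piece M d\<^esub> y) = act M d w x \<oplus>\<^bsub>piece M e\<^esub> act M d w y"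
      unfolding e by (rule act_add[OF M x y])
    then show ?case using Cons.IH[OF L] c V F2_lcomm[OF V c(2,3,4)] by (simp add: wg evaluate_Cons F2_assoc)
  qed (use unstable_vs[OF M] in simp)
  then show ?thesis unfolding conj_Sq_def using conj_terms_in by blast
qed

text \<open>On the tensor powers the total conjugate square is multiplicative and sends \<open>u\<close> to the sum of
  all \<open>u^(2 ^ k)\<close>.\<close>

fun conj_total :: "nat list \<Rightarrow> (nat list \<Rightarrow> bit) \<Rightarrow> bit" where
  "conj_total [] f = f []"
| "conj_total (b # bs) f = (\<Sum>a\<le>b. conj_total bs (\<lambda>as. f (a # as)))"

text \<open>The total square in the transposed form of \<open>Sq_coeff\<close>: with no degree to
  account for, each entry is simply kept or lowered.\<close>

fun Sq_total :: "nat list \<Rightarrow> (nat list \<Rightarrow> bit) \<Rightarrow> bit" where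
  "Sq_total [] f = f []"
| "Sq_total (b # bs) f = Sq_total bs (\<lambda>as. f (b # as)) + (if 0 < b then Sq_total bs (\<lambda>as. f ((b - 1) # as)) else 0)"

lemma Sq_total_sum: "Sq_total b (\<lambda>a. \<Sum>k\<in>A. F k a) = (\<Sum>k\<in>A. Sq_total b (F k))"
proof (induction b arbitrary: F)
  case (Cons b bs)
  show ?case by (cases "0 < b") (simp_all add: Cons sum.distrib)
qed simp

text \<open>In each variable the sum over a <= b from the kept entry and the sum over a <= b - 1
  from the lowered one cancel except for a = b.\<close>

lemma Sq_total_conj: "Sq_total b (\<lambda>a. conj_total a f) = f b"
proof (induction b arbitrary: f)
  case (Cons b bs)
  show ?case
  proof (cases b)
    case 0
    then show ?thesis by (simp add: Cons)
  next
    case (Suc c)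
    have "Sq_total (b # bs) (\<lambda>a. conj_total a f) =
        Sq_total bs (\<lambda>as. \<Sum>a\<le>Suc c. conj_total as (\<lambda>as. f (a # as))) + Sq_total bs (\<lambda>as. \<Sum>a\<le>c. conj_total as (\<lambda>as. f (a # as)))"
      using Suc by simp
    also have "\<dots> = (\<Sum>a\<le>Suc c. f (a # bs)) + (\<Sum>a\<le>c. f (a # bs))"
      unfolding Sq_total_sum by (simp add: Cons)
    finally show ?thesis using Suc by (simp add: ac_simps)
  qed
qed simp

lemma Sq_total_eq: "mdeg b \<le> N \<Longrightarrow> (\<Sum>i\<le>N. Sq_coeff b i f) = Sq_total b f"
proof (induction b arbitrary: N f)
  case Nil
  show ?case by (simp add: sum.delta)
next
  case (Cons b bs)
  have 1: "(\<Sum>i\<le>N. Sq_coeff bs i (\<lambda>as. f (b # as))) = Sq_total bs (\<lambda>as. f (b # as))"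
    using Cons.prems by (intro Cons.IH) simp
  show ?case
  proof (cases b)
    case 0
    then show ?thesis using 1 by simp
  next
    case (Suc c)
    have "(\<Sum>i\<le>N. if 2 ^ c \<le> i then Sq_coeff bs (i - 2 ^ c) (\<lambda>as. f (c # as)) else 0) =
        (\<Sum>i\<in>{2 ^ c..N}. Sq_coeff bs (i - 2 ^ c) (\<lambda>as. f (c # as)))"
      by (rule sum.mono_neutral_cong_right) auto
    also have "\<dots> = (\<Sum>i\<le>N - 2 ^ c. Sq_coeff bs i (\<lambda>as. f (c # as)))"
      by (rule sum.reindex_bij_witness[of _ "\<lambda>i. i + 2 ^ c" "\<lambda>i. i - 2 ^ c"]) (use Cons.prems Suc in auto)
    also have "\<dots> = Sq_total bs (\<lambda>as. f (c # as))"
      using Cons.prems Suc by (intro Cons.IH) simp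
    finally show ?thesis using 1 Suc by (simp add: sum.distrib cong: if_cong)
  qed
qed

lemma conj_total_support: "conj_total b f \<noteq> 0 \<Longrightarrow> \<exists>a. f a \<noteq> 0 \<and> length a = length b \<and> mdeg a \<le> mdeg b"
proof (induction b arbitrary: f)
  case (Cons b bs)
  then obtain a where a: "a \<le> b" "conj_total bs (\<lambda>as. f (a # as)) \<noteq> 0"
    by (metis (no_types, lifting) atMost_iff conj_total.simps(2) sum.neutral)
  then obtain as where "f (a # as) \<noteq> 0" "length as = length bs" "mdeg as \<le> mdeg bs" using Cons.IH by blast
  moreover have "(2::nat) ^ a \<le> 2 ^ b" using a(1) by simp
  ultimately show ?case by (intro exI[of _ "a # as"]) (simp add: add_mono)
qed auto

text \<open>Over \<open>bit\<close>, equality means that the sum vanishes, and to the sum f + g the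
  support lemma applies.\<close>

lemma Sq_coeff_cong:
  assumes "\<And>a. length a = length b \<Longrightarrow> mdeg b = mdeg a + i \<Longrightarrow> f a = g a"
  shows "Sq_coeff b i f = Sq_coeff b i g"
proof -
  have "Sq_coeff b i (\<lambda>a. f a + g a) = 0"
  proof (rule ccontr)
    assume "Sq_coeff b i (\<lambda>a. f a + g a) \<noteq> 0"
    then obtain a where a: "f a + g a \<noteq> 0" "length a = length b" "mdeg b = mdeg a + i"
      using Sq_coeff_support by meson
    then show False using assms[OF a(2,3)] by simp
  qed
  then have "Sq_coeff b i f + Sq_coeff b i g = 0" by (simp only: Sq_coeff_add)
  then show ?thesis by (cases "Sq_coeff b i f"; cases "Sq_coeff b i g") auto
qed

text \<open>The recursion for \<open>conj_Sq\<close> says that the total square inverts the total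
  conjugate square, and \<open>Sq_total_conj\<close> says the same of the explicit
  \<open>conj_total\<close>. The two are compared degree by degree.\<close>

lemma conj_Sq_tensor:
  assumes f: "f \<in> carrier (piece (tensor_module m) d)"
  shows "conj_Sq (tensor_module m) n d f b = (if mdeg b = d + n then conj_total b f else 0)"
proof (induction n arbitrary: b rule: less_induct)
  case (less n)
  note T = tensor_unstable[of m]
  \<comment> \<open>The total conjugate square does not lower degrees, so it vanishes below the
    degree \<open>d\<close> of \<open>f\<close>; this is what truncates the sums that
    follow.\<close>
  have van: "conj_total a f = 0" if "mdeg a < d" for a
    using conj_total_support[of a f] f that by (cases "conj_total a f = 0") (simp_all del: bit_not_zero_iff, fastforce)
  have in_deg: "mdeg b = d + n" if "conj_Sq (tensor_module m) n d f b \<noteq> 0"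
    using conj_Sq_closed[OF T f refl, of n] that by simp
  show ?case
  proof (cases "mdeg b = d + n")
    case deg: True
    show ?thesis
    proof (cases "n = 0")
      case True
      have "(\<Sum>i\<le>mdeg b. Sq_coeff b i (\<lambda>a. conj_total a f)) = (\<Sum>i\<in>{0}. Sq_coeff b i (\<lambda>a. conj_total a f))"
      proof (rule sum.mono_neutral_right)
        show "\<forall>i\<in>{..mdeg b} - {0}. Sq_coeff b i (\<lambda>a. conj_total a f) = 0"
        proof
          fix i assume i: "i \<in> {..mdeg b} - {0}"
          have "Sq_coeff b i (\<lambda>a. conj_total a f) = Sq_coeff b i (\<lambda>a. 0)"
            by (rule Sq_coeff_cong) (use i deg True in \<open>auto intro!: van\<close>)
          then show "Sq_coeff b i (\<lambda>a. conj_total a f) = 0" by simp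
        qed
      qed auto
      then have "conj_total b f = f b"
        using Sq_total_eq[of b "mdeg b" "\<lambda>a. conj_total a f"] Sq_total_conj[of b f] by simp
      then show ?thesis using True deg conj_Sq_0[OF T f] by simp
    next
      case False
      have "conj_Sq (tensor_module m) n d f b = (\<Sum>i\<leftarrow>[1..<Suc n]. Sq_coeff b i (conj_Sq (tensor_module m) (n - i) d f))"
        using conj_Sq_rec[OF T f, of n] False by (simp add: vsum_tensor comp_def del: upt_Suc)
      also have "\<dots> = (\<Sum>i\<in>{1..<Suc n}. Sq_coeff b i (conj_Sq (tensor_module m) (n - i) d f))"
        by (simp add: sum_list_distinct_conv_sum_set del: upt_Suc)
      also have "\<dots> = (\<Sum>i\<in>{1..<Suc n}. Sq_coeff b i (\<lambda>a. conj_total a f))"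
      proof (rule sum.cong[OF refl], rule Sq_coeff_cong)
        fix i a assume i: "i \<in> {1..<Suc n}" and "mdeg b = mdeg a + i"
        then have "mdeg a = d + (n - i)" "n - i < n" using deg by auto
        then show "conj_Sq (tensor_module m) (n - i) d f a = conj_total a f" using less by simp
      qed
      also have "\<dots> = (\<Sum>i\<in>{1..mdeg b}. Sq_coeff b i (\<lambda>a. conj_total a f))"
      proof (rule sum.mono_neutral_left)
        show "\<forall>i\<in>{1..mdeg b} - {1..<Suc n}. Sq_coeff b i (\<lambda>a. conj_total a f) = 0"
        proof
          fix i assume i: "i \<in> {1..mdeg b} - {1..<Suc n}"
          have "Sq_coeff b i (\<lambda>a. conj_total a f) = Sq_coeff b i (\<lambda>a. 0)"
            by (rule Sq_coeff_cong) (use i deg in \<open>auto intro!: van\<close>)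
          then show "Sq_coeff b i (\<lambda>a. conj_total a f) = 0" by simp
        qed
      qed (use deg in auto)
      \<comment> \<open>The sum is completed by its term for i = 0, which is
        \<open>conj_total b f\<close>. The completed sum is a total square and equals
        \<open>f b\<close>, which is zero because n > 0 puts \<open>b\<close> in the wrong
        degree.\<close>
      also have "\<dots> = (\<Sum>i\<le>mdeg b. Sq_coeff b i (\<lambda>a. conj_total a f)) + conj_total b f"
      proof -
        have "{..mdeg b} = insert 0 {1..mdeg b}" by auto
        then have "(\<Sum>i\<le>mdeg b. Sq_coeff b i (\<lambda>a. conj_total a f)) =
            conj_total b f + (\<Sum>i\<in>{1..mdeg b}. Sq_coeff b i (\<lambda>a. conj_total a f))" by simp
        then show ?thesis by (cases "conj_total b f") (auto simp: ac_simps simp flip: add.assoc)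
      qed
      also have "(\<Sum>i\<le>mdeg b. Sq_coeff b i (\<lambda>a. conj_total a f)) = f b"
        using Sq_total_eq[of b "mdeg b" "\<lambda>a. conj_total a f"] Sq_total_conj[of b f] by simp
      also have "f b = 0" using f deg False by (cases "f b = 0") (simp_all del: bit_not_zero_iff)
      finally show ?thesis using deg by simp
    qed
  next
    case False
    then show ?thesis using in_deg by (cases "conj_Sq (tensor_module m) n d f b = 0") (simp_all del: bit_not_zero_iff)
  qed
qed

lemma conj_Sq_fundamental:
  "conj_Sq (tensor_module m) n m (fundamental m) b = (if mdeg b = m + n then conj_total b (fundamental m) else 0)"
  by (rule conj_Sq_tensor[OF fundamental_in])

text \<open>For j > 0 the ones occur an even number of times; merging them in pairs and halving all
  summands lowers \<open>j\<close> by one and the length by at least one. The extremal case is 1 + 1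
  + 2 + ... + 2^(j-1).\<close>

lemma mdeg_power_of_2:
  "mdeg b = 2 ^ j \<Longrightarrow> 0 \<in> set b \<Longrightarrow> j < length b"
proof (induction j arbitrary: b)
  case (Suc j)
  define z where "z = length (filter (\<lambda>k. k = 0) b)"
  define b' where "b' = map (\<lambda>k. k - 1) (filter (\<lambda>k. k \<noteq> 0) b)"
  have *: "mdeg c = length (filter (\<lambda>k. k = 0) c) + 2 * mdeg (map (\<lambda>k. k - 1) (filter (\<lambda>k. k \<noteq> 0) c)) \<and>
      length c = length (filter (\<lambda>k. k = 0) c) + length (filter (\<lambda>k. k \<noteq> 0) c)" for c
  proof (induction c)
    case (Cons k c)
    then show ?case by (cases k) auto
  qed simp
  have b: "mdeg b = z + 2 * mdeg b'" "length b = z + length b'" using *[of b] by (auto simp: z_def b'_def)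
  have "0 < z" using Suc.prems(2) by (auto simp: z_def filter_empty_conv)
  obtain y where y: "z = 2 * y"
  proof
    show "z = 2 * (2 ^ j - mdeg b')" using b(1) Suc.prems(1) by simp
  qed
  have app: "mdeg (c @ c') = mdeg c + mdeg c'" for c c' by (simp add: mdeg_def)
  have "mdeg (replicate y 0 @ b') = 2 ^ j" using b(1) Suc.prems(1) y by (simp add: app)
  moreover have "0 \<in> set (replicate y 0 @ b')" using \<open>0 < z\<close> y by simp
  ultimately have "j < length (replicate y 0 @ b')" by (rule Suc.IH)
  then show ?case using b(2) y \<open>0 < z\<close> by simp
qed auto

text \<open>The total conjugate square sends u to the sum of all u^(2^k), and u^2 to the same sum
  without u. Where no variable has exponent one the two cannot be told apart, so each of the m
  choose i monomials of Sq^i applied to the fundamental class contributes 1.\<close>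

lemma conj_total_Sq_fundamental:
  "0 \<notin> set b \<Longrightarrow> length b = m \<Longrightarrow> conj_total b (\<lambda>a. Sq_coeff a i (fundamental m)) = of_nat (m choose i)"
proof (induction b arbitrary: m i)
  case Nil
  then show ?case by (cases i) (auto simp: fundamental_def)
next
  case (Cons b bs)
  then obtain m' where m: "m = Suc m'" "length bs = m'" by auto
  obtain c where b: "b = Suc c" using Cons.prems by (cases b) auto
  let ?t = "\<lambda>a. conj_total bs (\<lambda>as. Sq_coeff (a # as) i (fundamental m))"
  have z: "conj_total bs (\<lambda>as. 0) = 0"
  proof (rule ccontr)
    assume "conj_total bs (\<lambda>as. 0) \<noteq> 0"
    from conj_total_support[OF this] show False by simp
  qed
  have "(\<Sum>a\<le>b. ?t a) = (\<Sum>a\<in>{0,1}. ?t a)"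
  proof (rule sum.mono_neutral_right)
    show "\<forall>a\<in>{..b} - {0, 1}. ?t a = 0"
      by (auto simp: m fundamental_Cons z cong: if_cong)
  qed (use b in auto)
  also have "\<dots> = ?t 0 + ?t 1" by simp
  also have "?t 0 = of_nat (m' choose i)" using Cons.IH[of m' i] Cons.prems m by (simp add: fundamental_Cons)
  also have "?t 1 = (if 1 \<le> i then of_nat (m' choose (i - 1)) else 0)"
    using Cons.IH[of m' "i - 1"] Cons.prems m by (simp add: fundamental_Cons z)
  finally show ?case by (cases i) (simp_all add: m add.commute)
qed

lemma act_append: "act M m (w @ [i]) x = act M (m + i) w (Sq M i m x)"
  by (induction w) (simp_all add: ac_simps)

text \<open>In degree 2^j with m <= j, no monomial of length \<open>m\<close> contains a variable to
  the first power, so \<open>conj_total_Sq_fundamental\<close> evaluates both sides on the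
  fundamental class. The binomial coefficient is the one in Sq^i u^m, which is why functionals
  composed with conjugate squares give maps to \<open>RP 0\<close>.\<close>

lemma conj_Sq_right:
  fixes E :: "'e sq_module"
  assumes E: "unstable_module E" and cnt: "\<And>n. countable (carrier (piece E n))"
    and x: "x \<in> carrier (piece E m)" and j: "m + i \<le> 2 ^ j" "m \<le> j"
  shows "conj_Sq E (2 ^ j - (m + i)) (m + i) (Sq E i m x) =
    (if odd (m choose i) then conj_Sq E (2 ^ j - m) m x else \<zero>\<^bsub>piece E (2 ^ j)\<^esub>)"
proof -
  define N where "N = 2 ^ j - (m + i)"
  \<comment> \<open>Both sides become formal sums over one class of degree \<open>m\<close>:
    appending \<open>i\<close> to a word makes Sq^i the operation that is applied first.\<close>
  define K where "K = map (\<lambda>(w, g). (w @ [i], g)) (conj_terms N)"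
  define K' where "K' = (if odd (m choose i) then conj_terms (2 ^ j - m) else [])"
  have N: "m + i + N = 2 ^ j" "m + (2 ^ j - m) = 2 ^ j" using j by (auto simp: N_def)
  have Kt: "K \<in> terms (\<lambda>_. m) (2 ^ j)"
    using conj_terms_in[of N "m + i"] unfolding N by (auto simp: K_def terms_def)
  have K't: "K' \<in> terms (\<lambda>_. m) (2 ^ j)"
    using conj_terms_in[of "2 ^ j - m" m] unfolding N by (auto simp: K'_def)
  let ?T = "tensor_module m"
  have K_T: "evaluate ?T (\<lambda>_. m) (\<lambda>_. fundamental m) (2 ^ j) K = conj_Sq ?T N (m + i) (Sq ?T i m (fundamental m))"
    unfolding conj_Sq_def evaluate_def K_def N by (simp add: comp_def case_prod_unfold act_append del: tensor_simps)
  have K'_T: "evaluate ?T (\<lambda>_. m) (\<lambda>_. fundamental m) (2 ^ j) K' =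
     (if odd (m choose i) then conj_Sq ?T (2 ^ j - m) m (fundamental m) else \<zero>\<^bsub>piece ?T (2 ^ j)\<^esub>)"
    unfolding conj_Sq_def K'_def N by simp
  have T0: "evaluate ?T (\<lambda>_. m) (\<lambda>_. fundamental m) (2 ^ j) (K @ K') = (\<lambda>_. 0)"
  proof
    fix b
    let ?l = "conj_Sq ?T N (m + i) (Sq ?T i m (fundamental m))"
    let ?r = "if odd (m choose i) then conj_Sq ?T (2 ^ j - m) m (fundamental m) else \<zero>\<^bsub>piece ?T (2 ^ j)\<^esub>"
    have "evaluate ?T (\<lambda>_. m) (\<lambda>_. fundamental m) (2 ^ j) (K @ K') b = ?l b + ?r b"
      unfolding evaluate_append[OF tensor_unstable fundamental_in Kt K't] K_T K'_T by simp
    also have "\<dots> = 0"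
    proof (cases "mdeg b = 2 ^ j \<and> length b = m")
      case True
      \<comment> \<open>A summand 1 among \<open>m\<close> powers of two with sum 2^j would force m
        > j.\<close>
      then have "0 \<notin> set b" using mdeg_power_of_2[of b j] j by auto
      then have "conj_total b (\<lambda>a. Sq_coeff a k (fundamental m)) = of_nat (m choose k)" for k
        using True by (intro conj_total_Sq_fundamental) auto
      from this[of i] this[of 0] show ?thesis
        using True N conj_Sq_tensor[where n = N and b = b, OF tensor_Sq_closed[where i = i, OF fundamental_in[of m]]]
          conj_Sq_fundamental[of m "2 ^ j - m" b] by (auto simp: of_nat_bit_even elim!: oddE)
    next
      case False
      have "?l \<in> carrier (piece ?T (2 ^ j))"
        by (rule conj_Sq_closed[OF tensor_unstable tensor_Sq_closed[OF fundamental_in]]) (simp add: N)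
      moreover have "?r \<in> carrier (piece ?T (2 ^ j))"
        using conj_Sq_closed[OF tensor_unstable fundamental_in, of "2 ^ j" m "2 ^ j - m"] N F2_zero[OF tensor_vs] by auto
      ultimately show ?thesis using False by (simp only: tensor_simps(1)) (metis add_0)
    qed
    finally show "evaluate ?T (\<lambda>_. m) (\<lambda>_. fundamental m) (2 ^ j) (K @ K') b = 0" .
  qed
  have KK: "K @ K' \<in> terms (\<lambda>_. m) (2 ^ j)" using Kt K't by simp
  have "evaluate E (\<lambda>_. m) (\<lambda>_. x) (2 ^ j) K \<oplus>\<^bsub>piece E (2 ^ j)\<^esub> evaluate E (\<lambda>_. m) (\<lambda>_. x) (2 ^ j) K' = \<zero>\<^bsub>piece E (2 ^ j)\<^esub>"
    using tensor_detects[OF KK T0 E cnt x] unfolding evaluate_append[OF E x Kt K't] .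
  then have "evaluate E (\<lambda>_. m) (\<lambda>_. x) (2 ^ j) K = evaluate E (\<lambda>_. m) (\<lambda>_. x) (2 ^ j) K'"
    using F2_add_eq_zero[OF unstable_vs[OF E] evaluate_closed[OF E x Kt] evaluate_closed[OF E x K't]] by simp
  then show ?thesis
    unfolding K'_def conj_Sq_def N_def[symmetric] N
    by (simp add: evaluate_def K_def comp_def case_prod_unfold act_append split: if_splits)
qed

text \<open>With a single variable the only monomial of degree 2^(j+1) is \<open>[Suc j]\<close>,
  and both sides have coefficient 1 there.\<close>

lemma conj_Sq_degree_1:
  fixes E :: "'e sq_module"
  assumes E: "unstable_module E" and cnt: "\<And>n. countable (carrier (piece E n))" and x: "x \<in> carrier (piece E 1)"
  shows "conj_Sq E (2 ^ Suc j - 1) 1 x = Sq E (2 ^ j) (2 ^ j) (conj_Sq E (2 ^ j - 1) 1 x)"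
proof -
  define K where "K = conj_terms (2 ^ Suc j - 1)"
  define K' where "K' = Sq_terms (2 ^ j) (conj_terms (2 ^ j - 1))"
  have d: "1 + (2 ^ Suc j - 1) = (2 ^ Suc j :: nat)" "1 + (2 ^ j - 1) = (2 ^ j :: nat)" "2 ^ j + 2 ^ j = (2 ^ Suc j :: nat)" by simp_all
  have Kt: "K \<in> terms (\<lambda>_. 1) (2 ^ Suc j)"
    using conj_terms_in[of "2 ^ Suc j - 1" 1] unfolding d K_def .
  have K't: "K' \<in> terms (\<lambda>_. 1) (2 ^ Suc j)"
    using Sq_terms_in[OF conj_terms_in[of "2 ^ j - 1" 1], of "2 ^ j"] unfolding d K'_def .
  have KE: "evaluate E (\<lambda>_. 1) (\<lambda>_. x) (2 ^ Suc j) K = conj_Sq E (2 ^ Suc j - 1) 1 x"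
    unfolding conj_Sq_def K_def d by simp
  have K': "evaluate E (\<lambda>_. 1) (\<lambda>_. x) (2 ^ Suc j) K' = Sq E (2 ^ j) (2 ^ j) (conj_Sq E (2 ^ j - 1) 1 x)"
    using evaluate_Sq[OF E x conj_terms_in[of "2 ^ j - 1" 1], of "2 ^ j"]
    unfolding conj_Sq_def K'_def d .
  let ?T = "tensor_module 1" and ?u = "fundamental 1"
  have KT: "evaluate ?T (\<lambda>_. 1) (\<lambda>_. ?u) (2 ^ Suc j) K = conj_Sq ?T (2 ^ Suc j - 1) 1 ?u"
    unfolding conj_Sq_def K_def d by simp
  have K'T: "evaluate ?T (\<lambda>_. 1) (\<lambda>_. ?u) (2 ^ Suc j) K' = Sq ?T (2 ^ j) (2 ^ j) (conj_Sq ?T (2 ^ j - 1) 1 ?u)"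
    using evaluate_Sq[OF tensor_unstable fundamental_in conj_terms_in[of "2 ^ j - 1" 1], of "2 ^ j"]
    unfolding conj_Sq_def K'_def d .
  have tot: "conj_total [k] ?u = 1" for k
  proof -
    have "conj_total [k] ?u = (\<Sum>a\<in>{0}. ?u [a])"
      unfolding conj_total.simps by (rule sum.mono_neutral_right) (auto simp: fundamental_def)
    then show ?thesis by (simp add: fundamental_def)
  qed
  let ?l = "conj_Sq ?T (2 ^ Suc j - 1) 1 ?u" and ?r = "Sq ?T (2 ^ j) (2 ^ j) (conj_Sq ?T (2 ^ j - 1) 1 ?u)"
  have lr: "?l b = ?r b" for b
  proof -
    have c: "conj_Sq ?T (2 ^ j - 1) 1 ?u \<in> carrier (piece ?T (2 ^ j))"
      by (rule conj_Sq_closed[OF tensor_unstable fundamental_in]) simp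
    have l: "?l \<in> carrier (piece ?T (2 ^ Suc j))"
      by (rule conj_Sq_closed[OF tensor_unstable fundamental_in]) simp
    have r: "?r \<in> carrier (piece ?T (2 ^ Suc j))"
      using tensor_Sq_closed[OF c, of "2 ^ j"] unfolding d .
    show ?thesis
    proof (cases "b = [Suc j]")
      case True
      have "?l b = 1" using True conj_Sq_fundamental[of 1 "2 ^ Suc j - 1" b] tot[of "Suc j"] by simp
      moreover have "?r b = conj_Sq ?T (2 ^ j - 1) 1 ?u [j]"
        using True c by (simp only: tensor_simps(5)) (subst Sq_coeff_top, auto)
      moreover have "conj_Sq ?T (2 ^ j - 1) 1 ?u [j] = 1"
        using conj_Sq_fundamental[of 1 "2 ^ j - 1" "[j]"] tot[of j] by simp
      ultimately show ?thesis by simp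
    next
      case False
      have "\<not> (length b = 1 \<and> mdeg b = 2 ^ Suc j)"
      proof
        assume a: "length b = 1 \<and> mdeg b = 2 ^ Suc j"
        then obtain k where "b = [k]" by (auto simp: length_Suc_conv)
        with a have "(2::nat) ^ k = 2 ^ Suc j" by simp
        then have "k = Suc j" by (simp only: power_inject_exp)
        with False \<open>b = [k]\<close> show False by simp
      qed
      then have "?l b = 0" "?r b = 0" using l r by (simp_all only: tensor_simps(1)) blast+
      then show ?thesis by simp
    qed
  qed
  have KK: "K @ K' \<in> terms (\<lambda>_. 1) (2 ^ Suc j)" using Kt K't by simp
  have T0: "evaluate ?T (\<lambda>_. 1) (\<lambda>_. ?u) (2 ^ Suc j) (K @ K') = (\<lambda>_. 0)"
    unfolding evaluate_append[OF tensor_unstable fundamental_in Kt K't] KT K'T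
    unfolding tensor_simps(3) using lr by simp
  have "evaluate E (\<lambda>_. 1) (\<lambda>_. x) (2 ^ Suc j) K \<oplus>\<^bsub>piece E (2 ^ Suc j)\<^esub> evaluate E (\<lambda>_. 1) (\<lambda>_. x) (2 ^ Suc j) K' = \<zero>\<^bsub>piece E (2 ^ Suc j)\<^esub>"
    using tensor_detects[OF KK T0 E cnt x] unfolding evaluate_append[OF E x Kt K't] .
  then show ?thesis
    using F2_add_eq_zero[OF unstable_vs[OF E] evaluate_closed[OF E x Kt] evaluate_closed[OF E x K't]] KE K' by simp
qed

subsection \<open>Maps to suspensions of the cohomology of real projective space\<close>

text \<open>Degree 1 is reached by iterating the top square. For m = 2k write u^m = Sq^k u^k; for
  odd m > 1 use Sq^1 u^m = u^(m+1), where (m+1)/2 < m. In both cases \<open>conj_Sq_right\<close>,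
  with an odd binomial coefficient, reduces the claim to a smaller degree. The bound
  \<open>N\<close> provides the hypotheses of that lemma.\<close>

lemma RP_conj_Sq:
  assumes "0 < m"
  shows "\<exists>N. \<forall>j\<ge>N. \<forall>x. conj_Sq (RP 0) (2 ^ j - m) m x = x"
  using assms
proof (induction m rule: less_induct)
  case (less m)
  note U = RP_unstable[of 0]
  have cnt: "countable (carrier (piece (RP 0) n))" for n by (rule countableI_type)
  have dbl: "\<exists>N. \<forall>j\<ge>N. \<forall>x. conj_Sq (RP 0) (2 ^ j - (k + k)) (k + k) x = x" if k: "0 < k" "k < m" for k
  proof -
    obtain N where N: "\<And>j x. N \<le> j \<Longrightarrow> conj_Sq (RP 0) (2 ^ j - k) k x = x" using less.IH[OF k(2,1)] by blast
    show ?thesis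
    proof (intro exI[of _ "max N (k + k)"] allI impI)
      fix j x assume j: "max N (k + k) \<le> j"
      then have "k + k \<le> 2 ^ j" using less_exp[of j] by linarith
      then have "conj_Sq (RP 0) (2 ^ j - (k + k)) (k + k) (Sq (RP 0) k k x) = conj_Sq (RP 0) (2 ^ j - k) k x"
        using conj_Sq_right[OF U cnt, of x k k j] j k by simp
      then show "conj_Sq (RP 0) (2 ^ j - (k + k)) (k + k) x = x" using N j k by simp
    qed
  qed
  consider "m = 1" | "even m" | "odd m" "m \<noteq> 1" by blast
  then show ?case
  proof cases
    case 1
    have "conj_Sq (RP 0) (2 ^ j - 1) 1 x = x" for j x
    proof (induction j)
      case 0
      show ?case using conj_Sq_0[OF U, of x 1] by simp
    next
      case (Suc j)
      then show ?case using conj_Sq_degree_1[OF U cnt, of x j] by simp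
    qed
    then show ?thesis unfolding 1 by blast
  next
    case 2
    then obtain k where k: "m = 2 * k" by blast
    then have "0 < k" "k < m" using less.prems by auto
    from dbl[OF this] show ?thesis using k by (simp add: mult_2)
  next
    case 3
    then obtain k where k: "Suc m = 2 * k" by (metis evenE even_Suc)
    then have "0 < k" "k < m" using 3 by presburger+
    from dbl[OF this] obtain N where N: "\<And>j x. N \<le> j \<Longrightarrow> conj_Sq (RP 0) (2 ^ j - (m + 1)) (m + 1) x = x"
      using k by (auto simp: mult_2)
    show ?thesis
    proof (intro exI[of _ "max N (m + 1)"] allI impI)
      fix j x assume j: "max N (m + 1) \<le> j"
      then have "m + 1 \<le> 2 ^ j" using less_exp[of j] by linarith
      then have "conj_Sq (RP 0) (2 ^ j - (m + 1)) (m + 1) (Sq (RP 0) 1 m x) = conj_Sq (RP 0) (2 ^ j - m) m x"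
        using conj_Sq_right[OF U cnt, of x m 1 j] j 3 less.prems by simp
      moreover have "Sq (RP 0) 1 m x = x"
      proof -
        have "(of_nat m :: bit) = 1" using 3(1) by (auto elim!: oddE simp: of_nat_bit_even)
        then show ?thesis using less.prems by simp
      qed
      ultimately show "conj_Sq (RP 0) (2 ^ j - m) m x = x" using N j by simp
    qed
  qed
qed

text \<open>A subspace maximal among those that contain \<open>K0\<close> and miss \<open>x0\<close>
  has index two, since y + x0 lies in it for every \<open>y\<close> outside. The functional is the
  indicator of its complement.\<close>

lemma separating_functional:
  assumes V: "module F2 V" and K0: "K0 \<subseteq> carrier V" "\<zero>\<^bsub>V\<^esub> \<in> K0" "\<And>x y. x \<in> K0 \<Longrightarrow> y \<in> K0 \<Longrightarrow> x \<oplus>\<^bsub>V\<^esub> y \<in> K0"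
    and x0: "x0 \<in> carrier V" "x0 \<notin> K0"
  obtains \<Psi> :: "'a \<Rightarrow> bit" where "\<And>x y. x \<in> carrier V \<Longrightarrow> y \<in> carrier V \<Longrightarrow> \<Psi> (x \<oplus>\<^bsub>V\<^esub> y) = \<Psi> x + \<Psi> y"
    "\<And>x. x \<in> K0 \<Longrightarrow> \<Psi> x = 0" "\<Psi> x0 = 1"
proof -
  define \<K> where "\<K> = {K. K0 \<subseteq> K \<and> K \<subseteq> carrier V \<and> (\<forall>x\<in>K. \<forall>y\<in>K. x \<oplus>\<^bsub>V\<^esub> y \<in> K) \<and> x0 \<notin> K}"
  have "K0 \<in> \<K>" using K0 x0 by (auto simp: \<K>_def)
  then have "\<exists>K\<in>\<K>. \<forall>X\<in>\<K>. K \<subseteq> X \<longrightarrow> X = K"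
  proof (intro subset_Zorn_nonempty)
    fix C assume C: "C \<noteq> {}" "subset.chain \<K> C"
    have ord: "X \<subseteq> Y \<or> Y \<subseteq> X" if "X \<in> C" "Y \<in> C" for X Y
      using C(2) that unfolding subset.chain_def by blast
    have sub: "X \<in> \<K>" if "X \<in> C" for X using C(2) that unfolding subset.chain_def by blast
    have "x \<oplus>\<^bsub>V\<^esub> y \<in> \<Union>C" if "x \<in> \<Union>C" "y \<in> \<Union>C" for x y
    proof -
      obtain X Y where XY: "x \<in> X" "X \<in> C" "y \<in> Y" "Y \<in> C" using \<open>x \<in> \<Union>C\<close> \<open>y \<in> \<Union>C\<close> by blast
      then have "x \<in> X \<and> y \<in> X \<or> x \<in> Y \<and> y \<in> Y" using ord[of X Y] by blast
      then show ?thesis using sub[OF XY(2)] sub[OF XY(4)] XY unfolding \<K>_def by blast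
    qed
    then show "\<Union>C \<in> \<K>" using C(1) sub unfolding \<K>_def by blast
  qed blast
  then obtain K where K: "K \<in> \<K>" and max: "\<And>X. X \<in> \<K> \<Longrightarrow> K \<subseteq> X \<Longrightarrow> X = K" by blast
  have Ka: "x \<oplus>\<^bsub>V\<^esub> y \<in> K" if "x \<in> K" "y \<in> K" for x y using K that by (simp add: \<K>_def)
  have Ks: "K0 \<subseteq> K" "K \<subseteq> carrier V" "x0 \<notin> K" using K by (auto simp: \<K>_def)
  have KV: "x \<in> carrier V" if "x \<in> K" for x using Ks that by blast
  \<comment> \<open>By maximality, adjoining \<open>y\<close> to \<open>K\<close> must capture
    \<open>x0\<close>, so that x0 = k + y with k in \<open>K\<close>.\<close>
  have coset: "y \<oplus>\<^bsub>V\<^esub> x0 \<in> K" if y: "y \<in> carrier V" "y \<notin> K" for y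
  proof -
    define X where "X = K \<union> {k \<oplus>\<^bsub>V\<^esub> y | k. k \<in> K}"
    have z: "\<zero>\<^bsub>V\<^esub> \<in> K" using K0 Ks by blast
    have "y \<in> X" using z F2_l0[OF V y(1)] by (force simp: X_def)
    then have "X \<noteq> K" using y by blast
    have "X \<notin> \<K>" using max[of X] \<open>X \<noteq> K\<close> by (auto simp: X_def)
    moreover have "K0 \<subseteq> X" "X \<subseteq> carrier V" using Ks y V by (auto simp: X_def)
    moreover have "a \<oplus>\<^bsub>V\<^esub> b \<in> X" if ab: "a \<in> X" "b \<in> X" for a b
    proof -
      have 1: "a' \<oplus>\<^bsub>V\<^esub> (b' \<oplus>\<^bsub>V\<^esub> y) \<in> X" "(b' \<oplus>\<^bsub>V\<^esub> y) \<oplus>\<^bsub>V\<^esub> a' \<in> X" if "a' \<in> K" "b' \<in> K" for a' b'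
      proof -
        have e: "a' \<oplus>\<^bsub>V\<^esub> (b' \<oplus>\<^bsub>V\<^esub> y) = (a' \<oplus>\<^bsub>V\<^esub> b') \<oplus>\<^bsub>V\<^esub> y"
          using F2_assoc[OF V KV[OF that(1)] KV[OF that(2)] y(1)] by simp
        show "a' \<oplus>\<^bsub>V\<^esub> (b' \<oplus>\<^bsub>V\<^esub> y) \<in> X" unfolding e using Ka[OF that] by (auto simp: X_def)
        moreover have "(b' \<oplus>\<^bsub>V\<^esub> y) \<oplus>\<^bsub>V\<^esub> a' = a' \<oplus>\<^bsub>V\<^esub> (b' \<oplus>\<^bsub>V\<^esub> y)"
          using F2_comm[OF V _ KV[OF that(1)]] KV[OF that(2)] y(1) V by simp
        ultimately show "(b' \<oplus>\<^bsub>V\<^esub> y) \<oplus>\<^bsub>V\<^esub> a' \<in> X" by simp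
      qed
      have 2: "(a' \<oplus>\<^bsub>V\<^esub> y) \<oplus>\<^bsub>V\<^esub> (b' \<oplus>\<^bsub>V\<^esub> y) \<in> X" if "a' \<in> K" "b' \<in> K" for a' b'
      proof -
        have "(a' \<oplus>\<^bsub>V\<^esub> y) \<oplus>\<^bsub>V\<^esub> (b' \<oplus>\<^bsub>V\<^esub> y) = a' \<oplus>\<^bsub>V\<^esub> (y \<oplus>\<^bsub>V\<^esub> (y \<oplus>\<^bsub>V\<^esub> b'))"
          using KV[OF that(1)] KV[OF that(2)] y(1) V F2_comm[OF V KV[OF that(2)] y(1)] by (simp add: F2_assoc)
        also have "\<dots> = a' \<oplus>\<^bsub>V\<^esub> b'" using KV[OF that(2)] y(1) V by simp
        finally show ?thesis using Ka[OF that] by (simp add: X_def)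
      qed
      have KX: "k \<in> X" if "k \<in> K" for k using that by (simp add: X_def)
      have "a \<in> K \<or> (\<exists>k\<in>K. a = k \<oplus>\<^bsub>V\<^esub> y)" "b \<in> K \<or> (\<exists>k\<in>K. b = k \<oplus>\<^bsub>V\<^esub> y)"
        using ab by (auto simp: X_def)
      then show ?thesis
        by (elim disjE bexE) (simp_all only: 1 2 KX Ka)
    qed
    ultimately have "x0 \<in> X" unfolding \<K>_def by blast
    then obtain k where k: "k \<in> K" "x0 = k \<oplus>\<^bsub>V\<^esub> y" using Ks(3) by (auto simp: X_def)
    have "y \<oplus>\<^bsub>V\<^esub> x0 = k" using k y(1) KV V F2_comm[OF V KV[OF k(1)] y(1)] by simp
    then show ?thesis using k by simp
  qed
  show ?thesis
  proof (rule that[of "\<lambda>x. if x \<in> K then 0 else 1"])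
    show "x \<in> K0 \<Longrightarrow> (if x \<in> K then 0 else 1) = (0::bit)" for x using Ks by auto
    show "(if x0 \<in> K then 0 else 1) = (1::bit)" using Ks by simp
    fix x y assume x: "x \<in> carrier V" and y: "y \<in> carrier V"
    have m: "b \<in> K" if "a \<in> K" "a \<oplus>\<^bsub>V\<^esub> b \<in> K" "b \<in> carrier V" for a b
      using Ka[OF that(1,2)] F2_self2[OF V KV[OF that(1)] that(3)] by simp
    consider "x \<in> K" "y \<in> K" | "x \<in> K" "y \<notin> K" | "x \<notin> K" "y \<in> K" | "x \<notin> K" "y \<notin> K" by blast
    then show "(if x \<oplus>\<^bsub>V\<^esub> y \<in> K then 0 else 1) = (if x \<in> K then 0 else 1) + (if y \<in> K then 0 else (1::bit))"
    proof cases
      case 1 then show ?thesis using Ka by simp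
    next
      case 2 then show ?thesis using m[of x y] y by auto
    next
      case 3 then show ?thesis using m[of y x] x F2_comm[OF V x y] by auto
    next
      case 4
      have "(x \<oplus>\<^bsub>V\<^esub> x0) \<oplus>\<^bsub>V\<^esub> (y \<oplus>\<^bsub>V\<^esub> x0) = x \<oplus>\<^bsub>V\<^esub> (x0 \<oplus>\<^bsub>V\<^esub> (x0 \<oplus>\<^bsub>V\<^esub> y))"
        using x y x0(1) V F2_comm[OF V y x0(1)] by (simp add: F2_assoc)
      also have "\<dots> = x \<oplus>\<^bsub>V\<^esub> y" using x y x0(1) V by simp
      finally have "x \<oplus>\<^bsub>V\<^esub> y \<in> K" using Ka[OF coset[OF x 4(1)] coset[OF y 4(2)]] by simp
      then show ?thesis using 4 by simp
    qed
  qed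
qed

section \<open>Complexes of projective modules with bounded homology\<close>

definition cycles :: "(nat \<Rightarrow> 'a sq_module) \<Rightarrow> (nat \<Rightarrow> nat \<Rightarrow> 'a \<Rightarrow> 'a) \<Rightarrow> nat \<Rightarrow> nat \<Rightarrow> 'a set" where
  "cycles C d s n = {x \<in> carrier (piece (C s) n). s \<noteq> 0 \<longrightarrow> d (s - 1) n x = \<zero>\<^bsub>piece (C (s - 1)) n\<^esub>}"

text \<open>Exactness is too much to ask for, since \<open>\<Omega>\<close> does not preserve it; it does preserve that the homology is
  bounded above in each homological degree.\<close>

definition projective_complex :: "(nat \<Rightarrow> (nat \<times> bit) sq_module) \<Rightarrow> (nat \<Rightarrow> nat \<Rightarrow> nat \<times> bit \<Rightarrow> nat \<times> bit) \<Rightarrow> bool" where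
  "projective_complex C d \<longleftrightarrow> (\<forall>s. projective (C s)) \<and> (\<forall>s. d s \<in> sq_hom (C (Suc s)) (C s)) \<and>
     (\<forall>s n. d s n ` carrier (piece (C (Suc s)) n) \<subseteq> cycles C d s n) \<and>
     (\<forall>s. \<exists>b. \<forall>n>b. cycles C d s n \<subseteq> d s n ` carrier (piece (C (Suc s)) n))"

text \<open>Degree 0 is included, where every cocycle has to vanish; this accounts for the empty sum
  at s = 0 in the theorem.\<close>

definition hom_acyclic :: "(nat \<Rightarrow> 'a sq_module) \<Rightarrow> (nat \<Rightarrow> nat \<Rightarrow> 'a \<Rightarrow> 'a) \<Rightarrow> bit sq_module \<Rightarrow> bool" where
  "hom_acyclic C d N \<longleftrightarrow> (\<forall>s. \<forall>f\<in>sq_hom (C s) N.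
     (\<forall>n. \<forall>x\<in>carrier (piece (C (Suc s)) n). f n (d s n x) = \<zero>\<^bsub>piece N n\<^esub>) \<longrightarrow>
     (case s of 0 \<Rightarrow> \<forall>n. \<forall>x\<in>carrier (piece (C s) n). f n x = \<zero>\<^bsub>piece N n\<^esub>
      | Suc r \<Rightarrow> \<exists>g\<in>sq_hom (C r) N. \<forall>n. \<forall>x\<in>carrier (piece (C s) n). g n (d r n x) = f n x))"

lemma cycles_Suc: "x \<in> cycles C d (Suc r) n \<longleftrightarrow> x \<in> carrier (piece (C (Suc r)) n) \<and> d r n x = \<zero>\<^bsub>piece (C r) n\<^esub>"
  by (simp add: cycles_def)

lemma cycles_0: "cycles C d 0 n = carrier (piece (C 0) n)"
  by (simp add: cycles_def)

context
  fixes C :: "nat \<Rightarrow> (nat \<times> bit) sq_module" and d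
  assumes C: "projective_complex C d"
begin

lemma complex_projective: "projective (C s)"
  and complex_map: "d s \<in> sq_hom (C (Suc s)) (C s)"
  and complex_unstable: "unstable_module (C s)"
  and complex_boundary: "x \<in> carrier (piece (C (Suc s)) n) \<Longrightarrow> d s n x \<in> cycles C d s n"
  and complex_bounded: "\<exists>b. \<forall>n>b. cycles C d s n \<subseteq> d s n ` carrier (piece (C (Suc s)) n)"
proof -
  note C' = C[unfolded projective_complex_def]
  show P: "projective (C s)" using C' by blast
  show "unstable_module (C s)" by (rule projective_unstable[OF P])
  show "d s \<in> sq_hom (C (Suc s)) (C s)" using C' by blast
  show "\<exists>b. \<forall>n>b. cycles C d s n \<subseteq> d s n ` carrier (piece (C (Suc s)) n)" using C' by blast
  have "d s n ` carrier (piece (C (Suc s)) n) \<subseteq> cycles C d s n" using C' by blast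
  then show "x \<in> carrier (piece (C (Suc s)) n) \<Longrightarrow> d s n x \<in> cycles C d s n" by blast
qed

lemma complex_square: "x \<in> carrier (piece (C (Suc (Suc s))) n) \<Longrightarrow> d s n (d (Suc s) n x) = \<zero>\<^bsub>piece (C s) n\<^esub>"
  using complex_boundary[of x "Suc s" n] by (simp add: cycles_Suc)

lemma cycles_Sq: "x \<in> cycles C d s n \<Longrightarrow> Sq (C s) i n x \<in> cycles C d s (n + i)"
  using unstable_Sq_closed[OF complex_unstable _ refl, of x s n i]
    sq_hom_Sq[OF complex_map[of "s - 1"], of x n "n + i" i] unstable_Sq_zero[OF complex_unstable refl, of "s - 1" i n]
  by (cases s) (auto simp: cycles_def)

lemma omega_boundary:
  assumes x: "x \<in> carrier (piece (C (Suc s)) (Suc n))"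
  shows "omega_map (C (Suc s)) (C s) (d s) n (omega_rep (C (Suc s)) (Suc n) x) = omega_rep (C s) (Suc n) (d s (Suc n) x)"
  by (rule omega_map_rep[OF complex_unstable complex_unstable complex_map x])

text \<open>If x is a cycle after applying \<open>omega\<close>, in degree n, then dx is zero or
  Sq^h z with 2h = n + 1. In the second case reducedness gives dz = 0, and above the bound z = dw.
  Then x + Sq^h w is a cycle of \<open>C\<close> with the same class as x, hence a boundary in large
  degrees.\<close>

lemma omega_complex: "projective_complex (\<lambda>s. omega (C s)) (\<lambda>s. omega_map (C (Suc s)) (C s) (d s))"
  (is "projective_complex ?D ?d")
  unfolding projective_complex_def
proof (intro conjI allI)
  note U = complex_unstable
  show "projective (?D s)" for s by (rule omega_projective[OF complex_projective])
  show dh: "?d s \<in> sq_hom (?D (Suc s)) (?D s)" for s by (rule omega_map_hom[OF U U complex_map])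
  show "?d s n ` carrier (piece (?D (Suc s)) n) \<subseteq> cycles ?D ?d s n" for s n
  proof
    fix y assume "y \<in> ?d s n ` carrier (piece (?D (Suc s)) n)"
    then obtain x where x: "x \<in> carrier (piece (C (Suc s)) (Suc n))" "y = ?d s n x" "x \<in> carrier (piece (?D (Suc s)) n)"
       "omega_rep (C (Suc s)) (Suc n) x = x"
      using omega_sub[OF U] by blast
    have yD: "y \<in> carrier (piece (?D s) n)" unfolding x(2) by (rule sq_hom_closed[OF dh x(3)])
    have y: "y = omega_rep (C s) (Suc n) (d s (Suc n) x)" using omega_boundary[OF x(1)] x by simp
    have "?d r n y = \<zero>\<^bsub>piece (?D r) n\<^esub>" if s: "s = Suc r" for r
    proof -
      have "?d r n y = omega_rep (C r) (Suc n) (d r (Suc n) (d (Suc r) (Suc n) x))"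
        using omega_boundary[of "d (Suc r) (Suc n) x" r n] sq_hom_closed[OF complex_map, of x "Suc r" "Suc n"] x(1)
        unfolding y s by simp
      also have "\<dots> = \<zero>\<^bsub>piece (?D r) n\<^esub>"
        using complex_square[of x r "Suc n"] x(1) unfolding s by (simp add: omega_zero[OF U])
      finally show ?thesis .
    qed
    then show "y \<in> cycles ?D ?d s n" using yD by (cases s) (simp_all add: cycles_def)
  qed
  show "\<exists>b. \<forall>n>b. cycles ?D ?d s n \<subseteq> ?d s n ` carrier (piece (?D (Suc s)) n)" for s
  proof -
    obtain b where b: "\<And>n. b < n \<Longrightarrow> cycles C d s n \<subseteq> d s n ` carrier (piece (C (Suc s)) n)"
      using complex_bounded[of s] by blast
    obtain b' where b': "\<And>n. b' < n \<Longrightarrow> cycles C d (s - 1) n \<subseteq> d (s - 1) n ` carrier (piece (C (Suc (s - 1))) n)"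
      using complex_bounded[of "s - 1"] by blast
    have hit: "x \<in> ?d s n ` carrier (piece (?D (Suc s)) n)"
      if x: "x \<in> carrier (piece (?D s) n)" and y: "y \<in> cycles C d s (Suc n)"
        "omega_rep (C s) (Suc n) x = omega_rep (C s) (Suc n) y" and n: "b < Suc n" for x y n
    proof -
      obtain v where v: "v \<in> carrier (piece (C (Suc s)) (Suc n))" "y = d s (Suc n) v" using b[OF n] y(1) by blast
      then have "x = ?d s n (omega_rep (C (Suc s)) (Suc n) v)"
        using omega_boundary[OF v(1)] y(2) omega_sub[OF U x] by simp
      then show ?thesis using omega_rep_in[OF U v(1)] by blast
    qed
    \<comment> \<open>The auxiliary class z has half of degree n + 1, hence the factor 2 in front of
      \<open>b'\<close>.\<close>
    have "cycles ?D ?d s n \<subseteq> ?d s n ` carrier (piece (?D (Suc s)) n)" if n: "max b (2 * b') < n" for n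
    proof
      fix x assume x: "x \<in> cycles ?D ?d s n"
      then have xD: "x \<in> carrier (piece (?D s) n)" by (simp add: cycles_def)
      then have x': "x \<in> carrier (piece (C s) (Suc n))" "omega_rep (C s) (Suc n) x = x" using omega_sub[OF U] by auto
      have nb: "b < Suc n" using n by simp
      show "x \<in> ?d s n ` carrier (piece (?D (Suc s)) n)"
      proof (cases s)
        case 0
        then show ?thesis using hit[OF xD, of x] x' nb by (simp add: cycles_0)
      next
        case (Suc r)
        let ?dx = "d r (Suc n) x"
        have xS: "x \<in> carrier (piece (C (Suc r)) (Suc n))" using x' Suc by simp
        have dxc: "?dx \<in> carrier (piece (C r) (Suc n))" by (rule sq_hom_closed[OF complex_map xS])
        have "omega_rep (C r) (Suc n) ?dx = \<zero>\<^bsub>piece (?D r) n\<^esub>"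
          using x omega_boundary[OF xS] x'(2) unfolding Suc by (simp add: cycles_Suc)
        then have "?dx \<in> frobenius_image (C r) (Suc n)" using omega_rep_zero_iff[OF U dxc] by blast
        then consider "?dx = \<zero>\<^bsub>piece (C r) (Suc n)\<^esub>" | h z where "z \<in> carrier (piece (C r) h)" "Suc n = h + h" "?dx = Sq (C r) h h z"
          unfolding frobenius_image_def by blast
        then show ?thesis
        proof cases
          case 1
          then show ?thesis using hit[OF xD, of x] nb xS by (simp add: cycles_Suc Suc)
        next
          case (2 h z)
          \<comment> \<open>The Frobenius of dz is d(dx) = 0, and the Frobenius is injective on
            projective modules.\<close>
          have "z \<in> cycles C d r h"
          proof (cases r)
            case (Suc q)
            have zq: "z \<in> carrier (piece (C (Suc q)) h)" using 2(1) Suc by simp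
            have "Sq (C q) h h (d q h z) = d q (h + h) (Sq (C (Suc q)) h h z)"
              by (rule sq_hom_Sq[OF complex_map zq refl, symmetric])
            also have "\<dots> = \<zero>\<^bsub>piece (C q) (h + h)\<^esub>"
              using complex_square[of x q "Suc n"] xS 2(2,3) Suc by simp
            finally have "d q h z = \<zero>\<^bsub>piece (C q) h\<^esub>"
              by (rule projective_reduced[OF complex_projective sq_hom_closed[OF complex_map zq]])
            then show ?thesis using zq Suc by (simp add: cycles_Suc)
          qed (use 2(1) in \<open>simp add: cycles_0\<close>)
          moreover have "b' < h" using n 2(2) by linarith
          ultimately obtain w where w: "w \<in> carrier (piece (C s) h)" "z = d r h w"
            using b'[of h] Suc by auto
          have wS: "w \<in> carrier (piece (C (Suc r)) h)" using w Suc by simp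
          let ?w = "Sq (C s) h h w"
          have wc: "?w \<in> carrier (piece (C s) (Suc n))" unfolding 2(2) by (rule unstable_Sq_closed[OF U w(1) refl])
          let ?y = "x \<oplus>\<^bsub>piece (C s) (Suc n)\<^esub> ?w"
          note V = unstable_vs[OF U, of s "Suc n"]
          have "d r (Suc n) ?w = Sq (C r) h h z"
            unfolding 2(2) w(2) Suc by (rule sq_hom_Sq[OF complex_map wS refl])
          then have "d r (Suc n) ?y = \<zero>\<^bsub>piece (C r) (Suc n)\<^esub>"
            using sq_hom_add[OF complex_map xS, of ?w] wc 2(3) dxc unstable_vs[OF U, of r] unfolding Suc by simp
          then have "?y \<in> cycles C d s (Suc n)" using x'(1) wc V by (simp add: cycles_Suc Suc)
          moreover have "omega_rep (C s) (Suc n) x = omega_rep (C s) (Suc n) ?y"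
          proof -
            have "x \<oplus>\<^bsub>piece (C s) (Suc n)\<^esub> ?y = ?w" using x'(1) wc V by simp
            then have "x \<oplus>\<^bsub>piece (C s) (Suc n)\<^esub> ?y \<in> frobenius_image (C s) (Suc n)"
              using frobenius_image_Sq_top[OF U w(1)] 2(2) by simp
            then show ?thesis using omega_rep_eq_iff[OF U x'(1), of ?y] x'(1) wc V by simp
          qed
          ultimately show ?thesis using hit[OF xD _ _ nb] by blast
        qed
      qed
    qed
    then show ?thesis by blast
  qed
qed

text \<open>As Sq^n u^n = u^(2n), a nonzero value at \<open>z\<close> persists on the iterated top
  squares of \<open>z\<close>. These are cycles of arbitrarily large degree, so some of them are
  boundaries, where \<open>f\<close> vanishes.\<close>

lemma RP_kills_cycles:
  assumes f: "f \<in> sq_hom (C s) (RP 0)"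
    and fd: "\<And>n x. x \<in> carrier (piece (C (Suc s)) n) \<Longrightarrow> f n (d s n x) = 0"
    and z: "z \<in> cycles C d s n"
  shows "f n z = 0"
proof (rule ccontr)
  assume nz: "f n z \<noteq> 0"
  have cyc: "x \<in> carrier (piece (C s) n)" if "x \<in> cycles C d s n" for x n using that by (simp add: cycles_def)
  have "\<exists>n z. k < n \<and> z \<in> cycles C d s n \<and> f n z \<noteq> 0" for k
  proof (induction k)
    case 0
    \<comment> \<open>\<open>RP 0\<close> vanishes in degree 0; a positive degree is what makes
      doubling increase it.\<close>
    have "n \<noteq> 0" using sq_hom_closed[OF f cyc[OF z]] nz by (auto split: if_splits)
    then show ?case using z nz by blast
  next
    case (Suc k)
    then obtain n z where n: "k < n" "z \<in> cycles C d s n" "f n z \<noteq> 0" by blast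
    have "f (n + n) (Sq (C s) n n z) = f n z"
      using sq_hom_Sq[OF f cyc[OF n(2)] refl, of n] n(1) by simp
    then show ?case using n cycles_Sq[OF n(2), of n] by (intro exI[of _ "n + n"] exI[of _ "Sq (C s) n n z"]) auto
  qed
  moreover obtain b where "\<And>n. b < n \<Longrightarrow> cycles C d s n \<subseteq> d s n ` carrier (piece (C (Suc s)) n)"
    using complex_bounded by blast
  ultimately show False using fd by blast
qed

end

lemma conj_Sq_zero:
  assumes M: "unstable_module M" and e: "e = d + n"
  shows "conj_Sq M n d \<zero>\<^bsub>piece M d\<^esub> = \<zero>\<^bsub>piece M e\<^esub>"
proof -
  have z: "\<zero>\<^bsub>piece M d\<^esub> \<in> carrier (piece M d)" by (rule F2_zero[OF unstable_vs[OF M]])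
  have "conj_Sq M n d (\<zero>\<^bsub>piece M d\<^esub> \<oplus>\<^bsub>piece M d\<^esub> \<zero>\<^bsub>piece M d\<^esub>) = \<zero>\<^bsub>piece M e\<^esub>"
    using conj_Sq_add[OF M z z, of n] conj_Sq_closed[OF M z refl, of n] unstable_vs[OF M] e by simp
  then show ?thesis using z unstable_vs[OF M] by simp
qed

text \<open>A map \<open>f\<close> on \<open>C\<^sub>r\<^sub>+\<^sub>1\<close> that kills the cycles amounts to a functional on the colimit over the Frobenius of
  the boundaries in degrees \<open>2 ^ j\<close>. Extend it to a functional \<open>\<Psi>\<close> of \<open>C\<^sub>r\<close>; the wanted map is
  \<open>p \<mapsto> \<Psi>(\<chi>(Sq\<^sup>2^j\<^sup>-\<^sup>m) p) u\<^sup>m\<close> for large \<open>j\<close>. Instead of the colimit, sequences modulo eventually zero ones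
  are used.\<close>

lemma RP_0_acyclic:
  assumes C: "projective_complex C d"
  shows "hom_acyclic C d (RP 0)"
  unfolding hom_acyclic_def
proof (intro allI ballI impI)
  fix s f assume f: "f \<in> sq_hom (C s) (RP 0)"
    and "\<forall>n. \<forall>x\<in>carrier (piece (C (Suc s)) n). f n (d s n x) = \<zero>\<^bsub>piece (RP 0) n\<^esub>"
  then have fd: "f n (d s n x) = 0" if "x \<in> carrier (piece (C (Suc s)) n)" for n x using that by simp
  note kill = RP_kills_cycles[OF C f fd]
  note U = complex_unstable[OF C] and R = RP_unstable[of 0]
  show "case s of 0 \<Rightarrow> \<forall>n. \<forall>x\<in>carrier (piece (C s) n). f n x = \<zero>\<^bsub>piece (RP 0) n\<^esub>
      | Suc r \<Rightarrow> \<exists>g\<in>sq_hom (C r) (RP 0). \<forall>n. \<forall>x\<in>carrier (piece (C s) n). g n (d r n x) = f n x"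
  proof (cases s)
    case 0
    then show ?thesis using kill by (simp add: cycles_0)
  next
    case s: (Suc r)
    have cyc: "x \<in> cycles C d s n \<longleftrightarrow> x \<in> carrier (piece (C s) n) \<and> d r n x = \<zero>\<^bsub>piece (C r) n\<^esub>" for x n
      unfolding s by (rule cycles_Suc)
    have dh: "d r \<in> sq_hom (C s) (C r)" using complex_map[OF C, of r] s by simp
    have "\<exists>g\<in>sq_hom (C r) (RP 0). \<forall>n. \<forall>x\<in>carrier (piece (C s) n). g n (d r n x) = f n x"
    \<comment> \<open>The functional will come from separating one sequence from a subspace, which
      requires a class \<open>b0\<close> with value 1; the zero map is treated apart.\<close>
    proof (cases "\<forall>n. \<forall>x\<in>carrier (piece (C s) n). f n x = 0")
      case True
      have "sq_zero (C r) (RP 0) \<in> sq_hom (C r) (RP 0)"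
        by (rule sq_zero_hom[OF U unstable_vs[OF R] unstable_Sq_zero[OF R refl]])
      moreover have "sq_zero (C r) (RP 0) n (d r n x) = 0" if "x \<in> carrier (piece (C s) n)" for n x
        using sq_hom_closed[OF dh that] by (simp add: sq_zero_def)
      ultimately show ?thesis using True by (intro bexI[of _ "sq_zero (C r) (RP 0)"]) simp_all
    next
      case False
      then obtain m0 b0 where b0: "b0 \<in> carrier (piece (C s) m0)" "f m0 b0 = 1" by auto
      have m0: "0 < m0" using sq_hom_closed[OF f b0(1)] b0(2) by (auto split: if_splits)
      define V where "V = mk_vs {x. \<forall>j. x j \<in> carrier (piece (C r) (2 ^ j))} (\<lambda>j. \<zero>\<^bsub>piece (C r) (2 ^ j)\<^esub>)
        (\<lambda>x y j. x j \<oplus>\<^bsub>piece (C r) (2 ^ j)\<^esub> y j) (\<lambda>b x j. b \<odot>\<^bsub>piece (C r) (2 ^ j)\<^esub> x j)"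
      note CV = unstable_vs[OF U[of r]] and CsV = unstable_vs[OF U[of s]]
      have Vc: "x \<in> carrier V \<longleftrightarrow> (\<forall>j. x j \<in> carrier (piece (C r) (2 ^ j)))"
        and Va: "x \<oplus>\<^bsub>V\<^esub> y = (\<lambda>j. x j \<oplus>\<^bsub>piece (C r) (2 ^ j)\<^esub> y j)"
        and Vz: "\<zero>\<^bsub>V\<^esub> = (\<lambda>j. \<zero>\<^bsub>piece (C r) (2 ^ j)\<^esub>)" for x y
        by (simp_all add: V_def)
      have V: "module F2 V"
        by (rule module_F2I) (auto simp: Vc Va Vz CV F2_assoc[OF CV] fun_eq_iff V_def F2_smult[OF CV] intro: F2_comm[OF CV])
      \<comment> \<open>\<open>K0\<close> contains all eventually zero sequences, so a functional
        that kills it sees only tails. It also contains the tails d w with f w = 0, so on boundaries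
        such a functional depends only on the values of \<open>f\<close>.\<close>
      define K0 where "K0 = {x \<in> carrier V. \<exists>N. \<forall>j\<ge>N. \<exists>w\<in>carrier (piece (C s) (2 ^ j)).
        x j = d r (2 ^ j) w \<and> f (2 ^ j) w = 0}"
      \<comment> \<open>For j < m the difference 2^j - m could be truncated; those entries are set
        to zero, since only the tail matters.\<close>
      define sq where "sq m p j = (if m \<le> j then conj_Sq (C r) (2 ^ j - m) m p else \<zero>\<^bsub>piece (C r) (2 ^ j)\<^esub>)" for m p j
      have pow: "m + (2 ^ j - m) = 2 ^ j" if "m \<le> j" for m j :: nat
        using that less_exp[of j] by linarith
      have sqc: "sq m p \<in> carrier V" if "p \<in> carrier (piece (C r) m)" for m p
        using conj_Sq_closed[OF U that pow[symmetric]] CV by (simp add: Vc sq_def)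
      have d_conj: "d r (2 ^ j) (conj_Sq (C s) (2 ^ j - m) m b) = conj_Sq (C r) (2 ^ j - m) m (d r m b)"
        if "b \<in> carrier (piece (C s) m)" "m \<le> j" for b m j
        by (rule conj_Sq_hom[OF U that(1) dh CV pow[OF that(2), symmetric]])
      have f_conj: "\<exists>N. \<forall>j\<ge>N. conj_Sq (C s) (2 ^ j - m) m b \<in> carrier (piece (C s) (2 ^ j)) \<and>
          f (2 ^ j) (conj_Sq (C s) (2 ^ j - m) m b) = f m b \<and> sq m (d r m b) j = d r (2 ^ j) (conj_Sq (C s) (2 ^ j - m) m b)"
        if b: "b \<in> carrier (piece (C s) m)" and m: "0 < m" for b m
      proof -
        obtain N where N: "\<And>j x. N \<le> j \<Longrightarrow> conj_Sq (RP 0) (2 ^ j - m) m x = x" using RP_conj_Sq[OF m] by blast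
        show ?thesis
        proof (intro exI[of _ "max N m"] allI impI)
          fix j assume j: "max N m \<le> j"
          then have mj: "m \<le> j" "N \<le> j" by auto
          have "f (2 ^ j) (conj_Sq (C s) (2 ^ j - m) m b) = conj_Sq (RP 0) (2 ^ j - m) m (f m b)"
            by (rule conj_Sq_hom[OF U b f unstable_vs[OF R] pow[OF mj(1), symmetric]])
          then show "conj_Sq (C s) (2 ^ j - m) m b \<in> carrier (piece (C s) (2 ^ j)) \<and>
          f (2 ^ j) (conj_Sq (C s) (2 ^ j - m) m b) = f m b \<and> sq m (d r m b) j = d r (2 ^ j) (conj_Sq (C s) (2 ^ j - m) m b)"
            using N[OF mj(2)] d_conj[OF b mj(1)] conj_Sq_closed[OF U b pow[OF mj(1), symmetric]] mj(1) by (simp add: sq_def)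
        qed
      qed
      have ev0: "x \<in> K0" if "x \<in> carrier V" "\<And>j. N \<le> j \<Longrightarrow> x j = \<zero>\<^bsub>piece (C r) (2 ^ j)\<^esub>" for x N
      proof -
        have "\<zero>\<^bsub>piece (C s) (2 ^ j)\<^esub> \<in> carrier (piece (C s) (2 ^ j))" "d r (2 ^ j) \<zero>\<^bsub>piece (C s) (2 ^ j)\<^esub> = \<zero>\<^bsub>piece (C r) (2 ^ j)\<^esub>"
          "f (2 ^ j) \<zero>\<^bsub>piece (C s) (2 ^ j)\<^esub> = 0" for j
          using CsV sq_hom_zero[OF dh CsV CV] sq_hom_zero[OF f CsV unstable_vs[OF R], of "2 ^ j"] by auto
        with that show ?thesis unfolding K0_def by (simp, metis)
      qed
      let ?xb = "sq m0 (d r m0 b0)"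
      obtain \<Psi> :: "(nat \<Rightarrow> nat \<times> bit) \<Rightarrow> bit" where \<Psi>: "\<And>x y. x \<in> carrier V \<Longrightarrow> y \<in> carrier V \<Longrightarrow> \<Psi> (x \<oplus>\<^bsub>V\<^esub> y) = \<Psi> x + \<Psi> y"
        "\<And>x. x \<in> K0 \<Longrightarrow> \<Psi> x = 0" "\<Psi> ?xb = 1"
      proof (rule separating_functional[OF V, of K0 ?xb])
        show "K0 \<subseteq> carrier V" by (auto simp: K0_def)
        show "\<zero>\<^bsub>V\<^esub> \<in> K0" by (rule ev0[of _ 0]) (use F2_zero[OF V] in \<open>simp_all add: Vz\<close>)
        show "x \<oplus>\<^bsub>V\<^esub> y \<in> K0" if "x \<in> K0" "y \<in> K0" for x y
        proof -
          obtain N N' where N: "\<And>j. N \<le> j \<Longrightarrow> \<exists>w\<in>carrier (piece (C s) (2 ^ j)). x j = d r (2 ^ j) w \<and> f (2 ^ j) w = 0"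
            "\<And>j. N' \<le> j \<Longrightarrow> \<exists>w\<in>carrier (piece (C s) (2 ^ j)). y j = d r (2 ^ j) w \<and> f (2 ^ j) w = 0"
            using \<open>x \<in> K0\<close> \<open>y \<in> K0\<close> unfolding K0_def by blast
          have "\<exists>w\<in>carrier (piece (C s) (2 ^ j)). (x \<oplus>\<^bsub>V\<^esub> y) j = d r (2 ^ j) w \<and> f (2 ^ j) w = 0" if j: "max N N' \<le> j" for j
          proof -
            obtain w w' where w: "w \<in> carrier (piece (C s) (2 ^ j))" "x j = d r (2 ^ j) w" "f (2 ^ j) w = 0"
              "w' \<in> carrier (piece (C s) (2 ^ j))" "y j = d r (2 ^ j) w'" "f (2 ^ j) w' = 0"
              using N[of j] j by auto
            then show ?thesis
              using CsV sq_hom_add[OF dh w(1,4)] sq_hom_add[OF f w(1,4)]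
              by (intro bexI[of _ "w \<oplus>\<^bsub>piece (C s) (2 ^ j)\<^esub> w'"]) (simp_all add: Va)
          qed
          moreover have "x \<oplus>\<^bsub>V\<^esub> y \<in> carrier V" using that V by (simp add: K0_def)
          ultimately show ?thesis unfolding K0_def by blast
        qed
        show "?xb \<in> carrier V" by (rule sqc[OF sq_hom_closed[OF dh b0(1)]])
        \<comment> \<open>If the sequence were eventually d w with f w = 0, then the conjugate
          square of \<open>b0\<close> plus w would be a cycle on which \<open>f\<close> is
          1.\<close>
        show "?xb \<notin> K0"
        proof
          assume "?xb \<in> K0"
          then obtain N where N: "\<And>j. N \<le> j \<Longrightarrow> \<exists>w\<in>carrier (piece (C s) (2 ^ j)). ?xb j = d r (2 ^ j) w \<and> f (2 ^ j) w = 0"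
            unfolding K0_def by blast
          obtain N' where N': "\<And>j. N' \<le> j \<Longrightarrow> conj_Sq (C s) (2 ^ j - m0) m0 b0 \<in> carrier (piece (C s) (2 ^ j)) \<and>
            f (2 ^ j) (conj_Sq (C s) (2 ^ j - m0) m0 b0) = f m0 b0 \<and> ?xb j = d r (2 ^ j) (conj_Sq (C s) (2 ^ j - m0) m0 b0)"
            using f_conj[OF b0(1) m0] by blast
          define j where "j = max N N'"
          obtain w where w: "w \<in> carrier (piece (C s) (2 ^ j))" "?xb j = d r (2 ^ j) w" "f (2 ^ j) w = 0"
            using N[of j] by (auto simp: j_def)
          let ?c = "conj_Sq (C s) (2 ^ j - m0) m0 b0"
          have c: "?c \<in> carrier (piece (C s) (2 ^ j))" "f (2 ^ j) ?c = 1" "d r (2 ^ j) ?c = d r (2 ^ j) w"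
            using N'[of j] b0(2) w(2) by (auto simp: j_def)
          have "?c \<oplus>\<^bsub>piece (C s) (2 ^ j)\<^esub> w \<in> cycles C d s (2 ^ j)"
            using c w(1) CsV CV sq_hom_add[OF dh c(1) w(1)] sq_hom_closed[OF dh w(1)] by (simp add: cyc)
          from kill[OF _ this] have "f (2 ^ j) (?c \<oplus>\<^bsub>piece (C s) (2 ^ j)\<^esub> w) = 0" by simp
          then show False using sq_hom_add[OF f c(1) w(1)] c(2) w(3) by simp
        qed
      qed blast
      have \<Psi>_eq: "\<Psi> x = \<Psi> y" if "x \<in> carrier V" "y \<in> carrier V" "x \<oplus>\<^bsub>V\<^esub> y \<in> K0" for x y
        using \<Psi>(1)[OF that(1,2)] \<Psi>(2)[OF that(3)] by (cases "\<Psi> x"; cases "\<Psi> y") auto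
      define g where "g m p = (if m = 0 then 0 else \<Psi> (sq m p))" for m p
      have "(\<lambda>m. restrict (g m) (carrier (piece (C r) m))) \<in> sq_hom (C r) (RP 0)"
      proof (rule sq_hom_restrictI)
        fix m p assume p: "p \<in> carrier (piece (C r) m)"
        show "g m p \<in> carrier (piece (RP 0) m)" by (simp add: g_def)
        show "Sq (C r) i m p \<in> carrier (piece (C r) (m + i))" for i by (rule unstable_Sq_closed[OF U p refl])
        \<comment> \<open>Up to finitely many entries, \<open>conj_Sq_right\<close> turns the
          sequence of Sq^i p into m choose i times the sequence of p. For m = 0 both sides are
          zero.\<close>
        show "g (m + i) (Sq (C r) i m p) = Sq (RP 0) i m (g m p)" for i
        proof (cases "m = 0")
          case True
          show ?thesis
          proof (cases "i = 0")
            case False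
            have z: "Sq (C r) i m p = \<zero>\<^bsub>piece (C r) i\<^esub>" using unstable_Sq_big[OF U p, of i] True False by simp
            have zc: "\<zero>\<^bsub>piece (C r) i\<^esub> \<in> carrier (piece (C r) i)" using CV by simp
            have "sq i \<zero>\<^bsub>piece (C r) i\<^esub> \<in> K0"
              by (rule ev0[OF sqc[OF zc], of 0]) (use conj_Sq_zero[OF U pow[symmetric]] in \<open>simp add: sq_def\<close>)
            then show ?thesis using True False \<Psi>(2) z by (simp add: g_def)
          qed (use True in \<open>simp add: g_def\<close>)
        next
          case False
          let ?y = "if odd (m choose i) then sq m p else \<zero>\<^bsub>V\<^esub>"
          have y: "?y \<in> carrier V" using sqc[OF p] F2_zero[OF V] by simp
          have x: "sq (m + i) (Sq (C r) i m p) \<in> carrier V" by (rule sqc[OF unstable_Sq_closed[OF U p refl]])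
          have "sq (m + i) (Sq (C r) i m p) \<oplus>\<^bsub>V\<^esub> ?y \<in> K0"
          proof (rule ev0[of _ "m + i"])
            fix j assume j: "m + i \<le> j"
            then have j': "m + i \<le> 2 ^ j" "m \<le> j" using less_exp[of j] by linarith+
            have "sq (m + i) (Sq (C r) i m p) j = ?y j"
              using conj_Sq_right[OF U countableI_type p j'] j by (simp add: sq_def Vz)
            then show "(sq (m + i) (Sq (C r) i m p) \<oplus>\<^bsub>V\<^esub> ?y) j = \<zero>\<^bsub>piece (C r) (2 ^ j)\<^esub>"
              using y CV by (simp only: Va Vc F2_self)
          qed (use F2_add[OF V x y] in simp)
          then have "\<Psi> (sq (m + i) (Sq (C r) i m p)) = \<Psi> ?y" by (rule \<Psi>_eq[OF x y])
          moreover have "\<Psi> \<zero>\<^bsub>V\<^esub> = 0" using \<Psi>(1)[OF F2_zero[OF V] F2_zero[OF V]] V by simp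
          ultimately show ?thesis using False by (auto simp: g_def of_nat_bit_even elim!: oddE)
        qed
        fix q assume q: "q \<in> carrier (piece (C r) m)"
        have "sq m (p \<oplus>\<^bsub>piece (C r) m\<^esub> q) = sq m p \<oplus>\<^bsub>V\<^esub> sq m q"
        proof
          fix j
          show "sq m (p \<oplus>\<^bsub>piece (C r) m\<^esub> q) j = (sq m p \<oplus>\<^bsub>V\<^esub> sq m q) j"
          proof (cases "m \<le> j")
            case True
            then show ?thesis using conj_Sq_add[OF U p q, of "2 ^ j - m"] pow[OF True] by (simp add: sq_def Va)
          qed (use CV in \<open>simp add: sq_def Va\<close>)
        qed
        then show "g m (p \<oplus>\<^bsub>piece (C r) m\<^esub> q) = g m p \<oplus>\<^bsub>piece (RP 0) m\<^esub> g m q"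
          using \<Psi>(1)[OF sqc[OF p] sqc[OF q]] by (simp add: g_def)
      qed (use CV unstable_vs[OF R] in simp_all)
      moreover have "g m (d r m b) = f m b" if b: "b \<in> carrier (piece (C s) m)" for m b
      proof (cases "m = 0")
        case True
        then show ?thesis using sq_hom_closed[OF f b] by (simp add: g_def)
      next
        case False
        then have m: "0 < m" by simp
        have x: "sq m (d r m b) \<in> carrier V" by (rule sqc[OF sq_hom_closed[OF dh b]])
        obtain N where N: "\<And>j. N \<le> j \<Longrightarrow> conj_Sq (C s) (2 ^ j - m) m b \<in> carrier (piece (C s) (2 ^ j)) \<and>
          f (2 ^ j) (conj_Sq (C s) (2 ^ j - m) m b) = f m b \<and> sq m (d r m b) j = d r (2 ^ j) (conj_Sq (C s) (2 ^ j - m) m b)"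
          using f_conj[OF b m] by blast
        show ?thesis
        proof (cases "f m b = 0")
          case True
          have "sq m (d r m b) \<in> K0" unfolding K0_def using x N True by (simp, metis)
          then show ?thesis using \<Psi>(2) False True by (simp add: g_def)
        next
          \<comment> \<open>\<open>f\<close> is 1 on both \<open>b\<close> and \<open>b0\<close>, so
            the sum of their sequences is eventually d w with f w = 0; the functional therefore
            takes the value 1 on both.\<close>
          case fb: False
          have x0: "?xb \<in> carrier V" by (rule sqc[OF sq_hom_closed[OF dh b0(1)]])
          obtain N' where N': "\<And>j. N' \<le> j \<Longrightarrow> conj_Sq (C s) (2 ^ j - m0) m0 b0 \<in> carrier (piece (C s) (2 ^ j)) \<and>
            f (2 ^ j) (conj_Sq (C s) (2 ^ j - m0) m0 b0) = f m0 b0 \<and> ?xb j = d r (2 ^ j) (conj_Sq (C s) (2 ^ j - m0) m0 b0)"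
            using f_conj[OF b0(1) m0] by blast
          have "\<exists>w\<in>carrier (piece (C s) (2 ^ j)). (sq m (d r m b) \<oplus>\<^bsub>V\<^esub> ?xb) j = d r (2 ^ j) w \<and> f (2 ^ j) w = 0"
            if j: "max N N' \<le> j" for j
          proof -
            let ?c = "conj_Sq (C s) (2 ^ j - m) m b" and ?e = "conj_Sq (C s) (2 ^ j - m0) m0 b0"
            have c: "?c \<in> carrier (piece (C s) (2 ^ j))" "?e \<in> carrier (piece (C s) (2 ^ j))"
              "f (2 ^ j) ?c = 1" "f (2 ^ j) ?e = 1" "sq m (d r m b) j = d r (2 ^ j) ?c" "?xb j = d r (2 ^ j) ?e"
              using N[of j] N'[of j] j fb b0(2) by simp_all
            show ?thesis
              using c CsV sq_hom_add[OF dh c(1,2)] sq_hom_add[OF f c(1,2)]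
              by (intro bexI[of _ "?c \<oplus>\<^bsub>piece (C s) (2 ^ j)\<^esub> ?e"]) (simp_all add: Va)
          qed
          then have "sq m (d r m b) \<oplus>\<^bsub>V\<^esub> ?xb \<in> K0" unfolding K0_def using F2_add[OF V x x0] by blast
          then show ?thesis using \<Psi>_eq[OF x x0] \<Psi>(3) False fb by (simp add: g_def)
        qed
      qed
      ultimately show ?thesis
        using sq_hom_closed[OF dh] by (intro bexI[of _ "\<lambda>m. restrict (g m) (carrier (piece (C r) m))"]) simp_all
    qed
    then show ?thesis using s by simp
  qed
qed

text \<open>Maps into a suspension are maps out of \<open>\<Omega>\<close>.\<close>

lemma RP_acyclic:
  "projective_complex C d \<Longrightarrow> hom_acyclic C d (RP t)"
proof (induction t arbitrary: C d)
  case 0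
  then show ?case by (rule RP_0_acyclic)
next
  case (Suc t)
  note C = Suc.prems
  note U = complex_unstable[OF C]
  let ?D = "\<lambda>s. omega (C s)" and ?d = "\<lambda>s. omega_map (C (Suc s)) (C s) (d s)"
  have acyc: "hom_acyclic ?D ?d (RP t)" by (rule Suc.IH[OF omega_complex[OF C]])
  show ?case
    unfolding hom_acyclic_def
  proof (intro allI ballI impI)
    fix s f assume f: "f \<in> sq_hom (C s) (RP (Suc t))"
      and fd: "\<forall>n. \<forall>x\<in>carrier (piece (C (Suc s)) n). f n (d s n x) = \<zero>\<^bsub>piece (RP (Suc t)) n\<^esub>"
    have f0: "f 0 x = 0" if "x \<in> carrier (piece (C s) 0)" for x using sq_hom_closed[OF f that] by simp
    \<comment> \<open>\<open>RP (Suc t)\<close> is the suspension of \<open>RP t\<close>, so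
      \<open>f\<close> corresponds to a map \<open>v\<close> on \<open>omega (C s)\<close>.\<close>
    obtain v where v: "v \<in> sq_hom (?D s) (RP t)"
      "\<And>n x. x \<in> carrier (piece (C s) (Suc n)) \<Longrightarrow> v n (omega_rep (C s) (Suc n) x) = f (Suc n) x"
    proof (rule omega_factor[OF U[of s] RP_unstable[of t], of "\<lambda>n. f (Suc n)"])
      fix n i x assume x: "x \<in> carrier (piece (C s) (Suc n))"
      show "f (Suc n) x \<in> carrier (piece (RP t) n)" using sq_hom_closed[OF f x] by simp
      show "f (Suc (n + i)) (Sq (C s) i (Suc n) x) = Sq (RP t) i n (f (Suc n) x)"
        using sq_hom_Sq[OF f x, of "Suc (n + i)" i] by simp
      fix y assume y: "y \<in> carrier (piece (C s) (Suc n))"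
      show "f (Suc n) (x \<oplus>\<^bsub>piece (C s) (Suc n)\<^esub> y) = f (Suc n) x \<oplus>\<^bsub>piece (RP t) n\<^esub> f (Suc n) y"
        using sq_hom_add[OF f x y] by simp
    qed blast
    have vd: "v n (?d s n x) = \<zero>\<^bsub>piece (RP t) n\<^esub>" if x: "x \<in> carrier (piece (?D (Suc s)) n)" for n x
    proof -
      have x': "x \<in> carrier (piece (C (Suc s)) (Suc n))" "omega_rep (C (Suc s)) (Suc n) x = x"
        using omega_sub[OF U x] by auto
      have "?d s n x = omega_rep (C s) (Suc n) (d s (Suc n) x)"
        using omega_boundary[OF C x'(1)] x'(2) by simp
      then show ?thesis using v(2)[OF sq_hom_closed[OF complex_map[OF C] x'(1)]] fd x'(1) by simp
    qed
    then have key: "case s of 0 \<Rightarrow> \<forall>n. \<forall>x\<in>carrier (piece (?D s) n). v n x = \<zero>\<^bsub>piece (RP t) n\<^esub>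
      | Suc r \<Rightarrow> \<exists>g\<in>sq_hom (?D r) (RP t). \<forall>n. \<forall>x\<in>carrier (piece (?D s) n). g n (?d r n x) = v n x"
      using acyc v(1) unfolding hom_acyclic_def by blast
    show "case s of 0 \<Rightarrow> \<forall>n. \<forall>x\<in>carrier (piece (C s) n). f n x = \<zero>\<^bsub>piece (RP (Suc t)) n\<^esub>
      | Suc r \<Rightarrow> \<exists>g\<in>sq_hom (C r) (RP (Suc t)). \<forall>n. \<forall>x\<in>carrier (piece (C s) n). g n (d r n x) = f n x"
    proof (cases s)
      case 0
      have "f n x = 0" if x: "x \<in> carrier (piece (C s) n)" for n x
      proof (cases n)
        case (Suc n')
        then have x': "x \<in> carrier (piece (C s) (Suc n'))" using x by simp
        show ?thesis using v(2)[OF x'] key omega_rep_in[OF U x'] 0 Suc by simp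
      qed (use f0 x in simp)
      then show ?thesis using 0 by simp
    next
      case s: (Suc r)
      then obtain g where g: "g \<in> sq_hom (?D r) (RP t)" "\<And>n x. x \<in> carrier (piece (?D s) n) \<Longrightarrow> g n (?d r n x) = v n x"
        using key by auto
      \<comment> \<open>The adjoint of \<open>g\<close>, with value zero in degree 0, where
        \<open>RP (Suc t)\<close> vanishes.\<close>
      define g' where "g' n x = (case n of 0 \<Rightarrow> 0 | Suc n \<Rightarrow> g n (omega_rep (C r) (Suc n) x))" for n x
      have "(\<lambda>n. restrict (g' n) (carrier (piece (C r) n))) \<in> sq_hom (C r) (RP (Suc t))"
      proof (rule sq_hom_restrictI)
        fix n x assume x: "x \<in> carrier (piece (C r) n)"
        show "g' n x \<in> carrier (piece (RP (Suc t)) n)"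
        proof (cases n)
          case (Suc n')
          then show ?thesis using sq_hom_closed[OF g(1) omega_rep_in[OF U, of x r n']] x by (simp add: g'_def)
        qed (simp add: g'_def)
        show "Sq (C r) i n x \<in> carrier (piece (C r) (n + i))" for i by (rule unstable_Sq_closed[OF U x refl])
        show "g' (n + i) (Sq (C r) i n x) = Sq (RP (Suc t)) i n (g' n x)" for i
        proof (cases n)
          case 0
          show ?thesis
          proof (cases i)
            case (Suc i')
            then have "Sq (C r) i n x = \<zero>\<^bsub>piece (C r) (Suc i')\<^esub>" using unstable_Sq_big[OF U x, of i] 0 by simp
            then show ?thesis
              using 0 Suc sq_hom_zero[OF g(1) unstable_vs[OF omega_unstable[OF U]] unstable_vs[OF RP_unstable], of i']
              by (simp add: g'_def omega_zero[OF U])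
          qed (use 0 in \<open>simp add: g'_def\<close>)
        next
          case (Suc n')
          then have x': "x \<in> carrier (piece (C r) (Suc n'))" using x by simp
          show ?thesis
            using sq_hom_Sq[OF g(1) omega_rep_in[OF U x'], of "n' + i" i] omega_rep_Sq[OF U x', of i] Suc by (simp add: g'_def)
        qed
        fix y assume y: "y \<in> carrier (piece (C r) n)"
        show "g' n (x \<oplus>\<^bsub>piece (C r) n\<^esub> y) = g' n x \<oplus>\<^bsub>piece (RP (Suc t)) n\<^esub> g' n y"
        proof (cases n)
          case (Suc n')
          then have x': "x \<in> carrier (piece (C r) (Suc n'))" "y \<in> carrier (piece (C r) (Suc n'))" using x y by auto
          show ?thesis
            using sq_hom_add[OF g(1) omega_rep_in[OF U x'(1)] omega_rep_in[OF U x'(2)]] omega_rep_add[OF U x'] Suc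
            by (simp add: g'_def)
        qed (simp add: g'_def)
      qed (use unstable_vs[OF U] unstable_vs[OF RP_unstable] in simp_all)
      moreover have "g' n (d r n x) = f n x" if x: "x \<in> carrier (piece (C s) n)" for n x
      proof (cases n)
        case (Suc n')
        then have x': "x \<in> carrier (piece (C s) (Suc n'))" using x by simp
        then have x'': "x \<in> carrier (piece (C (Suc r)) (Suc n'))" using s by simp
        show ?thesis
          using g(2)[OF omega_rep_in[OF U x']] v(2)[OF x'] omega_boundary[OF C x''] Suc by (simp add: g'_def s)
      qed (use f0 x in \<open>simp add: g'_def\<close>)
      moreover have "d r n x \<in> carrier (piece (C r) n)" if "x \<in> carrier (piece (C s) n)" for n x
        using sq_hom_closed[OF complex_map[OF C], of x r n] that s by simp
      ultimately show ?thesis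
        unfolding s by (simp, intro bexI[of _ "\<lambda>n. restrict (g' n) (carrier (piece (C r) n))"]) (simp_all add: s)
    qed
  qed
qed

text \<open>A resolution is exact except at \<open>P 0\<close>, where the cokernel of
  \<open>d 0\<close> is concentrated in degree \<open>n\<close>; so \<open>n\<close> bounds the
  homology there.\<close>

lemma resolution_complex:
  assumes "projective_resolution P d e (suspension n F2_module)"
  shows "projective_complex P d"
proof -
  note r = assms[unfolded projective_resolution_def]
  have 0: "d 0 k ` carrier (piece (P (Suc 0)) k) = {x \<in> carrier (piece (P 0) k). e k x = 0}" for k
    using r by (simp add: suspension_F2_simps)
  have dh: "d s \<in> sq_hom (P (Suc s)) (P s)" for s using r by blast
  have eh: "e \<in> sq_hom (P 0) (suspension n F2_module)" using r by (simp add: sq_surj_def)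
  have Suc: "d (Suc s) k ` carrier (piece (P (Suc (Suc s))) k) = cycles P d (Suc s) k" for s k
    using r by (auto simp: cycles_Suc)
  have sub: "d s k ` carrier (piece (P (Suc s)) k) \<subseteq> cycles P d s k" for s k
  proof (cases s)
    case 0
    then show ?thesis using sq_hom_closed[OF dh] by (auto simp: cycles_0)
  qed (use Suc in simp)
  have "\<exists>b. \<forall>k>b. cycles P d s k \<subseteq> d s k ` carrier (piece (P (Suc s)) k)" for s
  proof (cases s)
    case 0
    have "x \<in> d 0 k ` carrier (piece (P (Suc 0)) k)" if "n < k" "x \<in> carrier (piece (P 0) k)" for k x
      unfolding \<open>\<And>k. d 0 k ` _ = _\<close> using sq_hom_closed[OF eh that(2)] that by (simp add: suspension_F2_simps)
    then show ?thesis using 0 by (intro exI[of _ n]) (auto simp: cycles_0)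
  next
    case (Suc s')
    then show ?thesis using \<open>\<And>s k. d (Suc s) k ` _ = _\<close> by auto
  qed
  then show ?thesis using r sub by (auto simp: projective_complex_def)
qed

subsection \<open>Quotients and direct sums\<close>

lemma module_F2_subspace:
  assumes V: "module F2 V" and Z: "Z \<subseteq> carrier V" "\<zero>\<^bsub>V\<^esub> \<in> Z" "\<And>x y. x \<in> Z \<Longrightarrow> y \<in> Z \<Longrightarrow> x \<oplus>\<^bsub>V\<^esub> y \<in> Z"
  shows "module F2 (V\<lparr>carrier := Z\<rparr>)"
proof (rule module_F2I)
  fix x y assume "x \<in> carrier (V\<lparr>carrier := Z\<rparr>)" "y \<in> carrier (V\<lparr>carrier := Z\<rparr>)"
  then have xy: "x \<in> carrier V" "y \<in> carrier V" using Z(1) by auto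
  show "x \<oplus>\<^bsub>V\<lparr>carrier := Z\<rparr>\<^esub> y = y \<oplus>\<^bsub>V\<lparr>carrier := Z\<rparr>\<^esub> x" using F2_comm[OF V xy] by simp
  show "\<zero>\<^bsub>V\<lparr>carrier := Z\<rparr>\<^esub> \<oplus>\<^bsub>V\<lparr>carrier := Z\<rparr>\<^esub> x = x" "x \<oplus>\<^bsub>V\<lparr>carrier := Z\<rparr>\<^esub> x = \<zero>\<^bsub>V\<lparr>carrier := Z\<rparr>\<^esub>"
    using V xy by simp_all
  show "b \<odot>\<^bsub>V\<lparr>carrier := Z\<rparr>\<^esub> x = (if b = 0 then \<zero>\<^bsub>V\<lparr>carrier := Z\<rparr>\<^esub> else x)" for b
    using F2_smult[OF V xy(1), of b] by simp
  fix z assume "z \<in> carrier (V\<lparr>carrier := Z\<rparr>)"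
  then have z: "z \<in> carrier V" using Z(1) by auto
  show "x \<oplus>\<^bsub>V\<lparr>carrier := Z\<rparr>\<^esub> y \<oplus>\<^bsub>V\<lparr>carrier := Z\<rparr>\<^esub> z = x \<oplus>\<^bsub>V\<lparr>carrier := Z\<rparr>\<^esub> (y \<oplus>\<^bsub>V\<lparr>carrier := Z\<rparr>\<^esub> z)"
    using F2_assoc[OF V xy z] by simp
qed (use Z in auto)

context
  fixes V :: "'a vs" and H :: "'a set"
  assumes V: "module F2 V" and H: "H \<subseteq> carrier V" "\<zero>\<^bsub>V\<^esub> \<in> H" "\<And>x y. x \<in> H \<Longrightarrow> y \<in> H \<Longrightarrow> x \<oplus>\<^bsub>V\<^esub> y \<in> H"
begin

lemma coset_iff: "x \<in> carrier V \<Longrightarrow> y \<in> H +>\<^bsub>V\<^esub> x \<longleftrightarrow> y \<in> carrier V \<and> x \<oplus>\<^bsub>V\<^esub> y \<in> H"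
proof
  assume x: "x \<in> carrier V"
  { assume "y \<in> H +>\<^bsub>V\<^esub> x"
    then obtain h where h: "h \<in> H" "y = h \<oplus>\<^bsub>V\<^esub> x" by (auto simp: a_r_coset_def')
    then have hV: "h \<in> carrier V" using H by auto
    have "x \<oplus>\<^bsub>V\<^esub> y = h" using h(2) x hV V F2_comm[OF V hV x] by simp
    then show "y \<in> carrier V \<and> x \<oplus>\<^bsub>V\<^esub> y \<in> H" using h hV x V by simp }
  assume y: "y \<in> carrier V \<and> x \<oplus>\<^bsub>V\<^esub> y \<in> H"
  have "y = (x \<oplus>\<^bsub>V\<^esub> y) \<oplus>\<^bsub>V\<^esub> x" using x y V F2_comm[OF V x, of y] by (simp add: F2_assoc)
  then show "y \<in> H +>\<^bsub>V\<^esub> x" using y by (auto simp: a_r_coset_def')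
qed

lemma coset_eq_iff:
  assumes x: "x \<in> carrier V" and y: "y \<in> carrier V"
  shows "H +>\<^bsub>V\<^esub> x = H +>\<^bsub>V\<^esub> y \<longleftrightarrow> x \<oplus>\<^bsub>V\<^esub> y \<in> H"
proof
  have yy: "y \<in> H +>\<^bsub>V\<^esub> y" using y H(2) V by (simp add: coset_iff)
  show "H +>\<^bsub>V\<^esub> x = H +>\<^bsub>V\<^esub> y \<Longrightarrow> x \<oplus>\<^bsub>V\<^esub> y \<in> H" using yy coset_iff[OF x] by blast
  assume xy: "x \<oplus>\<^bsub>V\<^esub> y \<in> H"
  show "H +>\<^bsub>V\<^esub> x = H +>\<^bsub>V\<^esub> y"
  proof (rule Set.set_eqI)
    fix z
    have "x \<oplus>\<^bsub>V\<^esub> z = (x \<oplus>\<^bsub>V\<^esub> y) \<oplus>\<^bsub>V\<^esub> (y \<oplus>\<^bsub>V\<^esub> z)" "y \<oplus>\<^bsub>V\<^esub> z = (x \<oplus>\<^bsub>V\<^esub> y) \<oplus>\<^bsub>V\<^esub> (x \<oplus>\<^bsub>V\<^esub> z)" if z: "z \<in> carrier V"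
    proof -
      show "x \<oplus>\<^bsub>V\<^esub> z = (x \<oplus>\<^bsub>V\<^esub> y) \<oplus>\<^bsub>V\<^esub> (y \<oplus>\<^bsub>V\<^esub> z)"
        using x y z V by (simp add: F2_assoc)
      show "y \<oplus>\<^bsub>V\<^esub> z = (x \<oplus>\<^bsub>V\<^esub> y) \<oplus>\<^bsub>V\<^esub> (x \<oplus>\<^bsub>V\<^esub> z)"
        unfolding F2_comm[OF V x y] using x y z V by (simp add: F2_assoc)
    qed
    then show "z \<in> H +>\<^bsub>V\<^esub> x \<longleftrightarrow> z \<in> H +>\<^bsub>V\<^esub> y"
      using H(3)[OF xy] coset_iff[OF x] coset_iff[OF y] by metis
  qed
qed

lemma coset_zero: "H +>\<^bsub>V\<^esub> \<zero>\<^bsub>V\<^esub> = H"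
  using H V by (auto simp: coset_iff)

lemma
  shows quotient_carrier: "carrier (vs_quotient V H) = (\<lambda>x. H +>\<^bsub>V\<^esub> x) ` carrier V"
    and quotient_zero: "\<zero>\<^bsub>vs_quotient V H\<^esub> = H"
    and quotient_add: "x \<in> carrier V \<Longrightarrow> y \<in> carrier V \<Longrightarrow>
      (H +>\<^bsub>V\<^esub> x) \<oplus>\<^bsub>vs_quotient V H\<^esub> (H +>\<^bsub>V\<^esub> y) = H +>\<^bsub>V\<^esub> (x \<oplus>\<^bsub>V\<^esub> y)"
    and quotient_smult: "x \<in> carrier V \<Longrightarrow> b \<odot>\<^bsub>vs_quotient V H\<^esub> (H +>\<^bsub>V\<^esub> x) = (if b = 0 then H else H +>\<^bsub>V\<^esub> x)"
proof -
  show "carrier (vs_quotient V H) = (\<lambda>x. H +>\<^bsub>V\<^esub> x) ` carrier V"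
    by (auto simp: vs_quotient_def A_RCOSETS_def')
  show "\<zero>\<^bsub>vs_quotient V H\<^esub> = H" by (simp add: vs_quotient_def)
  have self: "x \<in> H +>\<^bsub>V\<^esub> x" if "x \<in> carrier V" for x using that H(2) V by (simp add: coset_iff)
  assume x: "x \<in> carrier V"
  show "b \<odot>\<^bsub>vs_quotient V H\<^esub> (H +>\<^bsub>V\<^esub> x) = (if b = 0 then H else H +>\<^bsub>V\<^esub> x)"
  proof -
    have "(\<Union>z\<in>H +>\<^bsub>V\<^esub> x. H +>\<^bsub>V\<^esub> (b \<odot>\<^bsub>V\<^esub> z)) = (\<Union>z\<in>H +>\<^bsub>V\<^esub> x. if b = 0 then H else H +>\<^bsub>V\<^esub> x)"
    proof (rule SUP_cong[OF refl])
      fix z assume "z \<in> H +>\<^bsub>V\<^esub> x"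
      then have z: "z \<in> carrier V" "x \<oplus>\<^bsub>V\<^esub> z \<in> H" by (auto simp: coset_iff[OF x])
      then show "H +>\<^bsub>V\<^esub> (b \<odot>\<^bsub>V\<^esub> z) = (if b = 0 then H else H +>\<^bsub>V\<^esub> x)"
        using coset_eq_iff[OF x z(1)] F2_smult[OF V z(1), of b] by (simp add: coset_zero)
    qed
    then show ?thesis using self[OF x] by (auto simp: vs_quotient_def)
  qed
  assume y: "y \<in> carrier V"
  have "(H +>\<^bsub>V\<^esub> x) <+>\<^bsub>V\<^esub> (H +>\<^bsub>V\<^esub> y) = H +>\<^bsub>V\<^esub> (x \<oplus>\<^bsub>V\<^esub> y)"
  proof (intro equalityI subsetI)
    fix z assume "z \<in> (H +>\<^bsub>V\<^esub> x) <+>\<^bsub>V\<^esub> (H +>\<^bsub>V\<^esub> y)"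
    then obtain a b where ab: "a \<in> H +>\<^bsub>V\<^esub> x" "b \<in> H +>\<^bsub>V\<^esub> y" "z = a \<oplus>\<^bsub>V\<^esub> b" by (auto simp: set_add_def')
    then have a: "a \<in> carrier V" "x \<oplus>\<^bsub>V\<^esub> a \<in> H" and b: "b \<in> carrier V" "y \<oplus>\<^bsub>V\<^esub> b \<in> H"
      by (auto simp: coset_iff[OF x] coset_iff[OF y])
    have "(x \<oplus>\<^bsub>V\<^esub> y) \<oplus>\<^bsub>V\<^esub> (a \<oplus>\<^bsub>V\<^esub> b) = (x \<oplus>\<^bsub>V\<^esub> a) \<oplus>\<^bsub>V\<^esub> (y \<oplus>\<^bsub>V\<^esub> b)"
      using x y a b V F2_lcomm[OF V y a(1) b(1)] by (simp add: F2_assoc)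
    then show "z \<in> H +>\<^bsub>V\<^esub> (x \<oplus>\<^bsub>V\<^esub> y)" using H(3)[OF a(2) b(2)] ab(3) a b x y V by (simp add: coset_iff)
  next
    fix z assume "z \<in> H +>\<^bsub>V\<^esub> (x \<oplus>\<^bsub>V\<^esub> y)"
    then have z: "z \<in> carrier V" "(x \<oplus>\<^bsub>V\<^esub> y) \<oplus>\<^bsub>V\<^esub> z \<in> H" using x y V by (auto simp: coset_iff)
    have "y \<oplus>\<^bsub>V\<^esub> (y \<oplus>\<^bsub>V\<^esub> z) = z" "x \<oplus>\<^bsub>V\<^esub> (y \<oplus>\<^bsub>V\<^esub> z) = (x \<oplus>\<^bsub>V\<^esub> y) \<oplus>\<^bsub>V\<^esub> z"
      using x y z V by (simp_all add: F2_assoc)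
    moreover from this have "y \<oplus>\<^bsub>V\<^esub> z \<in> H +>\<^bsub>V\<^esub> x" using x y z V by (simp add: coset_iff)
    moreover have "z = (y \<oplus>\<^bsub>V\<^esub> z) \<oplus>\<^bsub>V\<^esub> y" using F2_comm[OF V _ y, of "y \<oplus>\<^bsub>V\<^esub> z"] y z V by simp
    ultimately show "z \<in> (H +>\<^bsub>V\<^esub> x) <+>\<^bsub>V\<^esub> (H +>\<^bsub>V\<^esub> y)"
      using self[OF y] unfolding set_add_def' by blast
  qed
  then show "(H +>\<^bsub>V\<^esub> x) \<oplus>\<^bsub>vs_quotient V H\<^esub> (H +>\<^bsub>V\<^esub> y) = H +>\<^bsub>V\<^esub> (x \<oplus>\<^bsub>V\<^esub> y)"
    by (simp add: vs_quotient_def)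
qed

lemma quotient_module: "module F2 (vs_quotient V H)"
proof (rule module_F2I)
  let ?Q = "vs_quotient V H"
  show "\<zero>\<^bsub>?Q\<^esub> \<in> carrier ?Q"
    unfolding quotient_carrier quotient_zero using coset_zero F2_zero[OF V] by (metis imageI)
  fix X assume "X \<in> carrier ?Q"
  then obtain x where x: "x \<in> carrier V" "X = H +>\<^bsub>V\<^esub> x" by (auto simp: quotient_carrier)
  note z = F2_zero[OF V]
  show "\<zero>\<^bsub>?Q\<^esub> \<oplus>\<^bsub>?Q\<^esub> X = X" using quotient_add[OF z x(1)] x V unfolding coset_zero quotient_zero by simp
  show "X \<oplus>\<^bsub>?Q\<^esub> X = \<zero>\<^bsub>?Q\<^esub>" using quotient_add[OF x(1) x(1)] x V unfolding quotient_zero by (simp add: coset_zero)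
  show "b \<odot>\<^bsub>?Q\<^esub> X = (if b = 0 then \<zero>\<^bsub>?Q\<^esub> else X)" for b using quotient_smult[OF x(1), of b] x(2) by (simp add: quotient_zero)
  fix Y assume "Y \<in> carrier ?Q"
  then obtain y where y: "y \<in> carrier V" "Y = H +>\<^bsub>V\<^esub> y" by (auto simp: quotient_carrier)
  have xy: "X \<oplus>\<^bsub>?Q\<^esub> Y = H +>\<^bsub>V\<^esub> (x \<oplus>\<^bsub>V\<^esub> y)" using quotient_add x y by simp
  then show "X \<oplus>\<^bsub>?Q\<^esub> Y \<in> carrier ?Q" using x y V by (simp add: quotient_carrier)
  show "X \<oplus>\<^bsub>?Q\<^esub> Y = Y \<oplus>\<^bsub>?Q\<^esub> X" using quotient_add x y F2_comm[OF V x(1) y(1)] by simp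
  fix W assume "W \<in> carrier ?Q"
  then obtain w where w: "w \<in> carrier V" "W = H +>\<^bsub>V\<^esub> w" by (auto simp: quotient_carrier)
  show "X \<oplus>\<^bsub>?Q\<^esub> Y \<oplus>\<^bsub>?Q\<^esub> W = X \<oplus>\<^bsub>?Q\<^esub> (Y \<oplus>\<^bsub>?Q\<^esub> W)"
    using x y w V by (simp add: quotient_add F2_assoc)
qed

end

lemma direct_sum_simps:
  assumes "finite I"
  shows "carrier (vs_direct_sum I V) = (\<Pi>\<^sub>E i\<in>I. carrier (V i))"
    "\<zero>\<^bsub>vs_direct_sum I V\<^esub> = (\<lambda>i\<in>I. \<zero>\<^bsub>V i\<^esub>)"
    "x \<oplus>\<^bsub>vs_direct_sum I V\<^esub> y = (\<lambda>i\<in>I. x i \<oplus>\<^bsub>V i\<^esub> y i)"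
    "b \<odot>\<^bsub>vs_direct_sum I V\<^esub> x = (\<lambda>i\<in>I. b \<odot>\<^bsub>V i\<^esub> x i)"
  using assms by (auto simp: vs_direct_sum_def)

lemma direct_sum_module:
  assumes I: "finite I" and V: "\<And>i. i \<in> I \<Longrightarrow> module F2 (V i)"
  shows "module F2 (vs_direct_sum I V)"
proof (rule module_F2I)
  let ?D = "vs_direct_sum I V"
  have mem: "x \<in> carrier ?D \<longleftrightarrow> (\<forall>i\<in>I. x i \<in> carrier (V i)) \<and> x \<in> extensional I" for x
    by (simp add: direct_sum_simps[OF I] PiE_iff)
  have z: "\<zero>\<^bsub>?D\<^esub> = (\<lambda>i\<in>I. \<zero>\<^bsub>V i\<^esub>)" and a: "x \<oplus>\<^bsub>?D\<^esub> y = (\<lambda>i\<in>I. x i \<oplus>\<^bsub>V i\<^esub> y i)" for x y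
    by (simp_all add: direct_sum_simps[OF I])
  show "\<zero>\<^bsub>?D\<^esub> \<in> carrier ?D" unfolding mem z using V by simp
  fix x assume "x \<in> carrier ?D"
  then have x: "\<And>i. i \<in> I \<Longrightarrow> x i \<in> carrier (V i)" "x \<in> extensional I" unfolding mem by auto
  show "\<zero>\<^bsub>?D\<^esub> \<oplus>\<^bsub>?D\<^esub> x = x" unfolding z a
    by (rule extensionalityI[of _ I]) (use x V in simp_all)
  show "x \<oplus>\<^bsub>?D\<^esub> x = \<zero>\<^bsub>?D\<^esub>" unfolding z a
    by (rule extensionalityI[of _ I]) (use x V in simp_all)
  show "b \<odot>\<^bsub>?D\<^esub> x = (if b = 0 then \<zero>\<^bsub>?D\<^esub> else x)" for b unfolding z direct_sum_simps(4)[OF I]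
    by (rule extensionalityI[of _ I]) (use x V F2_smult[OF V x(1)] in auto)
  fix y assume "y \<in> carrier ?D"
  then have y: "\<And>i. i \<in> I \<Longrightarrow> y i \<in> carrier (V i)" "y \<in> extensional I" unfolding mem by auto
  show "x \<oplus>\<^bsub>?D\<^esub> y \<in> carrier ?D" unfolding mem a using x y V by simp
  show "x \<oplus>\<^bsub>?D\<^esub> y = y \<oplus>\<^bsub>?D\<^esub> x" unfolding a
    by (rule extensionalityI[of _ I]) (use F2_comm[OF V x(1) y(1)] in simp_all)
  fix w assume "w \<in> carrier ?D"
  then have w: "\<And>i. i \<in> I \<Longrightarrow> w i \<in> carrier (V i)" "w \<in> extensional I" unfolding mem by auto
  show "x \<oplus>\<^bsub>?D\<^esub> y \<oplus>\<^bsub>?D\<^esub> w = x \<oplus>\<^bsub>?D\<^esub> (y \<oplus>\<^bsub>?D\<^esub> w)" unfolding a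
    by (rule extensionalityI[of _ I]) (use F2_assoc[OF V x(1) y(1) w(1)] in simp_all)
qed

text \<open>Both spaces are quotients of \<open>X\<close> by the same kernel. Comparing them through
  \<open>X\<close> avoids inverting a connecting homomorphism on classes.\<close>

lemma isomorphic_by_surjections:
  assumes X: "module F2 X" and Y: "module F2 Y" and Y': "module F2 Y'"
    and p: "vs_linear X Y p" "p ` carrier X = carrier Y"
    and q: "vs_linear X Y' q" "q ` carrier X = carrier Y'"
    and ker: "\<And>x. x \<in> carrier X \<Longrightarrow> p x = \<zero>\<^bsub>Y\<^esub> \<longleftrightarrow> q x = \<zero>\<^bsub>Y'\<^esub>"
  shows "vs_isomorphic Y Y'"
proof -
  have eq: "p x = p x' \<longleftrightarrow> q x = q x'" if x: "x \<in> carrier X" "x' \<in> carrier X" for x x'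
  proof -
    have "p x = p x' \<longleftrightarrow> p (x \<oplus>\<^bsub>X\<^esub> x') = \<zero>\<^bsub>Y\<^esub>"
      using vs_linear_add[OF p(1) x] F2_add_eq_zero[OF Y vs_linear_closed[OF p(1) x(1)] vs_linear_closed[OF p(1) x(2)]] by simp
    also have "\<dots> \<longleftrightarrow> q (x \<oplus>\<^bsub>X\<^esub> x') = \<zero>\<^bsub>Y'\<^esub>" using ker[of "x \<oplus>\<^bsub>X\<^esub> x'"] X x by simp
    also have "\<dots> \<longleftrightarrow> q x = q x'"
      using vs_linear_add[OF q(1) x] F2_add_eq_zero[OF Y' vs_linear_closed[OF q(1) x(1)] vs_linear_closed[OF q(1) x(2)]] by simp
    finally show ?thesis .
  qed
  define f where "f y = q (SOME x. x \<in> carrier X \<and> p x = y)" for y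
  have f: "f (p x) = q x" if x: "x \<in> carrier X" for x
  proof -
    have "(SOME x'. x' \<in> carrier X \<and> p x' = p x) \<in> carrier X \<and> p (SOME x'. x' \<in> carrier X \<and> p x' = p x) = p x"
      by (rule someI[of _ x]) (use x in simp)
    then show ?thesis unfolding f_def using eq x by metis
  qed
  have "vs_linear Y Y' f"
    unfolding vs_linear_iff[OF Y Y'] p(2)[symmetric]
    using f vs_linear_closed[OF q(1)] vs_linear_add[OF p(1)] vs_linear_add[OF q(1)] F2_add[OF X]
    by (auto simp flip: vs_linear_add[OF p(1)])
  moreover have "bij_betw f (carrier Y) (carrier Y')"
    unfolding bij_betw_def inj_on_def p(2)[symmetric] q(2)[symmetric] using f eq by (auto simp: image_image)
  ultimately show ?thesis unfolding vs_isomorphic_def using Y Y' by blast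
qed

subsection \<open>Cohomology of the complexes of morphisms\<close>

lemma
  shows hom_space_carrier: "carrier (sq_hom_space M N) = sq_hom M N"
    and hom_space_zero: "\<zero>\<^bsub>sq_hom_space M N\<^esub> = sq_zero M N"
    and hom_space_add: "f \<oplus>\<^bsub>sq_hom_space M N\<^esub> g = (\<lambda>n. \<lambda>x\<in>carrier (piece M n). f n x \<oplus>\<^bsub>piece N n\<^esub> g n x)"
    and hom_space_smult: "b \<odot>\<^bsub>sq_hom_space M N\<^esub> f = (\<lambda>n. \<lambda>x\<in>carrier (piece M n). b \<odot>\<^bsub>piece N n\<^esub> f n x)"
  by (simp_all add: sq_hom_space_def)

context
  fixes M :: "'a sq_module" and N :: "'b sq_module"
  assumes M: "unstable_module M" and N: "unstable_module N"
begin

lemma sq_zero_in: "sq_zero M N \<in> sq_hom M N"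
  by (rule sq_zero_hom[OF M unstable_vs[OF N] unstable_Sq_zero[OF N refl]])

lemma hom_space_add_in:
  assumes f: "f \<in> sq_hom M N" and g: "g \<in> sq_hom M N"
  shows "f \<oplus>\<^bsub>sq_hom_space M N\<^esub> g \<in> sq_hom M N"
  unfolding hom_space_add
proof (rule sq_hom_restrictI)
  note NV = unstable_vs[OF N]
  fix n x assume x: "x \<in> carrier (piece M n)"
  note fx = sq_hom_closed[OF f x] and gx = sq_hom_closed[OF g x]
  show "f n x \<oplus>\<^bsub>piece N n\<^esub> g n x \<in> carrier (piece N n)" using fx gx NV by simp
  show "Sq M i n x \<in> carrier (piece M (n + i))" for i by (rule unstable_Sq_closed[OF M x refl])
  show "f (n + i) (Sq M i n x) \<oplus>\<^bsub>piece N (n + i)\<^esub> g (n + i) (Sq M i n x) = Sq N i n (f n x \<oplus>\<^bsub>piece N n\<^esub> g n x)" for i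
    using unstable_Sq_add[OF N fx gx, of i] sq_hom_Sq[OF f x refl, of i] sq_hom_Sq[OF g x refl, of i] by simp
  fix y assume y: "y \<in> carrier (piece M n)"
  note fy = sq_hom_closed[OF f y] and gy = sq_hom_closed[OF g y]
  show "f n (x \<oplus>\<^bsub>piece M n\<^esub> y) \<oplus>\<^bsub>piece N n\<^esub> g n (x \<oplus>\<^bsub>piece M n\<^esub> y) =
      (f n x \<oplus>\<^bsub>piece N n\<^esub> g n x) \<oplus>\<^bsub>piece N n\<^esub> (f n y \<oplus>\<^bsub>piece N n\<^esub> g n y)"
    using fx gx fy gy NV F2_lcomm[OF NV fy gx gy] by (simp add: sq_hom_add[OF f x y] sq_hom_add[OF g x y] F2_assoc)
qed (simp_all add: M N)

lemma hom_space_module: "module F2 (sq_hom_space M N)"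
proof (rule module_F2I)
  note NV = unstable_vs[OF N]
  let ?V = "sq_hom_space M N"
  show "\<zero>\<^bsub>?V\<^esub> \<in> carrier ?V" by (simp add: hom_space_carrier hom_space_zero sq_zero_in)
  fix f assume "f \<in> carrier ?V"
  then have f: "f \<in> sq_hom M N" by (simp add: hom_space_carrier)
  note fx = sq_hom_closed[OF f]
  have z: "\<zero>\<^bsub>?V\<^esub> \<in> sq_hom M N" by (simp add: hom_space_zero sq_zero_in)
  have z0: "\<zero>\<^bsub>?V\<^esub> n x = \<zero>\<^bsub>piece N n\<^esub>" if "x \<in> carrier (piece M n)" for n x using that by (simp add: hom_space_zero sq_zero_def)
  show "\<zero>\<^bsub>?V\<^esub> \<oplus>\<^bsub>?V\<^esub> f = f"
    by (rule sq_hom_eqI[OF hom_space_add_in[OF z f] f]) (simp add: hom_space_add z0 fx NV)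
  show "f \<oplus>\<^bsub>?V\<^esub> f = \<zero>\<^bsub>?V\<^esub>"
    by (rule sq_hom_eqI[OF hom_space_add_in[OF f f] z]) (simp add: hom_space_add z0 fx NV)
  show "b \<odot>\<^bsub>?V\<^esub> f = (if b = 0 then \<zero>\<^bsub>?V\<^esub> else f)" for b
  proof (rule ext_eqI[of _ "\<lambda>n. carrier (piece M n)"])
    fix n
    show "(if b = 0 then \<zero>\<^bsub>?V\<^esub> else f) n \<in> extensional (carrier (piece M n))"
      using sq_hom_ext[OF f] sq_hom_ext[OF z] by simp
    fix x assume x: "x \<in> carrier (piece M n)"
    show "(b \<odot>\<^bsub>?V\<^esub> f) n x = (if b = 0 then \<zero>\<^bsub>?V\<^esub> else f) n x"
      using F2_smult[OF NV fx[OF x], of b] x by (simp add: hom_space_smult z0)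
  qed (simp add: hom_space_smult)
  fix g assume "g \<in> carrier ?V"
  then have g: "g \<in> sq_hom M N" by (simp add: hom_space_carrier)
  note gx = sq_hom_closed[OF g]
  show "f \<oplus>\<^bsub>?V\<^esub> g \<in> carrier ?V" unfolding hom_space_carrier by (rule hom_space_add_in[OF f g])
  show "f \<oplus>\<^bsub>?V\<^esub> g = g \<oplus>\<^bsub>?V\<^esub> f"
    by (rule sq_hom_eqI[OF hom_space_add_in[OF f g] hom_space_add_in[OF g f]])
      (simp add: hom_space_add F2_comm[OF NV fx gx])
  fix h assume "h \<in> carrier ?V"
  then have h: "h \<in> sq_hom M N" by (simp add: hom_space_carrier)
  show "f \<oplus>\<^bsub>?V\<^esub> g \<oplus>\<^bsub>?V\<^esub> h = f \<oplus>\<^bsub>?V\<^esub> (g \<oplus>\<^bsub>?V\<^esub> h)"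
    by (rule sq_hom_eqI[OF hom_space_add_in[OF hom_space_add_in[OF f g] h] hom_space_add_in[OF f hom_space_add_in[OF g h]]])
      (simp add: hom_space_add F2_assoc[OF NV fx gx sq_hom_closed[OF h]])
qed

lemma hom_space_apply: "x \<in> carrier (piece M n) \<Longrightarrow> (f \<oplus>\<^bsub>sq_hom_space M N\<^esub> g) n x = f n x \<oplus>\<^bsub>piece N n\<^esub> g n x"
  by (simp add: hom_space_add)

end

definition cocycle_space :: "(nat \<Rightarrow> 'p sq_module) \<Rightarrow> (nat \<Rightarrow> nat \<Rightarrow> 'p \<Rightarrow> 'p) \<Rightarrow> nat \<Rightarrow> 'b sq_module \<Rightarrow> (nat \<Rightarrow> 'p \<Rightarrow> 'b) vs" where
  "cocycle_space P d s N = (sq_hom_space (P s) N)\<lparr>carrier := hom_cocycles P d s N\<rparr>"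

definition cohomology_class :: "(nat \<Rightarrow> 'p sq_module) \<Rightarrow> (nat \<Rightarrow> nat \<Rightarrow> 'p \<Rightarrow> 'p) \<Rightarrow> nat \<Rightarrow> 'b sq_module \<Rightarrow>
    (nat \<Rightarrow> 'p \<Rightarrow> 'b) \<Rightarrow> (nat \<Rightarrow> 'p \<Rightarrow> 'b) set" where
  "cohomology_class P d s N f = hom_coboundaries P d s N +>\<^bsub>cocycle_space P d s N\<^esub> f"

lemma cocycle_space_simps [simp]:
  "carrier (cocycle_space P d s N) = hom_cocycles P d s N" "\<zero>\<^bsub>cocycle_space P d s N\<^esub> = sq_zero (P s) N"
  "f \<oplus>\<^bsub>cocycle_space P d s N\<^esub> g = f \<oplus>\<^bsub>sq_hom_space (P s) N\<^esub> g"
  by (simp_all add: cocycle_space_def hom_space_zero)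

context
  fixes P :: "nat \<Rightarrow> (nat \<times> bit) sq_module" and d
  assumes P: "projective_complex P d"
begin

lemma
  assumes N: "unstable_module N"
  shows cocycles_iff: "f \<in> hom_cocycles P d s N \<longleftrightarrow> f \<in> sq_hom (P s) N \<and>
      (\<forall>n. \<forall>x\<in>carrier (piece (P (Suc s)) n). f n (d s n x) = \<zero>\<^bsub>piece N n\<^esub>)"
    and coboundaries_0_iff: "f \<in> hom_cocycles P d 0 N \<Longrightarrow> f \<in> hom_coboundaries P d 0 N \<longleftrightarrow>
      (\<forall>n. \<forall>x\<in>carrier (piece (P 0) n). f n x = \<zero>\<^bsub>piece N n\<^esub>)"
    and coboundaries_Suc_iff: "f \<in> hom_cocycles P d (Suc s) N \<Longrightarrow> f \<in> hom_coboundaries P d (Suc s) N \<longleftrightarrow>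
      (\<exists>k\<in>sq_hom (P s) N. \<forall>n. \<forall>x\<in>carrier (piece (P (Suc s)) n). k n (d s n x) = f n x)"
proof -
  note U = complex_unstable[OF P]
  show 1: "f \<in> hom_cocycles P d s N \<longleftrightarrow> f \<in> sq_hom (P s) N \<and>
      (\<forall>n. \<forall>x\<in>carrier (piece (P (Suc s)) n). f n (d s n x) = \<zero>\<^bsub>piece N n\<^esub>)" for f s
    unfolding hom_cocycles_def mem_Collect_eq sq_comp_eq_iff[OF sq_zero_in[OF U N]] by (auto simp: sq_zero_def)
  show "f \<in> hom_coboundaries P d 0 N \<longleftrightarrow> (\<forall>n. \<forall>x\<in>carrier (piece (P 0) n). f n x = \<zero>\<^bsub>piece N n\<^esub>)"
    if "f \<in> hom_cocycles P d 0 N"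
  proof
    assume a: "\<forall>n. \<forall>x\<in>carrier (piece (P 0) n). f n x = \<zero>\<^bsub>piece N n\<^esub>"
    have "f = sq_zero (P 0) N"
      by (rule sq_hom_eqI[of _ "P 0" N _ N]) (use a that 1 sq_zero_in[OF U N] in \<open>auto simp: sq_zero_def\<close>)
    then show "f \<in> hom_coboundaries P d 0 N" by simp
  qed (simp add: sq_zero_def)
  show "f \<in> hom_coboundaries P d (Suc s) N \<longleftrightarrow>
      (\<exists>k\<in>sq_hom (P s) N. \<forall>n. \<forall>x\<in>carrier (piece (P (Suc s)) n). k n (d s n x) = f n x)"
    if "f \<in> hom_cocycles P d (Suc s) N"
  proof -
    have f: "f \<in> sq_hom (P (Suc s)) N" using that 1 by blast
    show ?thesis unfolding hom_coboundaries.simps image_iff using sq_comp_eq_iff[OF f] by metis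
  qed
qed

lemma cocycle_space_module:
  assumes N: "unstable_module N"
  shows "module F2 (cocycle_space P d s N)"
  unfolding cocycle_space_def
proof (rule module_F2_subspace[OF hom_space_module[OF complex_unstable[OF P] N]])
  note U = complex_unstable[OF P] and c = cocycles_iff[OF N]
  have dc: "d s n x \<in> carrier (piece (P s) n)" if "x \<in> carrier (piece (P (Suc s)) n)" for n x
    by (rule sq_hom_closed[OF complex_map[OF P] that])
  show "hom_cocycles P d s N \<subseteq> carrier (sq_hom_space (P s) N)" using c by (auto simp: hom_space_carrier)
  show "\<zero>\<^bsub>sq_hom_space (P s) N\<^esub> \<in> hom_cocycles P d s N"
    unfolding c hom_space_zero using sq_zero_in[OF U N] dc by (simp add: sq_zero_def)
  fix f g assume "f \<in> hom_cocycles P d s N" "g \<in> hom_cocycles P d s N"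
  then show "f \<oplus>\<^bsub>sq_hom_space (P s) N\<^esub> g \<in> hom_cocycles P d s N"
    unfolding c using hom_space_add_in[OF U N] dc unstable_vs[OF N] by (simp add: hom_space_apply[OF U N])
qed

lemma
  assumes N: "unstable_module N"
  shows coboundaries_sub: "hom_coboundaries P d s N \<subseteq> hom_cocycles P d s N"
    and coboundaries_zero: "sq_zero (P s) N \<in> hom_coboundaries P d s N"
    and coboundaries_add: "f \<in> hom_coboundaries P d s N \<Longrightarrow> g \<in> hom_coboundaries P d s N \<Longrightarrow>
      f \<oplus>\<^bsub>sq_hom_space (P s) N\<^esub> g \<in> hom_coboundaries P d s N"
proof -
  note U = complex_unstable[OF P] and c = cocycles_iff[OF N]
  note Zm = cocycle_space_module[OF N]
  have dc: "d s n x \<in> carrier (piece (P s) n)" if "x \<in> carrier (piece (P (Suc s)) n)" for s n x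
    by (rule sq_hom_closed[OF complex_map[OF P] that])
  have z: "sq_zero (P s) N \<in> hom_cocycles P d s N" for s using F2_zero[OF Zm[of s]] by simp
  show sub: "hom_coboundaries P d s N \<subseteq> hom_cocycles P d s N" for s
  proof (cases s)
    case 0
    then show ?thesis using z[of 0] by simp
  next
    case (Suc r)
    have "sq_comp (P (Suc r)) k (d r) \<in> hom_cocycles P d (Suc r) N" if k: "k \<in> sq_hom (P r) N" for k
      unfolding c using sq_comp_unstable[OF complex_map[OF P] k U N] dc
        complex_square[OF P] sq_hom_zero[OF k unstable_vs[OF U] unstable_vs[OF N]] by simp
    then show ?thesis using Suc by auto
  qed
  show "sq_zero (P s) N \<in> hom_coboundaries P d s N"
  proof (cases s)
    case (Suc r)
    show ?thesis unfolding Suc coboundaries_Suc_iff[OF N z]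
      by (rule bexI[OF _ sq_zero_in[OF U N]]) (simp add: sq_zero_def dc)
  qed simp
  assume fg: "f \<in> hom_coboundaries P d s N" "g \<in> hom_coboundaries P d s N"
  have fgc: "f \<oplus>\<^bsub>sq_hom_space (P s) N\<^esub> g \<in> hom_cocycles P d s N"
    using F2_add[OF Zm[of s], of f g] fg sub[of s] by auto
  show "f \<oplus>\<^bsub>sq_hom_space (P s) N\<^esub> g \<in> hom_coboundaries P d s N"
  proof (cases s)
    case 0
    have "f = sq_zero (P 0) N" "g = sq_zero (P 0) N" using fg 0 by auto
    then show ?thesis using F2_l0[OF hom_space_module[OF U N], of "sq_zero (P 0) N"] sq_zero_in[OF U N] 0
      by (simp add: hom_space_carrier flip: hom_space_zero)
  next
    case (Suc r)
    obtain k where k: "k \<in> sq_hom (P r) N" "\<forall>n. \<forall>x\<in>carrier (piece (P (Suc r)) n). k n (d r n x) = f n x"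
      using fg(1) sub[of s] coboundaries_Suc_iff[OF N, of f r] unfolding Suc by blast
    obtain l where l: "l \<in> sq_hom (P r) N" "\<forall>n. \<forall>x\<in>carrier (piece (P (Suc r)) n). l n (d r n x) = g n x"
      using fg(2) sub[of s] coboundaries_Suc_iff[OF N, of g r] unfolding Suc by blast
    show ?thesis unfolding Suc coboundaries_Suc_iff[OF N fgc[unfolded Suc]]
      by (rule bexI[OF _ hom_space_add_in[OF U N k(1) l(1)]])
        (use k l dc in \<open>simp add: hom_space_apply[OF U N]\<close>)
  qed
qed

lemma
  assumes N: "unstable_module N"
  shows cohomology_module: "module F2 (hom_cohomology P d s N)"
    and cohomology_carrier: "carrier (hom_cohomology P d s N) = cohomology_class P d s N ` hom_cocycles P d s N"
    and cohomology_add: "f \<in> hom_cocycles P d s N \<Longrightarrow> g \<in> hom_cocycles P d s N \<Longrightarrow>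
      cohomology_class P d s N f \<oplus>\<^bsub>hom_cohomology P d s N\<^esub> cohomology_class P d s N g =
      cohomology_class P d s N (f \<oplus>\<^bsub>sq_hom_space (P s) N\<^esub> g)"
    and cohomology_class_zero_iff: "f \<in> hom_cocycles P d s N \<Longrightarrow>
      cohomology_class P d s N f = \<zero>\<^bsub>hom_cohomology P d s N\<^esub> \<longleftrightarrow> f \<in> hom_coboundaries P d s N"
proof -
  let ?Z = "cocycle_space P d s N" and ?B = "hom_coboundaries P d s N"
  have E: "hom_cohomology P d s N = vs_quotient ?Z ?B"
    by (simp add: hom_cohomology_def cocycle_space_def)
  note Z = cocycle_space_module[OF N, of s]
  have B: "?B \<subseteq> carrier ?Z" "\<zero>\<^bsub>?Z\<^esub> \<in> ?B" "\<And>x y. x \<in> ?B \<Longrightarrow> y \<in> ?B \<Longrightarrow> x \<oplus>\<^bsub>?Z\<^esub> y \<in> ?B"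
    using coboundaries_sub[OF N] coboundaries_zero[OF N] coboundaries_add[OF N] by auto
  show "module F2 (hom_cohomology P d s N)" unfolding E by (rule quotient_module[OF Z B])
  show "carrier (hom_cohomology P d s N) = cohomology_class P d s N ` hom_cocycles P d s N"
  proof -
    have "carrier (vs_quotient ?Z ?B) = (\<lambda>x. ?B +>\<^bsub>?Z\<^esub> x) ` carrier ?Z" by (rule quotient_carrier[OF Z B])
    also have "\<dots> = cohomology_class P d s N ` hom_cocycles P d s N"
      by (rule image_cong) (simp_all add: cohomology_class_def)
    finally show ?thesis unfolding E .
  qed
  assume f: "f \<in> hom_cocycles P d s N"
  then have f': "f \<in> carrier ?Z" by simp
  show "cohomology_class P d s N f = \<zero>\<^bsub>hom_cohomology P d s N\<^esub> \<longleftrightarrow> f \<in> ?B"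
  proof -
    have "\<zero>\<^bsub>vs_quotient ?Z ?B\<^esub> = ?B" by (rule quotient_zero[OF Z B])
    moreover have "?B +>\<^bsub>?Z\<^esub> \<zero>\<^bsub>?Z\<^esub> = ?B" by (rule coset_zero[OF Z B])
    moreover have "?B +>\<^bsub>?Z\<^esub> f = ?B +>\<^bsub>?Z\<^esub> \<zero>\<^bsub>?Z\<^esub> \<longleftrightarrow> f \<oplus>\<^bsub>?Z\<^esub> \<zero>\<^bsub>?Z\<^esub> \<in> ?B"
      by (rule coset_eq_iff[OF Z B f' F2_zero[OF Z]])
    ultimately show ?thesis unfolding E cohomology_class_def F2_r0[OF Z f'] by metis
  qed
  assume g: "g \<in> hom_cocycles P d s N"
  then have g': "g \<in> carrier ?Z" by simp
  show "cohomology_class P d s N f \<oplus>\<^bsub>hom_cohomology P d s N\<^esub> cohomology_class P d s N g =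
      cohomology_class P d s N (f \<oplus>\<^bsub>sq_hom_space (P s) N\<^esub> g)"
  proof -
    have "(?B +>\<^bsub>?Z\<^esub> f) \<oplus>\<^bsub>vs_quotient ?Z ?B\<^esub> (?B +>\<^bsub>?Z\<^esub> g) = ?B +>\<^bsub>?Z\<^esub> (f \<oplus>\<^bsub>?Z\<^esub> g)"
      by (rule quotient_add[OF Z B f' g'])
    then show ?thesis unfolding E cohomology_class_def cocycle_space_simps .
  qed
qed

text \<open>The long exact sequence of \<open>0 \<rightarrow> A \<rightarrow> B \<rightarrow> Q\<^sub>1 \<oplus> Q\<^sub>2 \<rightarrow> 0\<close> when the middle term is acyclic. Both sides are
  quotients, by the same subspace, of the space of all \<open>g : P\<^sub>s \<rightarrow> B\<close> with \<open>g \<circ> d\<close> in \<open>A\<close>.\<close>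

lemma cohomology_step:
  fixes A :: "'a sq_module" and B :: "bit sq_module" and Q1 :: "'c sq_module" and Q2 :: "'e sq_module" and Y :: "'y vs"
  assumes A: "unstable_module A" and B: "unstable_module B" and Q1: "unstable_module Q1" and Q2: "unstable_module Q2"
    and k: "k \<in> sq_hom A B" "\<And>n. inj_on (k n) (carrier (piece A n))"
    and q1: "q1 \<in> sq_hom B Q1" and q2: "q2 \<in> sq_hom B Q2"
    and q1k: "\<And>n x. x \<in> carrier (piece A n) \<Longrightarrow> q1 n (k n x) = \<zero>\<^bsub>piece Q1 n\<^esub>"
    and q2k: "\<And>n x. x \<in> carrier (piece A n) \<Longrightarrow> q2 n (k n x) = \<zero>\<^bsub>piece Q2 n\<^esub>"
    and ex: "\<And>n y. y \<in> carrier (piece B n) \<Longrightarrow> q1 n y = \<zero>\<^bsub>piece Q1 n\<^esub> \<Longrightarrow> q2 n y = \<zero>\<^bsub>piece Q2 n\<^esub> \<Longrightarrow>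
      y \<in> k n ` carrier (piece A n)"
    and lift: "\<And>r a b. a \<in> sq_hom (P r) Q1 \<Longrightarrow> b \<in> sq_hom (P r) Q2 \<Longrightarrow>
      \<exists>g\<in>sq_hom (P r) B. \<forall>n. \<forall>x\<in>carrier (piece (P r) n). q1 n (g n x) = a n x \<and> q2 n (g n x) = b n x"
    and ac: "hom_acyclic P d B"
    and Y: "module F2 Y"
    and \<tau>: "\<And>u v. u \<in> carrier (hom_cohomology P d s Q1) \<Longrightarrow> v \<in> carrier (hom_cohomology P d s Q2) \<Longrightarrow> \<tau> u v \<in> carrier Y"
    and \<tau>_surj: "\<And>y. y \<in> carrier Y \<Longrightarrow> \<exists>u\<in>carrier (hom_cohomology P d s Q1). \<exists>v\<in>carrier (hom_cohomology P d s Q2). y = \<tau> u v"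
    and \<tau>_add: "\<And>u u' v v'. u \<in> carrier (hom_cohomology P d s Q1) \<Longrightarrow> u' \<in> carrier (hom_cohomology P d s Q1) \<Longrightarrow>
      v \<in> carrier (hom_cohomology P d s Q2) \<Longrightarrow> v' \<in> carrier (hom_cohomology P d s Q2) \<Longrightarrow>
      \<tau> (u \<oplus>\<^bsub>hom_cohomology P d s Q1\<^esub> u') (v \<oplus>\<^bsub>hom_cohomology P d s Q2\<^esub> v') = \<tau> u v \<oplus>\<^bsub>Y\<^esub> \<tau> u' v'"
    and \<tau>_zero: "\<And>u v. u \<in> carrier (hom_cohomology P d s Q1) \<Longrightarrow> v \<in> carrier (hom_cohomology P d s Q2) \<Longrightarrow>
      \<tau> u v = \<zero>\<^bsub>Y\<^esub> \<longleftrightarrow> u = \<zero>\<^bsub>hom_cohomology P d s Q1\<^esub> \<and> v = \<zero>\<^bsub>hom_cohomology P d s Q2\<^esub>"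
  shows "vs_isomorphic (hom_cohomology P d (Suc s) A) Y"
proof -
  note U = complex_unstable[OF P]
  note BV = unstable_vs[OF B] and AV = unstable_vs[OF A]
  have dc: "d r n x \<in> carrier (piece (P r) n)" if "x \<in> carrier (piece (P (Suc r)) n)" for r n x
    by (rule sq_hom_closed[OF complex_map[OF P] that])
  \<comment> \<open>Exactness puts the values of \<open>g\<close> into the image of
    \<open>k\<close>. Injectivity of \<open>k\<close> makes the preimages unique, hence compatible
    with sums and squares.\<close>
  have factor: "\<exists>h\<in>sq_hom M A. \<forall>n. \<forall>x\<in>carrier (piece M n). k n (h n x) = g n x"
    if M: "unstable_module M" and g: "g \<in> sq_hom M B"
      and 0: "\<And>n x. x \<in> carrier (piece M n) \<Longrightarrow> q1 n (g n x) = \<zero>\<^bsub>piece Q1 n\<^esub> \<and> q2 n (g n x) = \<zero>\<^bsub>piece Q2 n\<^esub>"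
    for M :: "(nat \<times> bit) sq_module" and g
  proof -
    have "\<forall>n x. \<exists>y. x \<in> carrier (piece M n) \<longrightarrow> y \<in> carrier (piece A n) \<and> k n y = g n x"
      using ex[OF sq_hom_closed[OF g]] 0 by (metis imageE)
    then obtain h where h: "\<And>n x. x \<in> carrier (piece M n) \<Longrightarrow> h n x \<in> carrier (piece A n)"
      "\<And>n x. x \<in> carrier (piece M n) \<Longrightarrow> k n (h n x) = g n x" by metis
    have inj: "y = z" if "y \<in> carrier (piece A n)" "z \<in> carrier (piece A n)" "k n y = k n z" for n y z
      using k(2) that by (auto dest: inj_onD)
    have "(\<lambda>n. restrict (h n) (carrier (piece M n))) \<in> sq_hom M A"
    proof (rule sq_hom_restrictI)
      fix n x assume x: "x \<in> carrier (piece M n)"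
      show "h n x \<in> carrier (piece A n)" by (rule h(1)[OF x])
      show Sx: "Sq M i n x \<in> carrier (piece M (n + i))" for i by (rule unstable_Sq_closed[OF M x refl])
      show "h (n + i) (Sq M i n x) = Sq A i n (h n x)" for i
      proof (rule inj[OF h(1)[OF Sx] unstable_Sq_closed[OF A h(1)[OF x] refl]])
        show "k (n + i) (h (n + i) (Sq M i n x)) = k (n + i) (Sq A i n (h n x))"
          using h(2)[OF Sx] h(2)[OF x] sq_hom_Sq[OF g x refl, of i] sq_hom_Sq[OF k(1) h(1)[OF x] refl, of i] by simp
      qed
      fix y assume y: "y \<in> carrier (piece M n)"
      have xy: "x \<oplus>\<^bsub>piece M n\<^esub> y \<in> carrier (piece M n)" using x y unstable_vs[OF M] by simp
      show "h n (x \<oplus>\<^bsub>piece M n\<^esub> y) = h n x \<oplus>\<^bsub>piece A n\<^esub> h n y"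
      proof (rule inj[OF h(1)[OF xy] F2_add[OF AV h(1)[OF x] h(1)[OF y]]])
        show "k n (h n (x \<oplus>\<^bsub>piece M n\<^esub> y)) = k n (h n x \<oplus>\<^bsub>piece A n\<^esub> h n y)"
          using h(2)[OF xy] h(2)[OF x] h(2)[OF y] sq_hom_add[OF g x y] sq_hom_add[OF k(1) h(1)[OF x] h(1)[OF y]] by simp
      qed
    qed (simp_all add: M A)
    then show ?thesis using h(2) by (intro bexI[of _ "\<lambda>n. restrict (h n) (carrier (piece M n))"]) simp_all
  qed
  have kinj: "y = z" if "y \<in> carrier (piece A n)" "z \<in> carrier (piece A n)" "k n y = k n z" for n y z
    using k(2) that by (auto dest: inj_onD)
  have kz: "k n \<zero>\<^bsub>piece A n\<^esub> = \<zero>\<^bsub>piece B n\<^esub>" for n by (rule sq_hom_zero[OF k(1) AV BV])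
  define XC where "XC = {g \<in> sq_hom (P s) B. \<forall>n. \<forall>x\<in>carrier (piece (P (Suc s)) n).
      q1 n (g n (d s n x)) = \<zero>\<^bsub>piece Q1 n\<^esub> \<and> q2 n (g n (d s n x)) = \<zero>\<^bsub>piece Q2 n\<^esub>}"
  define X where "X = (sq_hom_space (P s) B)\<lparr>carrier := XC\<rparr>"
  have Xc: "carrier X = XC" and Xa: "f \<oplus>\<^bsub>X\<^esub> g = f \<oplus>\<^bsub>sq_hom_space (P s) B\<^esub> g" for f g by (simp_all add: X_def)
  have X: "module F2 X"
    unfolding X_def
  proof (rule module_F2_subspace[OF hom_space_module[OF U B]])
    show "XC \<subseteq> carrier (sq_hom_space (P s) B)" by (auto simp: XC_def hom_space_carrier)
    show "\<zero>\<^bsub>sq_hom_space (P s) B\<^esub> \<in> XC"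
      using sq_zero_in[OF U B] dc sq_hom_zero[OF q1 BV unstable_vs[OF Q1]] sq_hom_zero[OF q2 BV unstable_vs[OF Q2]]
      by (simp add: XC_def hom_space_zero sq_zero_def)
    fix f g assume "f \<in> XC" "g \<in> XC"
    then show "f \<oplus>\<^bsub>sq_hom_space (P s) B\<^esub> g \<in> XC"
      using hom_space_add_in[OF U B] dc sq_hom_closed[of f "P s" B] sq_hom_closed[of g "P s" B]
        sq_hom_add[OF q1] sq_hom_add[OF q2] unstable_vs[OF Q1] unstable_vs[OF Q2]
      by (simp add: XC_def hom_space_apply[OF U B])
  qed
  have XCh: "g \<in> sq_hom (P s) B" if "g \<in> XC" for g using that by (simp add: XC_def)
  have "\<exists>h\<in>sq_hom (P (Suc s)) A. \<forall>n. \<forall>x\<in>carrier (piece (P (Suc s)) n). k n (h n x) = g n (d s n x)" if g: "g \<in> XC" for g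
    using factor[OF U sq_comp_unstable[OF complex_map[OF P] XCh[OF g] U B]] g by (simp add: XC_def)
  \<comment> \<open>The connecting homomorphism on the level of cochains: \<open>g\<close> composed
    with d, regarded as a map to \<open>A\<close>.\<close>
  then obtain \<delta> where \<delta>: "\<And>g. g \<in> XC \<Longrightarrow> \<delta> g \<in> sq_hom (P (Suc s)) A"
    "\<And>g n x. g \<in> XC \<Longrightarrow> x \<in> carrier (piece (P (Suc s)) n) \<Longrightarrow> k n (\<delta> g n x) = g n (d s n x)" by metis
  have \<delta>_unique: "\<delta> g = h" if g: "g \<in> XC" and h: "h \<in> sq_hom (P (Suc s)) A"
    "\<And>n x. x \<in> carrier (piece (P (Suc s)) n) \<Longrightarrow> k n (h n x) = g n (d s n x)" for g h
  proof (rule sq_hom_eqI[OF \<delta>(1)[OF g] h(1)])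
    fix n x assume x: "x \<in> carrier (piece (P (Suc s)) n)"
    show "\<delta> g n x = h n x"
      by (rule kinj[OF sq_hom_closed[OF \<delta>(1)[OF g] x] sq_hom_closed[OF h(1) x]]) (simp add: \<delta>(2)[OF g x] h(2)[OF x])
  qed
  have \<delta>_coc: "\<delta> g \<in> hom_cocycles P d (Suc s) A" if g: "g \<in> XC" for g
    unfolding cocycles_iff[OF A]
  proof (intro conjI \<delta>(1)[OF g] allI ballI)
    fix n x assume x: "x \<in> carrier (piece (P (Suc (Suc s))) n)"
    have "k n (\<delta> g n (d (Suc s) n x)) = k n \<zero>\<^bsub>piece A n\<^esub>"
      using \<delta>(2)[OF g dc[OF x]] complex_square[OF P x] sq_hom_zero[OF XCh[OF g] unstable_vs[OF U] BV] kz by simp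
    then show "\<delta> g n (d (Suc s) n x) = \<zero>\<^bsub>piece A n\<^esub>"
      by (rule kinj[OF sq_hom_closed[OF \<delta>(1)[OF g] dc[OF x]] F2_zero[OF AV]])
  qed
  have \<delta>_add: "\<delta> (f \<oplus>\<^bsub>X\<^esub> g) = \<delta> f \<oplus>\<^bsub>sq_hom_space (P (Suc s)) A\<^esub> \<delta> g" if f: "f \<in> XC" and g: "g \<in> XC" for f g
  proof (rule \<delta>_unique)
    show "f \<oplus>\<^bsub>X\<^esub> g \<in> XC" using F2_add[OF X, of f g] f g Xc by simp
    show "\<delta> f \<oplus>\<^bsub>sq_hom_space (P (Suc s)) A\<^esub> \<delta> g \<in> sq_hom (P (Suc s)) A" by (rule hom_space_add_in[OF U A \<delta>(1)[OF f] \<delta>(1)[OF g]])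
    fix n x assume x: "x \<in> carrier (piece (P (Suc s)) n)"
    show "k n ((\<delta> f \<oplus>\<^bsub>sq_hom_space (P (Suc s)) A\<^esub> \<delta> g) n x) = (f \<oplus>\<^bsub>X\<^esub> g) n (d s n x)"
      unfolding Xa hom_space_apply[OF U A x] hom_space_apply[OF U B dc[OF x]]
      using sq_hom_add[OF k(1) sq_hom_closed[OF \<delta>(1)[OF f] x] sq_hom_closed[OF \<delta>(1)[OF g] x]] \<delta>(2)[OF f x] \<delta>(2)[OF g x] by simp
  qed
  define c1 where "c1 g = sq_comp (P s) q1 g" for g
  define c2 where "c2 g = sq_comp (P s) q2 g" for g
  have c1: "c1 g \<in> hom_cocycles P d s Q1" and c2: "c2 g \<in> hom_cocycles P d s Q2" if g: "g \<in> XC" for g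
    using g dc sq_comp_unstable[OF XCh[OF g] q1 U Q1] sq_comp_unstable[OF XCh[OF g] q2 U Q2]
    by (simp_all add: cocycles_iff[OF Q1] cocycles_iff[OF Q2] c1_def c2_def XC_def)
  have c1_add: "c1 (f \<oplus>\<^bsub>X\<^esub> g) = c1 f \<oplus>\<^bsub>sq_hom_space (P s) Q1\<^esub> c1 g"
    and c2_add: "c2 (f \<oplus>\<^bsub>X\<^esub> g) = c2 f \<oplus>\<^bsub>sq_hom_space (P s) Q2\<^esub> c2 g" if f: "f \<in> XC" and g: "g \<in> XC" for f g
  proof -
    have fg: "f \<oplus>\<^bsub>X\<^esub> g \<in> XC" using F2_add[OF X, of f g] f g Xc by simp
    note ff = sq_hom_closed[OF XCh[OF f]] and gg = sq_hom_closed[OF XCh[OF g]]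
    have 1: "c1 h \<in> sq_hom (P s) Q1" "c2 h \<in> sq_hom (P s) Q2" if "h \<in> XC" for h
      using c1[OF that] c2[OF that] cocycles_iff[OF Q1] cocycles_iff[OF Q2] by blast+
    show "c1 (f \<oplus>\<^bsub>X\<^esub> g) = c1 f \<oplus>\<^bsub>sq_hom_space (P s) Q1\<^esub> c1 g"
      by (rule sq_hom_eqI[OF 1(1)[OF fg] hom_space_add_in[OF U Q1 1(1)[OF f] 1(1)[OF g]]])
        (simp add: hom_space_apply[OF U Q1] Xa hom_space_apply[OF U B] c1_def sq_hom_add[OF q1 ff gg])
    show "c2 (f \<oplus>\<^bsub>X\<^esub> g) = c2 f \<oplus>\<^bsub>sq_hom_space (P s) Q2\<^esub> c2 g"
      by (rule sq_hom_eqI[OF 1(2)[OF fg] hom_space_add_in[OF U Q2 1(2)[OF f] 1(2)[OF g]]])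
        (simp add: hom_space_apply[OF U Q2] Xa hom_space_apply[OF U B] c2_def sq_hom_add[OF q2 ff gg])
  qed
  define p where "p g = cohomology_class P d (Suc s) A (\<delta> g)" for g
  define q where "q g = \<tau> (cohomology_class P d s Q1 (c1 g)) (cohomology_class P d s Q2 (c2 g))" for g
  have cl1: "cohomology_class P d s Q1 (c1 g) \<in> carrier (hom_cohomology P d s Q1)"
    and cl2: "cohomology_class P d s Q2 (c2 g) \<in> carrier (hom_cohomology P d s Q2)" if "g \<in> XC" for g
    using c1[OF that] c2[OF that] cohomology_carrier[OF Q1] cohomology_carrier[OF Q2] by blast+
  show ?thesis
  proof (rule isomorphic_by_surjections[OF X cohomology_module[OF A] Y])
    show "vs_linear X (hom_cohomology P d (Suc s) A) p"
      unfolding vs_linear_iff[OF X cohomology_module[OF A]] Xc p_def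
      using \<delta>_coc by (auto simp: cohomology_carrier[OF A] \<delta>_add cohomology_add[OF A])
    show "vs_linear X Y q"
      unfolding vs_linear_iff[OF X Y] Xc q_def
    proof (intro conjI ballI)
      fix f g assume f: "f \<in> XC" and g: "g \<in> XC"
      show "\<tau> (cohomology_class P d s Q1 (c1 (f \<oplus>\<^bsub>X\<^esub> g))) (cohomology_class P d s Q2 (c2 (f \<oplus>\<^bsub>X\<^esub> g))) =
        \<tau> (cohomology_class P d s Q1 (c1 f)) (cohomology_class P d s Q2 (c2 f)) \<oplus>\<^bsub>Y\<^esub>
        \<tau> (cohomology_class P d s Q1 (c1 g)) (cohomology_class P d s Q2 (c2 g))"
        using \<tau>_add[OF cl1[OF f] cl1[OF g] cl2[OF f] cl2[OF g]]
        unfolding c1_add[OF f g] c2_add[OF f g] cohomology_add[OF Q1 c1[OF f] c1[OF g]] cohomology_add[OF Q2 c2[OF f] c2[OF g]] .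
    qed (rule \<tau>[OF cl1 cl2])
    show "p ` carrier X = carrier (hom_cohomology P d (Suc s) A)"
      unfolding Xc cohomology_carrier[OF A]
    proof (intro equalityI subsetI)
      fix y assume "y \<in> cohomology_class P d (Suc s) A ` hom_cocycles P d (Suc s) A"
      then obtain h where h: "h \<in> hom_cocycles P d (Suc s) A" "y = cohomology_class P d (Suc s) A h" by blast
      have hh: "h \<in> sq_hom (P (Suc s)) A" and hd: "\<And>n x. x \<in> carrier (piece (P (Suc (Suc s))) n) \<Longrightarrow> h n (d (Suc s) n x) = \<zero>\<^bsub>piece A n\<^esub>"
        using h(1) unfolding cocycles_iff[OF A] by blast+
      have kh: "sq_comp (P (Suc s)) k h \<in> sq_hom (P (Suc s)) B" by (rule sq_comp_unstable[OF hh k(1) U B])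
      \<comment> \<open>A cocycle with values in \<open>A\<close> is also one in \<open>B\<close>,
        where acyclicity makes it the composite of some \<open>g\<close> with d.\<close>
      have "\<forall>n. \<forall>x\<in>carrier (piece (P (Suc (Suc s))) n). sq_comp (P (Suc s)) k h n (d (Suc s) n x) = \<zero>\<^bsub>piece B n\<^esub>"
        using dc hd kz by simp
      then have "case Suc s of 0 \<Rightarrow> \<forall>n. \<forall>x\<in>carrier (piece (P (Suc s)) n). sq_comp (P (Suc s)) k h n x = \<zero>\<^bsub>piece B n\<^esub>
        | Suc r \<Rightarrow> \<exists>g\<in>sq_hom (P r) B. \<forall>n. \<forall>x\<in>carrier (piece (P (Suc s)) n). g n (d r n x) = sq_comp (P (Suc s)) k h n x"
        using ac kh unfolding hom_acyclic_def by blast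
      then obtain g where g: "g \<in> sq_hom (P s) B"
        "\<And>n x. x \<in> carrier (piece (P (Suc s)) n) \<Longrightarrow> g n (d s n x) = k n (h n x)"
        by auto
      have gX: "g \<in> XC" using g q1k q2k sq_hom_closed[OF hh] by (simp add: XC_def)
      have "\<delta> g = h" by (rule \<delta>_unique[OF gX hh]) (simp add: g(2))
      then show "y \<in> p ` XC" using gX h(2) by (auto simp: p_def)
    qed (use \<delta>_coc in \<open>auto simp: p_def\<close>)
    show "q ` carrier X = carrier Y"
      unfolding Xc
    proof (intro equalityI subsetI)
      fix y assume "y \<in> carrier Y"
      then obtain u v where uv: "u \<in> carrier (hom_cohomology P d s Q1)" "v \<in> carrier (hom_cohomology P d s Q2)" "y = \<tau> u v"
        using \<tau>_surj by blast
      then obtain a b where a: "a \<in> hom_cocycles P d s Q1" "u = cohomology_class P d s Q1 a"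
        and b: "b \<in> hom_cocycles P d s Q2" "v = cohomology_class P d s Q2 b"
        unfolding cohomology_carrier[OF Q1] cohomology_carrier[OF Q2] by blast
      have ah: "a \<in> sq_hom (P s) Q1" and bh: "b \<in> sq_hom (P s) Q2" using a(1) b(1) cocycles_iff[OF Q1] cocycles_iff[OF Q2] by blast+
      obtain g where g: "g \<in> sq_hom (P s) B" "\<And>n x. x \<in> carrier (piece (P s) n) \<Longrightarrow> q1 n (g n x) = a n x \<and> q2 n (g n x) = b n x"
        using lift[OF ah bh] by blast
      have gX: "g \<in> XC" using g a(1) b(1) dc by (simp add: XC_def cocycles_iff[OF Q1] cocycles_iff[OF Q2])
      have "c1 g = a" unfolding c1_def sq_comp_eq_iff[OF ah] using g(2) by blast
      moreover have "c2 g = b" unfolding c2_def sq_comp_eq_iff[OF bh] using g(2) by blast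
      ultimately show "y \<in> q ` XC" using gX uv(3) a(2) b(2) by (auto simp: q_def)
    qed (use \<tau>[OF cl1 cl2] in \<open>auto simp: q_def\<close>)
    fix g assume "g \<in> carrier X"
    then have g: "g \<in> XC" using Xc by simp
    note gh = XCh[OF g]
    have "p g = \<zero>\<^bsub>hom_cohomology P d (Suc s) A\<^esub> \<longleftrightarrow> (\<exists>h\<in>sq_hom (P s) A. \<forall>n. \<forall>x\<in>carrier (piece (P (Suc s)) n). h n (d s n x) = \<delta> g n x)"
      unfolding p_def cohomology_class_zero_iff[OF A \<delta>_coc[OF g]] coboundaries_Suc_iff[OF A \<delta>_coc[OF g]] ..
    also have "\<dots> \<longleftrightarrow> c1 g \<in> hom_coboundaries P d s Q1 \<and> c2 g \<in> hom_coboundaries P d s Q2"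
    proof
      assume "\<exists>h\<in>sq_hom (P s) A. \<forall>n. \<forall>x\<in>carrier (piece (P (Suc s)) n). h n (d s n x) = \<delta> g n x"
      then obtain h where h: "h \<in> sq_hom (P s) A" "\<And>n x. x \<in> carrier (piece (P (Suc s)) n) \<Longrightarrow> h n (d s n x) = \<delta> g n x" by blast
      \<comment> \<open>Subtracting the part that comes from \<open>A\<close> leaves a cocycle in
        \<open>B\<close>, which is zero for s = 0 and a coboundary otherwise; \<open>q1\<close> and
        \<open>q2\<close> do not see the difference.\<close>
      let ?f = "g \<oplus>\<^bsub>sq_hom_space (P s) B\<^esub> sq_comp (P s) k h"
      have kh: "sq_comp (P s) k h \<in> sq_hom (P s) B" by (rule sq_comp_unstable[OF h(1) k(1) U B])
      have f: "?f \<in> sq_hom (P s) B" by (rule hom_space_add_in[OF U B gh kh])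
      have fa: "?f n x = g n x \<oplus>\<^bsub>piece B n\<^esub> k n (h n x)" if "x \<in> carrier (piece (P s) n)" for n x
        using that by (simp add: hom_space_apply[OF U B])
      have "?f n (d s n x) = \<zero>\<^bsub>piece B n\<^esub>" if x: "x \<in> carrier (piece (P (Suc s)) n)" for n x
        using fa[OF dc[OF x]] h(2)[OF x] \<delta>(2)[OF g x] sq_hom_closed[OF gh dc[OF x]] BV by simp
      then have ac': "case s of 0 \<Rightarrow> \<forall>n. \<forall>x\<in>carrier (piece (P s) n). ?f n x = \<zero>\<^bsub>piece B n\<^esub>
        | Suc r \<Rightarrow> \<exists>l\<in>sq_hom (P r) B. \<forall>n. \<forall>x\<in>carrier (piece (P s) n). l n (d r n x) = ?f n x"
        using ac f unfolding hom_acyclic_def by blast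
      have gf: "g n x = ?f n x \<oplus>\<^bsub>piece B n\<^esub> k n (h n x)" if x: "x \<in> carrier (piece (P s) n)" for n x
        using fa[OF x] sq_hom_closed[OF gh x] sq_hom_closed[OF k(1) sq_hom_closed[OF h(1) x]] BV by (simp add: F2_assoc)
      have q1g: "q1 n (g n x) = q1 n (?f n x)" and q2g: "q2 n (g n x) = q2 n (?f n x)" if x: "x \<in> carrier (piece (P s) n)" for n x
      proof -
        note a = sq_hom_closed[OF f x] and b = sq_hom_closed[OF k(1) sq_hom_closed[OF h(1) x]]
        show "q1 n (g n x) = q1 n (?f n x)"
          unfolding gf[OF x] sq_hom_add[OF q1 a b] q1k[OF sq_hom_closed[OF h(1) x]]
          using sq_hom_closed[OF q1 a] unstable_vs[OF Q1] by simp
        show "q2 n (g n x) = q2 n (?f n x)"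
          unfolding gf[OF x] sq_hom_add[OF q2 a b] q2k[OF sq_hom_closed[OF h(1) x]]
          using sq_hom_closed[OF q2 a] unstable_vs[OF Q2] by simp
      qed
      show "c1 g \<in> hom_coboundaries P d s Q1 \<and> c2 g \<in> hom_coboundaries P d s Q2"
      proof (cases s)
        case 0
        have "c1 g \<in> hom_cocycles P d 0 Q1" "c2 g \<in> hom_cocycles P d 0 Q2" using c1[OF g] c2[OF g] 0 by auto
        then show ?thesis
          using ac' q1g q2g 0 sq_hom_zero[OF q1 BV unstable_vs[OF Q1]] sq_hom_zero[OF q2 BV unstable_vs[OF Q2]]
          by (simp add: coboundaries_0_iff[OF Q1] coboundaries_0_iff[OF Q2] c1_def c2_def del: hom_coboundaries.simps)
      next
        case s: (Suc r)
        then obtain l where l: "l \<in> sq_hom (P r) B" "\<And>n x. x \<in> carrier (piece (P s) n) \<Longrightarrow> l n (d r n x) = ?f n x"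
          using ac' by auto
        have dr: "d r n x \<in> carrier (piece (P r) n)" if "x \<in> carrier (piece (P s) n)" for n x using dc that s by simp
        have cc: "c1 g \<in> hom_cocycles P d (Suc r) Q1" "c2 g \<in> hom_cocycles P d (Suc r) Q2" using c1[OF g] c2[OF g] s by auto
        have "\<exists>u\<in>sq_hom (P r) Q1. \<forall>n. \<forall>x\<in>carrier (piece (P s) n). u n (d r n x) = c1 g n x"
          by (rule bexI[OF _ sq_comp_unstable[OF l(1) q1 U Q1]]) (simp add: dr l(2) q1g c1_def)
        moreover have "\<exists>u\<in>sq_hom (P r) Q2. \<forall>n. \<forall>x\<in>carrier (piece (P s) n). u n (d r n x) = c2 g n x"
          by (rule bexI[OF _ sq_comp_unstable[OF l(1) q2 U Q2]]) (simp add: dr l(2) q2g c2_def)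
        ultimately show ?thesis
          using coboundaries_Suc_iff[OF Q1 cc(1)] coboundaries_Suc_iff[OF Q2 cc(2)] unfolding s by blast
      qed
    next
      assume cb: "c1 g \<in> hom_coboundaries P d s Q1 \<and> c2 g \<in> hom_coboundaries P d s Q2"
      \<comment> \<open>For s = 0 the zero map will do. Otherwise cochains that bound
        \<open>c1 g\<close> and \<open>c2 g\<close> are lifted together to \<open>B\<close>, and
        composing with d gives a cocycle with the same images as \<open>g\<close>.\<close>
      have "\<exists>f\<in>sq_hom (P s) B. (\<forall>n. \<forall>x\<in>carrier (piece (P s) n). q1 n (f n x) = q1 n (g n x) \<and> q2 n (f n x) = q2 n (g n x)) \<and>
          (\<forall>n. \<forall>x\<in>carrier (piece (P (Suc s)) n). f n (d s n x) = \<zero>\<^bsub>piece B n\<^esub>)"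
      proof (cases s)
        case 0
        have "c1 g \<in> hom_cocycles P d 0 Q1" "c2 g \<in> hom_cocycles P d 0 Q2" using c1[OF g] c2[OF g] 0 by auto
        then have "\<forall>n. \<forall>x\<in>carrier (piece (P s) n). q1 n (g n x) = \<zero>\<^bsub>piece Q1 n\<^esub> \<and> q2 n (g n x) = \<zero>\<^bsub>piece Q2 n\<^esub>"
          using cb 0 by (simp add: coboundaries_0_iff[OF Q1] coboundaries_0_iff[OF Q2] c1_def c2_def del: hom_coboundaries.simps)
        then show ?thesis
          using dc sq_hom_zero[OF q1 BV unstable_vs[OF Q1]] sq_hom_zero[OF q2 BV unstable_vs[OF Q2]]
          by (intro bexI[OF _ sq_zero_in[OF U B]]) (simp add: sq_zero_def)
      next
        case s: (Suc r)
        have dr: "d r n x \<in> carrier (piece (P r) n)" if "x \<in> carrier (piece (P s) n)" for n x using dc that s by simp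
        have cc: "c1 g \<in> hom_cocycles P d (Suc r) Q1" "c2 g \<in> hom_cocycles P d (Suc r) Q2" using c1[OF g] c2[OF g] s by auto
        obtain a b where a: "a \<in> sq_hom (P r) Q1" "\<And>n x. x \<in> carrier (piece (P s) n) \<Longrightarrow> a n (d r n x) = c1 g n x"
          and b: "b \<in> sq_hom (P r) Q2" "\<And>n x. x \<in> carrier (piece (P s) n) \<Longrightarrow> b n (d r n x) = c2 g n x"
          using cb coboundaries_Suc_iff[OF Q1 cc(1)] coboundaries_Suc_iff[OF Q2 cc(2)] unfolding s by blast
        obtain l where l: "l \<in> sq_hom (P r) B" "\<And>n x. x \<in> carrier (piece (P r) n) \<Longrightarrow> q1 n (l n x) = a n x \<and> q2 n (l n x) = b n x"
          using lift[OF a(1) b(1)] by blast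
        have lf: "sq_comp (P s) l (d r) \<in> sq_hom (P s) B"
          unfolding s by (rule sq_comp_unstable[OF complex_map[OF P] l(1) U B])
        have "d r n (d s n x) = \<zero>\<^bsub>piece (P r) n\<^esub>" if "x \<in> carrier (piece (P (Suc s)) n)" for n x
          using complex_square[OF P, of x r n] that s by simp
        then show ?thesis
          using dr dc l(2) a(2) b(2) sq_hom_zero[OF l(1) unstable_vs[OF U] BV]
          by (intro bexI[OF _ lf]) (simp add: c1_def c2_def)
      qed
      then obtain f where f: "f \<in> sq_hom (P s) B"
        "\<And>n x. x \<in> carrier (piece (P s) n) \<Longrightarrow> q1 n (f n x) = q1 n (g n x) \<and> q2 n (f n x) = q2 n (g n x)"
        "\<And>n x. x \<in> carrier (piece (P (Suc s)) n) \<Longrightarrow> f n (d s n x) = \<zero>\<^bsub>piece B n\<^esub>" by blast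
      \<comment> \<open>\<open>g\<close> and \<open>f\<close> have the same image in both quotients,
        so their sum takes values in \<open>A\<close>; as \<open>f\<close> vanishes on boundaries,
        this sum composed with d is \<open>\<delta> g\<close>.\<close>
      let ?e = "g \<oplus>\<^bsub>sq_hom_space (P s) B\<^esub> f"
      have e: "?e \<in> sq_hom (P s) B" by (rule hom_space_add_in[OF U B gh f(1)])
      have "q1 n (?e n x) = \<zero>\<^bsub>piece Q1 n\<^esub> \<and> q2 n (?e n x) = \<zero>\<^bsub>piece Q2 n\<^esub>" if x: "x \<in> carrier (piece (P s) n)" for n x
        unfolding hom_space_apply[OF U B x] sq_hom_add[OF q1 sq_hom_closed[OF gh x] sq_hom_closed[OF f(1) x]]
          sq_hom_add[OF q2 sq_hom_closed[OF gh x] sq_hom_closed[OF f(1) x]]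
        using f(2)[OF x] sq_hom_closed[OF q1 sq_hom_closed[OF gh x]] sq_hom_closed[OF q2 sq_hom_closed[OF gh x]]
          unstable_vs[OF Q1] unstable_vs[OF Q2] by simp
      then obtain h where h: "h \<in> sq_hom (P s) A" "\<And>n x. x \<in> carrier (piece (P s) n) \<Longrightarrow> k n (h n x) = ?e n x"
        using factor[OF U e] by blast
      have "h n (d s n x) = \<delta> g n x" if x: "x \<in> carrier (piece (P (Suc s)) n)" for n x
      proof (rule kinj[OF sq_hom_closed[OF h(1) dc[OF x]] sq_hom_closed[OF \<delta>(1)[OF g] x]])
        show "k n (h n (d s n x)) = k n (\<delta> g n x)"
          unfolding h(2)[OF dc[OF x]] hom_space_apply[OF U B dc[OF x]] \<delta>(2)[OF g x] f(3)[OF x]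
          using sq_hom_closed[OF gh dc[OF x]] BV by simp
      qed
      then show "\<exists>h\<in>sq_hom (P s) A. \<forall>n. \<forall>x\<in>carrier (piece (P (Suc s)) n). h n (d s n x) = \<delta> g n x" using h(1) by blast
    qed
    also have "\<dots> \<longleftrightarrow> q g = \<zero>\<^bsub>Y\<^esub>"
      unfolding q_def \<tau>_zero[OF cl1[OF g] cl2[OF g]] cohomology_class_zero_iff[OF Q1 c1[OF g]] cohomology_class_zero_iff[OF Q2 c2[OF g]] ..
    finally show "p g = \<zero>\<^bsub>hom_cohomology P d (Suc s) A\<^esub> \<longleftrightarrow> q g = \<zero>\<^bsub>Y\<^esub>" .
  qed
qed

end

subsection \<open>The cohomology of complex projective space\<close>

text \<open>Lucas modulo 2: in two applications of Pascal's rule the middle term acquires a factor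
  2. Thus Sq^(2i) has the same coefficient on u^(2k), on u^(2k+1) and on x^k.\<close>

lemma binomial_double:
  "(of_nat ((2 * k) choose (2 * i)) :: bit) = of_nat (k choose i)"
  "(of_nat (Suc (2 * k) choose (2 * i)) :: bit) = of_nat (k choose i)"
proof -
  show 1: "(of_nat ((2 * k) choose (2 * i)) :: bit) = of_nat (k choose i)" for i
  proof (induction k arbitrary: i)
    case 0
    then show ?case by (cases i) auto
  next
    case (Suc k)
    show ?case
    proof (cases i)
      case (Suc i')
      have "(of_nat ((2 * Suc k) choose (2 * Suc i')) :: bit) =
          of_nat ((2 * k) choose (2 * i')) + of_nat ((2 * k) choose (2 * Suc i'))"
        by (simp add: ac_simps)
      then show ?thesis using Suc.IH[of i'] Suc.IH[of "Suc i'"] Suc by simp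
    qed simp
  qed
  show "(of_nat (Suc (2 * k) choose (2 * i)) :: bit) = of_nat (k choose i)"
  proof (cases i)
    case (Suc i')
    have "even ((2 * k) choose (Suc (2 * i')))" by (rule even_binomial) simp_all
    then have "(of_nat ((2 * k) choose (Suc (2 * i'))) :: bit) = 0" by (rule of_nat_bit_even)
    moreover have "Suc (2 * k) choose (2 * i) = ((2 * k) choose (Suc (2 * i'))) + ((2 * k) choose (2 * i))"
      using Suc by simp
    ultimately show ?thesis using 1[of i] by simp
  qed simp
qed

lemma suspension_CP_simps:
  "p \<in> carrier (piece (suspension t CP_infinity_module) n) \<longleftrightarrow> (\<forall>k. coeff p k \<noteq> 0 \<longrightarrow> 0 < k \<and> n = t + 2 * k)"
  "\<zero>\<^bsub>piece (suspension t CP_infinity_module) n\<^esub> = 0"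
  "p \<oplus>\<^bsub>piece (suspension t CP_infinity_module) n\<^esub> q = p + q"
  "b \<odot>\<^bsub>piece (suspension t CP_infinity_module) n\<^esub> p = Polynomial.smult b p"
  "Sq (suspension t CP_infinity_module) i n p = (if n < t then 0 else if even i \<and> even (n - t)
     then monom (of_nat (((n - t) div 2) choose (i div 2)) * coeff p ((n - t) div 2)) ((n - t + i) div 2) else 0)"
  by (auto simp: suspension_def CP_infinity_module_def vs_zero_def mk_vs_def poly_eq_iff)

text \<open>The inclusion x -> u^2. In degree t + 2k an element is determined by its coefficient at
  x^k. In all other degrees the elements are zero, so the truncation and the rounding in the index
  do no harm.\<close>

definition CP_to_RP :: "nat \<Rightarrow> nat \<Rightarrow> bit poly \<Rightarrow> bit" where
  "CP_to_RP t n p = coeff p ((n - t) div 2)"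

lemma suspension_CP_cases:
  assumes "p \<in> carrier (piece (suspension t CP_infinity_module) n)"
  obtains "p = 0" | k where "0 < k" "n = t + 2 * k" "p = monom 1 k"
proof (cases "p = 0")
  case False
  then obtain k where k: "coeff p k \<noteq> 0" by (metis leading_coeff_0_iff)
  have deg: "0 < j \<and> n = t + 2 * j" if "coeff p j \<noteq> 0" for j
    using assms that unfolding suspension_CP_simps(1) by blast
  have n: "0 < k" "n = t + 2 * k" using deg[OF k] by simp_all
  have "p = monom 1 k"
  proof (rule poly_eqI)
    fix j
    have "coeff p j = 0" if "j \<noteq> k" using deg[of j] n(2) that by fastforce
    then show "coeff p j = coeff (monom 1 k) j"
      using k by (cases "j = k") simp_all
  qed
  with n show ?thesis using that by blast
qed (use that in blast)

lemma CP_to_RP_Sq: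
  assumes p: "p \<in> carrier (piece (suspension t CP_infinity_module) n)"
  shows "CP_to_RP t (n + i) (Sq (suspension t CP_infinity_module) i n p) = Sq (RP t) i n (CP_to_RP t n p)"
  using p
proof (cases rule: suspension_CP_cases)
  case 1
  then show ?thesis by (simp add: CP_to_RP_def suspension_CP_simps)
next
  case (2 k)
  show ?thesis
  proof (cases "even i")
    case True
    then obtain j where "i = 2 * j" by blast
    then show ?thesis using 2 binomial_double(1)[of k j] by (simp add: CP_to_RP_def suspension_CP_simps)
  next
    case False
    then have "(of_nat ((2 * k) choose i) :: bit) = 0" by (intro of_nat_bit_even even_binomial) simp_all
    then show ?thesis using 2 False by (simp add: CP_to_RP_def suspension_CP_simps)
  qed
qed

lemma CP_to_RP_closed:
  assumes "p \<in> carrier (piece (suspension t CP_infinity_module) n)"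
  shows "CP_to_RP t n p \<in> carrier (piece (RP t) n)"
  using assms by (cases rule: suspension_CP_cases) (simp_all add: CP_to_RP_def)

lemma CP_to_RP_inj:
  assumes p: "p \<in> carrier (piece (suspension t CP_infinity_module) n)"
    and q: "q \<in> carrier (piece (suspension t CP_infinity_module) n)" and eq: "CP_to_RP t n p = CP_to_RP t n q"
  shows "p = q"
proof (rule poly_eqI)
  fix k
  show "coeff p k = coeff q k"
  proof (cases "n = t + 2 * k")
    case True
    then show ?thesis using eq by (simp add: CP_to_RP_def)
  next
    case False
    then have "coeff p k = 0" "coeff q k = 0" using p q unfolding suspension_CP_simps(1) by blast+
    then show ?thesis by simp
  qed
qed

text \<open>The module embeds into \<open>RP t\<close>, where all the relations hold.\<close>

lemma suspension_CP_unstable: "unstable_module (suspension t CP_infinity_module)"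
proof (rule unstable_jointly[where \<H> = "{(RP t, CP_to_RP t)}"])
  let ?A = "suspension t CP_infinity_module"
  fix n p assume p: "p \<in> carrier (piece ?A n)"
  show "b \<odot>\<^bsub>piece ?A n\<^esub> p = (if b = 0 then \<zero>\<^bsub>piece ?A n\<^esub> else p)" for b by (simp add: suspension_CP_simps)
  show "Sq ?A i n p \<in> carrier (piece ?A (n + i))" for i
    using p
  proof (cases rule: suspension_CP_cases)
    case (2 k)
    then show ?thesis by (auto simp: suspension_CP_simps elim!: evenE)
  qed (simp add: suspension_CP_simps)
  fix q assume q: "q \<in> carrier (piece ?A n)"
  show "p \<oplus>\<^bsub>piece ?A n\<^esub> q \<in> carrier (piece ?A n)"
    using p q unfolding suspension_CP_simps(1,3) coeff_add by (metis add.right_neutral)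
  assume "\<And>E h. (E, h) \<in> {(RP t, CP_to_RP t)} \<Longrightarrow> h n p = h n q"
  then show "p = q" using CP_to_RP_inj[OF p q] by simp
qed (auto simp: RP_unstable CP_to_RP_Sq CP_to_RP_closed simp del: RP_simps, (simp_all add: suspension_CP_simps CP_to_RP_def))

subsection \<open>The short exact sequence\<close>

definition RP_to_F2 :: "nat \<Rightarrow> nat \<Rightarrow> bit \<Rightarrow> bit" where
  "RP_to_F2 t = (\<lambda>n. restrict (\<lambda>x. if n = Suc t then x else 0) (carrier (piece (RP t) n)))"

text \<open>Sends u^(2k+1) to x^k, with suspensions by t and t + 1, for k > 0. The bottom class u is
  left out, as x^0 is not in the augmentation ideal.\<close>

definition RP_to_CP :: "nat \<Rightarrow> nat \<Rightarrow> bit \<Rightarrow> bit poly" where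
  "RP_to_CP t = (\<lambda>n. restrict (\<lambda>x. if Suc t < n \<and> odd (n - t) then monom x ((n - Suc t) div 2) else 0) (carrier (piece (RP t) n)))"

lemma RP_cases:
  assumes "x \<in> carrier (piece (RP t) n)"
  obtains "x = 0" | k where "0 < k" "n = t + 2 * k" | "n = Suc t" | k where "0 < k" "n = Suc t + 2 * k"
proof (cases "x = 0 \<or> n \<le> t")
  case True
  then show ?thesis using assms that(1) by (auto split: if_splits)
next
  case False
  then obtain m where m: "n = t + m" "0 < m" by (metis less_imp_add_positive not_le)
  show ?thesis
  proof (cases "even m")
    case True
    then obtain k where "m = 2 * k" by blast
    then show ?thesis using that(2)[of k] m by simp
  next
    case False
    then obtain k where "m = 2 * k + 1" by (auto elim: oddE)
    then show ?thesis using that(3) that(4)[of k] m by (cases "k = 0") simp_all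
  qed
qed

text \<open>The class u is the lowest one, so no positive square arrives at it, and its own positive
  squares land in degrees where the projection is zero.\<close>

lemma RP_to_F2_hom: "RP_to_F2 t \<in> sq_hom (RP t) (suspension (Suc t) F2_module)"
  unfolding RP_to_F2_def
proof (rule sq_hom_restrictI)
  fix n i x assume x: "x \<in> carrier (piece (RP t) n)"
  show "Sq (RP t) i n x \<in> carrier (piece (RP t) (n + i))" by (rule unstable_Sq_closed[OF RP_unstable x refl])
  show "(if n + i = Suc t then Sq (RP t) i n x else 0) = Sq (suspension (Suc t) F2_module) i n (if n = Suc t then x else 0)"
    using x by (auto simp: suspension_F2_simps)
qed (auto simp: suspension_F2_vs suspension_F2_simps module_bit_vs)

text \<open>Sq^(2j) has the same coefficient on u^(2k+1) as on x^k by
  \<open>binomial_double\<close>. On u the even squares of positive degree vanish, so leaving out u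
  is compatible with the squares.\<close>

lemma RP_to_CP_hom: "RP_to_CP t \<in> sq_hom (RP t) (suspension (Suc t) CP_infinity_module)"
  unfolding RP_to_CP_def
proof (rule sq_hom_restrictI)
  fix n x assume x: "x \<in> carrier (piece (RP t) n)"
  show "(if Suc t < n \<and> odd (n - t) then monom x ((n - Suc t) div 2) else 0) \<in> carrier (piece (suspension (Suc t) CP_infinity_module) n)"
  proof (cases "Suc t < n \<and> odd (n - t)")
    case True
    from conjunct2[OF True] obtain k where "n - t = 2 * k + 1" by (rule oddE)
    then have "n = Suc t + 2 * k" "0 < k" using True by auto
    then show ?thesis by (simp add: suspension_CP_simps)
  next
    case False
    show ?thesis unfolding if_not_P[OF False] suspension_CP_simps(1) by simp
  qed
  fix i
  show "Sq (RP t) i n x \<in> carrier (piece (RP t) (n + i))" by (rule unstable_Sq_closed[OF RP_unstable x refl])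
  show "(if Suc t < n + i \<and> odd (n + i - t) then monom (Sq (RP t) i n x) ((n + i - Suc t) div 2) else 0) =
      Sq (suspension (Suc t) CP_infinity_module) i n (if Suc t < n \<and> odd (n - t) then monom x ((n - Suc t) div 2) else 0)"
    using x
  proof (cases rule: RP_cases)
    case 1
    then show ?thesis by (simp add: suspension_CP_simps)
  next
    case (2 k)
    have "odd i \<Longrightarrow> (of_nat ((2 * k) choose i) :: bit) = 0" by (rule of_nat_bit_even, rule even_binomial) simp_all
    then show ?thesis using 2 by (simp add: suspension_CP_simps)
  next
    case 3
    have "Suc 0 choose i = 0" if "even i" "0 < i" using that by (intro binomial_eq_0) (auto elim!: evenE)
    then have "(of_nat (Suc 0 choose i) :: bit) = 0" if "even i" "0 < i" using that by (metis of_nat_0)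
    then show ?thesis using 3 by (simp add: suspension_CP_simps)
  next
    case (4 k)
    show ?thesis
    proof (cases "even i")
      case True
      then obtain j where "i = 2 * j" by blast
      then show ?thesis using 4 binomial_double(2)[of k j] by (simp add: suspension_CP_simps)
    next
      case False
      then show ?thesis using 4 by (simp add: suspension_CP_simps)
    qed
  qed
next
  fix n x y
  show "(if Suc t < n \<and> odd (n - t) then monom (x \<oplus>\<^bsub>piece (RP t) n\<^esub> y) ((n - Suc t) div 2) else 0) =
    (if Suc t < n \<and> odd (n - t) then monom x ((n - Suc t) div 2) else 0) \<oplus>\<^bsub>piece (suspension (Suc t) CP_infinity_module) n\<^esub>
    (if Suc t < n \<and> odd (n - t) then monom y ((n - Suc t) div 2) else 0)"
    by (simp add: suspension_CP_simps add_monom)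
qed (simp_all only: unstable_vs[OF RP_unstable] unstable_vs[OF suspension_CP_unstable])

text \<open>The two components together are one map to \<open>RP_odd t\<close>, the direct sum of
  the two targets, and this map lifts to \<open>RP t\<close>.\<close>

lemma RP_odd_lift:
  fixes M :: "(nat \<times> bit) sq_module"
  assumes M: "projective M" and a: "a \<in> sq_hom M (suspension (Suc t) F2_module)"
    and b: "b \<in> sq_hom M (suspension (Suc t) CP_infinity_module)"
  shows "\<exists>g\<in>sq_hom M (RP t). \<forall>n. \<forall>x\<in>carrier (piece M n). RP_to_F2 t n (g n x) = a n x \<and> RP_to_CP t n (g n x) = b n x"
proof -
  have U: "unstable_module M" by (rule projective_unstable[OF M])
  \<comment> \<open>The first summand sits in degree t + 1 and the second starts in degree t + 3, so
    at most one component is nonzero in each degree.\<close>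
  define c where "c n x = (if n = Suc t then a n x else CP_to_RP (Suc t) n (b n x))" for n x
  note bc = sq_hom_closed[OF b] and ac = sq_hom_closed[OF a]
  have b0: "b n x = 0" if x: "x \<in> carrier (piece M n)" and n: "\<not> (Suc t < n \<and> odd (n - t))" for n x
    using bc[OF x] n by (cases rule: suspension_CP_cases) auto
  have a0: "a n x = 0" if x: "x \<in> carrier (piece M n)" and n: "n \<noteq> Suc t" for n x
    using ac[OF x] n by (simp add: suspension_F2_simps)
  have "(\<lambda>n. restrict (c n) (carrier (piece M n))) \<in> sq_hom M (RP_odd t)"
  proof (rule sq_hom_restrictI)
    fix n x assume x: "x \<in> carrier (piece M n)"
    show "c n x \<in> carrier (piece (RP_odd t) n)"
      using b0[OF x] by (auto simp: c_def CP_to_RP_def)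
    show Sx: "Sq M i n x \<in> carrier (piece M (n + i))" for i by (rule unstable_Sq_closed[OF U x refl])
    show "c (n + i) (Sq M i n x) = Sq (RP_odd t) i n (c n x)" for i
    proof (cases "i = 0")
      case True
      have "c n x = 0" if "\<not> (t < n \<and> odd (n - t))" using b0[OF x] that by (auto simp: c_def CP_to_RP_def)
      then show ?thesis using True unstable_Sq0[OF U x] by auto
    next
      case i: False
      have bS: "CP_to_RP (Suc t) (n + i) (b (n + i) (Sq M i n x)) = Sq (RP (Suc t)) i n (CP_to_RP (Suc t) n (b n x))"
        using sq_hom_Sq[OF b x refl, of i] CP_to_RP_Sq[OF bc[OF x], of i] by simp
      have aS: "a (n + i) (Sq M i n x) = 0"
        using sq_hom_Sq[OF a x refl, of i] i by (simp add: suspension_F2_simps)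
      consider "n = Suc t" | "Suc t < n" "odd (n - t)" | "n \<noteq> Suc t" "\<not> (Suc t < n \<and> odd (n - t))" by blast
      then show ?thesis
      proof cases
        case 1
        have "Suc 0 choose i = 0" if "even i" using i that by (intro binomial_eq_0) (auto elim!: evenE)
        then have "(of_nat (Suc 0 choose i) :: bit) = 0" if "even i" using that by (metis of_nat_0)
        then show ?thesis using 1 i bS by (simp add: c_def)
      next
        case 2
        obtain k where k: "n = Suc t + 2 * k" "0 < k"
        proof -
          from 2(2) obtain m where m: "n - t = 2 * m + 1" by (rule oddE)
          then show ?thesis using that[of m] 2(1) by auto
        qed
        have "(of_nat ((2 * k) choose i) :: bit) = (if even i then of_nat (Suc (2 * k) choose i) else 0)"
        proof (cases "even i")
          case True
          then obtain j where "i = 2 * j" by blast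
          then show ?thesis using binomial_double[of k j] by simp
        next
          case False
          then show ?thesis by (simp add: of_nat_bit_even even_binomial)
        qed
        then show ?thesis using bS k i by (simp add: c_def)
      next
        case 3
        have "b n x = 0" using b0[OF x] 3 by blast
        then show ?thesis using bS aS 3 by (cases "n + i = Suc t") (simp_all add: c_def CP_to_RP_def)
      qed
    qed
    fix y assume y: "y \<in> carrier (piece M n)"
    show "c n (x \<oplus>\<^bsub>piece M n\<^esub> y) = c n x \<oplus>\<^bsub>piece (RP_odd t) n\<^esub> c n y"
      using sq_hom_add[OF a x y] sq_hom_add[OF b x y]
      by (cases "n = Suc t") (simp_all add: c_def CP_to_RP_def suspension_F2_simps suspension_CP_simps)
  qed (simp_all only: unstable_vs[OF U] unstable_vs[OF RP_odd_unstable])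
  note ch = this
  obtain g where g: "g \<in> sq_hom M (RP t)"
    "\<And>n x. x \<in> carrier (piece M n) \<Longrightarrow> restrict (\<lambda>x. if t < n \<and> odd (n - t) then x else 0) (carrier (piece (RP t) n)) (g n x) =
      restrict (c n) (carrier (piece M n)) x"
    by (rule projective_lift[OF M RP_unstable RP_odd_unstable countableI_type RP_odd_quotient ch]) metis
  have "RP_to_F2 t n (g n x) = a n x \<and> RP_to_CP t n (g n x) = b n x" if x: "x \<in> carrier (piece M n)" for n x
  proof -
    note gc = sq_hom_closed[OF g(1) x]
    have gx: "(if t < n \<and> odd (n - t) then g n x else 0) = c n x" using g(2)[OF x] gc x by (simp del: RP_simps)
    have "RP_to_F2 t n (g n x) = a n x"
      using gx a0[OF x] gc by (auto simp: RP_to_F2_def c_def simp del: RP_simps)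
    moreover have "RP_to_CP t n (g n x) = b n x"
    proof (cases "Suc t < n \<and> odd (n - t)")
      case True
      have "g n x = CP_to_RP (Suc t) n (b n x)" using gx True by (auto simp: c_def)
      then have "RP_to_CP t n (g n x) = monom (CP_to_RP (Suc t) n (b n x)) ((n - Suc t) div 2)"
        using True gc by (simp add: RP_to_CP_def del: RP_simps)
      also have "\<dots> = b n x"
        using bc[OF x] by (cases rule: suspension_CP_cases) (simp_all add: CP_to_RP_def)
      finally show ?thesis .
    next
      case False
      have "RP_to_CP t n (g n x) = 0" using False gc unfolding RP_to_CP_def by (simp only: restrict_apply' if_False)
      then show ?thesis using b0[OF x False] by simp
    qed
    ultimately show ?thesis ..
  qed
  then show ?thesis using g(1) by blast
qed

lemma RP_exact:
  assumes y: "y \<in> carrier (piece (RP t) n)" and "RP_to_F2 t n y = 0" "RP_to_CP t n y = 0"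
  shows "y \<in> restrict (CP_to_RP t n) (carrier (piece (suspension t CP_infinity_module) n)) ` carrier (piece (suspension t CP_infinity_module) n)"
proof -
  have "\<exists>p\<in>carrier (piece (suspension t CP_infinity_module) n). y = CP_to_RP t n p"
    using y
  proof (cases rule: RP_cases)
    case 1
    show ?thesis by (rule bexI[of _ 0]) (simp_all add: 1 CP_to_RP_def suspension_CP_simps)
  next
    case (2 k)
    show ?thesis by (rule bexI[of _ "monom y k"]) (use 2 in \<open>auto simp: CP_to_RP_def suspension_CP_simps split: if_splits\<close>)
  next
    case 3
    then have "y = 0" using assms by (simp add: RP_to_F2_def)
    then show ?thesis by (intro bexI[of _ 0]) (simp_all add: CP_to_RP_def suspension_CP_simps)
  next
    case (4 k)
    then have "y = 0" using assms by (simp add: RP_to_CP_def)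
    then show ?thesis by (intro bexI[of _ 0]) (simp_all add: CP_to_RP_def suspension_CP_simps)
  qed
  then show ?thesis by auto
qed

section \<open>Induction on the cohomological degree\<close>

lemma chosen_resolution:
  assumes "chosen_resolution (suspension n F2_module) = (P, d)"
  shows "projective_complex P d"
proof -
  obtain P' :: "nat \<Rightarrow> (nat \<times> bit) sq_module" and d' e where "projective_resolution P' d' e (suspension n F2_module)"
    using resolution_exists[OF suspension_F2_unstable countableI_type] by metis
  then have "case (P', d') of (P, d) \<Rightarrow> \<exists>e. projective_resolution P d e (suspension n F2_module)" by auto
  then have "case chosen_resolution (suspension n F2_module) of (P, d) \<Rightarrow> \<exists>e. projective_resolution P d e (suspension n F2_module)"
    unfolding chosen_resolution_def by (rule someI)
  then show ?thesis using resolution_complex unfolding assms by auto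
qed

text \<open>\<open>t\<close> varies in the induction, because each step lowers \<open>s\<close> and
  raises \<open>t\<close> by one. For s = 0 the sum is empty: a cocycle followed by the inclusion
  into \<open>RP t\<close> vanishes by acyclicity in degree 0, and the inclusion is
  injective.\<close>

lemma cohomology_suspension_CP:
  assumes P: "projective_complex P d"
  shows "vs_isomorphic (hom_cohomology P d s (suspension t CP_infinity_module))
    (vs_direct_sum {1..s} (\<lambda>m. hom_cohomology P d (s - m) (suspension (t + m) F2_module)))"
proof (induction s arbitrary: t)
  let ?A = "\<lambda>t. suspension t CP_infinity_module"
  let ?Q = "\<lambda>t. suspension t F2_module"
  let ?E = "\<lambda>s. hom_cohomology P d s"
  have ac: "hom_acyclic P d (RP t)" for t by (rule RP_acyclic[OF P])
  note Aun = suspension_CP_unstable and Qun = suspension_F2_unstable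
  have k: "(\<lambda>n. restrict (CP_to_RP t n) (carrier (piece (?A t) n))) \<in> sq_hom (?A t) (RP t)" for t
    by (rule sq_hom_restrictI)
      (simp_all only: CP_to_RP_closed CP_to_RP_Sq unstable_vs[OF Aun] unstable_vs[OF RP_unstable] unstable_Sq_closed[OF Aun _ refl],
       simp add: CP_to_RP_def suspension_CP_simps)
  have Emod: "module F2 (?E s (?Q t))" "module F2 (?E s (?A t))" for s t
    by (rule cohomology_module[OF P Qun] cohomology_module[OF P Aun])+
  {
    case 0
    have z: "x = \<zero>\<^bsub>?E 0 (?A t)\<^esub>" if "x \<in> carrier (?E 0 (?A t))" for x
    proof -
      obtain f where f: "f \<in> hom_cocycles P d 0 (?A t)" "x = cohomology_class P d 0 (?A t) f"
        using \<open>x \<in> _\<close> unfolding cohomology_carrier[OF P Aun] by blast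
      have fh: "f \<in> sq_hom (P 0) (?A t)" and fd: "\<And>n y. y \<in> carrier (piece (P (Suc 0)) n) \<Longrightarrow> f n (d 0 n y) = \<zero>\<^bsub>piece (?A t) n\<^esub>"
        using f(1) unfolding cocycles_iff[OF P Aun] by auto
      let ?k = "\<lambda>n. restrict (CP_to_RP t n) (carrier (piece (?A t) n))"
      have kf: "sq_comp (P 0) ?k f \<in> sq_hom (P 0) (RP t)"
        by (rule sq_comp_unstable[OF fh k complex_unstable[OF P] RP_unstable])
      have kz: "?k n \<zero>\<^bsub>piece (?A t) n\<^esub> = \<zero>\<^bsub>piece (RP t) n\<^esub>" for n
        by (rule sq_hom_zero[OF k unstable_vs[OF Aun] unstable_vs[OF RP_unstable]])
      have "\<forall>n. \<forall>y\<in>carrier (piece (P (Suc 0)) n). sq_comp (P 0) ?k f n (d 0 n y) = \<zero>\<^bsub>piece (RP t) n\<^esub>"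
        using fd kz sq_hom_closed[OF complex_map[OF P]] by simp
      then have "case 0 of 0 \<Rightarrow> \<forall>n. \<forall>y\<in>carrier (piece (P 0) n). sq_comp (P 0) ?k f n y = \<zero>\<^bsub>piece (RP t) n\<^esub>
        | Suc r \<Rightarrow> \<exists>g\<in>sq_hom (P r) (RP t). \<forall>n. \<forall>y\<in>carrier (piece (P 0) n). g n (d r n y) = sq_comp (P 0) ?k f n y"
        using ac[of t] kf unfolding hom_acyclic_def by blast
      then have kf0: "?k n (f n y) = ?k n \<zero>\<^bsub>piece (?A t) n\<^esub>" if "y \<in> carrier (piece (P 0) n)" for n y
        unfolding kz using that by simp
      have "f n y = \<zero>\<^bsub>piece (?A t) n\<^esub>" if y: "y \<in> carrier (piece (P 0) n)" for n y
        using kf0[OF y] sq_hom_closed[OF fh y] F2_zero[OF unstable_vs[OF Aun]]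
        by (intro CP_to_RP_inj[OF sq_hom_closed[OF fh y] F2_zero[OF unstable_vs[OF Aun]]]) (simp only: restrict_apply')
      then have "f \<in> hom_coboundaries P d 0 (?A t)" using coboundaries_0_iff[OF P Aun f(1)] by blast
      then show ?thesis using cohomology_class_zero_iff[OF P Aun f(1)] f(2) by blast
    qed
    let ?D = "vs_direct_sum {1..0} (\<lambda>m. ?E (0 - m) (?Q (t + m)))"
    have D: "module F2 ?D" by (rule direct_sum_module) (simp_all add: Emod)
    have D0: "carrier ?D = {\<zero>\<^bsub>?D\<^esub>}" by (simp add: direct_sum_simps restrict_def)
    have E0: "carrier (?E 0 (?A t)) = {\<zero>\<^bsub>?E 0 (?A t)\<^esub>}" using z F2_zero[OF Emod(2)] by blast
    show ?case
    proof (rule isomorphic_by_surjections[OF Emod(2)[of 0 t] Emod(2)[of 0 t] D, where p = "\<lambda>x. x" and q = "\<lambda>x. \<zero>\<^bsub>?D\<^esub>"])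
      show "vs_linear (?E 0 (?A t)) (?E 0 (?A t)) (\<lambda>x. x)" by (simp only: vs_linear_iff[OF Emod(2) Emod(2)]) blast
      show "vs_linear (?E 0 (?A t)) ?D (\<lambda>x. \<zero>\<^bsub>?D\<^esub>)"
        unfolding vs_linear_iff[OF Emod(2) D] using F2_zero[OF D] F2_self[OF D F2_zero[OF D]] by metis
      show "(\<lambda>x. \<zero>\<^bsub>?D\<^esub>) ` carrier (?E 0 (?A t)) = carrier ?D" unfolding E0 D0 by blast
      show "x = \<zero>\<^bsub>?E 0 (?A t)\<^esub> \<longleftrightarrow> \<zero>\<^bsub>?D\<^esub> = \<zero>\<^bsub>?D\<^esub>" if "x \<in> carrier (?E 0 (?A t))" for x
        using z[OF that] by blast
    qed blast
  next
    case (Suc s)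
    let ?D = "vs_direct_sum {1..s} (\<lambda>m. ?E (s - m) (?Q (Suc t + m)))"
    let ?Y = "vs_direct_sum {1..Suc s} (\<lambda>m. ?E (Suc s - m) (?Q (t + m)))"
    obtain \<psi> where \<psi>: "vs_linear (?E s (?A (Suc t))) ?D \<psi>" "bij_betw \<psi> (carrier (?E s (?A (Suc t)))) (carrier ?D)"
      using Suc.IH[of "Suc t"] unfolding vs_isomorphic_def by blast
    have D: "module F2 ?D" and Y: "module F2 ?Y" by (rule direct_sum_module, simp, rule Emod)+
    \<comment> \<open>The class \<open>u\<close> becomes the summand for m = 1. The summand
      \<open>m\<close> of the induction hypothesis for \<open>Suc t\<close> becomes the summand
      \<open>Suc m\<close>, as s - m = Suc s - Suc m and Suc t + m = t + Suc m.\<close>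
    define \<tau> where "\<tau> u v = (\<lambda>m\<in>{1..Suc s}. if m = 1 then u else \<psi> v (m - 1))" for u v
    have memD: "w \<in> carrier ?D \<longleftrightarrow> (\<forall>m\<in>{1..s}. w m \<in> carrier (?E (s - m) (?Q (Suc t + m)))) \<and> w \<in> extensional {1..s}" for w
      by (simp add: direct_sum_simps PiE_iff)
    have memY: "w \<in> carrier ?Y \<longleftrightarrow> (\<forall>m\<in>{1..Suc s}. w m \<in> carrier (?E (Suc s - m) (?Q (t + m)))) \<and> w \<in> extensional {1..Suc s}" for w
      by (simp add: direct_sum_simps PiE_iff)
    have shift: "?E (Suc s - m) (?Q (t + m)) = ?E (s - (m - 1)) (?Q (Suc t + (m - 1)))" "m - 1 \<in> {1..s}" if "m \<in> {1..Suc s}" "m \<noteq> 1" for m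
      using that by (auto simp: Suc_diff_le)
    have one: "?E (Suc s - 1) (?Q (t + 1)) = ?E s (?Q (Suc t))" by simp
    have \<psi>D: "\<psi> v \<in> carrier ?D" if "v \<in> carrier (?E s (?A (Suc t)))" for v
      using vs_linear_closed[OF \<psi>(1) that] .
    have \<psi>0: "\<psi> v = \<zero>\<^bsub>?D\<^esub> \<longleftrightarrow> v = \<zero>\<^bsub>?E s (?A (Suc t))\<^esub>" if v: "v \<in> carrier (?E s (?A (Suc t)))" for v
      using inj_on_eq_iff[OF bij_betw_imp_inj_on[OF \<psi>(2)] v F2_zero[OF Emod(2)]]
      unfolding vs_linear_zero[OF \<psi>(1) Emod(2) D] .
    show ?case
    \<comment> \<open>\<open>\<tau>\<close> feeds the induction hypothesis into the step: the
      cohomology with values in the second quotient, the (t+1)-fold suspension of the cohomology of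
      CP^inf, enters through its isomorphism \<open>\<psi>\<close> with a direct sum.\<close>
    proof (rule cohomology_step[OF P Aun RP_unstable Qun Aun k _ RP_to_F2_hom RP_to_CP_hom, where \<tau> = \<tau>])
      show "inj_on (restrict (CP_to_RP t n) (carrier (piece (?A t) n))) (carrier (piece (?A t) n))" for n
        by (rule inj_onI) (use CP_to_RP_inj in \<open>simp only: restrict_apply'\<close>)
      fix n x assume x: "x \<in> carrier (piece (?A t) n)"
      note kx = CP_to_RP_closed[OF x]
      have "RP_to_F2 t n (CP_to_RP t n x) = 0 \<and> RP_to_CP t n (CP_to_RP t n x) = 0"
        using x
      proof (cases rule: suspension_CP_cases)
        case 1
        then show ?thesis by (simp add: RP_to_F2_def RP_to_CP_def CP_to_RP_def)
      next
        case (2 k)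
        then show ?thesis by (auto simp: RP_to_F2_def RP_to_CP_def)
      qed
      then show "RP_to_F2 t n (restrict (CP_to_RP t n) (carrier (piece (?A t) n)) x) = \<zero>\<^bsub>piece (?Q (Suc t)) n\<^esub>"
        "RP_to_CP t n (restrict (CP_to_RP t n) (carrier (piece (?A t) n)) x) = \<zero>\<^bsub>piece (?A (Suc t)) n\<^esub>"
        using x by (simp_all only: restrict_apply' suspension_F2_simps suspension_CP_simps(2))
    next
      fix n y assume "y \<in> carrier (piece (RP t) n)" "RP_to_F2 t n y = \<zero>\<^bsub>piece (?Q (Suc t)) n\<^esub>" "RP_to_CP t n y = \<zero>\<^bsub>piece (?A (Suc t)) n\<^esub>"
      then show "y \<in> restrict (CP_to_RP t n) (carrier (piece (?A t) n)) ` carrier (piece (?A t) n)"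
        by (intro RP_exact) (simp_all only: suspension_F2_simps suspension_CP_simps(2))
    next
      fix u v assume u: "u \<in> carrier (?E s (?Q (Suc t)))" and v: "v \<in> carrier (?E s (?A (Suc t)))"
      have \<psi>m: "\<psi> v (m - 1) \<in> carrier (?E (Suc s - m) (?Q (t + m)))" if "m \<in> {1..Suc s}" "m \<noteq> 1" for m
        using \<psi>D[OF v] shift[OF that] unfolding memD by simp
      show "\<tau> u v \<in> carrier ?Y"
        unfolding memY using u \<psi>m by (auto simp: \<tau>_def)
      show "\<tau> u v = \<zero>\<^bsub>?Y\<^esub> \<longleftrightarrow> u = \<zero>\<^bsub>?E s (?Q (Suc t))\<^esub> \<and> v = \<zero>\<^bsub>?E s (?A (Suc t))\<^esub>"
      proof
        assume eq: "\<tau> u v = \<zero>\<^bsub>?Y\<^esub>"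
        have m: "\<tau> u v m = \<zero>\<^bsub>?E (Suc s - m) (?Q (t + m))\<^esub>" if "m \<in> {1..Suc s}" for m
          unfolding eq using that by (simp add: direct_sum_simps)
        have "u = \<zero>\<^bsub>?E s (?Q (Suc t))\<^esub>" using m[of 1] by (simp add: \<tau>_def)
        moreover have "\<psi> v = \<zero>\<^bsub>?D\<^esub>"
        proof (rule extensionalityI[of _ "{1..s}"])
          fix m assume "m \<in> {1..s}"
          then show "\<psi> v m = \<zero>\<^bsub>?D\<^esub> m" using m[of "Suc m"] by (simp add: \<tau>_def direct_sum_simps)
        qed (use \<psi>D[OF v] in \<open>simp only: memD\<close>, simp add: direct_sum_simps)
        ultimately show "u = \<zero>\<^bsub>?E s (?Q (Suc t))\<^esub> \<and> v = \<zero>\<^bsub>?E s (?A (Suc t))\<^esub>" using \<psi>0[OF v] by blast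
      next
        assume uv: "u = \<zero>\<^bsub>?E s (?Q (Suc t))\<^esub> \<and> v = \<zero>\<^bsub>?E s (?A (Suc t))\<^esub>"
        then have \<psi>z: "\<psi> v = \<zero>\<^bsub>?D\<^esub>" using \<psi>0[OF v] by blast
        show "\<tau> u v = \<zero>\<^bsub>?Y\<^esub>"
        proof (rule extensionalityI[of _ "{1..Suc s}"])
          fix m assume m: "m \<in> {1..Suc s}"
          show "\<tau> u v m = \<zero>\<^bsub>?Y\<^esub> m"
          proof (cases "m = 1")
            case True
            then show ?thesis using uv by (simp add: \<tau>_def direct_sum_simps)
          next
            case False
            then have "\<tau> u v m = \<zero>\<^bsub>?E (s - (m - 1)) (?Q (Suc t + (m - 1)))\<^esub>"
              using m shift(2)[OF m False] by (simp add: \<tau>_def \<psi>z direct_sum_simps)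
            then show ?thesis using m unfolding shift(1)[OF m False, symmetric] by (simp add: direct_sum_simps)
          qed
        qed (simp_all add: \<tau>_def direct_sum_simps)
      qed
      fix u' v' assume u': "u' \<in> carrier (?E s (?Q (Suc t)))" and v': "v' \<in> carrier (?E s (?A (Suc t)))"
      show "\<tau> (u \<oplus>\<^bsub>?E s (?Q (Suc t))\<^esub> u') (v \<oplus>\<^bsub>?E s (?A (Suc t))\<^esub> v') = \<tau> u v \<oplus>\<^bsub>?Y\<^esub> \<tau> u' v'"
      proof (rule extensionalityI[of _ "{1..Suc s}"])
        fix m assume m: "m \<in> {1..Suc s}"
        show "\<tau> (u \<oplus>\<^bsub>?E s (?Q (Suc t))\<^esub> u') (v \<oplus>\<^bsub>?E s (?A (Suc t))\<^esub> v') m = (\<tau> u v \<oplus>\<^bsub>?Y\<^esub> \<tau> u' v') m"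
        proof (cases "m = 1")
          case True
          then show ?thesis by (simp add: \<tau>_def direct_sum_simps)
        next
          case False
          have "\<tau> (u \<oplus>\<^bsub>?E s (?Q (Suc t))\<^esub> u') (v \<oplus>\<^bsub>?E s (?A (Suc t))\<^esub> v') m =
              \<psi> v (m - 1) \<oplus>\<^bsub>?E (s - (m - 1)) (?Q (Suc t + (m - 1)))\<^esub> \<psi> v' (m - 1)"
            using m False shift(2)[OF m False] vs_linear_add[OF \<psi>(1) v v'] by (simp add: \<tau>_def direct_sum_simps)
          then show ?thesis using m False unfolding shift(1)[OF m False, symmetric] by (simp add: \<tau>_def direct_sum_simps)
        qed
      qed (simp_all add: \<tau>_def direct_sum_simps)
    next
      fix y assume y: "y \<in> carrier ?Y"
      define w where "w = (\<lambda>m\<in>{1..s}. y (Suc m))"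
      have "w \<in> carrier ?D"
        unfolding memD
      proof (intro conjI ballI)
        fix m assume m: "m \<in> {1..s}"
        then have "Suc m \<in> {1..Suc s}" by simp
        then have "y (Suc m) \<in> carrier (?E (Suc s - Suc m) (?Q (t + Suc m)))" using y unfolding memY by blast
        then show "w m \<in> carrier (?E (s - m) (?Q (Suc t + m)))" using m by (simp add: w_def)
      qed (simp add: w_def)
      then have "w \<in> \<psi> ` carrier (?E s (?A (Suc t)))" unfolding bij_betw_imp_surj_on[OF \<psi>(2)] .
      then obtain v where v: "v \<in> carrier (?E s (?A (Suc t)))" "\<psi> v = w" by blast
      have "y 1 \<in> carrier (?E (Suc s - 1) (?Q (t + 1)))" using y unfolding memY by (rule bspec[OF conjunct1]) simp
      then have "y 1 \<in> carrier (?E s (?Q (Suc t)))" unfolding one .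
      moreover have "y = \<tau> (y 1) v"
      proof (rule extensionalityI[of _ "{1..Suc s}"])
        fix m assume m: "m \<in> {1..Suc s}"
        show "y m = \<tau> (y 1) v m"
          using m by (cases "m = 1") (auto simp: \<tau>_def v(2) w_def)
      qed (use y in \<open>simp only: memY\<close>, simp add: \<tau>_def)
      ultimately show "\<exists>u\<in>carrier (?E s (?Q (Suc t))). \<exists>v\<in>carrier (?E s (?A (Suc t))). y = \<tau> u v" using v(1) by blast
    next
      fix r a b assume "a \<in> sq_hom (P r) (?Q (Suc t))" "b \<in> sq_hom (P r) (?A (Suc t))"
      then show "\<exists>g\<in>sq_hom (P r) (RP t). \<forall>n. \<forall>x\<in>carrier (piece (P r) n). RP_to_F2 t n (g n x) = a n x \<and> RP_to_CP t n (g n x) = b n x"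
        by (rule RP_odd_lift[OF complex_projective[OF P]])
    qed (rule ac, rule Y)
  }
qed

theorem theorem11p3:
  fixes s n t :: nat
  shows "vs_isomorphic
           (Ext_U s (suspension n F2_module) (suspension t CP_infinity_module))
           (vs_direct_sum {1..s}
             (\<lambda>m. Ext_U (s - m) (suspension n F2_module) (suspension (t + m) F2_module)))"
proof -
  obtain P d where Pd: "chosen_resolution (suspension n F2_module) = (P, d)" by fastforce
  show ?thesis
    using cohomology_suspension_CP[OF chosen_resolution[OF Pd]] by (simp add: Ext_U_def Pd)
qed

end
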